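(* Let $s>5/2$ and let $U$ be a limit point, as $\varepsilon\to0$, of the filtered solutions $(U^\varepsilon)_{\varepsilon>0}$ with initial datum $V_0\in H^s(\mathbb T^3)$ (see context), and let $$\overline V_0=\sum_{n\in\mathbb Z^3,\ n_h\ne0}\langle\widehat V_0(n)|e_0(n)\rangle e^{i\check n\cdot x}e_0(n)\in H^s(\mathbb T^3).$$ Then the projection $\overline U$ of $U$ onto the subspace spanned by $\{e^{i\check n\cdot x}e_0(n)\}_{n_h\neq0}$ belongs to $$\mathcal C\left([0,T];H^\sigma(\mathbb T^3)\right),\qquad\sigma\in(s-2,s),$$ for each $T\in[0,T^\star)$, and $\overline U=(\overline u^h,0,0)$ solves the Cauchy problem $$\begin{cases}\partial_t\overline u^h+\overline u^h\cdot\nabla_h\overline u^h+\underline u^h\cdot\nabla_h\overline u^h-\nu\Delta\overline u^h=-\nabla_h\overline p,\\ \operatorname{div}_h\overline u^h=0,\\ \overline U|_{t=0}=\overline V_0\end{cases}$$ almost everywhere in $\mathbb T^3\times[0,T]$, where $\underline u^h$ denotes the first two components of the horizontal average $\underline U$ of $U$.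
   Context: Fix $a_1,a_2,a_3>0$ and $\nu>0$. $\mathbb T^3=\prod_{i=1}^3\mathbb R/(2\pi a_i\mathbb Z)$. For $n\in\mathbb Z^3$: $n_h=(n_1,n_2)$, $\check n=(n_1/a_1,n_2/a_2,n_3/a_3)$, $\check n_h=(\check n_1,\check n_2)$; $f(x)=\sum_n\widehat f(n)e^{i\check n\cdot x}$. For $n_h\neq0$, $e_0(n)=\frac1{|\check n_h|}(-\check n_2,\check n_1,0,0)^\intercal$; $\langle\cdot|\cdot\rangle$ is the Hermitian product of $\mathbb C^4$. Horizontal average: $\underline V(x_3)=\frac1{4\pi^2a_1a_2}\int_{\mathbb T^2_h}V(y_h,x_3)\,dy_h$. $\nabla_h=(\partial_1,\partial_2)$, $\operatorname{div}_h$ are horizontal operators. Fields $V=(v,V^4)$ have four components, zero mean over $\mathbb T^3$, and $\operatorname{div}v=0$. $(\mathrm{PBS}_\varepsilon)$: $\partial_tV^\varepsilon+v^\varepsilon\cdot\nabla V^\varepsilon-\mathcal A_2(D)V^\varepsilon+\frac1\varepsilon\mathcal AV^\varepsilon=-\frac1\varepsilon(\nabla\Phi^\varepsilon,0)^\intercal$, $\operatorname{div}v^\varepsilon=0$, $V^\varepsilon|_{t=0}=V_0$, with $\mathcal A_2(D)=\mathrm{diag}(\nu\Delta,\nu\Delta,\nu\Delta,0)$, $\mathcal A(X_1,X_2,X_3,X_4)^\intercal=(0,0,X_4,-X_3)^\intercal$. $\mathbb P$ is the Leray projector on the first three components and the identity on the fourth; $\mathcal L(\tau)=e^{-\tau\mathbb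 P\mathcal A}$. There is $T^\star>0$, independent of $\varepsilon$, such that for every $T\in[0,T^\star)$ the system has a unique solution in $\mathcal C([0,T];H^s)$, bounded uniformly in $\varepsilon$. The filtered solution is $U^\varepsilon=\mathcal L(-t/\varepsilon)V^\varepsilon$; the family $(U^\varepsilon)$ is relatively compact in $\mathcal C([0,T];H^\sigma(\mathbb T^3))$, $\sigma\in(s-2,s)$, and limit points are taken in this topology. *)

theory Defs
  imports "HOL-Analysis.Analysis"
begin

section \<open>Functions on the torus\<close>

text \<open>
  The torus with side lengths \<open>2 * pi * a$i\<close> is represented by the periodic functions on
  \<open>real^3\<close>; integrals are taken over one period cell.  Physical fields are real-valued,
  their Fourier coefficients are complex.
\<close>

definition cell :: "real^3 \<Rightarrow> (real^3) set"
  where "cell a = cbox 0 ((2 * pi) *\<^sub>R a)"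

definition periodic :: "real^3 \<Rightarrow> (real^3 \<Rightarrow> 'b) \<Rightarrow> bool"
  where "periodic a f \<longleftrightarrow> (\<forall>x i. f (x + axis i (2 * pi * a$i)) = f x)"

definition freq :: "real^3 \<Rightarrow> int^3 \<Rightarrow> real^3"
  where "freq a n = (\<chi> i. of_int (n$i) / a$i)"

definition fourier :: "real^3 \<Rightarrow> (real^3 \<Rightarrow> real^'k) \<Rightarrow> int^3 \<Rightarrow> complex^'k"
  where "fourier a f n = (\<chi> i.
    (LINT x:cell a|lborel. cis (- (freq a n \<bullet> x)) * complex_of_real (f x $ i))
      / complex_of_real ((2 * pi)^3 * a$1 * a$2 * a$3))"

text \<open>
  The field with given Fourier coefficients.  It is only used for coefficients with
  \<open>c (- n) = cnj (c n)\<close>, so the real part drops nothing, and that decay like those of an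
  \<open>H\<^sup>s\<close> function with \<open>s > 5/2\<close>.  The series then converges absolutely,
  and its pointwise sum is the continuous representative.
\<close>

definition synth :: "real^3 \<Rightarrow> (int^3 \<Rightarrow> complex^'k) \<Rightarrow> real^3 \<Rightarrow> real^'k"
  where "synth a c x = (\<chi> i. Re (\<Sum>\<^sub>\<infinity>n. c n $ i * cis (freq a n \<bullet> x)))"

text \<open>
  Sobolev spaces of nonnegative order (in this development all orders are positive), hence
  spaces of square integrable functions.
\<close>

definition sobolev :: "real^3 \<Rightarrow> real \<Rightarrow> (real^3 \<Rightarrow> real^'k) set"
  where "sobolev a \<sigma> = {f. periodic a f \<and> f \<in> borel_measurable borel \<and>
    set_integrable lborel (cell a) (\<lambda>x. (norm (f x))\<^sup>2) \<and>
    (\<lambda>n. (1 + (norm (freq a n))\<^sup>2) powr \<sigma> * (norm (fourier a f n))\<^sup>2) summable_on UNIV}"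

definition sobolev_norm :: "real^3 \<Rightarrow> real \<Rightarrow> (real^3 \<Rightarrow> real^'k) \<Rightarrow> real"
  where "sobolev_norm a \<sigma> f =
    sqrt (\<Sum>\<^sub>\<infinity>n. (1 + (norm (freq a n))\<^sup>2) powr \<sigma> * (norm (fourier a f n))\<^sup>2)"

text \<open>
  \<open>C([0,T]; H\<^sup>\<sigma>)\<close>.  Members of \<open>H\<^sup>\<sigma>\<close> being classes modulo null sets, a
  curve of representatives need not be jointly measurable; measurability in \<open>(t,x)\<close> selects
  representatives for which statements almost everywhere in space-time make sense.
\<close>

definition cont_sobolev :: "real^3 \<Rightarrow> real \<Rightarrow> real \<Rightarrow> (real \<Rightarrow> real^3 \<Rightarrow> real^'k) set"
  where "cont_sobolev a T \<sigma> = {u.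
    set_borel_measurable borel ({0..T} \<times> UNIV) (\<lambda>(t, x). u t x) \<and>
    (\<forall>t\<in>{0..T}. u t \<in> sobolev a \<sigma>) \<and>
    (\<forall>t\<in>{0..T}. ((\<lambda>\<tau>. sobolev_norm a \<sigma> (\<lambda>x. u \<tau> x - u t x)) \<longlongrightarrow> 0) (at t within {0..T}))}"


section \<open>Weak derivatives in space-time\<close>

primrec Ck :: "nat \<Rightarrow> ('a::euclidean_space \<Rightarrow> real) \<Rightarrow> bool" where
  "Ck 0 f \<longleftrightarrow> continuous_on UNIV f"
| "Ck (Suc k) f \<longleftrightarrow> (\<forall>x. f differentiable (at x)) \<and>
     (\<forall>b\<in>Basis. Ck k (\<lambda>x. frechet_derivative f (at x) b))"

definition smooth :: "('a::euclidean_space \<Rightarrow> real) \<Rightarrow> bool"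
  where "smooth f \<longleftrightarrow> (\<forall>k. Ck k f)"

definition test_function :: "real^3 \<Rightarrow> real \<Rightarrow> (real \<times> (real^3) \<Rightarrow> real) \<Rightarrow> bool"
  where "test_function a T \<phi> \<longleftrightarrow> smooth \<phi> \<and> (\<forall>t. periodic a (\<lambda>x. \<phi> (t, x))) \<and>
    (\<exists>c d. 0 < c \<and> d < T \<and> (\<forall>t x. t \<notin> {c..d} \<longrightarrow> \<phi> (t, x) = 0))"

text \<open>\<open>g\<close> is the distributional derivative of \<open>f\<close> in the direction \<open>b\<close> on
  the product of \<open>(0,T)\<close> with the torus, both being integrable functions.\<close>

definition weak_deriv ::
  "real^3 \<Rightarrow> real \<Rightarrow> real \<times> (real^3) \<Rightarrow> (real \<Rightarrow> real^3 \<Rightarrow> 'b::euclidean_space) \<Rightarrow>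
    (real \<Rightarrow> real^3 \<Rightarrow> 'b) \<Rightarrow> bool"
  where "weak_deriv a T b f g \<longleftrightarrow>
    set_integrable lborel ({0..T} \<times> cell a) (\<lambda>(t, x). f t x) \<and>
    set_integrable lborel ({0..T} \<times> cell a) (\<lambda>(t, x). g t x) \<and>
    (\<forall>\<phi>. test_function a T \<phi> \<longrightarrow>
      (LINT z:{0..T} \<times> cell a|lborel. frechet_derivative \<phi> (at z) b *\<^sub>R f (fst z) (snd z)) =
      - (LINT z:{0..T} \<times> cell a|lborel. \<phi> z *\<^sub>R g (fst z) (snd z)))"

abbreviation weak_dt where "weak_dt a T \<equiv> weak_deriv a T (1, 0)"

abbreviation weak_dx where "weak_dx a T j \<equiv> weak_deriv a T (0, axis j 1)"

definition ae_torus :: "real^3 \<Rightarrow> real \<Rightarrow> (real \<Rightarrow> real^3 \<Rightarrow> bool) \<Rightarrow> bool"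
  where "ae_torus a T P \<longleftrightarrow>
    (AE z in lborel. z \<in> {0..T} \<times> cell a \<longrightarrow> P (fst z) (snd z))"

definition weakly_div_free :: "real^3 \<Rightarrow> (real^3 \<Rightarrow> real^3) \<Rightarrow> bool"
  where "weakly_div_free a v \<longleftrightarrow> (\<forall>\<phi>. smooth \<phi> \<and> periodic a \<phi> \<longrightarrow>
    (LINT x:cell a|lborel. (\<Sum>j\<in>UNIV. frechet_derivative \<phi> (at x) (axis j 1) * v x $ j)) = 0)"


section \<open>The perturbed Boussinesq system and its filtering\<close>

lemma vector_4:
  "(vector [w, x, y, z] :: 'a::zero^4) $ 1 = w"
  "(vector [w, x, y, z] :: 'a::zero^4) $ 2 = x"
  "(vector [w, x, y, z] :: 'a::zero^4) $ 3 = y"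
  "(vector [w, x, y, z] :: 'a::zero^4) $ 4 = z"
  unfolding vector_def by simp_all

definition vel :: "real^4 \<Rightarrow> real^3"
  where "vel X = vector [X$1, X$2, X$3]"

definition hor :: "real^4 \<Rightarrow> real^2"
  where "hor X = vector [X$1, X$2]"

definition with_fourth :: "real^3 \<Rightarrow> real \<Rightarrow> real^4"
  where "with_fourth w c = vector [w$1, w$2, w$3, c]"

definition A_op :: "'a::ab_group_add^4 \<Rightarrow> 'a^4"
  where "A_op X = vector [0, 0, X$4, - X$3]"

text \<open>The data space: \<open>H\<^sup>s\<close> fields of zero mean with divergence-free velocity.\<close>

definition data_space :: "real^3 \<Rightarrow> real \<Rightarrow> (real^3 \<Rightarrow> real^4) set"
  where "data_space a s = {V0 \<in> sobolev a s.
    (LINT x:cell a|lborel. V0 x) = 0 \<and> weakly_div_free a (\<lambda>x. vel (V0 x))}"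

text \<open>
  \<open>V\<close> is a solution in \<open>C([0,T]; H\<^sup>s)\<close>: the weak derivatives \<open>Vt\<close>,
  \<open>D j\<close> (of \<open>V\<close>), \<open>D2 j\<close> (second ones of the velocity) and \<open>G\<close> (gradient of the
  pressure) exist as functions, and the equations hold almost everywhere.
\<close>

definition pbs_solution ::
  "real^3 \<Rightarrow> real \<Rightarrow> real \<Rightarrow> real \<Rightarrow> real \<Rightarrow> (real^3 \<Rightarrow> real^4) \<Rightarrow>
    (real \<Rightarrow> real^3 \<Rightarrow> real^4) \<Rightarrow> bool"
  where "pbs_solution a \<nu> \<epsilon> s T V0 V \<longleftrightarrow>
    V \<in> cont_sobolev a T s \<and>
    (\<forall>t\<in>{0..T}. (LINT x:cell a|lborel. V t x) = 0) \<and>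
    (AE x in lborel. V 0 x = V0 x) \<and>
    (\<exists>Vt D D2 \<Phi> G.
      weak_dt a T V Vt \<and>
      (\<forall>j. weak_dx a T j V (D j)) \<and>
      (\<forall>j. weak_dx a T j (\<lambda>t x. vel (D j t x)) (D2 j)) \<and>
      (\<forall>t. periodic a (\<Phi> t)) \<and>
      (\<forall>j. weak_dx a T j \<Phi> (\<lambda>t x. G t x $ j)) \<and>
      ae_torus a T (\<lambda>t x.
        Vt t x + (\<Sum>j\<in>UNIV. vel (V t x) $ j *\<^sub>R D j t x)
          - with_fourth (\<nu> *\<^sub>R (\<Sum>j\<in>UNIV. D2 j t x)) 0
          + (1 / \<epsilon>) *\<^sub>R A_op (V t x)
        = - ((1 / \<epsilon>) *\<^sub>R with_fourth (G t x) 0)) \<and>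
      ae_torus a T (\<lambda>t x. (\<Sum>j\<in>UNIV. vel (D j t x) $ j) = 0))"

text \<open>Symbol of the Leray projector on the first three components and the identity on the
  fourth.  At frequency zero, division by zero makes it the identity, as it should be.\<close>

definition leray :: "real^3 \<Rightarrow> int^3 \<Rightarrow> complex^4 \<Rightarrow> complex^4"
  where "leray a n X =
    (let k = freq a n;
         q = (of_real (k$1) * X$1 + of_real (k$2) * X$2 + of_real (k$3) * X$3)
               / of_real ((norm k)\<^sup>2)
     in vector [X$1 - q * of_real (k$1), X$2 - q * of_real (k$2), X$3 - q * of_real (k$3), X$4])"

text \<open>Symbol of \<open>exp (- \<tau> P A)\<close>, as the exponential power series of the symbol of
  \<open>P A\<close>.\<close>

definition propagator_symbol :: "real^3 \<Rightarrow> real \<Rightarrow> int^3 \<Rightarrow> complex^4 \<Rightarrow> complex^4"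
  where "propagator_symbol a \<tau> n X =
    (\<Sum>k. ((- \<tau>)^k / fact k) *\<^sub>R ((\<lambda>Y. leray a n (A_op Y)) ^^ k) X)"

definition propagator :: "real^3 \<Rightarrow> real \<Rightarrow> (real^3 \<Rightarrow> real^4) \<Rightarrow> real^3 \<Rightarrow> real^4"
  where "propagator a \<tau> f = synth a (\<lambda>n. propagator_symbol a \<tau> n (fourier a f n))"

definition filtered ::
  "real^3 \<Rightarrow> (real \<Rightarrow> real \<Rightarrow> real^3 \<Rightarrow> real^4) \<Rightarrow> real \<Rightarrow> real \<Rightarrow> real^3 \<Rightarrow> real^4"
  where "filtered a V \<epsilon> t = propagator a (- t / \<epsilon>) (V \<epsilon> t)"

text \<open>\<open>U\<close> is a limit point of the family \<open>W \<epsilon>\<close> in \<open>C([0,T]; H\<^sup>\<sigma>)\<close>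
  as \<open>\<epsilon>\<close> tends to zero from above.\<close>

definition limit_point ::
  "real^3 \<Rightarrow> real \<Rightarrow> real \<Rightarrow> (real \<Rightarrow> real \<Rightarrow> real^3 \<Rightarrow> real^4) \<Rightarrow>
    (real \<Rightarrow> real^3 \<Rightarrow> real^4) \<Rightarrow> bool"
  where "limit_point a T \<sigma> W U \<longleftrightarrow>
    U \<in> cont_sobolev a T \<sigma> \<and>
    (\<exists>e. (\<forall>k::nat. 0 < e k) \<and> e \<longlonglongrightarrow> 0 \<and>
      (\<forall>\<delta>>0. \<forall>\<^sub>F k in sequentially. \<forall>t\<in>{0..T}.
        sobolev_norm a \<sigma> (\<lambda>x. W (e k) t x - U t x) < \<delta>))"


section \<open>The limit system\<close>

definition e0 :: "real^3 \<Rightarrow> int^3 \<Rightarrow> complex^4"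
  where "e0 a n =
    (let k = freq a n; r = sqrt ((k$1)\<^sup>2 + (k$2)\<^sup>2)
     in vector [of_real (- k$2 / r), of_real (k$1 / r), 0, 0])"

definition hermitian :: "complex^4 \<Rightarrow> complex^4 \<Rightarrow> complex"
  where "hermitian X Y = (\<Sum>i\<in>UNIV. X$i * cnj (Y$i))"

text \<open>Projection onto the span of the fields with wave vector \<open>n\<close>, horizontal part
  \<open>(n$1, n$2)\<close> not zero, and amplitude \<open>e0 a n\<close>.\<close>

definition proj0 :: "real^3 \<Rightarrow> (real^3 \<Rightarrow> real^4) \<Rightarrow> real^3 \<Rightarrow> real^4"
  where "proj0 a f = synth a (\<lambda>n. if n$1 \<noteq> 0 \<or> n$2 \<noteq> 0
    then hermitian (fourier a f n) (e0 a n) *s e0 a n else 0)"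

definition hor_average :: "real^3 \<Rightarrow> (real^3 \<Rightarrow> real^4) \<Rightarrow> real \<Rightarrow> real^4"
  where "hor_average a f x3 = (1 / (4 * pi\<^sup>2 * a$1 * a$2)) *\<^sub>R
    (LINT y:cbox (0::real^2) (vector [2 * pi * a$1, 2 * pi * a$2])|lborel.
      f (vector [y$1, y$2, x3]))"

text \<open>
  \<open>u\<close> solves, with the given advecting field \<open>w\<close> depending on \<open>(t, x\<^sub>3)\<close> only,
  the limit equations almost everywhere on the product of the torus with \<open>[0,T]\<close>; all
  derivatives are weak derivatives that are functions, as for the original system.
\<close>

definition limit_solution ::
  "real^3 \<Rightarrow> real \<Rightarrow> real \<Rightarrow> (real \<Rightarrow> real \<Rightarrow> real^2) \<Rightarrow> (real \<Rightarrow> real^3 \<Rightarrow> real^2) \<Rightarrow> bool"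
  where "limit_solution a \<nu> T w u \<longleftrightarrow>
    (\<exists>ut D D2 p G.
      weak_dt a T u ut \<and>
      (\<forall>j. weak_dx a T j u (D j)) \<and>
      (\<forall>j. weak_dx a T j (D j) (D2 j)) \<and>
      (\<forall>t. periodic a (p t)) \<and>
      weak_dx a T 1 p (\<lambda>t x. G t x $ 1) \<and>
      weak_dx a T 2 p (\<lambda>t x. G t x $ 2) \<and>
      ae_torus a T (\<lambda>t x.
        ut t x + (u t x $ 1 *\<^sub>R D 1 t x + u t x $ 2 *\<^sub>R D 2 t x)
          + (w t (x$3) $ 1 *\<^sub>R D 1 t x + w t (x$3) $ 2 *\<^sub>R D 2 t x)
          - \<nu> *\<^sub>R (\<Sum>j\<in>UNIV. D2 j t x)
        = - (G t x :: real^2)) \<and>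
      ae_torus a T (\<lambda>t x. D 1 t x $ 1 + D 2 t x $ 2 = 0))"

end

theory Submission
  imports Defs
begin

text \<open>
  On the Fourier mode \<open>n\<close> the operator \<open>P A\<close> is a matrix.  If \<open>n\<close> has a horizontal part, this
  matrix has three eigenvectors with divergence-free velocity: \<open>e0 n\<close>, with eigenvalue zero, and two
  internal waves, with eigenvalues \<open>\<plusminus> \<i> omega n\<close>, where \<open>omega n\<close> is the length of the
  horizontal wave vector divided by the length of the wave vector.  Otherwise the matrix does not
  touch the horizontal velocity.  A solution of the system is therefore the sum of a slow part, which
  the propagator does not move, and of waves that turn with phases \<open>exp (\<plusminus> \<i> omega n t / \<epsilon>)\<close>
  (\<open>mode_decomposition\<close>).

  Testing the system with \<open>e0 n\<close> times the character of \<open>n\<close> removes the pressure and the singular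
  term, both orthogonal to \<open>e0 n\<close>, and leaves an equation for one amplitude with a quadratic sum
  over the pairs \<open>n = k + m\<close> (\<open>mode_equation\<close>).  Every pair splits into products of slow parts and
  waves.  A product whose total phase oscillates vanishes in the limit by the Riemann-Lebesgue
  lemma.  A product whose phase is constant, but which is not slow times slow, consists of two waves of
  equal frequency and opposite phase; its amplitude vanishes after symmetrisation in \<open>k\<close> and \<open>m\<close>, by
  an explicit computation (\<open>wave_interaction\<close>).  Hence only the slow part interacts with itself
  (\<open>interaction_limit\<close>), and the uniform decay of the Fourier coefficients allows the limit to be
  taken inside the sum (\<open>limit_mode_equation\<close>).

  The slow velocity is the projection plus the horizontal average, so its self-interaction is the
  convection term of the limit system; the average does not interact with itself.  The component of
  that term along the horizontal wave vector is a gradient, which defines the pressure mode by mode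
  through a bounded multiplier (\<open>dc_mode\<close>).

  It remains to return from modes to functions.  Truncations of the Fourier series have
  the expected weak derivatives, and weak derivatives pass to limits in \<open>L\<^sup>1\<close>
  (\<open>weak_deriv_mean_limit\<close>).  For the second derivatives, whose coefficients are only square summable
  with a positive weight, the limit comes from completeness of \<open>L\<^sup>1\<close> (\<open>mean_limit_weighted\<close>).
  Continuity in time with values in the weaker Sobolev spaces follows from the continuity of each mode
  and the uniform bound in the strongest space (\<open>cont_sobolev_synth\<close>).  The horizontal average
  and the representatives of the fields are compared with Fourier series through the completeness of
  the characters (\<open>fourier_complete\<close>).
\<close>

section \<open>Lattice sums\<close>

locale torus =
  fixes a :: "real^3"
  assumes side_pos: "\<And>i. 0 < a $ i"
begin

definition vol :: real where "vol = (2*pi)^3 * a$1 * a$2 * a$3"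

definition wt :: "int^3 \<Rightarrow> real" where "wt n = 1 + (norm (freq a n))\<^sup>2"

definition fc :: "(real^3 \<Rightarrow> real) \<Rightarrow> int^3 \<Rightarrow> complex" where
  "fc g n = (LINT x:cell a|lborel. cis (- (freq a n \<bullet> x)) * complex_of_real (g x)) / complex_of_real vol"

lemma vol_pos: "0 < vol"
  using side_pos by (simp add: vol_def)

lemma fourier_nth: "fourier a f n $ i = fc (\<lambda>x. f x $ i) n"
  by (simp add: fourier_def fc_def vol_def)

lemma freq_nth: "freq a n $ i = of_int (n$i) / a$i"
  by (simp add: freq_def)

lemma freq_add: "freq a (n + m) = freq a n + freq a m"
  and freq_minus: "freq a (- n) = - freq a n"
  and freq_diff: "freq a (n - m) = freq a n - freq a m"
  and freq_0 [simp]: "freq a 0 = 0"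
  by (simp_all add: vec_eq_iff freq_nth add_divide_distrib diff_divide_distrib)

lemma side_nz [simp]: "a $ i \<noteq> 0"
  using side_pos[of i] by simp

lemma wt_ge_1: "1 \<le> wt n" and wt_pos: "0 < wt n"
  by (simp_all add: wt_def add_pos_nonneg)

lemma wt_minus [simp]: "wt (- n) = wt n"
  by (simp add: wt_def freq_minus)

lemma norm_freq_le: "norm (freq a n) \<le> sqrt (wt n)"
  by (simp add: wt_def real_le_rsqrt)

lemma norm_freq_nth_le: "\<bar>freq a n $ i\<bar> \<le> sqrt (wt n)"
  using norm_freq_le component_le_norm_cart order_trans by blast

lemma wt_coordinate:
  obtains A where "1 \<le> A" "\<And>n i. 1 + (of_int (n$i))\<^sup>2 \<le> A * wt n"
proof
  define A where "A = 1 + (\<Sum>i\<in>UNIV. (a$i)\<^sup>2)"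
  show "1 \<le> A" by (simp add: A_def sum_nonneg)
  fix n :: "int^3" and i
  have "(a$i)\<^sup>2 \<le> (\<Sum>i\<in>UNIV. (a$i)\<^sup>2)" by (rule member_le_sum) auto
  then have Ai: "(a$i)\<^sup>2 \<le> A" by (simp add: A_def)
  have "(freq a n $ i)\<^sup>2 \<le> (norm (freq a n))\<^sup>2"
    using component_le_norm_cart[of "freq a n" i] by (metis abs_le_square_iff abs_norm_cancel)
  then have "(a$i)\<^sup>2 * (freq a n $ i)\<^sup>2 \<le> A * (norm (freq a n))\<^sup>2"
    using Ai order_trans[OF zero_le_power2 Ai] by (intro mult_mono) auto
  then have "(of_int (n$i))\<^sup>2 \<le> A * (norm (freq a n))\<^sup>2"
    by (simp add: freq_nth power_divide)
  then show "1 + (of_int (n$i))\<^sup>2 \<le> A * wt n"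
    using \<open>1 \<le> A\<close> by (simp add: wt_def algebra_simps)
qed

lemma summable_int_weight:
  assumes "1/2 < (q::real)"
  shows "(\<lambda>m::int. (1 + (of_int m)\<^sup>2) powr - q) summable_on UNIV"
proof -
  have "summable (\<lambda>m::nat. (1 + (real m)\<^sup>2) powr - q)"
  proof (rule summable_comparison_test_ev)
    show "summable (\<lambda>m::nat. real m powr (- 2 * q))"
      using assms by (subst summable_real_powr_iff) simp
    show "\<forall>\<^sub>F m in sequentially. norm ((1 + (real m)\<^sup>2) powr - q) \<le> real m powr (- 2 * q)"
      using eventually_gt_at_top[of 0]
    proof eventually_elim
      case (elim m)
      have "(1 + (real m)\<^sup>2) powr - q \<le> ((real m)\<^sup>2) powr - q"
        using assms elim by (intro powr_mono2') auto
      also have "\<dots> = real m powr (- 2 * q)"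
        using elim powr_powr[of "real m" 2 "-q"] by (simp add: powr_numeral)
      finally show ?case by simp
    qed
  qed
  then have nat: "(\<lambda>m::nat. (1 + (real m)\<^sup>2) powr - q) summable_on UNIV"
    by (subst summable_on_UNIV_nonneg_real_iff) auto
  have r: "(\<lambda>m::int. (1 + (of_int m)\<^sup>2) powr - q) summable_on range int"
    "(\<lambda>m::int. (1 + (of_int m)\<^sup>2) powr - q) summable_on range (\<lambda>m. - int m)"
    using nat by (subst summable_on_reindex; simp add: o_def inj_on_def)+
  have "(UNIV::int set) = range int \<union> range (\<lambda>m. - int m)"
  proof (intro equalityI subsetI)
    show "m \<in> range int \<union> range (\<lambda>m. - int m)" for m by (cases m rule: int_cases2) auto
  qed simp
  then show ?thesis using summable_on_union[OF r] by simp
qed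

lemma bij_vector3: "bij (\<lambda>(x, y, z). vector [x, y, z] :: 'b::zero^3)"
proof (rule bijI')
  show "((case p of (x, y, z) \<Rightarrow> (vector [x, y, z] :: 'b^3)) = (case p' of (x, y, z) \<Rightarrow> vector [x, y, z])) = (p = p')"
    for p p' :: "'b \<times> 'b \<times> 'b"
    by (auto simp: vec_eq_iff forall_3 split: prod.splits)
  show "\<exists>p. v = (case p of (x, y, z) \<Rightarrow> vector [x, y, z])" for v :: "'b^3"
    by (rule exI[of _ "(v$1, v$2, v$3)"]) (auto simp: vec_eq_iff forall_3)
qed

lemma summable_on_product:
  fixes f :: "'x \<Rightarrow> real" and g :: "'y \<Rightarrow> real"
  assumes "f summable_on UNIV" "g summable_on UNIV" "\<And>x. 0 \<le> f x" "\<And>y. 0 \<le> g y"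
  shows "(\<lambda>(x, y). f x * g y) summable_on UNIV"
proof -
  have "(\<lambda>(x, y). f x * g y) summable_on (UNIV \<times> UNIV)"
  proof (rule summable_on_SigmaI)
    show "((\<lambda>y. case (x, y) of (x, y) \<Rightarrow> f x * g y) has_sum f x * infsum g UNIV) UNIV" for x
      using assms by (auto intro!: has_sum_cmult_right has_sum_infsum)
    show "(\<lambda>x. f x * infsum g UNIV) summable_on UNIV"
      using assms by (intro summable_on_cmult_left)
  qed (use assms in auto)
  then show ?thesis by simp
qed

text \<open>Since \<open>wt n\<close> dominates each \<open>1 + n$i\<^sup>2\<close>, it dominates the cube root of their product, and
  the threefold sum factorises.\<close>

lemma summable_wt:
  assumes r: "3/2 < r"
  shows "(\<lambda>n. wt n powr - r) summable_on UNIV"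
proof -
  define q where "q = r / 3"
  have q: "1/2 < q" using r by (simp add: q_def)
  obtain A where A: "1 \<le> A" "\<And>n i. 1 + (of_int (n$i))\<^sup>2 \<le> A * wt n" using wt_coordinate by blast
  let ?h = "\<lambda>m::int. (1 + (of_int m)\<^sup>2) powr - q :: real"
  have h: "?h summable_on UNIV" by (rule summable_int_weight[OF q])
  have "(\<lambda>(x, y, z). ?h x * (?h y * ?h z)) summable_on UNIV"
    using summable_on_product[OF h summable_on_product[OF h h]] by (simp add: case_prod_unfold)
  then have "((\<lambda>n::int^3. ?h (n$1) * (?h (n$2) * ?h (n$3))) \<circ> (\<lambda>(x, y, z). vector [x, y, z])) summable_on UNIV"
    by (simp add: o_def case_prod_unfold)
  then have "(\<lambda>n::int^3. ?h (n$1) * (?h (n$2) * ?h (n$3))) summable_on range (\<lambda>(x, y, z). vector [x, y, z])"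
    by (rule summable_on_reindex[OF bij_is_inj[OF bij_vector3], THEN iffD2])
  then have "(\<lambda>n::int^3. ?h (n$1) * (?h (n$2) * ?h (n$3))) summable_on UNIV"
    unfolding bij_is_surj[OF bij_vector3] .
  then have s: "(\<lambda>n::int^3. A powr r * (?h (n$1) * (?h (n$2) * ?h (n$3)))) summable_on UNIV"
    by (rule summable_on_cmult_right)
  have "wt n powr - r \<le> A powr r * (?h (n$1) * (?h (n$2) * ?h (n$3)))" for n
  proof -
    have Aw: "0 < A * wt n" using A(1) wt_pos[of n] by simp
    have "(A * wt n) powr - q \<le> ?h (n$i)" for i
      using A(2)[where n=n and i=i] q by (intro powr_mono2') (auto simp: add_pos_nonneg)
    then have "(A * wt n) powr - q * ((A * wt n) powr - q * (A * wt n) powr - q)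
        \<le> ?h (n$1) * (?h (n$2) * ?h (n$3))"
      by (intro mult_mono) auto
    moreover have "(A * wt n) powr - q * ((A * wt n) powr - q * (A * wt n) powr - q) = (A * wt n) powr - r"
      by (simp add: powr_add[symmetric] q_def)
    moreover have "(A * wt n) powr - r = A powr - r * wt n powr - r"
      by (rule powr_mult)
    ultimately have "A powr - r * wt n powr - r \<le> ?h (n$1) * (?h (n$2) * ?h (n$3))" by simp
    then have "A powr r * (A powr - r * wt n powr - r) \<le> A powr r * (?h (n$1) * (?h (n$2) * ?h (n$3)))"
      by (rule mult_left_mono) simp
    moreover have "A powr r * A powr - r = 1"
      using A(1) by (simp add: powr_add[symmetric])
    ultimately show ?thesis by (simp add: mult.assoc[symmetric])
  qed
  then show ?thesis
    using summable_on_comparison_test[OF s] by simp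
qed

lemma finite_wt_le: "finite {n. wt n \<le> R}"
proof -
  obtain A where A: "1 \<le> A" "\<And>n i. 1 + (of_int (n$i))\<^sup>2 \<le> A * wt n" using wt_coordinate by blast
  define B where "B = \<lceil>A * R\<rceil>"
  have in_B: "n $ i \<in> {-B..B}" if "wt n \<le> R" for n :: "int^3" and i
  proof -
    have "(of_int (n$i))\<^sup>2 \<le> A * R"
      using A(2)[where n=n and i=i] mult_left_mono[OF that, of A] A(1) by linarith
    then have "(of_int ((n$i)\<^sup>2)::real) \<le> of_int B"
      using le_of_int_ceiling[of "A * R"] unfolding B_def of_int_power by (rule order_trans)
    then have "(n$i)\<^sup>2 \<le> B" by linarith
    moreover have "\<bar>n$i\<bar> \<le> (n$i)\<^sup>2"
    proof (cases "n$i = 0")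
      case False
      then have "\<bar>n$i\<bar> * 1 \<le> \<bar>n$i\<bar> * \<bar>n$i\<bar>" by (intro mult_left_mono) auto
      then show ?thesis by (simp add: power2_eq_square)
    qed simp
    ultimately show ?thesis by auto
  qed
  have "{n. wt n \<le> R} \<subseteq> (\<lambda>(x, y, z). vector [x, y, z]) ` ({-B..B} \<times> {-B..B} \<times> {-B..B})"
  proof
    fix n assume "n \<in> {n. wt n \<le> R}"
    then have "(n$1, n$2, n$3) \<in> {-B..B} \<times> {-B..B} \<times> {-B..B}" using in_B by simp
    moreover have "n = (\<lambda>(x, y, z). vector [x, y, z]) (n$1, n$2, n$3)" by (simp add: vec_eq_iff forall_3)
    ultimately show "n \<in> (\<lambda>(x, y, z). vector [x, y, z]) ` ({-B..B} \<times> {-B..B} \<times> {-B..B})"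
      by (rule rev_image_eqI)
  qed
  then show ?thesis by (rule finite_subset) simp
qed

text \<open>Radii that grow geometrically make consecutive truncations of a Fourier series differ
  by a geometrically small amount (see \<open>trunc_shell\<close>).\<close>

definition ball_modes :: "nat \<Rightarrow> (int^3) set" where "ball_modes N = {n. wt n < 2^N}"

lemma finite_ball_modes [simp]: "finite (ball_modes N)"
  by (rule finite_subset[OF _ finite_wt_le[of "2^N"]]) (auto simp: ball_modes_def)

lemma ball_modes_exhaust: "filterlim ball_modes (finite_subsets_at_top UNIV) sequentially"
proof -
  have mono: "ball_modes i \<subseteq> ball_modes j" if "i \<le> j" for i j
    using power_increasing[OF that, of "2::real"] by (auto simp: ball_modes_def intro: less_le_trans)
  have ev: "\<forall>\<^sub>F N in sequentially. X \<subseteq> ball_modes N" if "finite X" for X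
    using that
  proof (induction X)
    case empty then show ?case by simp
  next
    case (insert x X)
    obtain N where "wt x < 2^N" using real_arch_pow[of 2 "wt x"] by auto
    then have "x \<in> ball_modes N" by (simp add: ball_modes_def)
    then have "\<forall>\<^sub>F N in sequentially. x \<in> ball_modes N"
      using mono by (auto simp: eventually_sequentially intro!: exI[of _ N])
    with insert.IH show ?case by eventually_elim auto
  qed
  show ?thesis
    unfolding filterlim_def le_filter_def eventually_filtermap eventually_finite_subsets_at_top
  proof (intro allI impI, elim exE conjE)
    fix P and X :: "(int^3) set" assume "finite X" "\<forall>Y. finite Y \<and> X \<subseteq> Y \<and> Y \<subseteq> UNIV \<longrightarrow> P Y"
    with ev[OF \<open>finite X\<close>] show "\<forall>\<^sub>F N in sequentially. P (ball_modes N)"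
      by (auto elim!: eventually_mono)
  qed
qed

lemma has_sum_ball_modes:
  fixes f :: "int^3 \<Rightarrow> 'b::{comm_monoid_add, topological_space}"
  assumes "(f has_sum S) UNIV"
  shows "(\<lambda>N. sum f (ball_modes N)) \<longlonglongrightarrow> S"
  using assms ball_modes_exhaust unfolding has_sum_def by (rule filterlim_compose)

end

section \<open>Integration over the period cell\<close>

lemma prod_3: "prod f (UNIV :: 3 set) = f 1 * f 2 * f 3"
  for f :: "3 \<Rightarrow> 'b::comm_monoid_mult"
  unfolding UNIV_3 by (simp add: ac_simps)

lemma restrict_pair:
  fixes A :: "'b::euclidean_space set" and B :: "'c::euclidean_space set"
  assumes A: "A \<in> sets borel" and B: "B \<in> sets borel"
  shows "restrict_space lborel A \<Otimes>\<^sub>M restrict_space lborel B = restrict_space lborel (A \<times> B)"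
    (is "?M \<Otimes>\<^sub>M ?N = ?R")
proof (rule pair_measure_eqI)
  show "sigma_finite_measure ?M" "sigma_finite_measure ?N"
    using A B by (auto intro!: sigma_finite_measure_restrict_space lborel.sigma_finite_measure_axioms)
  have sp: "space ?R = A \<times> B" "space (?M \<Otimes>\<^sub>M ?N) = A \<times> B"
    by (simp_all add: space_restrict_space space_pair_measure)
  have AB: "A \<times> B \<in> sets borel" using A B borel_Times by blast
  have 1: "(\<lambda>z. z) \<in> ?R \<rightarrow>\<^sub>M ?M \<Otimes>\<^sub>M ?N"
  proof (rule measurable_pair)
    show "fst \<circ> (\<lambda>z. z) \<in> ?R \<rightarrow>\<^sub>M ?M" "snd \<circ> (\<lambda>z. z) \<in> ?R \<rightarrow>\<^sub>M ?N"
      by (intro measurable_restrict_space3;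
          auto simp: o_def intro!: borel_measurable_continuous_onI continuous_intros)+
  qed
  have 2: "(\<lambda>z. z) \<in> ?M \<Otimes>\<^sub>M ?N \<rightarrow>\<^sub>M ?R"
  proof (rule measurable_restrict_space2)
    have "(\<lambda>z. (fst z, snd z)) \<in> ?M \<Otimes>\<^sub>M ?N \<rightarrow>\<^sub>M borel"
      by (intro borel_measurable_Pair measurable_compose[OF measurable_fst] measurable_compose[OF measurable_snd])
        (simp_all add: measurable_restrict_space1)
    then show "(\<lambda>z. z) \<in> ?M \<Otimes>\<^sub>M ?N \<rightarrow>\<^sub>M lborel" by simp
  qed (simp add: sp)
  show "sets (?M \<Otimes>\<^sub>M ?N) = sets ?R"
  proof (intro equalityI subsetI)
    fix S assume "S \<in> sets (?M \<Otimes>\<^sub>M ?N)"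
    from measurable_sets[OF 1 this] sets.sets_into_space[OF this] show "S \<in> sets ?R" by (simp add: sp Int_absorb2)
  next
    fix S assume "S \<in> sets ?R"
    from measurable_sets[OF 2 this] sets.sets_into_space[OF this] show "S \<in> sets (?M \<Otimes>\<^sub>M ?N)" by (simp add: sp Int_absorb2)
  qed
  fix S S' assume "S \<in> sets ?M" "S' \<in> sets ?N"
  then have S: "S \<in> sets borel" "S \<subseteq> A" "S' \<in> sets borel" "S' \<subseteq> B"
    using A B by (auto simp: sets_restrict_space)
  have "emeasure ?R (S \<times> S') = emeasure (lborel \<Otimes>\<^sub>M lborel) (S \<times> S')"
    unfolding lborel_prod by (rule emeasure_restrict_space) (use S AB in auto)
  also have "\<dots> = emeasure lborel S * emeasure lborel S'"
    using S by (intro lborel.emeasure_pair_measure_Times) auto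
  finally show "emeasure ?M S * emeasure ?N S' = emeasure ?R (S \<times> S')"
    using S A B by (simp add: emeasure_restrict_space)
qed

context torus begin

abbreviation E :: "int^3 \<Rightarrow> real^3 \<Rightarrow> complex" where "E n x \<equiv> cis (freq a n \<bullet> x)"

definition cellM :: "(real^3) measure" where "cellM = restrict_space lborel (cell a)"
definition timeM :: "real \<Rightarrow> real measure" where "timeM T = restrict_space lborel {0..T}"
definition cylM :: "real \<Rightarrow> (real \<times> (real^3)) measure" where "cylM T = restrict_space lborel ({0..T} \<times> cell a)"

lemma mem_cell: "x \<in> cell a \<longleftrightarrow> (\<forall>i. 0 \<le> x$i \<and> x$i \<le> 2 * pi * a$i)"
  by (simp add: cell_def mem_box_cart)

lemma compact_cell: "compact (cell a)" by (simp add: cell_def)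

lemma cell_sets [measurable]: "cell a \<in> sets borel" by (simp add: cell_def)

lemma cyl_sets [measurable]: "{0..T::real} \<times> cell a \<in> sets borel"
  by (intro borel_closed closed_Times closed_atLeastAtMost) (simp add: cell_def closed_cbox)

lemma space_cellM [simp]: "space cellM = cell a" and space_timeM [simp]: "space (timeM T) = {0..T}"
  and space_cylM [simp]: "space (cylM T) = {0..T} \<times> cell a"
  by (simp_all add: cellM_def timeM_def cylM_def space_restrict_space)

lemma measure_cell: "emeasure lborel (cell a) = ennreal vol"
proof -
  have ne: "cbox 0 ((2 * pi) *\<^sub>R a) \<noteq> {}"
    using side_pos by (auto simp: interval_ne_empty_cart less_imp_le)
  have "measure lborel (cell a) = (\<Prod>i\<in>UNIV. 2 * pi * a$i)"
    unfolding cell_def using content_cbox_cart[OF ne] by simp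
  also have "\<dots> = vol" unfolding prod_3 by (simp add: vol_def power3_eq_cube)
  finally show ?thesis
    by (metis cell_def emeasure_eq_ennreal_measure emeasure_lborel_cbox_finite infinity_ennreal_def less_irrefl)
qed

sublocale cellM: finite_measure cellM
  by standard (simp add: cellM_def emeasure_restrict_space measure_cell space_restrict_space)

lemma measure_cellM [simp]: "measure cellM (cell a) = vol"
  using vol_pos by (simp add: cellM_def measure_def emeasure_restrict_space measure_cell)

lemma finite_timeM: "finite_measure (timeM T)"
  by standard (simp add: timeM_def emeasure_restrict_space space_restrict_space emeasure_lborel_Icc_eq)

sublocale timeM: finite_measure "timeM T" for T by (rule finite_timeM)

lemma integral_cell: "(LINT x:cell a|lborel. f x) = integral\<^sup>L cellM f"
  for f :: "real^3 \<Rightarrow> 'b::{banach, second_countable_topology}"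
  by (simp add: cellM_def integral_restrict_space set_lebesgue_integral_def)

lemma integrable_cell: "set_integrable lborel (cell a) f \<longleftrightarrow> integrable cellM f"
  for f :: "real^3 \<Rightarrow> 'b::{banach, second_countable_topology}"
  by (simp add: cellM_def integrable_restrict_space set_integrable_def)

lemma integral_cyl: "(LINT z:{0..T} \<times> cell a|lborel. f z) = integral\<^sup>L (cylM T) f"
  for f :: "real \<times> (real^3) \<Rightarrow> 'b::{banach, second_countable_topology}"
  by (simp add: cylM_def integral_restrict_space set_lebesgue_integral_def)

lemma integrable_cyl: "set_integrable lborel ({0..T} \<times> cell a) f \<longleftrightarrow> integrable (cylM T) f"
  for f :: "real \<times> (real^3) \<Rightarrow> 'b::{banach, second_countable_topology}"
  by (simp add: cylM_def integrable_restrict_space set_integrable_def)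

lemma AE_cell: "(AE x in cellM. P x) \<longleftrightarrow> (AE x in lborel. x \<in> cell a \<longrightarrow> P x)"
  unfolding cellM_def by (subst AE_restrict_space_iff) auto

lemma AE_cyl: "(AE z in cylM T. P z) \<longleftrightarrow> (AE z in lborel. z \<in> {0..T} \<times> cell a \<longrightarrow> P z)"
  unfolding cylM_def by (subst AE_restrict_space_iff) auto

lemma ae_torus_cyl: "ae_torus a T P \<longleftrightarrow> (AE z in cylM T. P (fst z) (snd z))"
  by (simp add: ae_torus_def AE_cyl)

lemma measurable_cellM: "f \<in> borel_measurable borel \<Longrightarrow> f \<in> borel_measurable cellM"
  by (simp add: cellM_def measurable_restrict_space1)

lemma measurable_timeM: "f \<in> borel_measurable borel \<Longrightarrow> f \<in> borel_measurable (timeM T)"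
  by (simp add: timeM_def measurable_restrict_space1)

lemma cylM_eq: "cylM T = timeM T \<Otimes>\<^sub>M cellM"
  unfolding cylM_def timeM_def cellM_def by (rule restrict_pair[symmetric]) auto

sublocale tc: pair_sigma_finite "timeM T" cellM for T by unfold_locales

lemma finite_cylM: "finite_measure (cylM T)"
proof
  show "emeasure (cylM T) (space (cylM T)) \<noteq> \<infinity>"
    using cellM.emeasure_pair_measure_Times[of "{0..T}" "timeM T" "cell a"]
      timeM.emeasure_finite[of T "{0..T}"] cellM.emeasure_finite[of "cell a"]
      sets.top[of "timeM T"] sets.top[of cellM]
    by (simp add: cylM_eq[symmetric] ennreal_mult_eq_top_iff)
qed

sublocale cylM: finite_measure "cylM T" for T by (rule finite_cylM)

lemma fubini_cyl:
  fixes f :: "real \<times> (real^3) \<Rightarrow> 'b::{banach, second_countable_topology}"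
  assumes "integrable (cylM T) f"
  shows "integral\<^sup>L (cylM T) f = (\<integral>t. (\<integral>x. f (t, x) \<partial>cellM) \<partial>timeM T)"
    and "integrable (timeM T) (\<lambda>t. \<integral>x. f (t, x) \<partial>cellM)"
  using tc.integral_fst'[of T f] tc.integrable_fst'[of T f] assms by (simp_all add: cylM_eq)

text \<open>The exceptional null set may depend on the time without any control; measurability of
  the good set is what lets the sections decide.\<close>

lemma AE_cyl_combine:
  assumes "{z \<in> space (cylM T). P z} \<in> sets (cylM T)" "\<And>t. t \<in> {0..T} \<Longrightarrow> AE x in cellM. P (t, x)"
  shows "AE z in cylM T. P z"
proof -
  have "AE t in timeM T. AE x in cellM. P (t, x)"
    by (rule AE_I2) (use assms in auto)
  then show ?thesis
    using assms(1) unfolding cylM_eq by (intro tc.AE_pair_measure) auto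
qed

lemma integrable_cell_continuous:
  fixes g :: "real^3 \<Rightarrow> 'b::{banach, second_countable_topology}"
  assumes "continuous_on UNIV g" shows "integrable cellM g"
  using borel_integrable_compact[OF compact_cell continuous_on_subset[OF assms]]
  by (simp add: integrable_cell[symmetric] set_integrable_def)

lemma integral_cell_HK:
  fixes g :: "real^3 \<Rightarrow> 'b::euclidean_space"
  assumes "continuous_on UNIV g" shows "integral\<^sup>L cellM g = integral (cell a) g"
  using set_borel_integral_eq_integral(2)[of "cell a" g] integrable_cell_continuous[OF assms]
  by (simp add: integral_cell integrable_cell)

subsection \<open>The half-open cell and periodic functions\<close>

definition hcell :: "(real^3) set" where "hcell = {x. \<forall>i. 0 \<le> x$i \<and> x$i < 2 * pi * a$i}"

lemma hcell_sub: "hcell \<subseteq> cell a" by (auto simp: hcell_def mem_cell less_imp_le)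

lemma hcell_sets [measurable]: "hcell \<in> sets borel"
  unfolding hcell_def by measurable

lemma null_cell_hcell: "cell a - hcell \<in> null_sets lborel"
proof -
  have "cell a - hcell \<subseteq> cbox 0 ((2 * pi) *\<^sub>R a) - box 0 ((2 * pi) *\<^sub>R a)"
    by (auto simp: cell_def hcell_def mem_box_cart less_imp_le)
  then have "negligible (cell a - hcell)"
    using negligible_frontier_interval negligible_subset by blast
  then show ?thesis
    by (simp add: negligible_iff_null_sets null_sets_completion_iff)
qed

lemma AE_hcell: "AE x in lborel. x \<in> cell a \<longleftrightarrow> x \<in> hcell"
  using AE_not_in[OF null_cell_hcell] hcell_sub by (auto elim!: eventually_mono)

lemma integral_translate:
  fixes f :: "real^3 \<Rightarrow> 'b::{banach, second_countable_topology}"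
  assumes [measurable]: "f \<in> borel_measurable borel"
  shows "(\<integral>x. f (c + x) \<partial>lborel) = integral\<^sup>L lborel f"
proof -
  have "integral\<^sup>L lborel f = integral\<^sup>L (distr lborel borel ((+) c)) f"
    by (simp add: lborel_distr_plus)
  also have "\<dots> = (\<integral>x. f (c + x) \<partial>lborel)" by (rule integral_distr) auto
  finally show ?thesis ..
qed

lemma integral_cell_hcell:
  fixes f :: "real^3 \<Rightarrow> 'b::{banach, second_countable_topology}"
  assumes [measurable]: "f \<in> borel_measurable borel"
  shows "integral\<^sup>L cellM f = (\<integral>x. indicator hcell x *\<^sub>R f x \<partial>lborel)"
  unfolding integral_cell[symmetric] set_lebesgue_integral_def
  by (rule integral_cong_AE) (use AE_hcell in \<open>auto elim!: eventually_mono simp: indicator_def\<close>)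

text \<open>Moving the cell by \<open>h\<close> along an edge only shifts a slab of it by a whole period.\<close>

lemma integral_cell_shift:
  fixes g :: "real^3 \<Rightarrow> 'b::{banach, second_countable_topology}"
  assumes c: "continuous_on UNIV g" and p: "periodic a g" and h: "0 \<le> h" "h \<le> 2 * pi * a$j"
  shows "(\<integral>x. g (x + h *\<^sub>R axis j 1) \<partial>cellM) = integral\<^sup>L cellM g"
proof -
  define L where "L = 2 * pi * a$j"
  have [measurable]: "g \<in> borel_measurable borel" using c by (rule borel_measurable_continuous_onI)
  define e :: "real^3" where "e = axis j 1"
  define A where "A = {x \<in> hcell. h \<le> x$j}"
  define B where "B = {x \<in> hcell. x$j < h}"
  have [measurable]: "A \<in> sets borel" "B \<in> sets borel" unfolding A_def B_def by measurable
  have gL: "g (x + L *\<^sub>R e) = g x" for x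
  proof -
    have "L *\<^sub>R e = axis j (2 * pi * a$j)" by (simp add: e_def L_def vec_eq_iff axis_def)
    then show ?thesis using p by (simp add: periodic_def)
  qed
  have ej: "e $ j = 1" and ei: "\<And>i. i \<noteq> j \<Longrightarrow> e $ i = 0"
    by (auto simp: e_def axis_def)
  have hc: "z \<in> hcell \<longleftrightarrow> (\<forall>i. i \<noteq> j \<longrightarrow> 0 \<le> z$i \<and> z$i < 2 * pi * a$i) \<and> 0 \<le> z$j \<and> z$j < L" for z
    unfolding hcell_def L_def by auto
  have int: "integrable lborel (\<lambda>x. indicator S x *\<^sub>R g x)" if S: "S \<in> sets borel" "bounded S" for S
  proof -
    obtain R where R: "S \<subseteq> cball 0 R" using S(2) bounded_iff mem_cball_0 by (metis subsetI)
    have "set_integrable lborel (cball 0 R) g"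
      unfolding set_integrable_def
      by (rule borel_integrable_compact) (use c continuous_on_subset in auto)
    from set_integrable_subset[OF this _ R] S show ?thesis by (simp add: set_integrable_def)
  qed
  have bA: "bounded A" and bB: "bounded B"
    using hcell_sub by (auto simp: A_def B_def intro!: bounded_subset[OF compact_imp_bounded[OF compact_cell]])
  have BL: "((\<lambda>y. y - L *\<^sub>R e) -` B) \<in> sets borel" (is "?BL \<in> _")
    by (rule measurable_sets_borel) measurable
  have bBL: "bounded ?BL"
  proof -
    have "?BL = (+) (L *\<^sub>R e) ` B" by (auto simp: image_iff intro!: bexI[of _ "_ - L *\<^sub>R e"])
    then show ?thesis using bB by (simp add: bounded_translation)
  qed
  have "(\<integral>x. g (x + h *\<^sub>R e) \<partial>cellM) = (\<integral>x. indicator hcell x *\<^sub>R g (x + h *\<^sub>R e) \<partial>lborel)"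
    by (rule integral_cell_hcell) measurable
  also have "\<dots> = (\<integral>x. indicator hcell ((h *\<^sub>R e + x) - h *\<^sub>R e) *\<^sub>R g (h *\<^sub>R e + x) \<partial>lborel)"
    by (simp add: add.commute)
  also have "\<dots> = (\<integral>y. indicator hcell (y - h *\<^sub>R e) *\<^sub>R g y \<partial>lborel)"
    by (rule integral_translate[where f="\<lambda>y. indicator hcell (y - h *\<^sub>R e) *\<^sub>R g y"]) measurable
  also have "\<dots> = (\<integral>y. indicator A y *\<^sub>R g y + indicator ?BL y *\<^sub>R g y \<partial>lborel)"
  proof (rule Bochner_Integration.integral_cong[OF refl])
    fix y
    have "indicator hcell (y - h *\<^sub>R e) = indicator A y + (indicator ?BL y :: real)"
    proof -
      have 1: "y - h *\<^sub>R e \<in> hcell \<longleftrightarrow> (\<forall>i. i \<noteq> j \<longrightarrow> 0 \<le> y$i \<and> y$i < 2 * pi * a$i) \<and> h \<le> y$j \<and> y$j < L + h"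
        by (auto simp: hc ej ei)
      have 2: "y - L *\<^sub>R e \<in> B \<longleftrightarrow> (\<forall>i. i \<noteq> j \<longrightarrow> 0 \<le> y$i \<and> y$i < 2 * pi * a$i) \<and> L \<le> y$j \<and> y$j < L + h"
        using h by (auto simp: hc B_def ej ei L_def)
      have 3: "y \<in> A \<longleftrightarrow> (\<forall>i. i \<noteq> j \<longrightarrow> 0 \<le> y$i \<and> y$i < 2 * pi * a$i) \<and> h \<le> y$j \<and> y$j < L"
        using h by (auto simp: hc A_def)
      show ?thesis using 1 2 3 h by (auto simp: indicator_def L_def)
    qed
    then show "indicator hcell (y - h *\<^sub>R e) *\<^sub>R g y = indicator A y *\<^sub>R g y + indicator ?BL y *\<^sub>R g y"
      by (simp add: scaleR_left_distrib)
  qed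
  also have "\<dots> = (\<integral>y. indicator A y *\<^sub>R g y \<partial>lborel) + (\<integral>y. indicator ?BL y *\<^sub>R g y \<partial>lborel)"
    using int bA BL bBL by (intro Bochner_Integration.integral_add) auto
  also have "(\<integral>y. indicator ?BL y *\<^sub>R g y \<partial>lborel) = (\<integral>y. indicator ?BL (L *\<^sub>R e + y) *\<^sub>R g (L *\<^sub>R e + y) \<partial>lborel)"
    using BL by (intro integral_translate[symmetric]) measurable
  also have "\<dots> = (\<integral>y. indicator B y *\<^sub>R g y \<partial>lborel)"
    using gL by (simp add: add.commute indicator_def)
  also have "(\<integral>y. indicator A y *\<^sub>R g y \<partial>lborel) + \<dots> = (\<integral>y. indicator A y *\<^sub>R g y + indicator B y *\<^sub>R g y \<partial>lborel)"
    using int bA bB by (intro Bochner_Integration.integral_add[symmetric]) auto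
  also have "\<dots> = (\<integral>y. indicator hcell y *\<^sub>R g y \<partial>lborel)"
    by (rule Bochner_Integration.integral_cong) (auto simp: A_def B_def indicator_def)
  also have "\<dots> = integral\<^sup>L cellM g" by (rule integral_cell_hcell[symmetric]) measurable
  finally show ?thesis by (simp add: e_def)
qed

text \<open>The integral over the cell of a translate does not depend on the translation;
  differentiating it under the integral sign gives the claim.\<close>

lemma integral_cell_partial:
  fixes g g' :: "real^3 \<Rightarrow> 'b::euclidean_space"
  assumes p: "periodic a g" and c: "continuous_on UNIV g" and c': "continuous_on UNIV g'"
    and d: "\<And>x h. ((\<lambda>h. g (x + h *\<^sub>R axis j 1)) has_vector_derivative g' (x + h *\<^sub>R axis j 1)) (at h)"
  shows "integral\<^sup>L cellM g' = 0"
proof -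
  define U where "U = {0..2 * pi * a$j}"
  have U: "0 \<in> U" "convex U" using side_pos[of j] by (auto simp: U_def)
  have cc: "continuous_on UNIV (\<lambda>x. g (x + h *\<^sub>R axis j 1))" for h
    by (rule continuous_on_compose2[OF c]) (auto intro!: continuous_intros)
  have "((\<lambda>h. integral (cbox 0 ((2 * pi) *\<^sub>R a)) (\<lambda>x. g (x + h *\<^sub>R axis j 1))) has_vector_derivative
      integral (cbox 0 ((2 * pi) *\<^sub>R a)) (\<lambda>x. g' (x + 0 *\<^sub>R axis j 1))) (at 0 within U)"
  proof (rule leibniz_rule_vector_derivative[where fx="\<lambda>h x. g' (x + h *\<^sub>R axis j 1)"])
    show "((\<lambda>h. g (x + h *\<^sub>R axis j 1)) has_vector_derivative g' (x + h *\<^sub>R axis j 1)) (at h within U)" for h x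
      using d has_vector_derivative_at_within by blast
    show "(\<lambda>x. g (x + h *\<^sub>R axis j 1)) integrable_on cbox 0 ((2 * pi) *\<^sub>R a)" for h
      using cc[of h] by (intro integrable_continuous) (auto intro: continuous_on_subset)
    show "continuous_on (U \<times> cbox 0 ((2 * pi) *\<^sub>R a)) (\<lambda>(h, x). g' (x + h *\<^sub>R axis j 1))"
      unfolding case_prod_unfold
      by (rule continuous_on_compose2[OF c']) (auto intro!: continuous_intros)
  qed (use U in auto)
  then have 1: "((\<lambda>h. integral (cell a) (\<lambda>x. g (x + h *\<^sub>R axis j 1))) has_vector_derivative
      integral (cell a) g') (at 0 within U)" by (simp add: cell_def)
  have eq: "integral (cell a) (\<lambda>x. g (x + h *\<^sub>R axis j 1)) = integral\<^sup>L cellM g" if "h \<in> U" for h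
    using integral_cell_shift[OF c p, of h j] that integral_cell_HK[OF cc[of h]] by (simp add: U_def)
  have 2: "((\<lambda>h. integral (cell a) (\<lambda>x. g (x + h *\<^sub>R axis j 1))) has_vector_derivative 0) (at 0 within U)"
    by (rule has_vector_derivative_transform[OF \<open>0 \<in> U\<close> eq]) auto
  have "at 0 within U \<noteq> bot"
    using side_pos[of j] by (auto simp: U_def trivial_limit_within islimpt_Icc)
  then have "integral (cell a) g' = 0"
    using vector_derivative_unique_within[OF _ 1 2] by simp
  then show ?thesis using integral_cell_HK[OF c'] by simp
qed

lemma periodic_E: "periodic a (E n)"
proof -
  have "E n (x + axis i (2 * pi * a$i)) = E n x" for x i
  proof -
    have "freq a n \<bullet> (x + axis i (2 * pi * a$i)) = freq a n \<bullet> x + 2 * pi * of_int (n$i)"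
      by (simp add: inner_add_right inner_axis freq_nth)
    then show ?thesis by (simp add: cis_mult[symmetric])
  qed
  then show ?thesis by (simp add: periodic_def)
qed

lemma E_0 [simp]: "E 0 x = 1" by simp
lemma E_add: "E (n + m) x = E n x * E m x" by (simp add: freq_add inner_add_left cis_mult)
lemma E_minus: "E (- n) x = cnj (E n x)" by (simp add: freq_minus cis_cnj)
lemma cnj_E: "cnj (E n x) = E (- n) x" by (simp add: E_minus)
lemma continuous_E [continuous_intros]: "continuous_on S (E n)" by (intro continuous_intros)
lemma E_measurable [measurable]: "E n \<in> borel_measurable borel"
  by (rule borel_measurable_continuous_onI) (rule continuous_E)

lemma E_derivative:
  "((\<lambda>h. E n (x + h *\<^sub>R axis j 1)) has_vector_derivative
     (\<i> * of_real (freq a n $ j) * E n (x + h *\<^sub>R axis j 1))) (at h)"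
proof -
  have "((\<lambda>h. cis (freq a n \<bullet> x + h * freq a n $ j)) has_vector_derivative
     (\<i> * of_real (freq a n $ j) * cis (freq a n \<bullet> x + h * freq a n $ j))) (at h)"
    unfolding has_vector_derivative_def
    by (auto intro!: derivative_eq_intros simp: scaleR_conv_of_real algebra_simps)
  then show ?thesis by (simp add: inner_add_right inner_axis)
qed

lemma integral_E: "integral\<^sup>L cellM (E n) = (if n = 0 then of_real vol else 0)"
proof (cases "n = 0")
  case True
  then show ?thesis by (simp add: scaleR_conv_of_real)
next
  case False
  then obtain j where j: "n $ j \<noteq> 0" by (auto simp: vec_eq_iff)
  have "integral\<^sup>L cellM (\<lambda>x. \<i> * of_real (freq a n $ j) * E n x) = 0"
    by (rule integral_cell_partial[where g="E n" and j=j])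
      (auto intro!: periodic_E E_derivative continuous_intros)
  then have "\<i> * of_real (freq a n $ j) * integral\<^sup>L cellM (E n) = 0"
    by (subst integral_mult_right_zero[symmetric])
  then show ?thesis using j False by (simp add: freq_nth)
qed

end

section \<open>Fourier series\<close>

lemma integrable_bounded_mult:
  fixes f g :: "'x \<Rightarrow> 'b::{real_normed_algebra, banach, second_countable_topology}"
  assumes f: "integrable M f" and g: "g \<in> borel_measurable M" and B: "\<And>x. x \<in> space M \<Longrightarrow> norm (g x) \<le> B"
  shows "integrable M (\<lambda>x. g x * f x)"
proof (rule Bochner_Integration.integrable_bound[where f="\<lambda>x. B *\<^sub>R norm (f x)"])
  show "integrable M (\<lambda>x. B *\<^sub>R norm (f x))" using f by auto
  show "(\<lambda>x. g x * f x) \<in> borel_measurable M" using f g by measurable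
  show "AE x in M. norm (g x * f x) \<le> norm (B *\<^sub>R norm (f x))"
  proof (rule AE_I2)
    fix x assume "x \<in> space M"
    from B[OF this] have "norm (g x) * norm (f x) \<le> B * norm (f x)" by (rule mult_right_mono) simp
    then show "norm (g x * f x) \<le> norm (B *\<^sub>R norm (f x))"
      using norm_mult_ineq[of "g x" "f x"] by simp
  qed
qed

lemma zero_if_le_multiples:
  fixes x G :: real
  assumes le: "\<And>e. 0 < e \<Longrightarrow> \<bar>x\<bar> \<le> e * G" and G: "0 \<le> G"
  shows "x = 0"
proof (rule ccontr)
  assume x: "x \<noteq> 0"
  have "\<bar>x\<bar> \<le> (\<bar>x\<bar> / (2 * (G + 1))) * G" using x G by (intro le) auto
  also have "\<dots> \<le> \<bar>x\<bar> / 2" using G by (simp add: field_simps)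
  finally show False using x by simp
qed

context torus begin

definition ser :: "(int^3 \<Rightarrow> complex) \<Rightarrow> real^3 \<Rightarrow> complex" where
  "ser c x = (\<Sum>\<^sub>\<infinity>n. c n * E n x)"

lemma synth_nth: "synth a c x $ i = Re (ser (\<lambda>n. c n $ i) x)"
  by (simp add: synth_def ser_def)

definition l1 :: "(int^3 \<Rightarrow> complex) \<Rightarrow> bool" where "l1 c \<longleftrightarrow> (\<lambda>n. norm (c n)) summable_on UNIV"
definition l1norm :: "(int^3 \<Rightarrow> complex) \<Rightarrow> real" where "l1norm c = (\<Sum>\<^sub>\<infinity>n. norm (c n))"

lemma ser_has_sum: "l1 c \<Longrightarrow> ((\<lambda>n. c n * E n x) has_sum ser c x) UNIV"
  unfolding ser_def l1_def
  by (rule has_sum_infsum, rule abs_summable_summable) (simp add: norm_mult)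

lemma ser_tendsto: "l1 c \<Longrightarrow> (\<lambda>N. \<Sum>n\<in>ball_modes N. c n * E n x) \<longlonglongrightarrow> ser c x"
  by (rule has_sum_ball_modes[OF ser_has_sum])

lemma norm_partial_ser: "l1 c \<Longrightarrow> finite F \<Longrightarrow> norm (\<Sum>n\<in>F. c n * E n x) \<le> l1norm c"
proof -
  assume c: "l1 c" and F: "finite F"
  have "norm (\<Sum>n\<in>F. c n * E n x) \<le> (\<Sum>n\<in>F. norm (c n))"
    by (rule order_trans[OF norm_sum]) (simp add: norm_mult)
  also have "\<dots> \<le> l1norm c"
    unfolding l1norm_def using c F by (intro finite_sum_le_infsum) (auto simp: l1_def)
  finally show ?thesis .
qed

lemma norm_ser: assumes c: "l1 c" shows "norm (ser c x) \<le> l1norm c"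
proof (rule LIMSEQ_le_const2[OF tendsto_norm[OF ser_tendsto[OF c]]])
  show "\<exists>N. \<forall>n\<ge>N. norm (\<Sum>n\<in>ball_modes n. c n * E n x) \<le> l1norm c"
    using norm_partial_ser[OF c finite_ball_modes] by simp
qed

lemma l1norm_nonneg: "0 \<le> l1norm c" unfolding l1norm_def by (rule infsum_nonneg) simp

lemma norm_ser_remainder:
  assumes c: "l1 c" and F: "finite F"
  shows "norm (ser c x - (\<Sum>n\<in>F. c n * E n x)) \<le> l1norm c - (\<Sum>n\<in>F. norm (c n))"
proof (rule norm_has_sum_bound)
  show "((\<lambda>n. c n * E n x) has_sum ser c x - (\<Sum>n\<in>F. c n * E n x)) (UNIV - F)"
    using F by (intro has_sum_Diff ser_has_sum[OF c] has_sum_finite) auto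
  have "((\<lambda>n. norm (c n)) has_sum l1norm c - (\<Sum>n\<in>F. norm (c n))) (UNIV - F)"
    using F c unfolding l1norm_def l1_def by (intro has_sum_Diff has_sum_infsum has_sum_finite) auto
  then show "((\<lambda>n. norm (c n * E n x)) has_sum l1norm c - (\<Sum>n\<in>F. norm (c n))) (UNIV - F)"
    by (simp add: norm_mult)
qed

lemma continuous_ser:
  assumes c: "l1 c" shows "continuous_on UNIV (ser c)"
proof (rule uniform_limit_theorem)
  show "\<forall>\<^sub>F N in sequentially. continuous_on UNIV (\<lambda>x. \<Sum>n\<in>ball_modes N. c n * E n x)"
    by (intro always_eventually allI continuous_intros)
  show "uniform_limit UNIV (\<lambda>N x. \<Sum>n\<in>ball_modes N. c n * E n x) (ser c) sequentially"
  proof (rule uniform_limitI)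
    fix e :: real assume "0 < e"
    have "(\<lambda>N. \<Sum>n\<in>ball_modes N. norm (c n)) \<longlonglongrightarrow> l1norm c"
      using c unfolding l1norm_def l1_def by (intro has_sum_ball_modes has_sum_infsum)
    from order_tendstoD(1)[OF this, of "l1norm c - e"] \<open>0 < e\<close>
    have "\<forall>\<^sub>F N in sequentially. l1norm c - (\<Sum>n\<in>ball_modes N. norm (c n)) < e"
      by (auto elim!: eventually_mono)
    then show "\<forall>\<^sub>F N in sequentially. \<forall>x\<in>UNIV. dist (\<Sum>n\<in>ball_modes N. c n * E n x) (ser c x) < e"
    proof eventually_elim
      case (elim N)
      then show ?case
        using norm_ser_remainder[OF c, of "ball_modes N"]
        by (auto simp: dist_norm norm_minus_commute intro: le_less_trans)
    qed
  qed
qed simp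

lemma ser_measurable [measurable]: "l1 c \<Longrightarrow> ser c \<in> borel_measurable borel"
  by (rule borel_measurable_continuous_onI[OF continuous_ser])

lemma periodic_ser: "periodic a (ser c)"
  using periodic_E by (simp add: periodic_def ser_def)

lemma ser_real:
  assumes "\<And>n. c (- n) = cnj (c n)"
  shows "Im (ser c x) = 0"
proof -
  have "cnj (ser c x) = (\<Sum>\<^sub>\<infinity>n. cnj (c n) * E (- n) x)"
    unfolding ser_def infsum_cnj[symmetric] by (simp add: cnj_E)
  also have "\<dots> = (\<Sum>\<^sub>\<infinity>n. c (- n) * E (- n) x)" using assms by simp
  also have "\<dots> = ser c x"
    unfolding ser_def by (rule infsum_reindex_bij_betw[where g=uminus]) (auto simp: bij_uminus)
  finally show ?thesis by (metis Reals_cnj_iff complex_is_Real_iff)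
qed

text \<open>Orthogonality of the characters; the partial sums are dominated by \<open>l1norm
  c\<close>, so the integral may be taken term by term.\<close>

lemma integral_E_ser:
  assumes c: "l1 c"
  shows "(\<integral>x. E (- m) x * ser c x \<partial>cellM) = of_real vol * c m"
proof -
  have "(\<lambda>N. \<integral>x. E (- m) x * (\<Sum>n\<in>ball_modes N. c n * E n x) \<partial>cellM) \<longlonglongrightarrow> (\<integral>x. E (- m) x * ser c x \<partial>cellM)"
  proof (rule integral_dominated_convergence[where w="\<lambda>_. l1norm c"])
    show "(\<lambda>x. E (- m) x * ser c x) \<in> borel_measurable cellM"
      using c by (intro measurable_cellM) measurable
    show "(\<lambda>x. E (- m) x * (\<Sum>n\<in>ball_modes N. c n * E n x)) \<in> borel_measurable cellM" for N
      by (intro measurable_cellM) measurable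
    show "AE x in cellM. (\<lambda>N. E (- m) x * (\<Sum>n\<in>ball_modes N. c n * E n x)) \<longlonglongrightarrow> E (- m) x * ser c x"
      by (intro AE_I2 tendsto_mult_left ser_tendsto c)
    show "AE x in cellM. norm (E (- m) x * (\<Sum>n\<in>ball_modes N. c n * E n x)) \<le> l1norm c" for N
      using norm_partial_ser[OF c] by (simp add: norm_mult)
  qed simp
  moreover have "\<forall>\<^sub>F N in sequentially. (\<integral>x. E (- m) x * (\<Sum>n\<in>ball_modes N. c n * E n x) \<partial>cellM) = of_real vol * c m"
  proof -
    have "\<forall>\<^sub>F N in sequentially. {m} \<subseteq> ball_modes N"
      using ball_modes_exhaust unfolding filterlim_finite_subsets_at_top
      by (auto dest!: spec[of _ "{m}"])
    then show ?thesis
    proof eventually_elim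
      case (elim N)
      have "(\<integral>x. E (- m) x * (\<Sum>n\<in>ball_modes N. c n * E n x) \<partial>cellM)
          = (\<integral>x. (\<Sum>n\<in>ball_modes N. c n * E (n - m) x) \<partial>cellM)"
      proof -
        have "E (- m) x * (c n * E n x) = c n * E (n - m) x" for n x
          using E_add[of n "- m" x] by simp
        then show ?thesis by (simp only: sum_distrib_left)
      qed
      also have "\<dots> = (\<Sum>n\<in>ball_modes N. \<integral>x. c n * E (n - m) x \<partial>cellM)"
        by (rule Bochner_Integration.integral_sum) (intro integrable_cell_continuous continuous_intros)
      also have "\<dots> = (\<Sum>n\<in>ball_modes N. if n = m then of_real vol * c m else 0)"
        by (rule sum.cong) (auto simp: integral_E)
      also have "\<dots> = of_real vol * c m" using elim by simp
      finally show ?case .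
    qed
  qed
  ultimately show ?thesis
    by (intro LIMSEQ_unique[OF _ tendsto_eventually])
qed

lemma fc_cellM: "fc g n = (\<integral>x. E (- n) x * of_real (g x) \<partial>cellM) / of_real vol"
  unfolding fc_def by (subst integral_cell) (simp add: freq_minus)

lemma fc_ser:
  assumes "l1 c" "\<And>n. c (- n) = cnj (c n)"
  shows "fc (\<lambda>x. Re (ser c x)) n = c n"
proof -
  have "of_real (Re (ser c x)) = ser c x" for x
    using ser_real[of c x, OF assms(2)] by (simp add: complex_eq_iff)
  then show ?thesis using vol_pos by (simp add: fc_cellM integral_E_ser[OF assms(1)])
qed

lemma integrable_E_mult:
  fixes g :: "real^3 \<Rightarrow> real"
  assumes "integrable cellM g" shows "integrable cellM (\<lambda>x. E n x * of_real (g x))"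
  by (rule integrable_bounded_mult[where B=1]) (use assms in \<open>auto intro: measurable_cellM\<close>)

lemma fc_minus_index: "fc g (- n) = cnj (fc g n)"
proof -
  have "cnj (\<integral>x. E (- n) x * of_real (g x) \<partial>cellM) = (\<integral>x. cnj (E (- n) x * of_real (g x)) \<partial>cellM)"
    by (rule Bochner_Integration.integral_cnj[symmetric])
  then show ?thesis by (simp add: fc_cellM cnj_E)
qed

lemma fc_diff:
  assumes "integrable cellM f" "integrable cellM g"
  shows "fc (\<lambda>x. f x - g x) n = fc f n - fc g n"
  using integrable_E_mult[OF assms(1), of "-n"] integrable_E_mult[OF assms(2), of "-n"]
  by (simp add: fc_cellM right_diff_distrib diff_divide_distrib)

lemma fc_cong_AE:
  assumes "AE x in cellM. f x = g x" "f \<in> borel_measurable cellM" "g \<in> borel_measurable cellM"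
  shows "fc f n = fc g n"
  unfolding fc_cellM using assms
  by (intro arg_cong2[where f="(/)"] integral_cong_AE refl)
    (auto intro!: borel_measurable_times measurable_cellM[OF E_measurable] elim: eventually_mono)

subsection \<open>Completeness of the characters\<close>

inductive trig_poly :: "(real^3 \<Rightarrow> complex) \<Rightarrow> bool" where
  mono: "trig_poly (\<lambda>x. z * E n x)"
| add: "trig_poly p \<Longrightarrow> trig_poly q \<Longrightarrow> trig_poly (\<lambda>x. p x + q x)"

lemma trig_poly_mult_mono: "trig_poly p \<Longrightarrow> trig_poly (\<lambda>x. (z * E n x) * p x)"
proof (induction rule: trig_poly.induct)
  case (mono w m)
  have "(\<lambda>x. (z * E n x) * (w * E m x)) = (\<lambda>x. (z * w) * E (n + m) x)" by (simp add: E_add fun_eq_iff ac_simps)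
  then show ?case using trig_poly.mono[of "z * w" "n + m"] by simp
next
  case (add p q)
  then show ?case using trig_poly.add by (simp add: distrib_left)
qed

lemma trig_poly_mult: "trig_poly p \<Longrightarrow> trig_poly q \<Longrightarrow> trig_poly (\<lambda>x. p x * q x)"
proof (induction rule: trig_poly.induct)
  case (mono z n) then show ?case by (rule trig_poly_mult_mono)
next
  case (add p1 p2)
  then show ?case using trig_poly.add[of "\<lambda>x. p1 x * q x" "\<lambda>x. p2 x * q x"] by (simp add: distrib_right)
qed

text \<open>The torus embedded in a Euclidean space, where polynomials are available.\<close>

definition embed :: "real^3 \<Rightarrow> (real^3) \<times> (real^3)" where
  "embed x = ((\<chi> i. cos (x$i / a$i)), (\<chi> i. sin (x$i / a$i)))"

lemma continuous_embed: "continuous_on S embed"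
  unfolding embed_def by (intro continuous_intros continuous_on_vec_lambda) auto

text \<open>The coordinates of \<open>embed\<close> are cosines and sines, and the trigonometric
  polynomials form an algebra.\<close>

lemma trig_poly_real_polynomial:
  assumes "real_polynomial_function h" shows "trig_poly (\<lambda>x. of_real (h (embed x)))"
  using assms
proof (induction rule: real_polynomial_function.induct)
  case (linear h)
  interpret h: bounded_linear h by fact
  have fr: "freq a (axis i 1) \<bullet> x = x$i / a$i" for i x
  proof -
    have "freq a (axis i 1) = axis i (1 / a$i)" by (simp add: vec_eq_iff freq_nth axis_def)
    then show ?thesis by (simp add: inner_axis' )
  qed
  have E1: "E (axis i 1) x = cis (x$i / a$i)" and E2: "E (- axis i 1) x = cis (- (x$i / a$i))" for i x
    by (simp_all add: freq_minus fr)
  have rep: "v = v$1 *\<^sub>R axis 1 1 + v$2 *\<^sub>R axis 2 1 + v$3 *\<^sub>R axis 3 1" for v :: "real^3"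
    by (simp add: vec_eq_iff forall_3 axis_def)
  have cos: "trig_poly (\<lambda>x. of_real (cos (x$i / a$i) * r))" for i r
  proof -
    have "(\<lambda>x. complex_of_real (cos (x$i / a$i) * r)) =
        (\<lambda>x. (of_real r / 2) * E (axis i 1) x + (of_real r / 2) * E (- axis i 1) x)"
      unfolding E1 E2 by (simp add: fun_eq_iff complex_eq_iff)
    then show ?thesis by (simp only:) (intro trig_poly.add trig_poly.mono)
  qed
  have sin: "trig_poly (\<lambda>x. of_real (sin (x$i / a$i) * r))" for i r
  proof -
    have "(\<lambda>x. complex_of_real (sin (x$i / a$i) * r)) =
        (\<lambda>x. (- \<i> * of_real r / 2) * E (axis i 1) x + (\<i> * of_real r / 2) * E (- axis i 1) x)"
      unfolding E1 E2 by (simp add: fun_eq_iff complex_eq_iff)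
    then show ?thesis by (simp only:) (intro trig_poly.add trig_poly.mono)
  qed
  have H: "h (u, v) = (u$1 * h (axis 1 1, 0) + u$2 * h (axis 2 1, 0) + u$3 * h (axis 3 1, 0)) +
      (v$1 * h (0, axis 1 1) + v$2 * h (0, axis 2 1) + v$3 * h (0, axis 3 1))" for u v
  proof -
    have "(u, v) = (u$1 *\<^sub>R (axis 1 1, 0) + u$2 *\<^sub>R (axis 2 1, 0) + u$3 *\<^sub>R (axis 3 1, 0)) +
      (v$1 *\<^sub>R (0, axis 1 1) + v$2 *\<^sub>R (0, axis 2 1) + v$3 *\<^sub>R (0, axis 3 1))"
      using rep[of u] rep[of v] by simp
    then have "h (u, v) = h ((u$1 *\<^sub>R (axis 1 1, 0) + u$2 *\<^sub>R (axis 2 1, 0) + u$3 *\<^sub>R (axis 3 1, 0)) +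
      (v$1 *\<^sub>R (0, axis 1 1) + v$2 *\<^sub>R (0, axis 2 1) + v$3 *\<^sub>R (0, axis 3 1)))" by (rule arg_cong)
    then show ?thesis unfolding h.add h.scaleR by simp
  qed
  have "(\<lambda>x. complex_of_real (h (embed x))) =
    (\<lambda>x. (of_real (cos (x$1 / a$1) * h (axis 1 1, 0)) + of_real (cos (x$2 / a$2) * h (axis 2 1, 0))
        + of_real (cos (x$3 / a$3) * h (axis 3 1, 0))) +
      (of_real (sin (x$1 / a$1) * h (0, axis 1 1)) + of_real (sin (x$2 / a$2) * h (0, axis 2 1))
        + of_real (sin (x$3 / a$3) * h (0, axis 3 1))))"
    unfolding embed_def H[of "\<chi> i. cos (_ $ i / a $ i)" "\<chi> i. sin (_ $ i / a $ i)"] by (simp add: fun_eq_iff)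
  then show ?case by (simp only:) (intro trig_poly.add cos sin)
next
  case (const c)
  show ?case using trig_poly.mono[of "of_real c" 0] by simp
next
  case (add f g) then show ?case using trig_poly.add by fastforce
next
  case (mult f g) then show ?case using trig_poly_mult by fastforce
qed

text \<open>Opposite faces of the closed cell have the same image, hence the half-open one.\<close>

lemma embed_inj:
  assumes "x \<in> hcell" "y \<in> hcell" "embed x = embed y" shows "x = y"
proof -
  have "x $ i = y $ i" for i
  proof -
    have "sin (y$i / a$i) = sin (x$i / a$i) \<and> cos (y$i / a$i) = cos (x$i / a$i)"
      using assms(3) by (simp add: embed_def vec_eq_iff)
    then obtain k :: int where k: "y$i / a$i = x$i / a$i + 2 * pi * k"
      unfolding sin_cos_eq_iff by blast
    have "0 \<le> x$i / a$i" "x$i / a$i < 2 * pi" "0 \<le> y$i / a$i" "y$i / a$i < 2 * pi"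
      using assms(1,2) side_pos[of i] by (auto simp: hcell_def divide_less_eq)
    then have "\<bar>2 * pi * of_int k\<bar> < 2 * pi * 1" using k by linarith
    then have "\<bar>of_int k :: real\<bar> < 1" by (simp add: abs_mult)
    then have "k = 0" by linarith
    with k side_pos[of i] show ?thesis by simp
  qed
  then show ?thesis by (simp add: vec_eq_iff)
qed

text \<open>A function orthogonal to all characters is orthogonal to all polynomials in
  \<open>embed\<close>, then by the Stone-Weierstrass theorem to all continuous functions of
  \<open>embed\<close>, then to indicators of compact sets.  Inner regularity of Lebesgue measure
  shows that it vanishes almost everywhere.\<close>

lemma fourier_complete:
  fixes g :: "real^3 \<Rightarrow> real"
  assumes g: "integrable cellM g" and z: "\<And>n. fc g n = 0"
  shows "AE x in cellM. g x = 0"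
proof -
  have gm [measurable]: "g \<in> borel_measurable cellM" using g by simp
  have E0: "(\<integral>x. E n x * of_real (g x) \<partial>cellM) = 0" for n
    using z[of "- n"] vol_pos by (simp add: fc_cellM)
  have tp: "integrable cellM (\<lambda>x. p x * of_real (g x)) \<and> (\<integral>x. p x * of_real (g x) \<partial>cellM) = 0"
    if "trig_poly p" for p
    using that
  proof (induction rule: trig_poly.induct)
    case (mono z n)
    show ?case using integrable_E_mult[OF g, of n] E0[of n] by (simp add: mult.assoc)
  next
    case (add p q)
    then show ?case by (simp add: distrib_right)
  qed
  have rp: "(\<integral>x. h (embed x) * g x \<partial>cellM) = 0" if "real_polynomial_function h" for h
  proof -
    have "complex_of_real (\<integral>x. h (embed x) * g x \<partial>cellM) = (\<integral>x. of_real (h (embed x)) * of_real (g x) \<partial>cellM)"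
      by (simp flip: integral_complex_of_real)
    also have "\<dots> = 0" using tp[OF trig_poly_real_polynomial[OF that]] by simp
    finally show ?thesis by simp
  qed
  have ch_meas: "(\<lambda>x. h (embed x)) \<in> borel_measurable cellM" if "continuous_on UNIV h" for h :: "_ \<Rightarrow> real"
    by (intro measurable_cellM borel_measurable_continuous_onI continuous_on_compose2[OF that continuous_embed]) auto
  have bdd: "\<exists>B. \<forall>x\<in>cell a. \<bar>h (embed x)\<bar> \<le> B" if "continuous_on UNIV h" for h :: "_ \<Rightarrow> real"
  proof -
    have "compact ((\<lambda>x. h (embed x)) ` cell a)"
      by (intro compact_continuous_image compact_cell continuous_on_compose2[OF that continuous_embed]) auto
    then show ?thesis using compact_imp_bounded bounded_iff by (metis imageI real_norm_def)
  qed
  have hint: "integrable cellM (\<lambda>x. h (embed x) * g x)" if h: "continuous_on UNIV h" for h :: "_ \<Rightarrow> real"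
  proof -
    from bdd[OF h] obtain B where "\<forall>x\<in>cell a. \<bar>h (embed x)\<bar> \<le> B" by blast
    then show ?thesis using g ch_meas[OF h] by (intro integrable_bounded_mult[where B=B]) auto
  qed
  have ch: "(\<integral>x. h (embed x) * g x \<partial>cellM) = 0" if h: "continuous_on UNIV h" for h :: "_ \<Rightarrow> real"
  proof -
    have "\<bar>\<integral>x. h (embed x) * g x \<partial>cellM\<bar> \<le> e * (\<integral>x. \<bar>g x\<bar> \<partial>cellM)" if "0 < e" for e
    proof -
      have "compact (embed ` cell a)" by (intro compact_continuous_image compact_cell continuous_embed)
      then obtain p where p: "real_polynomial_function p" "\<And>y. y \<in> embed ` cell a \<Longrightarrow> \<bar>h y - p y\<bar> < e"
        using Stone_Weierstrass_real_polynomial_function[of "embed ` cell a" h e] h \<open>0 < e\<close> continuous_on_subset by (metis subset_UNIV)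
      have pc: "continuous_on UNIV p"
        using p(1) by (simp add: continuous_on_polymonial_function real_polynomial_function_eq)
      have "(\<integral>x. h (embed x) * g x \<partial>cellM) = (\<integral>x. h (embed x) * g x \<partial>cellM) - (\<integral>x. p (embed x) * g x \<partial>cellM)"
        using rp[OF p(1)] by simp
      also have "\<dots> = (\<integral>x. h (embed x) * g x - p (embed x) * g x \<partial>cellM)"
        by (rule Bochner_Integration.integral_diff[symmetric]) (intro hint h pc)+
      finally have "\<bar>\<integral>x. h (embed x) * g x \<partial>cellM\<bar> \<le> (\<integral>x. \<bar>h (embed x) * g x - p (embed x) * g x\<bar> \<partial>cellM)"
        by simp
      also have "\<dots> \<le> (\<integral>x. e * \<bar>g x\<bar> \<partial>cellM)"
      proof (rule integral_mono)
        show "integrable cellM (\<lambda>x. \<bar>h (embed x) * g x - p (embed x) * g x\<bar>)"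
          by (intro integrable_abs Bochner_Integration.integrable_diff hint h pc)
        show "integrable cellM (\<lambda>x. e * \<bar>g x\<bar>)" using g by auto
        fix x assume "x \<in> space cellM"
        then have "\<bar>h (embed x) - p (embed x)\<bar> \<le> e" using p(2)[of "embed x"] by (simp add: less_imp_le)
        then show "\<bar>h (embed x) * g x - p (embed x) * g x\<bar> \<le> e * \<bar>g x\<bar>"
          by (simp add: left_diff_distrib[symmetric] abs_mult mult_right_mono)
      qed
      finally show ?thesis by simp
    qed
    then show ?thesis
    proof (rule zero_if_le_multiples)
      show "0 \<le> (\<integral>x. \<bar>g x\<bar> \<partial>cellM)" by (rule Bochner_Integration.integral_nonneg) simp
    qed
  qed
  text \<open>Compact sets in the half-open cell are preimages of compact sets, whose indicators are
    limits of continuous functions.\<close>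
  have cp: "(\<integral>x. indicator K x * g x \<partial>cellM) = 0" if K: "compact K" "K \<subseteq> hcell" for K
  proof (cases "K = {}")
    case False
    let ?h = "\<lambda>k y. max 0 (1 - real k * infdist y (embed ` K))"
    have hc: "continuous_on UNIV (?h k)" for k by (intro continuous_intros)
    have clK: "closed (embed ` K)" "embed ` K \<noteq> {}"
      using compact_continuous_image[OF continuous_embed K(1)] compact_imp_closed False by auto
    have Kb: "K \<in> sets borel" using K(1) by (simp add: borel_compact)
    have "(\<lambda>k. \<integral>x. ?h k (embed x) * g x \<partial>cellM) \<longlonglongrightarrow> (\<integral>x. indicator K x * g x \<partial>cellM)"
    proof (rule integral_dominated_convergence[where w="\<lambda>x. \<bar>g x\<bar>"])
      show "(\<lambda>x. indicator K x * g x) \<in> borel_measurable cellM"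
        using Kb by (intro borel_measurable_times gm measurable_cellM) auto
      show "(\<lambda>x. ?h k (embed x) * g x) \<in> borel_measurable cellM" for k
        by (intro borel_measurable_times gm ch_meas[OF hc])
      show "AE x in cellM. norm (?h k (embed x) * g x) \<le> \<bar>g x\<bar>" for k
        by (rule AE_I2) (simp add: abs_mult mult_left_le_one_le infdist_nonneg)
      have "AE x in cellM. x \<in> hcell"
        unfolding AE_cell using AE_hcell by (auto elim: eventually_mono)
      then show "AE x in cellM. (\<lambda>k. ?h k (embed x) * g x) \<longlonglongrightarrow> indicator K x * g x"
      proof eventually_elim
        case (elim x)
        have "(\<lambda>k. ?h k (embed x)) \<longlonglongrightarrow> indicator K x"
        proof (cases "x \<in> K")
          case True
          then have "?h k (embed x) = 1" for k by simp
          then show ?thesis using True by simp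
        next
          case False
          have "embed x \<notin> embed ` K" using False elim K(2) embed_inj by blast
          then have d: "0 < infdist (embed x) (embed ` K)" by (rule infdist_pos_not_in_closed[OF clK])
          obtain N where N: "1 < real N * infdist (embed x) (embed ` K)" using ex_less_of_nat_mult[OF d] by blast
          have "?h k (embed x) = 0" if "N \<le> k" for k
          proof -
            have "real N * infdist (embed x) (embed ` K) \<le> real k * infdist (embed x) (embed ` K)"
              using that d by (intro mult_right_mono) auto
            then show ?thesis using N by simp
          qed
          then have "\<forall>\<^sub>F k in sequentially. ?h k (embed x) = 0" by (auto simp: eventually_sequentially)
          then show ?thesis using False by (simp add: tendsto_eventually)
        qed
        then show ?case by (rule tendsto_mult_right)
      qed
    qed (use g in auto)
    moreover have "(\<integral>x. ?h k (embed x) * g x \<partial>cellM) = 0" for k by (rule ch[OF hc])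
    ultimately show ?thesis by (simp add: LIMSEQ_const_iff)
  qed simp
  have Ab: "{x \<in> hcell. 0 < s * g x} \<in> sets borel" for s :: real
  proof -
    have "{x \<in> space cellM. 0 < s * g x} \<in> sets cellM" by measurable
    then have "{x \<in> cell a. 0 < s * g x} \<in> sets borel" by (auto simp: cellM_def sets_restrict_space)
    then have "hcell \<inter> {x \<in> cell a. 0 < s * g x} \<in> sets borel" by auto
    moreover have "hcell \<inter> {x \<in> cell a. 0 < s * g x} = {x \<in> hcell. 0 < s * g x}" using hcell_sub by auto
    ultimately show ?thesis by simp
  qed
  text \<open>A set where \<open>g\<close> has a sign is exhausted by compact sets, each null.\<close>
  have sg: "emeasure lborel {x \<in> hcell. 0 < s * g x} = 0" for s :: real
  proof -
    let ?A = "{x \<in> hcell. 0 < s * g x}"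
    note Ab = Ab[of s]
    have "emeasure lborel ?A \<le> 0 + ennreal e" if e: "0 < e" for e
    proof -
      have Al: "?A \<in> sets lebesgue" using Ab by (intro sets_completionI_sets) simp
      obtain K where K: "closed K" "K \<subseteq> ?A" "?A - K \<in> lmeasurable" "emeasure lebesgue (?A - K) < ennreal e"
        by (rule sets_lebesgue_inner_closed[OF Al e])
      have Kb: "K \<in> sets borel" using K(1) by simp
      have "compact K"
        using K(1,2) hcell_sub compact_cell
        by (intro compact_eq_bounded_closed[THEN iffD2] conjI) (auto intro: bounded_subset[OF compact_imp_bounded])
      then have "(\<integral>x. s * (indicator K x * g x) \<partial>cellM) = 0" using cp[of K] K(2) by auto
      moreover have "integrable cellM (\<lambda>x. s * (indicator K x * g x))"
        using g Kb by (intro integrable_mult_right integrable_bounded_mult[where B=1] measurable_cellM) (auto simp: indicator_def)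
      moreover have "0 \<le> s * (indicator K x * g x)" for x using K(2) by (auto simp: indicator_def less_imp_le)
      ultimately have "AE x in cellM. s * (indicator K x * g x) = 0"
        by (subst (asm) integral_nonneg_eq_0_iff_AE) auto
      then have "AE x in lborel. x \<notin> K"
        unfolding AE_cell using K(2) hcell_sub by (auto elim!: eventually_mono simp: indicator_def split: if_splits)
      then have "emeasure lborel K = 0" using Kb by (subst (asm) AE_iff_measurable[OF _ refl]) auto
      moreover have "emeasure lborel ?A \<le> emeasure lborel K + emeasure lborel (?A - K)"
        using emeasure_subadditive[of K lborel "?A - K"] Kb Ab K(2) by (simp add: Un_absorb1)
      moreover have "emeasure lborel (?A - K) < ennreal e"
        using K(4) Kb Ab by (simp add: emeasure_completion sets.Diff)
      ultimately show ?thesis by (simp add: less_imp_le)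
    qed
    then have "emeasure lborel ?A \<le> 0" by (rule ennreal_le_epsilon)
    then show ?thesis by simp
  qed
  have n: "{x \<in> hcell. 0 < s * g x} \<in> null_sets lborel" for s
    using sg Ab by (intro null_setsI) simp_all
  have "{x \<in> hcell. g x \<noteq> 0} = {x \<in> hcell. 0 < 1 * g x} \<union> {x \<in> hcell. 0 < (-1) * g x}" by auto
  then have "{x \<in> hcell. g x \<noteq> 0} \<in> null_sets lborel"
    using null_sets.Un[OF n[of 1] n[of "-1"]] by (simp only:)
  then have "AE x in lborel. x \<notin> {x \<in> hcell. g x \<noteq> 0}" by (rule AE_not_in)
  then show ?thesis
    unfolding AE_cell using AE_hcell by eventually_elim auto
qed

lemma fourier_unique:
  fixes f g :: "real^3 \<Rightarrow> real"
  assumes "integrable cellM f" "integrable cellM g" "\<And>n. fc f n = fc g n"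
  shows "AE x in cellM. f x = g x"
  using fourier_complete[of "\<lambda>x. f x - g x"] assms by (simp add: fc_diff)

end

section \<open>Sobolev spaces in terms of Fourier coefficients\<close>

lemma norm_vec_square_sum: "(norm x)\<^sup>2 = (\<Sum>i\<in>UNIV. (norm (x $ i))\<^sup>2)" for x :: "'b::real_normed_vector ^ 'k"
  by (simp add: norm_vec_def L2_set_def sum_nonneg)

lemma integrable_vector:
  fixes f :: "'x \<Rightarrow> real^'k"
  assumes "\<And>i. integrable M (\<lambda>x. f x $ i)" shows "integrable M f"
proof -
  have "(\<lambda>x. \<Sum>i\<in>UNIV. f x $ i *\<^sub>R (axis i 1 :: real^'k)) = f"
    by (simp add: fun_eq_iff vec_eq_iff axis_def if_distrib[of "\<lambda>x. _ * x"] cong: if_cong)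
  moreover have "integrable M (\<lambda>x. \<Sum>i\<in>UNIV. f x $ i *\<^sub>R (axis i 1 :: real^'k))"
    by (intro Bochner_Integration.integrable_sum integrable_scaleR_left assms)
  ultimately show ?thesis by simp
qed

lemma norm_diff_square_le: "(norm (x - y))\<^sup>2 \<le> 2 * (norm x)\<^sup>2 + 2 * (norm y)\<^sup>2"
  for x y :: "'b::real_normed_vector"
proof -
  have "(norm (x - y))\<^sup>2 \<le> (norm x + norm y)\<^sup>2" by (intro power_mono norm_triangle_ineq4) simp
  also have "\<dots> \<le> 2 * (norm x)\<^sup>2 + 2 * (norm y)\<^sup>2"
    using sum_squares_bound[of "norm x" "norm y"] by (simp add: power2_sum)
  finally show ?thesis .
qed

lemma measurable_vec_nth [measurable]: "(\<lambda>v. v $ i) \<in> borel_measurable borel"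
  for i :: "'k::finite" and v :: "'b::real_normed_vector^'k"
  by (intro borel_measurable_continuous_onI continuous_intros)

context torus begin

definition weighted :: "real \<Rightarrow> (int^3 \<Rightarrow> 'b::real_normed_vector) \<Rightarrow> bool" where
  "weighted \<sigma> c \<longleftrightarrow> (\<lambda>n. wt n powr \<sigma> * (norm (c n))\<^sup>2) summable_on UNIV"

text \<open>The square of the Sobolev norm, expressed by the coefficients.\<close>

definition wnorm :: "real \<Rightarrow> (int^3 \<Rightarrow> 'b::real_normed_vector) \<Rightarrow> real" where
  "wnorm \<sigma> c = (\<Sum>\<^sub>\<infinity>n. wt n powr \<sigma> * (norm (c n))\<^sup>2)"

lemma wnorm_nonneg: "0 \<le> wnorm \<sigma> c"
  unfolding wnorm_def by (rule infsum_nonneg) simp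

lemma weighted_term_le: "weighted \<sigma> c \<Longrightarrow> wt n powr \<sigma> * (norm (c n))\<^sup>2 \<le> wnorm \<sigma> c"
  unfolding weighted_def wnorm_def
  using finite_sum_le_infsum[of "\<lambda>n. wt n powr \<sigma> * (norm (c n))\<^sup>2" UNIV "{n}"] by simp

lemma weighted_mono:
  assumes c: "weighted \<sigma> c" and d: "\<And>n. wt n powr \<rho> * (norm (d n))\<^sup>2 \<le> K * (wt n powr \<sigma> * (norm (c n))\<^sup>2)"
  shows "weighted \<rho> d" "wnorm \<rho> d \<le> K * wnorm \<sigma> c"
proof -
  have s: "(\<lambda>n. K * (wt n powr \<sigma> * (norm (c n))\<^sup>2)) summable_on UNIV"
    using c unfolding weighted_def by (rule summable_on_cmult_right)
  show 1: "weighted \<rho> d"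
    unfolding weighted_def by (rule summable_on_comparison_test[OF s]) (use d in auto)
  show "wnorm \<rho> d \<le> K * wnorm \<sigma> c"
    unfolding wnorm_def infsum_cmult_right'[symmetric]
    using d 1 s unfolding weighted_def by (intro infsum_mono) auto
qed

lemma weighted_diff:
  assumes "weighted \<sigma> c" "weighted \<sigma> d" shows "weighted \<sigma> (\<lambda>n. c n - d n)"
proof -
  have s: "(\<lambda>n. 2 * (wt n powr \<sigma> * (norm (c n))\<^sup>2) + 2 * (wt n powr \<sigma> * (norm (d n))\<^sup>2)) summable_on UNIV"
    using assms unfolding weighted_def by (intro summable_on_add summable_on_cmult_right)
  have "wt n powr \<sigma> * (norm (c n - d n))\<^sup>2
      \<le> 2 * (wt n powr \<sigma> * (norm (c n))\<^sup>2) + 2 * (wt n powr \<sigma> * (norm (d n))\<^sup>2)" for n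
    using mult_left_mono[OF norm_diff_square_le[of "c n" "d n"], of "wt n powr \<sigma>"] by (simp add: algebra_simps)
  then show ?thesis
    unfolding weighted_def by (intro summable_on_comparison_test[OF s]) auto
qed

text \<open>The Cauchy-Schwarz inequality against the summable weight, in the form \<open>x * y
  \<le> x\<^sup>2 + y\<^sup>2\<close>.\<close>

lemma l1_weighted:
  fixes c :: "int^3 \<Rightarrow> complex"
  assumes r: "3/2 < r" and c: "weighted r c"
  shows "l1 c" "l1norm c \<le> (\<Sum>\<^sub>\<infinity>n. wt n powr - r) + wnorm r c"
proof -
  have s: "(\<lambda>n. wt n powr - r + wt n powr r * (norm (c n))\<^sup>2) summable_on UNIV"
    using c summable_wt[OF r] unfolding weighted_def by (intro summable_on_add)
  have le: "norm (c n) \<le> wt n powr - r + wt n powr r * (norm (c n))\<^sup>2" for n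
  proof -
    define x where "x = wt n powr (- r / 2)"
    define y where "y = wt n powr (r / 2) * norm (c n)"
    have xy: "x * y = norm (c n)" using wt_pos[of n] by (simp add: x_def y_def powr_add[symmetric])
    have "x\<^sup>2 = wt n powr - r" "y\<^sup>2 = wt n powr r * (norm (c n))\<^sup>2"
      using wt_pos[of n] by (simp_all add: x_def y_def power_mult_distrib power2_eq_square powr_add[symmetric])
    moreover have "x * y \<le> x\<^sup>2 + y\<^sup>2"
      using sum_squares_bound[of x y] zero_le_power2[of x] zero_le_power2[of y] by linarith
    ultimately show ?thesis using xy by simp
  qed
  show 1: "l1 c" unfolding l1_def by (rule summable_on_comparison_test[OF s]) (use le in auto)
  have "l1norm c \<le> (\<Sum>\<^sub>\<infinity>n. wt n powr - r + wt n powr r * (norm (c n))\<^sup>2)"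
    unfolding l1norm_def using 1 s le unfolding l1_def by (intro infsum_mono) auto
  also have "\<dots> = (\<Sum>\<^sub>\<infinity>n. wt n powr - r) + wnorm r c"
    unfolding wnorm_def using c summable_wt[OF r] unfolding weighted_def by (rule infsum_add[rotated])
  finally show "l1norm c \<le> (\<Sum>\<^sub>\<infinity>n. wt n powr - r) + wnorm r c" .
qed

lemma weighted_nth:
  fixes c :: "int^3 \<Rightarrow> complex^'k"
  assumes "weighted \<sigma> c" shows "weighted \<sigma> (\<lambda>n. c n $ i)" "wnorm \<sigma> (\<lambda>n. c n $ i) \<le> wnorm \<sigma> c"
proof -
  have "wt n powr \<sigma> * (norm (c n $ i))\<^sup>2 \<le> 1 * (wt n powr \<sigma> * (norm (c n))\<^sup>2)" for n
    by (auto intro!: mult_left_mono power_mono Finite_Cartesian_Product.norm_nth_le)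
  from weighted_mono[OF assms this] show "weighted \<sigma> (\<lambda>n. c n $ i)" "wnorm \<sigma> (\<lambda>n. c n $ i) \<le> wnorm \<sigma> c"
    by auto
qed

lemma sobolev_iff:
  "f \<in> sobolev a \<sigma> \<longleftrightarrow> periodic a f \<and> f \<in> borel_measurable borel \<and>
     integrable cellM (\<lambda>x. (norm (f x))\<^sup>2) \<and> weighted \<sigma> (fourier a f)"
  by (simp add: sobolev_def integrable_cell weighted_def wt_def)

lemma sobolev_norm_wnorm: "sobolev_norm a \<sigma> f = sqrt (wnorm \<sigma> (fourier a f))"
  by (simp add: sobolev_norm_def wnorm_def wt_def)

lemma sobolev_nth_integrable:
  assumes "f \<in> sobolev a \<sigma>" shows "integrable cellM (\<lambda>x. f x $ i)"
proof (rule Bochner_Integration.integrable_bound[where f="\<lambda>x. 1 + (norm (f x))\<^sup>2"])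
  show "integrable cellM (\<lambda>x. 1 + (norm (f x))\<^sup>2)" using assms by (simp add: sobolev_iff)
  have "f \<in> borel_measurable borel" using assms by (simp add: sobolev_iff)
  then show "(\<lambda>x. f x $ i) \<in> borel_measurable cellM"
    by (intro measurable_cellM measurable_compose[OF _ measurable_vec_nth])
  show "AE x in cellM. norm (f x $ i) \<le> norm (1 + (norm (f x))\<^sup>2)"
  proof (rule AE_I2)
    fix x
    have "norm (f x $ i) \<le> norm (f x)" by (rule Finite_Cartesian_Product.norm_nth_le)
    also have "\<dots> \<le> 2 * norm (f x)" by simp
    also have "\<dots> \<le> 1 + (norm (f x))\<^sup>2"
      using sum_squares_bound[of "norm (f x)" 1] by simp
    finally show "norm (f x $ i) \<le> norm (1 + (norm (f x))\<^sup>2)" by simp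
  qed
qed

lemma fourier_minus_index: "fourier a f (- n) $ i = cnj (fourier a f n $ i)"
  by (simp add: fourier_nth fc_minus_index)

lemma fourier_diff:
  assumes "f \<in> sobolev a \<sigma>" "g \<in> sobolev a \<rho>"
  shows "fourier a (\<lambda>x. f x - g x) n = fourier a f n - fourier a g n"
  using assms by (simp add: vec_eq_iff fourier_nth fc_diff sobolev_nth_integrable)

lemma fourier_mode_le:
  assumes f: "weighted \<sigma> c" and \<sigma>: "0 \<le> \<sigma>" shows "norm (c n) \<le> sqrt (wnorm \<sigma> c)"
proof -
  have "1 * (norm (c n))\<^sup>2 \<le> wt n powr \<sigma> * (norm (c n))\<^sup>2"
    using wt_ge_1[of n] \<sigma> by (intro mult_right_mono) (auto intro: ge_one_powr_ge_zero)
  also have "\<dots> \<le> wnorm \<sigma> c" by (rule weighted_term_le[OF f])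
  finally show ?thesis by (simp add: real_le_rsqrt)
qed

lemma fourier_diff_le:
  assumes "f \<in> sobolev a \<sigma>" "g \<in> sobolev a \<sigma>" "0 \<le> \<sigma>"
  shows "norm (fourier a f n - fourier a g n) \<le> sobolev_norm a \<sigma> (\<lambda>x. f x - g x)"
proof -
  have "fourier a (\<lambda>x. f x - g x) = (\<lambda>n. fourier a f n - fourier a g n)"
    using assms by (auto simp: fourier_diff)
  then show ?thesis
    unfolding sobolev_norm_wnorm using assms
    by (auto simp: sobolev_iff intro!: fourier_mode_le[where c="\<lambda>n. fourier a f n - fourier a g n"] weighted_diff)
qed

lemma sobolev_l1:
  assumes "f \<in> sobolev a s" "3/2 < s"
  shows "l1 (\<lambda>n. fourier a f n $ i)"
proof -
  have "weighted s (fourier a f)" using assms(1) by (simp add: sobolev_iff)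
  from l1_weighted(1)[OF assms(2) weighted_nth(1)[OF this]] show ?thesis .
qed

text \<open>Above the exponent \<open>3/2\<close> the Fourier series converges absolutely; its sum
  has the same coefficients as the function, hence is the function by completeness.\<close>

lemma sobolev_eq_ser:
  assumes f: "f \<in> sobolev a s" and s: "3/2 < s"
  shows "AE x in cellM. f x $ i = Re (ser (\<lambda>n. fourier a f n $ i) x)"
proof (rule fourier_unique)
  show "integrable cellM (\<lambda>x. f x $ i)" by (rule sobolev_nth_integrable[OF f])
  have l: "l1 (\<lambda>n. fourier a f n $ i)" by (rule sobolev_l1[OF f s])
  show "integrable cellM (\<lambda>x. Re (ser (\<lambda>n. fourier a f n $ i) x))"
    by (intro integrable_cell_continuous continuous_intros continuous_ser l)
  show "fc (\<lambda>x. f x $ i) n = fc (\<lambda>x. Re (ser (\<lambda>n. fourier a f n $ i) x)) n" for n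
    unfolding fc_ser[of "\<lambda>n. fourier a f n $ i", OF l fourier_minus_index] by (simp add: fourier_nth)
qed

lemma fourier_synth:
  assumes "\<And>i. l1 (\<lambda>n. c n $ i)" "\<And>n i. c (- n) $ i = cnj (c n $ i)"
  shows "fourier a (synth a c) n = c n"
proof -
  have "fc (\<lambda>x. Re (ser (\<lambda>n. c n $ i) x)) n = c n $ i" for i
    using assms by (intro fc_ser[of "\<lambda>n. c n $ i"])
  then show ?thesis by (simp add: vec_eq_iff fourier_nth synth_nth)
qed

lemma continuous_synth:
  assumes "\<And>i. l1 (\<lambda>n. c n $ i)" shows "continuous_on UNIV (synth a c)"
proof -
  have "synth a c = (\<lambda>x. \<chi> i. Re (ser (\<lambda>n. c n $ i) x))" by (simp add: fun_eq_iff vec_eq_iff synth_nth)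
  then show ?thesis
    by (simp only:) (intro continuous_on_vec_lambda continuous_intros continuous_ser assms)
qed

lemma periodic_synth: "periodic a (synth a c)"
  using periodic_ser by (auto simp: periodic_def vec_eq_iff synth_nth)

lemma synth_sobolev:
  fixes c :: "int^3 \<Rightarrow> complex^'k"
  assumes l: "\<And>i. l1 (\<lambda>n. c n $ i)" and sym: "\<And>n i. c (- n) $ i = cnj (c n $ i)" and w: "weighted \<sigma> c"
  shows "synth a c \<in> sobolev a \<sigma>"
  unfolding sobolev_iff
proof (intro conjI)
  show "synth a c \<in> borel_measurable borel"
    by (rule borel_measurable_continuous_onI[OF continuous_synth[OF l]])
  show "integrable cellM (\<lambda>x. (norm (synth a c x))\<^sup>2)"
    by (intro integrable_cell_continuous continuous_intros continuous_synth l)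
  have "fourier a (synth a c) = c" using fourier_synth[OF l sym] by auto
  then show "weighted \<sigma> (fourier a (synth a c))" using w by simp
qed (rule periodic_synth)

lemma cont_sobolev_fourier:
  assumes u: "u \<in> cont_sobolev a T \<sigma>" and \<sigma>: "0 \<le> \<sigma>"
  shows "continuous_on {0..T} (\<lambda>t. fourier a (u t) n)"
  unfolding continuous_on_def
proof
  fix t assume t: "t \<in> {0..T}"
  have lim: "((\<lambda>\<tau>. sobolev_norm a \<sigma> (\<lambda>x. u \<tau> x - u t x)) \<longlongrightarrow> 0) (at t within {0..T})"
    using u t by (auto simp: cont_sobolev_def)
  have us: "u \<tau> \<in> sobolev a \<sigma>" if "\<tau> \<in> {0..T}" for \<tau> using u that by (auto simp: cont_sobolev_def)
  have "((\<lambda>\<tau>. fourier a (u \<tau>) n - fourier a (u t) n) \<longlongrightarrow> 0) (at t within {0..T})"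
  proof (rule Lim_null_comparison[OF _ lim])
    show "\<forall>\<^sub>F \<tau> in at t within {0..T}. norm (fourier a (u \<tau>) n - fourier a (u t) n) \<le> sobolev_norm a \<sigma> (\<lambda>x. u \<tau> x - u t x)"
      unfolding eventually_at_filter using us t \<sigma> by (intro always_eventually) (auto intro!: fourier_diff_le)
  qed
  then show "((\<lambda>t. fourier a (u t) n) \<longlongrightarrow> fourier a (u t) n) (at t within {0..T})"
    by (rule LIM_zero_cancel)
qed

end

section \<open>Smooth functions and test functions\<close>

lemma CkI:
  assumes "\<And>x. (f has_derivative f' x) (at x)" "\<And>b. b \<in> Basis \<Longrightarrow> Ck k (\<lambda>x. f' x b)"
  shows "Ck (Suc k) f"
proof -
  have "frechet_derivative f (at x) = f' x" for x
    using frechet_derivative_at[OF assms(1)] by simp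
  then show ?thesis using assms by (auto simp: differentiable_def)
qed

lemma Ck_has_derivative: "Ck (Suc k) f \<Longrightarrow> (f has_derivative frechet_derivative f (at x)) (at x)"
  by (simp add: frechet_derivative_works[symmetric])

lemma Ck_continuous: "Ck k f \<Longrightarrow> continuous_on UNIV f"
  by (cases k) (auto intro!: differentiable_imp_continuous_on simp: differentiable_on_def intro: differentiable_at_withinI)

lemma Ck_SucD: "Ck (Suc k) f \<Longrightarrow> Ck k f"
proof (induction k arbitrary: f)
  case 0 then show ?case using Ck_continuous[of "Suc 0" f] by simp
next
  case (Suc k)
  then show ?case by (metis Ck.simps(2))
qed

lemma Ck_const: "Ck k (\<lambda>x. c)"
proof (induction k arbitrary: c)
  case (Suc k) then show ?case by (intro CkI[where f'="\<lambda>_ _. 0"]) auto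
qed simp

lemma Ck_add: "Ck k f \<Longrightarrow> Ck k g \<Longrightarrow> Ck k (\<lambda>x. f x + g x)"
proof (induction k arbitrary: f g)
  case 0 then show ?case by (auto intro: continuous_on_add)
next
  case (Suc k)
  have "Ck k (\<lambda>x. frechet_derivative f (at x) b + frechet_derivative g (at x) b)" if "b \<in> Basis" for b
    using Suc that by (intro Suc.IH) auto
  then show ?case
    by (intro CkI[where f'="\<lambda>x b. frechet_derivative f (at x) b + frechet_derivative g (at x) b"]
      has_derivative_add Ck_has_derivative[OF Suc.prems(1)] Ck_has_derivative[OF Suc.prems(2)])
qed

lemma Ck_mult: "Ck k f \<Longrightarrow> Ck k g \<Longrightarrow> Ck k (\<lambda>x. f x * g x)"
proof (induction k arbitrary: f g)
  case 0 then show ?case by (auto intro: continuous_on_mult)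
next
  case (Suc k)
  have "Ck k (\<lambda>x. f x * frechet_derivative g (at x) b + frechet_derivative f (at x) b * g x)" if "b \<in> Basis" for b
    using Suc.prems that Ck_SucD[OF Suc.prems(1)] Ck_SucD[OF Suc.prems(2)] by (intro Ck_add Suc.IH) auto
  then show ?case
    by (intro CkI[where f'="\<lambda>x b. f x * frechet_derivative g (at x) b + frechet_derivative f (at x) b * g x"]
      has_derivative_mult Ck_has_derivative[OF Suc.prems(1)] Ck_has_derivative[OF Suc.prems(2)])
qed

lemma Ck_linear: "bounded_linear l \<Longrightarrow> Ck k l"
proof (cases k)
  case 0
  assume "bounded_linear l"
  with 0 show ?thesis by (simp add: linear_continuous_on)
next
  case (Suc m)
  assume "bounded_linear l"
  then show ?thesis
    unfolding Suc by (intro CkI[where f'="\<lambda>_. l"] Ck_const bounded_linear_imp_has_derivative)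
qed

lemma Ck_cos_sin:
  assumes l: "bounded_linear l"
  shows "Ck k (\<lambda>x. cos (l x)) \<and> Ck k (\<lambda>x. sin (l x))"
proof (induction k)
  case 0
  have "continuous_on UNIV l" using l by (simp add: linear_continuous_on)
  then show ?case by (auto intro!: continuous_intros)
next
  case (Suc k)
  have l': "(l has_derivative l) (at x)" for x by (rule bounded_linear_imp_has_derivative[OF l])
  have 1: "((\<lambda>x. cos (l x)) has_derivative (\<lambda>b. (- l b) * sin (l x))) (at x)" for x
    by (rule derivative_eq_intros l')+ (auto simp: algebra_simps)
  have 2: "((\<lambda>x. sin (l x)) has_derivative (\<lambda>b. l b * cos (l x))) (at x)" for x
    by (rule derivative_eq_intros l')+ (auto simp: algebra_simps)
  show ?case
    using Suc by (intro conjI CkI[OF 1] CkI[OF 2] Ck_mult Ck_const) auto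
qed

lemma smooth_const: "smooth (\<lambda>x. c)" by (simp add: smooth_def Ck_const)
lemma smooth_add: "smooth f \<Longrightarrow> smooth g \<Longrightarrow> smooth (\<lambda>x. f x + g x)" by (simp add: smooth_def Ck_add)
lemma smooth_mult: "smooth f \<Longrightarrow> smooth g \<Longrightarrow> smooth (\<lambda>x. f x * g x)" by (simp add: smooth_def Ck_mult)
lemma smooth_linear: "bounded_linear l \<Longrightarrow> smooth l" by (simp add: smooth_def Ck_linear)
lemma smooth_cos: "bounded_linear l \<Longrightarrow> smooth (\<lambda>x. cos (l x))"
  and smooth_sin: "bounded_linear l \<Longrightarrow> smooth (\<lambda>x. sin (l x))"
  using Ck_cos_sin by (auto simp: smooth_def)

lemma smooth_continuous: "smooth f \<Longrightarrow> continuous_on UNIV f"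
  using Ck_continuous by (auto simp: smooth_def)

lemma smooth_has_derivative: "smooth f \<Longrightarrow> (f has_derivative frechet_derivative f (at x)) (at x)"
  by (rule Ck_has_derivative[of 0]) (use smooth_def in blast)

lemma smooth_partial: "smooth f \<Longrightarrow> b \<in> Basis \<Longrightarrow> smooth (\<lambda>x. frechet_derivative f (at x) b)"
  unfolding smooth_def using Ck.simps(2) by blast

lemma smooth_polynomial:
  assumes p: "real_polynomial_function p" and l: "bounded_linear l"
  shows "smooth (\<lambda>x. p (l x))"
  using p
proof (induction rule: real_polynomial_function.induct)
  case (linear f) then show ?case using bounded_linear_compose[OF linear l] by (simp add: smooth_linear)
qed (auto intro: smooth_const smooth_add smooth_mult)

lemma time_in_Basis: "(1::real, 0::real^3) \<in> Basis"
  and space_in_Basis: "(0::real, axis j 1 :: real^3) \<in> Basis"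
  by (auto simp: Basis_prod_def axis_in_Basis_iff)

context torus begin

text \<open>Smoothness is asked of the function on space-time that ignores the position, so that
  closure properties of smooth functions there apply directly.\<close>

definition time_test :: "real \<Rightarrow> (real \<Rightarrow> real) \<Rightarrow> bool" where
  "time_test T \<theta> \<longleftrightarrow> smooth (\<lambda>z::real \<times> (real^3). \<theta> (fst z)) \<and>
     (\<exists>c d. 0 < c \<and> d < T \<and> (\<forall>t. t \<notin> {c..d} \<longrightarrow> \<theta> t = 0))"

lemma time_test_derivative:
  assumes "time_test T \<theta>"
  shows "(\<theta> has_real_derivative deriv \<theta> t) (at t)"
    and "frechet_derivative (\<lambda>z::real \<times> (real^3). \<theta> (fst z)) (at z) = (\<lambda>w. deriv \<theta> (fst z) * fst w)"
    and "continuous_on UNIV (deriv \<theta>)" and "continuous_on UNIV \<theta>"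
proof -
  let ?f = "\<lambda>z::real \<times> (real^3). \<theta> (fst z)"
  have sm: "smooth ?f" using assms by (simp add: time_test_def)
  have "(\<theta> has_real_derivative deriv \<theta> t) (at t)" for t
  proof -
    have "((?f \<circ> (\<lambda>t. (t, 0))) has_derivative (frechet_derivative ?f (at (t, 0)) \<circ> (\<lambda>t. (t, 0)))) (at t)"
      by (intro diff_chain_at smooth_has_derivative[OF sm])
        (auto intro!: bounded_linear_imp_has_derivative bounded_linear_Pair bounded_linear_ident bounded_linear_zero)
    then have "\<theta> differentiable (at t)" by (auto simp: o_def differentiable_def)
    then show ?thesis by (simp add: DERIV_deriv_iff_real_differentiable)
  qed
  note d = this
  then show "(\<theta> has_real_derivative deriv \<theta> t) (at t)" .
  have fd: "frechet_derivative ?f (at z) = (\<lambda>w. deriv \<theta> (fst z) * fst w)" for z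
  proof -
    have "((\<theta> \<circ> fst) has_derivative ((*) (deriv \<theta> (fst z)) \<circ> fst)) (at z)"
      by (intro diff_chain_at bounded_linear_imp_has_derivative bounded_linear_fst)
        (use d[of "fst z"] in \<open>simp add: has_field_derivative_def\<close>)
    then show ?thesis using frechet_derivative_at by (fastforce simp: o_def)
  qed
  then show "frechet_derivative ?f (at z) = (\<lambda>w. deriv \<theta> (fst z) * fst w)" .
  have "continuous_on UNIV (\<lambda>z. frechet_derivative ?f (at z) (1, 0))"
    by (rule smooth_continuous[OF smooth_partial[OF sm time_in_Basis]])
  then have "continuous_on UNIV (\<lambda>z::real \<times> (real^3). deriv \<theta> (fst z))" by (simp add: fd)
  from continuous_on_compose2[OF this, of UNIV "\<lambda>t. (t, 0)"]
  show "continuous_on UNIV (deriv \<theta>)" by (simp add: continuous_intros)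
  show "continuous_on UNIV \<theta>"
    using d by (intro continuous_at_imp_continuous_on) (auto intro: DERIV_isCont)
qed

lemma time_test_mult:
  assumes "time_test T \<theta>" "real_polynomial_function p" shows "time_test T (\<lambda>t. \<theta> t * p t)"
proof -
  have "smooth (\<lambda>z::real \<times> (real^3). \<theta> (fst z) * p (fst z))"
    using assms(1) smooth_polynomial[OF assms(2) bounded_linear_fst]
    by (intro smooth_mult) (auto simp: time_test_def)
  then show ?thesis using assms(1) by (fastforce simp: time_test_def)
qed

lemma time_test_boundary: "time_test T \<theta> \<Longrightarrow> \<theta> 0 = 0" "time_test T \<theta> \<Longrightarrow> \<theta> T = 0"
  unfolding time_test_def by fastforce+

lemma phase_linear: "bounded_linear (\<lambda>z::real \<times> (real^3). k \<bullet> snd z)"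
  by (intro bounded_linear_inner_right_comp bounded_linear_snd)

lemma test_function_trig:
  assumes th: "time_test T \<theta>"
  shows "test_function a T (\<lambda>z. \<theta> (fst z) * cos (freq a n \<bullet> snd z))"
    and "test_function a T (\<lambda>z. \<theta> (fst z) * sin (freq a n \<bullet> snd z))"
proof -
  have p: "cis (freq a n \<bullet> (x + axis i (2 * pi * a $ i))) = cis (freq a n \<bullet> x)" for x i
    using periodic_E[of n] by (simp add: periodic_def)
  have pc: "cos (freq a n \<bullet> (x + axis i (2 * pi * a $ i))) = cos (freq a n \<bullet> x)" for x i
    using arg_cong[OF p[of x i], of Re] by simp
  have ps: "sin (freq a n \<bullet> (x + axis i (2 * pi * a $ i))) = sin (freq a n \<bullet> x)" for x i
    using arg_cong[OF p[of x i], of Im] by simp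
  have sm: "smooth (\<lambda>z::real \<times> (real^3). \<theta> (fst z))" using th by (simp add: time_test_def)
  have supp: "\<exists>c d. 0 < c \<and> d < T \<and> (\<forall>t. t \<notin> {c..d} \<longrightarrow> \<theta> t = 0)" using th by (simp add: time_test_def)
  show "test_function a T (\<lambda>z. \<theta> (fst z) * cos (freq a n \<bullet> snd z))"
    unfolding test_function_def using supp
  proof (intro conjI smooth_mult sm smooth_cos phase_linear)
    show "\<forall>t. periodic a (\<lambda>x. \<theta> (fst (t, x)) * cos (freq a n \<bullet> snd (t, x)))" by (simp add: periodic_def pc)
    show "\<exists>c d. 0 < c \<and> d < T \<and> (\<forall>t x. t \<notin> {c..d} \<longrightarrow> \<theta> (fst (t, x)) * cos (freq a n \<bullet> snd (t, x)) = 0)"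
      using supp by fastforce
  qed
  show "test_function a T (\<lambda>z. \<theta> (fst z) * sin (freq a n \<bullet> snd z))"
    unfolding test_function_def using supp
  proof (intro conjI smooth_mult sm smooth_sin phase_linear)
    show "\<forall>t. periodic a (\<lambda>x. \<theta> (fst (t, x)) * sin (freq a n \<bullet> snd (t, x)))" by (simp add: periodic_def ps)
    show "\<exists>c d. 0 < c \<and> d < T \<and> (\<forall>t x. t \<notin> {c..d} \<longrightarrow> \<theta> (fst (t, x)) * sin (freq a n \<bullet> snd (t, x)) = 0)"
      using supp by fastforce
  qed
qed

lemma frechet_trig:
  assumes th: "time_test T \<theta>"
  shows "frechet_derivative (\<lambda>z. \<theta> (fst z) * cos (freq a n \<bullet> snd z)) (at z) =
      (\<lambda>w. deriv \<theta> (fst z) * fst w * cos (freq a n \<bullet> snd z) - \<theta> (fst z) * sin (freq a n \<bullet> snd z) * (freq a n \<bullet> snd w))"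
    and "frechet_derivative (\<lambda>z. \<theta> (fst z) * sin (freq a n \<bullet> snd z)) (at z) =
      (\<lambda>w. deriv \<theta> (fst z) * fst w * sin (freq a n \<bullet> snd z) + \<theta> (fst z) * cos (freq a n \<bullet> snd z) * (freq a n \<bullet> snd w))"
proof -
  have d: "((\<lambda>z::real \<times> (real^3). \<theta> (fst z)) has_derivative (\<lambda>w. deriv \<theta> (fst z) * fst w)) (at z)"
    using smooth_has_derivative[of "\<lambda>z::real \<times> (real^3). \<theta> (fst z)" z] th time_test_derivative(2)[OF th, of z]
    by (simp add: time_test_def)
  have l: "((\<lambda>z::real \<times> (real^3). freq a n \<bullet> snd z) has_derivative (\<lambda>w. freq a n \<bullet> snd w)) (at z)"
    by (rule bounded_linear_imp_has_derivative[OF phase_linear])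
  show "frechet_derivative (\<lambda>z. \<theta> (fst z) * cos (freq a n \<bullet> snd z)) (at z) =
      (\<lambda>w. deriv \<theta> (fst z) * fst w * cos (freq a n \<bullet> snd z) - \<theta> (fst z) * sin (freq a n \<bullet> snd z) * (freq a n \<bullet> snd w))"
    by (rule frechet_derivative_at[symmetric]) (rule derivative_eq_intros d l refl | simp add: fun_eq_iff algebra_simps)+
  show "frechet_derivative (\<lambda>z. \<theta> (fst z) * sin (freq a n \<bullet> snd z)) (at z) =
      (\<lambda>w. deriv \<theta> (fst z) * fst w * sin (freq a n \<bullet> snd z) + \<theta> (fst z) * cos (freq a n \<bullet> snd z) * (freq a n \<bullet> snd w))"
    by (rule frechet_derivative_at[symmetric]) (rule derivative_eq_intros d l refl | simp add: fun_eq_iff algebra_simps)+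
qed

text \<open>Each derivative in time passes under the integral over the cell; so the average of a test
  function against a fixed function of the position is a test function of the time.\<close>

lemma average_derivative:
  fixes \<psi> :: "real \<times> (real^3) \<Rightarrow> real"
  assumes s: "smooth \<psi>" and c: "continuous_on UNIV c"
  shows "((\<lambda>t. \<integral>x. \<psi> (t, x) * c x \<partial>cellM) has_real_derivative
     (\<integral>x. frechet_derivative \<psi> (at (t, x)) (1, 0) * c x \<partial>cellM)) (at t)"
proof -
  have c1: "continuous_on S (\<lambda>z. \<psi> z * c (snd z))" for S
    by (intro continuous_intros continuous_on_subset[OF smooth_continuous[OF s]]
        continuous_on_compose2[OF c] subset_UNIV)
  have c2: "continuous_on S (\<lambda>z. frechet_derivative \<psi> (at z) (1, 0) * c (snd z))" for S
    by (intro continuous_intros continuous_on_subset[OF smooth_continuous[OF smooth_partial[OF s time_in_Basis]]]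
        continuous_on_compose2[OF c] subset_UNIV)
  have c1': "continuous_on S (\<lambda>x. \<psi> (t, x) * c x)" for S t
    using continuous_on_compose2[OF c1[of UNIV], of S "\<lambda>x. (t, x)"] by (simp add: continuous_intros)
  have c2': "continuous_on S (\<lambda>x. frechet_derivative \<psi> (at (t, x)) (1, 0) * c x)" for S t
    using continuous_on_compose2[OF c2[of UNIV], of S "\<lambda>x. (t, x)"] by (simp add: continuous_intros)
  have "((\<lambda>t. integral (cbox 0 ((2 * pi) *\<^sub>R a)) (\<lambda>x. \<psi> (t, x) * c x)) has_field_derivative
     integral (cbox 0 ((2 * pi) *\<^sub>R a)) (\<lambda>x. frechet_derivative \<psi> (at (t, x)) (1, 0) * c x)) (at t within UNIV)"
  proof (rule leibniz_rule_field_derivative)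
    fix t x
    have "((\<psi> \<circ> (\<lambda>t. (t, x))) has_derivative (frechet_derivative \<psi> (at (t, x)) \<circ> (\<lambda>t. (t, 0)))) (at t)"
      by (intro diff_chain_at smooth_has_derivative[OF s]) (auto intro!: derivative_eq_intros)
    moreover have "frechet_derivative \<psi> (at (t, x)) \<circ> (\<lambda>t. (t, 0)) = (*) (frechet_derivative \<psi> (at (t, x)) (1, 0))"
    proof
      fix u :: real
      have "linear (frechet_derivative \<psi> (at (t, x)))"
        using smooth_has_derivative[OF s] by (rule has_derivative_linear)
      from linear_scale[OF this, of u "(1, 0)"]
      show "(frechet_derivative \<psi> (at (t, x)) \<circ> (\<lambda>t. (t, 0))) u = frechet_derivative \<psi> (at (t, x)) (1, 0) * u"
        by (simp add: mult.commute)
    qed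
    ultimately have "((\<lambda>t. \<psi> (t, x)) has_real_derivative frechet_derivative \<psi> (at (t, x)) (1, 0)) (at t)"
      by (simp add: o_def has_field_derivative_def)
    then show "((\<lambda>t. \<psi> (t, x) * c x) has_real_derivative frechet_derivative \<psi> (at (t, x)) (1, 0) * c x) (at t within UNIV)"
      by (rule DERIV_cmult_right)
  next
    show "(\<lambda>x. \<psi> (t, x) * c x) integrable_on cbox 0 ((2 * pi) *\<^sub>R a)" for t
      by (rule integrable_continuous[OF c1'])
    show "continuous_on (UNIV \<times> cbox 0 ((2 * pi) *\<^sub>R a)) (\<lambda>(t, x). frechet_derivative \<psi> (at (t, x)) (1, 0) * c x)"
      using c2 by (simp add: case_prod_unfold)
  qed auto
  then show ?thesis
    by (simp add: integral_cell_HK[OF c1'] integral_cell_HK[OF c2'] cell_def[symmetric])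
qed

lemma smooth_average:
  fixes \<psi> :: "real \<times> (real^3) \<Rightarrow> real"
  assumes c: "continuous_on UNIV c" and s: "smooth \<psi>"
  shows "smooth (\<lambda>z::real \<times> (real^3). \<integral>x. \<psi> (fst z, x) * c x \<partial>cellM)"
proof -
  have der: "((\<lambda>z::real \<times> (real^3). \<integral>x. \<psi> (fst z, x) * c x \<partial>cellM) has_derivative
      (\<lambda>w. (\<integral>x. frechet_derivative \<psi> (at (fst z, x)) (1, 0) * c x \<partial>cellM) * fst w)) (at z)"
    if s: "smooth \<psi>" for \<psi> :: "real \<times> (real^3) \<Rightarrow> real" and z
  proof -
    have "(((\<lambda>t. \<integral>x. \<psi> (t, x) * c x \<partial>cellM) \<circ> fst) has_derivative
      ((*) (\<integral>x. frechet_derivative \<psi> (at (fst z, x)) (1, 0) * c x \<partial>cellM) \<circ> fst)) (at z)"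
      by (intro diff_chain_at bounded_linear_imp_has_derivative bounded_linear_fst)
        (use average_derivative[OF s c, of "fst z"] in \<open>simp add: has_field_derivative_def\<close>)
    then show ?thesis by (simp add: o_def)
  qed
  have "Ck k (\<lambda>z::real \<times> (real^3). \<integral>x. \<psi> (fst z, x) * c x \<partial>cellM)"
    if "smooth \<psi>" for k and \<psi> :: "real \<times> (real^3) \<Rightarrow> real"
    using that
  proof (induction k arbitrary: \<psi>)
    case 0
    then show ?case
      using der[OF 0] by (auto intro!: continuous_at_imp_continuous_on intro: has_derivative_continuous)
  next
    case (Suc k)
    show ?case
    proof (rule CkI[OF der[OF Suc.prems]])
      fix b :: "real \<times> (real^3)" assume "b \<in> Basis"
      show "Ck k (\<lambda>z::real \<times> (real^3). (\<integral>x. frechet_derivative \<psi> (at (fst z, x)) (1, 0) * c x \<partial>cellM) * fst b)"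
        by (rule Ck_mult[OF Suc.IH[OF smooth_partial[OF Suc.prems time_in_Basis]] Ck_const])
    qed
  qed
  then show ?thesis using s by (simp add: smooth_def)
qed

lemma time_test_average:
  assumes \<phi>: "test_function a T \<phi>" and c: "continuous_on UNIV c"
  shows "time_test T (\<lambda>t. \<integral>x. \<phi> (t, x) * c x \<partial>cellM)"
    and "deriv (\<lambda>t. \<integral>x. \<phi> (t, x) * c x \<partial>cellM) t = (\<integral>x. frechet_derivative \<phi> (at (t, x)) (1, 0) * c x \<partial>cellM)"
proof -
  have s: "smooth \<phi>" using \<phi> by (simp add: test_function_def)
  obtain u v where uv: "0 < u" "v < T" "\<And>t x. t \<notin> {u..v} \<Longrightarrow> \<phi> (t, x) = 0"
    using \<phi> unfolding test_function_def by blast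
  have "(\<integral>x. \<phi> (t, x) * c x \<partial>cellM) = 0" if "t \<notin> {u..v}" for t
    using uv(3)[OF that] by simp
  then show "time_test T (\<lambda>t. \<integral>x. \<phi> (t, x) * c x \<partial>cellM)"
    unfolding time_test_def using smooth_average[OF c s] uv(1,2) by blast
  show "deriv (\<lambda>t. \<integral>x. \<phi> (t, x) * c x \<partial>cellM) t = (\<integral>x. frechet_derivative \<phi> (at (t, x)) (1, 0) * c x \<partial>cellM)"
    by (rule DERIV_imp_deriv[OF average_derivative[OF s c]])
qed

end

section \<open>Weak derivatives of the Fourier modes\<close>

text \<open>A time test function times a polynomial is again a time test function.  By the
  Weierstrass theorem these multiples already determine all multiples by continuous functions of
  time.\<close>

lemma polynomial_density:
  fixes F :: "'x \<Rightarrow> complex" and g :: "real \<Rightarrow> complex"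
  assumes F: "integrable M F" and \<tau> [measurable]: "\<tau> \<in> borel_measurable M"
    and \<tau>T: "\<And>z. z \<in> space M \<Longrightarrow> \<tau> z \<in> {0..T}"
    and poly: "\<And>p. real_polynomial_function p \<Longrightarrow> (\<integral>z. of_real (p (\<tau> z)) * F z \<partial>M) = 0"
    and g: "continuous_on {0..T} g"
  shows "(\<integral>z. g (\<tau> z) * F z \<partial>M) = 0"
proof -
  have meas: "(\<lambda>z. q (\<tau> z)) \<in> borel_measurable M" if q: "continuous_on {0..T} q"
    for q :: "real \<Rightarrow> 'b::{second_countable_topology, real_normed_vector}"
  proof -
    have "\<tau> \<in> M \<rightarrow>\<^sub>M restrict_space borel {0..T}"
      using \<tau>T by (intro measurable_restrict_space2) auto
    from measurable_compose[OF this borel_measurable_continuous_on_restrict[OF q]] show ?thesis .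
  qed
  have int: "integrable M (\<lambda>z. q (\<tau> z) * F z)" if q: "continuous_on {0..T} q" for q :: "real \<Rightarrow> complex"
  proof -
    have "compact (q ` {0..T})" by (intro compact_continuous_image q) auto
    then obtain B where B: "\<And>t. t \<in> {0..T} \<Longrightarrow> norm (q t) \<le> B"
      using compact_imp_bounded bounded_iff by (metis imageI)
    show ?thesis
      by (rule integrable_bounded_mult[OF F meas[OF q], of B]) (use B \<tau>T in auto)
  qed
  have real: "(\<integral>z. of_real (h (\<tau> z)) * F z \<partial>M) = 0" if h: "continuous_on {0..T} h" for h :: "real \<Rightarrow> real"
  proof -
    have le: "\<bar>norm (\<integral>z. of_real (h (\<tau> z)) * F z \<partial>M)\<bar> \<le> e * (\<integral>z. norm (F z) \<partial>M)" if e: "0 < e" for e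
    proof -
      obtain p where p: "real_polynomial_function p" "\<And>t. t \<in> {0..T} \<Longrightarrow> \<bar>h t - p t\<bar> < e"
        using Stone_Weierstrass_real_polynomial_function[OF compact_Icc h e] by metis
      have pc: "continuous_on {0..T} p"
        using p(1) by (simp add: continuous_on_polymonial_function real_polynomial_function_eq)
      have i1: "integrable M (\<lambda>z. of_real (h (\<tau> z)) * F z)" and i2: "integrable M (\<lambda>z. of_real (p (\<tau> z)) * F z)"
        using int[of "\<lambda>t. of_real (h t)"] int[of "\<lambda>t. of_real (p t)"] h pc by (auto intro: continuous_intros)
      have "(\<integral>z. of_real (h (\<tau> z)) * F z \<partial>M) = (\<integral>z. of_real (h (\<tau> z)) * F z - of_real (p (\<tau> z)) * F z \<partial>M)"
        using poly[OF p(1)] i1 i2 by simp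
      then have "norm (\<integral>z. of_real (h (\<tau> z)) * F z \<partial>M)
          \<le> (\<integral>z. norm (of_real (h (\<tau> z)) * F z - of_real (p (\<tau> z)) * F z) \<partial>M)"
        using integral_norm_bound[of M "\<lambda>z. of_real (h (\<tau> z)) * F z - of_real (p (\<tau> z)) * F z"] by simp
      also have "\<dots> \<le> (\<integral>z. e * norm (F z) \<partial>M)"
      proof (rule integral_mono)
        show "integrable M (\<lambda>z. norm (of_real (h (\<tau> z)) * F z - of_real (p (\<tau> z)) * F z))"
          by (intro integrable_norm Bochner_Integration.integrable_diff i1 i2)
        show "integrable M (\<lambda>z. e * norm (F z))" using F by auto
        fix z assume "z \<in> space M"
        then have "\<bar>h (\<tau> z) - p (\<tau> z)\<bar> \<le> e" using p(2)[OF \<tau>T] by (simp add: less_imp_le)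
        then show "norm (of_real (h (\<tau> z)) * F z - of_real (p (\<tau> z)) * F z) \<le> e * norm (F z)"
          by (simp add: left_diff_distrib[symmetric] norm_mult mult_right_mono flip: of_real_diff)
      qed
      finally show ?thesis by simp
    qed
    have "0 \<le> (\<integral>z. norm (F z) \<partial>M)" by (rule Bochner_Integration.integral_nonneg) simp
    from zero_if_le_multiples[OF le this] show ?thesis by simp
  qed
  have c1: "continuous_on {0..T} (\<lambda>t. Re (g t))" "continuous_on {0..T} (\<lambda>t. Im (g t))"
    by (intro continuous_intros g)+
  have i1: "integrable M (\<lambda>z. of_real (Re (g (\<tau> z))) * F z)" "integrable M (\<lambda>z. of_real (Im (g (\<tau> z))) * F z)"
    using int[of "\<lambda>t. of_real (Re (g t))"] int[of "\<lambda>t. of_real (Im (g t))"] c1 by (auto intro: continuous_intros)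
  have "(\<integral>z. g (\<tau> z) * F z \<partial>M) = (\<integral>z. of_real (Re (g (\<tau> z))) * F z + \<i> * (of_real (Im (g (\<tau> z))) * F z) \<partial>M)"
  proof (rule Bochner_Integration.integral_cong[OF refl])
    fix z
    show "g (\<tau> z) * F z = of_real (Re (g (\<tau> z))) * F z + \<i> * (of_real (Im (g (\<tau> z))) * F z)"
      using complex_eq[of "g (\<tau> z)"] by (metis distrib_right mult.assoc)
  qed
  also have "\<dots> = 0" using i1 real[OF c1(1)] real[OF c1(2)] by simp
  finally show ?thesis .
qed

context torus begin

lemma continuous_timeM:
  fixes h :: "real \<Rightarrow> 'b::{second_countable_topology, real_normed_vector}"
  assumes "continuous_on {0..T} h" shows "h \<in> borel_measurable (timeM T)"
proof -
  have "sets (timeM T) = sets (restrict_space borel {0..T})"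
    unfolding timeM_def by (rule sets_restrict_space_cong) simp
  then show ?thesis
    unfolding measurable_cong_sets[OF \<open>sets (timeM T) = _\<close> refl]
    by (intro borel_measurable_continuous_on_restrict assms)
qed

lemma continuous_bounded:
  fixes h :: "real \<Rightarrow> 'b::real_normed_vector"
  assumes h: "continuous_on {0..T} h" obtains B where "0 \<le> B" "\<And>t. t \<in> {0..T} \<Longrightarrow> norm (h t) \<le> B"
proof -
  have "compact (h ` {0..T})" by (intro compact_continuous_image h) auto
  then obtain B where B: "\<And>t. t \<in> {0..T} \<Longrightarrow> norm (h t) \<le> B"
    using compact_imp_bounded bounded_iff by (metis imageI)
  show thesis
  proof (rule that[of "max 0 B"])
    show "norm (h t) \<le> max 0 B" if "t \<in> {0..T}" for t using B[OF that] by simp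
  qed simp
qed

lemma continuous_integrable_timeM:
  fixes h :: "real \<Rightarrow> 'b::{second_countable_topology, banach}"
  assumes h: "continuous_on {0..T} h" shows "integrable (timeM T) h"
proof -
  obtain B where "0 \<le> B" "\<And>t. t \<in> {0..T} \<Longrightarrow> norm (h t) \<le> B" using continuous_bounded[OF h] by metis
  then show ?thesis
    by (intro timeM.integrable_const_bound[where B=B] AE_I2 continuous_timeM[OF h]) auto
qed

lemma fst_measurable_cyl: "fst \<in> cylM T \<rightarrow>\<^sub>M timeM T" and snd_measurable_cyl: "snd \<in> cylM T \<rightarrow>\<^sub>M cellM"
  by (simp_all add: cylM_eq)

lemma fst_borel_cyl [measurable]: "fst \<in> borel_measurable (cylM T)"
  and snd_borel_cyl [measurable]: "snd \<in> borel_measurable (cylM T)"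
  unfolding cylM_def
  by (auto intro!: measurable_restrict_space1 borel_measurable_continuous_onI continuous_intros)

text \<open>Up to the factor \<open>vol\<close> this is the \<open>n\<close>-th Fourier
  coefficient of \<open>f\<close>, tested in time with \<open>h\<close>; see
  \<open>MI_fubini\<close>.\<close>

definition MI :: "real \<Rightarrow> (real \<Rightarrow> complex) \<Rightarrow> int^3 \<Rightarrow> (real \<Rightarrow> real^3 \<Rightarrow> real) \<Rightarrow> complex" where
  "MI T h n f = (\<integral>z. h (fst z) * E (- n) (snd z) * complex_of_real (f (fst z) (snd z)) \<partial>cylM T)"

abbreviation cyl_integrable :: "real \<Rightarrow> (real \<Rightarrow> real^3 \<Rightarrow> 'b::{banach, second_countable_topology}) \<Rightarrow> bool" where
  "cyl_integrable T f \<equiv> integrable (cylM T) (\<lambda>z. f (fst z) (snd z))"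

lemma time_factor_measurable:
  fixes h :: "real \<Rightarrow> 'b::{second_countable_topology, real_normed_vector}"
  assumes "continuous_on {0..T} h" shows "(\<lambda>z. h (fst z)) \<in> borel_measurable (cylM T)"
  by (rule measurable_compose[OF fst_measurable_cyl continuous_timeM[OF assms]])

lemma E_cyl_measurable [measurable]: "(\<lambda>z. E n (snd z)) \<in> borel_measurable (cylM T)"
  by (rule measurable_compose[OF snd_borel_cyl E_measurable])

lemma MI_integrable:
  assumes h: "continuous_on {0..T} h" and f: "cyl_integrable T f"
  shows "integrable (cylM T) (\<lambda>z. h (fst z) * E n (snd z) * complex_of_real (f (fst z) (snd z)))"
proof -
  obtain B where B: "0 \<le> B" "\<And>t. t \<in> {0..T} \<Longrightarrow> norm (h t) \<le> B" using continuous_bounded[OF h] by metis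
  show ?thesis
  proof (rule integrable_bounded_mult[where B=B])
    show "integrable (cylM T) (\<lambda>z. complex_of_real (f (fst z) (snd z)))" using f by simp
    show "(\<lambda>z. h (fst z) * E n (snd z)) \<in> borel_measurable (cylM T)"
      using time_factor_measurable[OF h] by measurable
    show "norm (h (fst z) * E n (snd z)) \<le> B" if "z \<in> space (cylM T)" for z
      using B that by (auto simp: norm_mult)
  qed
qed

lemma MI_fubini:
  assumes h: "continuous_on {0..T} h" and f: "cyl_integrable T f"
  shows "MI T h n f = of_real vol * (\<integral>t. h t * fc (f t) n \<partial>timeM T)"
proof -
  have "MI T h n f = (\<integral>t. (\<integral>x. h t * (E (- n) x * complex_of_real (f t x)) \<partial>cellM) \<partial>timeM T)"
    unfolding MI_def by (subst fubini_cyl(1)[OF MI_integrable[OF h f]]) (simp add: mult.assoc)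
  also have "\<dots> = (\<integral>t. of_real vol * (h t * fc (f t) n) \<partial>timeM T)"
    using vol_pos by (simp add: fc_cellM)
  finally show ?thesis by simp
qed

lemma MI_split:
  assumes h: "continuous_on {0..T} h" and f: "cyl_integrable T f"
  shows "MI T (\<lambda>t. of_real (h t)) n f =
     of_real (\<integral>z. h (fst z) * cos (freq a n \<bullet> snd z) * f (fst z) (snd z) \<partial>cylM T) -
     \<i> * of_real (\<integral>z. h (fst z) * sin (freq a n \<bullet> snd z) * f (fst z) (snd z) \<partial>cylM T)"
proof -
  have i: "integrable (cylM T) (\<lambda>z. of_real (h (fst z)) * E (- n) (snd z) * complex_of_real (f (fst z) (snd z)))"
    using h by (intro MI_integrable f continuous_intros)
  show ?thesis
  proof (rule complex_eqI)
    show "Re (MI T (\<lambda>t. of_real (h t)) n f) = Re (of_real (\<integral>z. h (fst z) * cos (freq a n \<bullet> snd z) * f (fst z) (snd z) \<partial>cylM T) -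
     \<i> * of_real (\<integral>z. h (fst z) * sin (freq a n \<bullet> snd z) * f (fst z) (snd z) \<partial>cylM T))"
      unfolding MI_def by (subst integral_Re[OF i, symmetric]) (simp add: freq_minus)
    show "Im (MI T (\<lambda>t. of_real (h t)) n f) = Im (of_real (\<integral>z. h (fst z) * cos (freq a n \<bullet> snd z) * f (fst z) (snd z) \<partial>cylM T) -
     \<i> * of_real (\<integral>z. h (fst z) * sin (freq a n \<bullet> snd z) * f (fst z) (snd z) \<partial>cylM T))"
      unfolding MI_def by (subst integral_Im[OF i, symmetric]) (simp add: freq_minus)
  qed
qed

lemma weak_deriv_cyl:
  fixes f g :: "real \<Rightarrow> real^3 \<Rightarrow> 'b::euclidean_space"
  shows "weak_deriv a T b f g \<longleftrightarrow> cyl_integrable T f \<and> cyl_integrable T g \<and>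
    (\<forall>\<phi>. test_function a T \<phi> \<longrightarrow>
      (\<integral>z. frechet_derivative \<phi> (at z) b *\<^sub>R f (fst z) (snd z) \<partial>cylM T) = - (\<integral>z. \<phi> z *\<^sub>R g (fst z) (snd z) \<partial>cylM T))"
  by (simp add: weak_deriv_def integrable_cyl integral_cyl case_prod_unfold)

lemma weak_deriv_test:
  fixes f g :: "real \<Rightarrow> real^3 \<Rightarrow> 'b::euclidean_space"
  assumes "weak_deriv a T b f g" "test_function a T \<phi>"
  shows "(\<integral>z. frechet_derivative \<phi> (at z) b *\<^sub>R f (fst z) (snd z) \<partial>cylM T) = - (\<integral>z. \<phi> z *\<^sub>R g (fst z) (snd z) \<partial>cylM T)"
  using assms unfolding weak_deriv_cyl by blast

lemma weak_dx_MI: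
  fixes f g :: "real \<Rightarrow> real^3 \<Rightarrow> real"
  assumes w: "weak_dx a T j f g" and th: "time_test T \<theta>"
  shows "MI T (\<lambda>t. of_real (\<theta> t)) n g = \<i> * of_real (freq a n $ j) * MI T (\<lambda>t. of_real (\<theta> t)) n f"
proof -
  have th': "continuous_on {0..T} \<theta>" using time_test_derivative(4)[OF th] continuous_on_subset by blast
  have i: "cyl_integrable T f" "cyl_integrable T g" using w by (simp_all add: weak_deriv_cyl)
  let ?c = "\<lambda>f. \<integral>z. \<theta> (fst z) * cos (freq a n \<bullet> snd z) * f (fst z) (snd z) \<partial>cylM T"
  let ?s = "\<lambda>f. \<integral>z. \<theta> (fst z) * sin (freq a n \<bullet> snd z) * f (fst z) (snd z) \<partial>cylM T"
  have "(\<integral>z. (- (freq a n $ j)) * (\<theta> (fst z) * sin (freq a n \<bullet> snd z) * f (fst z) (snd z)) \<partial>cylM T) = - ?c g"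
    using weak_deriv_test[OF w test_function_trig(1)[OF th, of n]]
    unfolding frechet_trig(1)[OF th, of n] by (simp add: inner_axis mult_ac)
  then have 1: "?c g = freq a n $ j * ?s f" unfolding integral_mult_right_zero by simp
  have "(\<integral>z. freq a n $ j * (\<theta> (fst z) * cos (freq a n \<bullet> snd z) * f (fst z) (snd z)) \<partial>cylM T) = - ?s g"
    using weak_deriv_test[OF w test_function_trig(2)[OF th, of n]]
    unfolding frechet_trig(2)[OF th, of n] by (simp add: inner_axis mult_ac)
  then have 2: "?s g = - freq a n $ j * ?c f" unfolding integral_mult_right_zero by simp
  show ?thesis
    unfolding MI_split[OF th' i(1)] MI_split[OF th' i(2)] 1 2 by (simp add: complex_eq_iff)
qed

lemma weak_dt_MI:
  fixes f g :: "real \<Rightarrow> real^3 \<Rightarrow> real"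
  assumes w: "weak_dt a T f g" and th: "time_test T \<theta>"
  shows "MI T (\<lambda>t. of_real (deriv \<theta> t)) n f = - MI T (\<lambda>t. of_real (\<theta> t)) n g"
proof -
  have th': "continuous_on {0..T} \<theta>" "continuous_on {0..T} (deriv \<theta>)"
    using time_test_derivative(3,4)[OF th] continuous_on_subset by blast+
  have i: "cyl_integrable T f" "cyl_integrable T g" using w by (simp_all add: weak_deriv_cyl)
  have 1: "(\<integral>z. deriv \<theta> (fst z) * cos (freq a n \<bullet> snd z) * f (fst z) (snd z) \<partial>cylM T)
      = - (\<integral>z. \<theta> (fst z) * cos (freq a n \<bullet> snd z) * g (fst z) (snd z) \<partial>cylM T)"
    using weak_deriv_test[OF w test_function_trig(1)[OF th, of n]]
    unfolding frechet_trig(1)[OF th, of n] by (simp add: mult_ac)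
  have 2: "(\<integral>z. deriv \<theta> (fst z) * sin (freq a n \<bullet> snd z) * f (fst z) (snd z) \<partial>cylM T)
      = - (\<integral>z. \<theta> (fst z) * sin (freq a n \<bullet> snd z) * g (fst z) (snd z) \<partial>cylM T)"
    using weak_deriv_test[OF w test_function_trig(2)[OF th, of n]]
    unfolding frechet_trig(2)[OF th, of n] by (simp add: mult_ac)
  show ?thesis
    unfolding MI_split[OF th'(1) i(2)] MI_split[OF th'(2) i(1)] 1 2 by (simp add: complex_eq_iff)
qed

text \<open>The Fourier coefficients of an advecting field are merely continuous in time.  They
  become admissible as a factor of the test function through polynomial approximation.\<close>

lemma weak_dx_MI_continuous:
  fixes f g :: "real \<Rightarrow> real^3 \<Rightarrow> real"
  assumes w: "weak_dx a T j f g" and th: "time_test T \<theta>" and h: "continuous_on {0..T} h"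
  shows "MI T (\<lambda>t. h t * of_real (\<theta> t)) n g = \<i> * of_real (freq a n $ j) * MI T (\<lambda>t. h t * of_real (\<theta> t)) n f"
proof -
  have i: "cyl_integrable T f" "cyl_integrable T g" using w by (simp_all add: weak_deriv_cyl)
  have th': "continuous_on {0..T} (\<lambda>t. complex_of_real (\<theta> t))"
    using time_test_derivative(4)[OF th] continuous_on_subset by (blast intro: continuous_intros)
  let ?e = "\<lambda>f z. of_real (\<theta> (fst z)) * E (- n) (snd z) * complex_of_real (f (fst z) (snd z))"
  let ?k = "\<i> * of_real (freq a n $ j)"
  have ii: "integrable (cylM T) (?e f)" "integrable (cylM T) (?e g)"
    by (intro MI_integrable th' i)+
  have split: "(\<integral>z. q (fst z) * (?e g z - ?k * ?e f z) \<partial>cylM T) =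
      MI T (\<lambda>t. q t * of_real (\<theta> t)) n g - ?k * MI T (\<lambda>t. q t * of_real (\<theta> t)) n f"
    if q: "continuous_on {0..T} q" for q
  proof -
    have "(\<integral>z. q (fst z) * (?e g z - ?k * ?e f z) \<partial>cylM T) =
      (\<integral>z. q (fst z) * of_real (\<theta> (fst z)) * E (- n) (snd z) * complex_of_real (g (fst z) (snd z))
         - ?k * (q (fst z) * of_real (\<theta> (fst z)) * E (- n) (snd z) * complex_of_real (f (fst z) (snd z))) \<partial>cylM T)"
      by (simp add: algebra_simps)
    also have "\<dots> = MI T (\<lambda>t. q t * of_real (\<theta> t)) n g - ?k * MI T (\<lambda>t. q t * of_real (\<theta> t)) n f"
      unfolding MI_def
      by (subst Bochner_Integration.integral_diff) (intro MI_integrable integrable_mult_right i continuous_intros q th' | simp)+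
    finally show ?thesis .
  qed
  have "(\<integral>z. h (fst z) * (?e g z - ?k * ?e f z) \<partial>cylM T) = 0"
  proof (rule polynomial_density[OF _ fst_borel_cyl _ _ h])
    show "integrable (cylM T) (\<lambda>z. ?e g z - ?k * ?e f z)" using ii by simp
    show "fst z \<in> {0..T}" if "z \<in> space (cylM T)" for z using that by auto
    fix p :: "real \<Rightarrow> real" assume p: "real_polynomial_function p"
    have pc: "continuous_on {0..T} (\<lambda>t. complex_of_real (p t))"
      using p by (intro continuous_intros) (simp add: continuous_on_polymonial_function real_polynomial_function_eq)
    have "time_test T (\<lambda>t. p t * \<theta> t)" using time_test_mult[OF th p] by (simp add: mult.commute)
    from weak_dx_MI[OF w this, of n] show "(\<integral>z. of_real (p (fst z)) * (?e g z - ?k * ?e f z) \<partial>cylM T) = 0"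
      using split[OF pc] by simp
  qed
  then show ?thesis using split[OF h] by simp
qed

text \<open>By density, \<open>F\<close> may be tested with \<open>\<theta>\<close> times the
  conjugate of \<open>\<theta> F\<close>, which gives the squared modulus of \<open>\<theta>
  F\<close>.\<close>

lemma time_test_zero:
  assumes th: "time_test T \<theta>" and F: "continuous_on {0..T} F" and t: "t \<in> {0..T}"
    and z: "\<And>\<eta>. time_test T \<eta> \<Longrightarrow> (\<integral>t. of_real (\<eta> t) * F t \<partial>timeM T) = (0::complex)"
  shows "of_real (\<theta> t) * F t = 0"
proof (cases "0 < T")
  case False
  then have "t = 0" using t by auto
  then show ?thesis using time_test_boundary(1)[OF th] by simp
next
  case True
  define G where "G = (\<lambda>t. of_real (\<theta> t) * F t)"
  have th': "continuous_on {0..T} (\<lambda>t. complex_of_real (\<theta> t))"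
    using time_test_derivative(4)[OF th] continuous_on_subset by (blast intro: continuous_intros)
  have G: "continuous_on {0..T} G" unfolding G_def by (intro continuous_intros th' F)
  have G2: "continuous_on {0..T} (\<lambda>t. (norm (G t))\<^sup>2)" by (intro continuous_intros G)
  have "(\<integral>t. cnj (G t) * G t \<partial>timeM T) = 0"
  proof (rule polynomial_density[where \<tau>="\<lambda>t. t" and T=T])
    show "integrable (timeM T) G" by (rule continuous_integrable_timeM[OF G])
    show "continuous_on {0..T} (\<lambda>t. cnj (G t))" by (intro continuous_intros G)
    fix p :: "real \<Rightarrow> real" assume p: "real_polynomial_function p"
    show "(\<integral>t. of_real (p t) * G t \<partial>timeM T) = 0"
      using z[OF time_test_mult[OF th p]] by (simp add: G_def ac_simps)
  qed (auto intro: measurable_timeM)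
  moreover have "cnj (G t) * G t = of_real ((norm (G t))\<^sup>2)" for t
    by (metis complex_norm_square mult.commute)
  ultimately have "(\<integral>t. (norm (G t))\<^sup>2 \<partial>timeM T) = 0"
    by (simp only: integral_complex_of_real of_real_eq_0_iff)
  then have "integral {0..T} (\<lambda>t. (norm (G t))\<^sup>2) = 0"
    using set_borel_integral_eq_integral(2)[OF borel_integrable_atLeastAtMost'[OF G2]]
    by (simp add: timeM_def integral_restrict_space set_lebesgue_integral_def)
  then have "((\<lambda>t. (norm (G t))\<^sup>2) has_integral 0) (cbox 0 T)"
    using integrable_integral[OF integrable_continuous_real[OF G2]] by simp
  from has_integral_0_cbox_imp_0[OF _ _ this] have "(norm (G t))\<^sup>2 = 0"
    using G2 True t by auto
  then show ?thesis by (simp add: G_def)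
qed

end

section \<open>The Fourier modes of a solution\<close>

lemma vel_nth: "vel X $ 1 = X $ 1" "vel X $ 2 = X $ 2" "vel X $ 3 = X $ 3"
  by (simp_all add: vel_def)

context torus begin

lemma test_bounded:
  assumes "continuous_on UNIV (\<phi> :: real \<times> (real^3) \<Rightarrow> real)"
  obtains B where "\<And>z. z \<in> space (cylM T) \<Longrightarrow> norm (\<phi> z) \<le> B" "0 \<le> B" "\<phi> \<in> borel_measurable (cylM T)"
proof -
  have "compact (\<phi> ` ({0..T} \<times> cell a))"
    by (intro compact_continuous_image continuous_on_subset[OF assms] compact_Times compact_cell) auto
  then obtain B where B: "\<And>z. z \<in> {0..T} \<times> cell a \<Longrightarrow> norm (\<phi> z) \<le> B"
    using compact_imp_bounded bounded_iff by (metis imageI)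
  have m: "\<phi> \<in> borel_measurable (cylM T)"
    unfolding cylM_def using borel_measurable_continuous_onI[OF assms] by (intro measurable_restrict_space1) simp
  show thesis
  proof (rule that[of "max 0 B"])
    show "norm (\<phi> z) \<le> max 0 B" if "z \<in> space (cylM T)" for z
      using B[of z] that unfolding space_cylM le_max_iff_disj by blast
  qed (simp_all add: m)
qed

lemma test_mult_integrable:
  assumes "continuous_on UNIV (\<phi> :: real \<times> (real^3) \<Rightarrow> real)" "integrable (cylM T) q"
  shows "integrable (cylM T) (\<lambda>z. \<phi> z * q z)"
proof -
  obtain B where B: "\<And>z. z \<in> space (cylM T) \<Longrightarrow> norm (\<phi> z) \<le> B" "0 \<le> B" "\<phi> \<in> borel_measurable (cylM T)"
    using test_bounded[OF assms(1), where T=T] by metis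
  show ?thesis by (rule integrable_bounded_mult[OF assms(2) B(3,1)])
qed

lemma weak_deriv_components:
  fixes f g :: "real \<Rightarrow> real^3 \<Rightarrow> real^'k"
  assumes b: "b \<in> Basis"
  shows "weak_deriv a T b f g \<longleftrightarrow> (\<forall>i. weak_deriv a T b (\<lambda>t x. f t x $ i) (\<lambda>t x. g t x $ i))"
proof -
  have int: "cyl_integrable T h \<longleftrightarrow> (\<forall>i. cyl_integrable T (\<lambda>t x. h t x $ i))" for h :: "real \<Rightarrow> real^3 \<Rightarrow> real^'k"
    using integrable_vector[of "cylM T" "\<lambda>z. h (fst z) (snd z)"] by (auto intro: integrable_bounded_linear[OF bounded_linear_vec_nth])
  have nth: "(\<integral>z. \<phi> z *\<^sub>R h (fst z) (snd z) \<partial>cylM T) $ i = (\<integral>z. \<phi> z *\<^sub>R h (fst z) (snd z) $ i \<partial>cylM T)"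
    if \<phi>: "continuous_on UNIV \<phi>" and h: "cyl_integrable T h" for \<phi> and h :: "real \<Rightarrow> real^3 \<Rightarrow> real^'k" and i
  proof -
    have "integrable (cylM T) (\<lambda>z. \<phi> z *\<^sub>R h (fst z) (snd z))"
      by (rule integrable_vector) (use test_mult_integrable[OF \<phi> h[unfolded int, rule_format]] in simp)
    from integral_bounded_linear[OF bounded_linear_vec_nth this, of i] show ?thesis by simp
  qed
  have eq: "((\<integral>z. frechet_derivative \<phi> (at z) b *\<^sub>R f (fst z) (snd z) \<partial>cylM T) = - (\<integral>z. \<phi> z *\<^sub>R g (fst z) (snd z) \<partial>cylM T)) \<longleftrightarrow>
      (\<forall>i. (\<integral>z. frechet_derivative \<phi> (at z) b *\<^sub>R f (fst z) (snd z) $ i \<partial>cylM T) = - (\<integral>z. \<phi> z *\<^sub>R g (fst z) (snd z) $ i \<partial>cylM T))"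
    if \<phi>: "test_function a T \<phi>" and fg: "cyl_integrable T f" "cyl_integrable T g" for \<phi>
  proof -
    have sm: "smooth \<phi>" using \<phi> by (simp add: test_function_def)
    show ?thesis
      unfolding vec_eq_iff vector_uminus_component nth[OF smooth_continuous[OF sm] fg(2)]
        nth[OF smooth_continuous[OF smooth_partial[OF sm b]] fg(1)] ..
  qed
  show ?thesis
  proof (cases "cyl_integrable T f \<and> cyl_integrable T g")
    case True
    then show ?thesis unfolding weak_deriv_cyl int[symmetric] using eq int by auto
  next
    case False
    then show ?thesis unfolding weak_deriv_cyl int by auto
  qed
qed

lemma ser_cyl_measurable:
  assumes "\<And>n. (\<lambda>t. c t n) \<in> borel_measurable (timeM T)" and "\<And>t. t \<in> {0..T} \<Longrightarrow> l1 (c t)"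
  shows "(\<lambda>z. ser (c (fst z)) (snd z)) \<in> borel_measurable (cylM T)"
proof (rule borel_measurable_LIMSEQ_metric)
  show "(\<lambda>z. \<Sum>n\<in>ball_modes N. c (fst z) n * E n (snd z)) \<in> borel_measurable (cylM T)" for N
    using measurable_compose[OF fst_measurable_cyl assms(1)] by measurable
  show "(\<lambda>N. \<Sum>n\<in>ball_modes N. c (fst z) n * E n (snd z)) \<longlonglongrightarrow> ser (c (fst z)) (snd z)" if "z \<in> space (cylM T)" for z
    using that assms(2) by (intro ser_tendsto) auto
qed

lemma MI_cong_AE:
  assumes "AE z in cylM T. f (fst z) (snd z) = g (fst z) (snd z)" and h: "continuous_on {0..T} h"
    and "cyl_integrable T f" "cyl_integrable T g"
  shows "MI T h n f = MI T h n g"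
  unfolding MI_def
  by (rule integral_cong_AE) (use assms MI_integrable[OF h, THEN borel_measurable_integrable] in \<open>auto elim: eventually_mono\<close>)

lemma MI_lincomb:
  assumes h: "continuous_on {0..T} h" and "finite I" and f: "\<And>i. i \<in> I \<Longrightarrow> cyl_integrable T (f i)"
  shows "MI T h n (\<lambda>t x. \<Sum>i\<in>I. r i * f i t x) = (\<Sum>i\<in>I. of_real (r i) * MI T h n (f i))"
proof -
  have "MI T h n (\<lambda>t x. \<Sum>i\<in>I. r i * f i t x) = (\<integral>z. (\<Sum>i\<in>I. of_real (r i) *
      (h (fst z) * E (- n) (snd z) * complex_of_real (f i (fst z) (snd z)))) \<partial>cylM T)"
    unfolding MI_def by (simp add: sum_distrib_left ac_simps)
  also have "\<dots> = (\<Sum>i\<in>I. of_real (r i) * MI T h n (f i))"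
    unfolding MI_def
    by (subst Bochner_Integration.integral_sum) (auto intro!: MI_integrable[OF h f] integrable_mult_right)
  finally show ?thesis .
qed

text \<open>The advecting field is replaced by the partial sums of its absolutely convergent
  series; for each of its modes the derivative is then moved onto the test function, where it
  becomes multiplication with the wave number of \<open>f\<close>.\<close>

lemma convection_MI:
  fixes f D :: "real \<Rightarrow> real^3 \<Rightarrow> real"
  assumes w: "weak_dx a T j f D" and th: "time_test T \<theta>"
    and c: "\<And>k. continuous_on {0..T} (\<lambda>t. c t k)" and l: "\<And>t. t \<in> {0..T} \<Longrightarrow> l1 (c t)"
    and B: "\<And>t. t \<in> {0..T} \<Longrightarrow> l1norm (c t) \<le> B"
    and sym: "\<And>t k. t \<in> {0..T} \<Longrightarrow> c t (- k) = cnj (c t k)"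
  shows "cyl_integrable T (\<lambda>t x. Re (ser (c t) x) * D t x)"
    and "(\<lambda>N. \<Sum>k\<in>ball_modes N. \<i> * of_real (freq a (n - k) $ j) *
           (of_real vol * (\<integral>t. c t k * of_real (\<theta> t) * fc (f t) (n - k) \<partial>timeM T)))
         \<longlonglongrightarrow> MI T (\<lambda>t. of_real (\<theta> t)) n (\<lambda>t x. Re (ser (c t) x) * D t x)"
proof -
  have f: "cyl_integrable T f" and D: "cyl_integrable T D" using w by (simp_all add: weak_deriv_cyl)
  have th': "continuous_on {0..T} (\<lambda>t. complex_of_real (\<theta> t))"
    using time_test_derivative(4)[OF th] continuous_on_subset by (blast intro: continuous_intros)
  obtain A where A: "0 \<le> A" "\<And>t. t \<in> {0..T} \<Longrightarrow> norm (complex_of_real (\<theta> t)) \<le> A"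
    using continuous_bounded[OF th'] by metis
  have sm: "(\<lambda>z. ser (c (fst z)) (snd z)) \<in> borel_measurable (cylM T)"
    by (intro ser_cyl_measurable continuous_timeM c l)
  have sb: "norm (ser (c t) x) \<le> B" if "t \<in> {0..T}" for t x
    using norm_ser[OF l[OF that]] B[OF that] order_trans by blast
  have re: "of_real (Re (ser (c t) x)) = ser (c t) x" if "t \<in> {0..T}" for t x
    using ser_real[of "c t" x] sym[OF that] by (simp add: complex_eq_iff)
  show "cyl_integrable T (\<lambda>t x. Re (ser (c t) x) * D t x)"
  proof (rule integrable_bounded_mult[OF D, of _ B])
    show "(\<lambda>z. Re (ser (c (fst z)) (snd z))) \<in> borel_measurable (cylM T)" using sm by measurable
    show "norm (Re (ser (c (fst z)) (snd z))) \<le> B" if "z \<in> space (cylM T)" for z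
      using that sb[of "fst z" "snd z"] abs_Re_le_cmod[of "ser (c (fst z)) (snd z)"] by auto
  qed
  let ?F = "\<lambda>N z. of_real (\<theta> (fst z)) * E (- n) (snd z) * (\<Sum>k\<in>ball_modes N. c (fst z) k * E k (snd z)) * complex_of_real (D (fst z) (snd z))"
  have thme: "(\<lambda>z. complex_of_real (\<theta> (fst z))) \<in> borel_measurable (cylM T)"
    by (rule time_factor_measurable[OF th'])
  have cm: "(\<lambda>z. c (fst z) k) \<in> borel_measurable (cylM T)" for k by (rule time_factor_measurable[OF c])
  have Dm: "(\<lambda>z. complex_of_real (D (fst z) (snd z))) \<in> borel_measurable (cylM T)"
    using D by measurable
  have "(\<lambda>N. integral\<^sup>L (cylM T) (?F N)) \<longlonglongrightarrow>
     (\<integral>z. of_real (\<theta> (fst z)) * E (- n) (snd z) * ser (c (fst z)) (snd z) * complex_of_real (D (fst z) (snd z)) \<partial>cylM T)"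
  proof (rule integral_dominated_convergence[where w="\<lambda>z. (A * B) * \<bar>D (fst z) (snd z)\<bar>"])
    show "(\<lambda>z. of_real (\<theta> (fst z)) * E (- n) (snd z) * ser (c (fst z)) (snd z) * complex_of_real (D (fst z) (snd z))) \<in> borel_measurable (cylM T)"
      using thme sm Dm by measurable
    show "?F N \<in> borel_measurable (cylM T)" for N using thme cm Dm by measurable
    show "integrable (cylM T) (\<lambda>z. (A * B) * \<bar>D (fst z) (snd z)\<bar>)" using D by auto
    show "AE z in cylM T. (\<lambda>N. ?F N z) \<longlonglongrightarrow> of_real (\<theta> (fst z)) * E (- n) (snd z) * ser (c (fst z)) (snd z) * complex_of_real (D (fst z) (snd z))"
      by (intro AE_I2 tendsto_mult tendsto_const ser_tendsto l) auto
    show "AE z in cylM T. norm (?F N z) \<le> (A * B) * \<bar>D (fst z) (snd z)\<bar>" for N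
    proof (rule AE_I2)
      fix z assume z: "z \<in> space (cylM T)"
      then have t: "fst z \<in> {0..T}" by auto
      have p: "norm (\<Sum>k\<in>ball_modes N. c (fst z) k * E k (snd z)) \<le> B"
        using norm_partial_ser[OF l[OF t] finite_ball_modes] B[OF t] order_trans by blast
      have "norm (complex_of_real (\<theta> (fst z))) * norm (\<Sum>k\<in>ball_modes N. c (fst z) k * E k (snd z)) \<le> A * B"
        using A(1) A(2)[OF t] p by (intro mult_mono) auto
      then show "norm (?F N z) \<le> (A * B) * \<bar>D (fst z) (snd z)\<bar>"
        by (simp add: norm_mult mult_right_mono)
    qed
  qed
  moreover have "(\<integral>z. of_real (\<theta> (fst z)) * E (- n) (snd z) * ser (c (fst z)) (snd z) * complex_of_real (D (fst z) (snd z)) \<partial>cylM T)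
      = MI T (\<lambda>t. of_real (\<theta> t)) n (\<lambda>t x. Re (ser (c t) x) * D t x)"
    unfolding MI_def by (rule Bochner_Integration.integral_cong) (auto simp: re)
  moreover have "integral\<^sup>L (cylM T) (?F N) = (\<Sum>k\<in>ball_modes N. \<i> * of_real (freq a (n - k) $ j) *
           (of_real vol * (\<integral>t. c t k * of_real (\<theta> t) * fc (f t) (n - k) \<partial>timeM T)))" for N
  proof -
    have ch: "continuous_on {0..T} (\<lambda>t. c t k * of_real (\<theta> t))" for k by (intro continuous_intros c th')
    have "?F N z = (\<Sum>k\<in>ball_modes N. (c (fst z) k * of_real (\<theta> (fst z))) * E (- (n - k)) (snd z) * complex_of_real (D (fst z) (snd z)))" for z
    proof -
      have e: "E (- (n - k)) (snd z) = E (- n) (snd z) * E k (snd z)" for k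
        using E_add[of "- n" k "snd z"] by simp
      show ?thesis unfolding e by (simp add: sum_distrib_left sum_distrib_right ac_simps)
    qed
    then have "integral\<^sup>L (cylM T) (?F N) = (\<Sum>k\<in>ball_modes N. MI T (\<lambda>t. c t k * of_real (\<theta> t)) (n - k) D)"
      unfolding MI_def by (simp only:) (rule Bochner_Integration.integral_sum, rule MI_integrable[OF ch D])
    also have "\<dots> = (\<Sum>k\<in>ball_modes N. \<i> * of_real (freq a (n - k) $ j) *
           (of_real vol * (\<integral>t. c t k * of_real (\<theta> t) * fc (f t) (n - k) \<partial>timeM T)))"
      by (simp add: weak_dx_MI_continuous[OF w th c] MI_fubini[OF ch f])
    finally show ?thesis .
  qed
  ultimately show "(\<lambda>N. \<Sum>k\<in>ball_modes N. \<i> * of_real (freq a (n - k) $ j) *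
           (of_real vol * (\<integral>t. c t k * of_real (\<theta> t) * fc (f t) (n - k) \<partial>timeM T)))
         \<longlonglongrightarrow> MI T (\<lambda>t. of_real (\<theta> t)) n (\<lambda>t x. Re (ser (c t) x) * D t x)"
    by simp
qed

lemma cont_sobolev_cyl_measurable:
  assumes "u \<in> cont_sobolev a T \<sigma>"
  shows "(\<lambda>z. u (fst z) (snd z)) \<in> borel_measurable (cylM T)"
proof -
  have "(\<lambda>z. indicator ({0..T} \<times> UNIV) z *\<^sub>R u (fst z) (snd z)) \<in> borel_measurable borel"
    using assms by (simp add: cont_sobolev_def set_borel_measurable_def case_prod_unfold)
  then have "(\<lambda>z. indicator ({0..T} \<times> UNIV) z *\<^sub>R u (fst z) (snd z)) \<in> borel_measurable (cylM T)"
    unfolding cylM_def by (intro measurable_restrict_space1) simp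
  then show ?thesis
    by (rule measurable_cong[THEN iffD1, rotated]) auto
qed

lemma cont_sobolev_eq_ser:
  fixes u :: "real \<Rightarrow> real^3 \<Rightarrow> real^'k"
  assumes u: "u \<in> cont_sobolev a T s" and s: "3/2 < s"
  shows "AE z in cylM T. u (fst z) (snd z) $ i = Re (ser (\<lambda>n. fourier a (u (fst z)) n $ i) (snd z))"
proof -
  have us: "u t \<in> sobolev a s" if "t \<in> {0..T}" for t using u that by (auto simp: cont_sobolev_def)
  have c: "continuous_on {0..T} (\<lambda>t. fourier a (u t) n $ i)" for n
    using s by (intro continuous_intros cont_sobolev_fourier[OF u]) auto
  have m1: "(\<lambda>z. ser (\<lambda>n. fourier a (u (fst z)) n $ i) (snd z)) \<in> borel_measurable (cylM T)"
    by (rule ser_cyl_measurable[where c="\<lambda>t n. fourier a (u t) n $ i"])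
      (auto intro!: continuous_timeM c sobolev_l1[OF us s])
  have m2: "(\<lambda>z. u (fst z) (snd z) $ i) \<in> borel_measurable (cylM T)"
    by (rule measurable_compose[OF cont_sobolev_cyl_measurable[OF u] measurable_vec_nth])
  show ?thesis
  proof (rule AE_cyl_combine)
    show "{z \<in> space (cylM T). u (fst z) (snd z) $ i = Re (ser (\<lambda>n. fourier a (u (fst z)) n $ i) (snd z))} \<in> sets (cylM T)"
      using m1 m2 by measurable
    show "AE x in cellM. u (fst (t, x)) (snd (t, x)) $ i = Re (ser (\<lambda>n. fourier a (u (fst (t, x))) n $ i) (snd (t, x)))"
      if "t \<in> {0..T}" for t
      using sobolev_eq_ser[OF us[OF that] s] by simp
  qed
qed

end

text \<open>The index of a velocity component among the four components of a state.\<close>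

definition emb :: "3 \<Rightarrow> 4" where "emb j = (if j = 1 then 1 else if j = 2 then 2 else 3)"

lemma emb_simps [simp]: "emb 1 = 1" "emb 2 = 2" "emb 3 = 3"
  by (simp_all add: emb_def)

lemma vel_emb: "vel X $ j = X $ emb j"
  using exhaust_3[of j] by (auto simp: vel_nth)

lemma with_fourth_emb: "with_fourth w c $ emb j = w $ j"
  using exhaust_3[of j] by (auto simp: with_fourth_def vector_4)

lemma A_op_hor: "A_op X $ 1 = 0" "A_op X $ 2 = 0" "A_op X $ 3 = X $ 4" "A_op X $ 4 = - X $ 3"
  by (simp_all add: A_op_def vector_4)

lemma sum_4': "sum f (UNIV :: 4 set) = f 1 + f 2 + f 3 + f 4"
  for f :: "4 \<Rightarrow> 'b::comm_monoid_add"
  unfolding UNIV_4 by (simp add: ac_simps)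

lemma i_mult_twice: "\<i> * r * (\<i> * r * z) = - (r * r * z)"
proof -
  have "\<i> * r * (\<i> * r * z) = (\<i> * \<i>) * (r * r * z)" by (simp only: mult_ac)
  then show ?thesis by simp
qed

context torus begin

definition kdot :: "int^3 \<Rightarrow> complex^4 \<Rightarrow> complex" where
  "kdot n X = (\<Sum>j\<in>UNIV. of_real (freq a n $ j) * X $ emb j)"

definition rad :: "int^3 \<Rightarrow> real" where "rad n = sqrt ((freq a n $ 1)\<^sup>2 + (freq a n $ 2)\<^sup>2)"

definition perp :: "int^3 \<Rightarrow> 3 \<Rightarrow> real" where
  "perp n i = (if i = 1 then - freq a n $ 2 / rad n else if i = 2 then freq a n $ 1 / rad n else 0)"

definition horizontal :: "int^3 \<Rightarrow> bool" where "horizontal n \<longleftrightarrow> n$1 \<noteq> 0 \<or> n$2 \<noteq> 0"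

lemma perp_simps: "perp n 1 = - freq a n $ 2 / rad n" "perp n 2 = freq a n $ 1 / rad n" "perp n 3 = 0"
  by (simp_all add: perp_def)

lemma e0_nth: "e0 a n $ emb i = of_real (perp n i)" "e0 a n $ 4 = 0"
  using exhaust_3[of i] by (auto simp: e0_def Let_def vector_4 perp_def rad_def)

lemma e0_nth': "e0 a n $ 1 = of_real (perp n 1)" "e0 a n $ 2 = of_real (perp n 2)" "e0 a n $ 3 = 0" "e0 a n $ 4 = 0"
  using e0_nth(1)[of n 1] e0_nth(1)[of n 2] e0_nth(1)[of n 3] e0_nth(2)[of n] by (simp_all add: perp_simps)

lemma hermitian_e0: "hermitian X (e0 a n) = (\<Sum>i\<in>UNIV. of_real (perp n i) * X $ emb i)"
  by (simp add: hermitian_def sum_4' sum_3 e0_nth' perp_simps mult.commute)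

lemma rad_pos: "horizontal n \<Longrightarrow> 0 < rad n"
  by (auto simp: rad_def horizontal_def freq_nth sum_power2_gt_zero_iff)

lemma perp_orth: "(\<Sum>i\<in>UNIV. perp n i * freq a n $ i) = 0"
  by (simp add: sum_3 perp_simps)

lemma MI_add:
  assumes h: "continuous_on {0..T} h" and "cyl_integrable T f" "cyl_integrable T g"
  shows "MI T h n (\<lambda>t x. f t x + g t x) = MI T h n f + MI T h n g"
  unfolding MI_def
  using Bochner_Integration.integral_add[OF MI_integrable[OF h assms(2), of "-n"] MI_integrable[OF h assms(3), of "-n"]]
  by (simp add: algebra_simps)

lemma MI_cmult: "MI T h n (\<lambda>t x. r * f t x) = of_real r * MI T h n f"
  unfolding MI_def integral_mult_right_zero[symmetric] by (simp add: ac_simps)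

lemma MI_sum:
  assumes h: "continuous_on {0..T} h" and "finite I" and f: "\<And>i. i \<in> I \<Longrightarrow> cyl_integrable T (f i)"
  shows "MI T h n (\<lambda>t x. \<Sum>i\<in>I. f i t x) = (\<Sum>i\<in>I. MI T h n (f i))"
  using MI_lincomb[OF h \<open>finite I\<close> f, where r="\<lambda>_. 1"] by simp

lemma MI_fourier:
  assumes h: "continuous_on {0..T} h" and f: "cyl_integrable T (\<lambda>t x. V t x $ i)"
  shows "MI T h n (\<lambda>t x. V t x $ i) = of_real vol * (\<integral>t. h t * fourier a (V t) n $ i \<partial>timeM T)"
  using MI_fubini[OF assms] by (simp add: fourier_nth)

lemma solution_bound:
  fixes V :: "real \<Rightarrow> real^3 \<Rightarrow> real^4"
  assumes V: "V \<in> cont_sobolev a T s" and s: "3/2 < s" and C: "\<And>t. t \<in> {0..T} \<Longrightarrow> sobolev_norm a s (V t) \<le> C"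
    and t: "t \<in> {0..T}"
  shows "l1 (\<lambda>n. fourier a (V t) n $ i)"
    and "l1norm (\<lambda>n. fourier a (V t) n $ i) \<le> (\<Sum>\<^sub>\<infinity>n. wt n powr - s) + C\<^sup>2"
    and "wnorm s (fourier a (V t)) \<le> C\<^sup>2" and "weighted s (fourier a (V t))"
proof -
  show w: "weighted s (fourier a (V t))" using V t by (auto simp: cont_sobolev_def sobolev_iff)
  have "sqrt (wnorm s (fourier a (V t))) \<le> C" using C[OF t] by (simp add: sobolev_norm_wnorm)
  then show le: "wnorm s (fourier a (V t)) \<le> C\<^sup>2"
    using sqrt_le_D by blast
  show "l1 (\<lambda>n. fourier a (V t) n $ i)" by (rule l1_weighted(1)[OF s weighted_nth(1)[OF w]])
  show "l1norm (\<lambda>n. fourier a (V t) n $ i) \<le> (\<Sum>\<^sub>\<infinity>n. wt n powr - s) + C\<^sup>2"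
    using l1_weighted(2)[OF s weighted_nth(1)[OF w, of i]] weighted_nth(2)[OF w, of i] le by linarith
qed

text \<open>The factor \<open>\<theta> t\<close> restricts the claim to times in the interior of
  the interval, as the weak equation is only tested there.\<close>

lemma divergence_modes:
  assumes sol: "pbs_solution a \<nu> \<epsilon> s T V0 V" and s: "5/2 < s"
    and th: "time_test T \<theta>" and t: "t \<in> {0..T}"
  shows "of_real (\<theta> t) * kdot n (fourier a (V t) n) = 0"
proof -
  obtain D where D: "\<And>j. weak_dx a T j V (D j)" and div: "ae_torus a T (\<lambda>t x. (\<Sum>j\<in>UNIV. vel (D j t x) $ j) = 0)"
    using sol unfolding pbs_solution_def by blast
  have V: "V \<in> cont_sobolev a T s" using sol by (simp add: pbs_solution_def)
  have wD: "weak_dx a T j (\<lambda>t x. V t x $ i) (\<lambda>t x. D j t x $ i)" for i j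
    using D by (simp add: weak_deriv_components[OF space_in_Basis])
  have iV: "cyl_integrable T (\<lambda>t x. V t x $ i)" and iD: "cyl_integrable T (\<lambda>t x. D j t x $ i)" for i j
    using wD by (simp_all add: weak_deriv_cyl)
  have cV: "continuous_on {0..T} (\<lambda>t. fourier a (V t) n $ i)" for i n
    using s by (intro continuous_intros cont_sobolev_fourier[OF V]) auto
  show ?thesis
  proof (rule time_test_zero[OF th _ t])
    show "continuous_on {0..T} (\<lambda>t. kdot n (fourier a (V t) n))"
      unfolding kdot_def by (intro continuous_intros cV)
    fix \<eta> assume \<eta>: "time_test T \<eta>"
    have eta: "continuous_on {0..T} (\<lambda>t. complex_of_real (\<eta> t))"
      using time_test_derivative(4)[OF \<eta>] continuous_on_subset by (blast intro: continuous_intros)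
    have "MI T (\<lambda>t. of_real (\<eta> t)) n (\<lambda>t x. \<Sum>j\<in>UNIV. D j t x $ emb j) = MI T (\<lambda>t. of_real (\<eta> t)) n (\<lambda>t x. 0)"
    proof (rule MI_cong_AE[OF _ eta])
      show "AE z in cylM T. (\<Sum>j\<in>UNIV. D j (fst z) (snd z) $ emb j) = 0"
        using div by (simp add: ae_torus_cyl vel_emb)
      show "cyl_integrable T (\<lambda>t x. \<Sum>j\<in>UNIV. D j t x $ emb j)" by (intro Bochner_Integration.integrable_sum iD)
    qed simp
    moreover have "MI T (\<lambda>t. of_real (\<eta> t)) n (\<lambda>t x. 0) = 0" by (simp add: MI_def)
    moreover have "MI T (\<lambda>t. of_real (\<eta> t)) n (\<lambda>t x. \<Sum>j\<in>UNIV. D j t x $ emb j)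
        = (\<Sum>j\<in>UNIV. MI T (\<lambda>t. of_real (\<eta> t)) n (\<lambda>t x. D j t x $ emb j))"
      by (rule MI_sum[OF eta finite iD])
    ultimately have "0 = (\<Sum>j\<in>UNIV. MI T (\<lambda>t. of_real (\<eta> t)) n (\<lambda>t x. D j t x $ emb j))" by simp
    also have "\<dots> = (\<Sum>j\<in>UNIV. \<i> * of_real (freq a n $ j) * (of_real vol * (\<integral>t. of_real (\<eta> t) * fourier a (V t) n $ emb j \<partial>timeM T)))"
      by (simp add: weak_dx_MI[OF wD \<eta>] MI_fourier[OF eta iV])
    also have "\<dots> = (\<Sum>j\<in>UNIV. \<integral>t. \<i> * of_real vol * (of_real (\<eta> t) * (of_real (freq a n $ j) * fourier a (V t) n $ emb j)) \<partial>timeM T)"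
      unfolding integral_mult_right_zero[symmetric] by (simp add: ac_simps)
    also have "\<dots> = (\<integral>t. (\<Sum>j\<in>UNIV. \<i> * of_real vol * (of_real (\<eta> t) * (of_real (freq a n $ j) * fourier a (V t) n $ emb j))) \<partial>timeM T)"
      by (rule Bochner_Integration.integral_sum[symmetric])
        (intro continuous_integrable_timeM continuous_intros eta cV)
    also have "\<dots> = (\<integral>t. \<i> * of_real vol * (of_real (\<eta> t) * kdot n (fourier a (V t) n)) \<partial>timeM T)"
      by (simp add: kdot_def sum_distrib_left)
    finally have "0 = \<i> * of_real vol * (\<integral>t. of_real (\<eta> t) * kdot n (fourier a (V t) n) \<partial>timeM T)"
      unfolding integral_mult_right_zero .
    then show "(\<integral>t. of_real (\<eta> t) * kdot n (fourier a (V t) n) \<partial>timeM T) = 0" using vol_pos by simp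
  qed
qed

text \<open>Testing with the horizontal field \<open>e0\<close> removes the pressure and the singular term at once:
  both are orthogonal to it.\<close>

lemma mode_equation:
  assumes sol: "pbs_solution a \<nu> \<epsilon> s T V0 V" and s: "5/2 < s"
    and C: "\<And>t. t \<in> {0..T} \<Longrightarrow> sobolev_norm a s (V t) \<le> C"
    and th: "time_test T \<theta>"
  shows "(\<lambda>N. \<Sum>k\<in>ball_modes N. \<integral>t. \<i> * of_real (\<theta> t) * kdot (n - k) (fourier a (V t) k) *
            hermitian (fourier a (V t) (n - k)) (e0 a n) \<partial>timeM T)
      \<longlonglongrightarrow> (\<integral>t. of_real (deriv \<theta> t) * hermitian (fourier a (V t) n) (e0 a n) \<partial>timeM T)
        - of_real (\<nu> * (norm (freq a n))\<^sup>2) * (\<integral>t. of_real (\<theta> t) * hermitian (fourier a (V t) n) (e0 a n) \<partial>timeM T)"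
proof -
  obtain Vt D D2 \<Phi> G where Vt: "weak_dt a T V Vt" and D: "\<And>j. weak_dx a T j V (D j)"
    and D2: "\<And>j. weak_dx a T j (\<lambda>t x. vel (D j t x)) (D2 j)"
    and \<Phi>: "\<And>j. weak_dx a T j \<Phi> (\<lambda>t x. G t x $ j)"
    and eq: "ae_torus a T (\<lambda>t x.
        Vt t x + (\<Sum>j\<in>UNIV. vel (V t x) $ j *\<^sub>R D j t x)
          - with_fourth (\<nu> *\<^sub>R (\<Sum>j\<in>UNIV. D2 j t x)) 0
          + (1 / \<epsilon>) *\<^sub>R A_op (V t x)
        = - ((1 / \<epsilon>) *\<^sub>R with_fourth (G t x) 0))"
    using sol unfolding pbs_solution_def by blast
  have V: "V \<in> cont_sobolev a T s" using sol by (simp add: pbs_solution_def)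
  have s': "3/2 < s" using s by simp
  let ?V = "\<lambda>t n. fourier a (V t) n"
  let ?S = "\<lambda>j t x. Re (ser (\<lambda>k. ?V t k $ emb j) x)"
  have wD: "weak_dx a T j (\<lambda>t x. V t x $ i) (\<lambda>t x. D j t x $ i)" for i j
    using D by (simp add: weak_deriv_components[OF space_in_Basis])
  have wVt: "weak_dt a T (\<lambda>t x. V t x $ i) (\<lambda>t x. Vt t x $ i)" for i
    using Vt by (simp add: weak_deriv_components[OF time_in_Basis])
  have wD2: "weak_dx a T j (\<lambda>t x. D j t x $ emb i) (\<lambda>t x. D2 j t x $ i)" for i j
    using D2[of j] by (simp add: weak_deriv_components[OF space_in_Basis] vel_emb)
  have iV: "cyl_integrable T (\<lambda>t x. V t x $ i)" and iD: "cyl_integrable T (\<lambda>t x. D j t x $ i)"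
    and iVt: "cyl_integrable T (\<lambda>t x. Vt t x $ i)" for i j
    using wD wVt by (simp_all add: weak_deriv_cyl)
  have iD2: "cyl_integrable T (\<lambda>t x. D2 j t x $ i)" and iG: "cyl_integrable T (\<lambda>t x. G t x $ i)" for i j
    using wD2 \<Phi> by (simp_all add: weak_deriv_cyl)
  have cV: "continuous_on {0..T} (\<lambda>t. ?V t n $ i)" for i n
    using s by (intro continuous_intros cont_sobolev_fourier[OF V]) auto
  have thc: "continuous_on {0..T} (\<lambda>t. complex_of_real (\<theta> t))" and thc': "continuous_on {0..T} (\<lambda>t. complex_of_real (deriv \<theta> t))"
    using time_test_derivative(3,4)[OF th] continuous_on_subset by (blast intro: continuous_intros)+
  let ?M = "MI T (\<lambda>t. of_real (\<theta> t)) n"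
  note conv = convection_MI[OF wD th cV solution_bound(1)[OF V s' C] solution_bound(2)[OF V s' C] fourier_minus_index]
  have iS: "cyl_integrable T (\<lambda>t x. ?S j t x * D j t x $ i)" for i j
    by (rule conv(1)) auto
  have component: "(\<Sum>j\<in>UNIV. ?M (\<lambda>t x. ?S j t x * D j t x $ emb i)) =
      MI T (\<lambda>t. of_real (deriv \<theta> t)) n (\<lambda>t x. V t x $ emb i) - of_real (\<nu> * (norm (freq a n))\<^sup>2) * ?M (\<lambda>t x. V t x $ emb i)
      - \<i> * of_real (freq a n $ i) * (of_real (1 / \<epsilon>) * ?M \<Phi>)" if i: "i \<noteq> 3" for i
  proof -
    have Ai: "A_op X $ emb i = 0" for X :: "real^4"
      using exhaust_3[of i] i by (auto simp: A_op_hor)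
    have "\<forall>j. AE z in cylM T. V (fst z) (snd z) $ emb j = ?S j (fst z) (snd z)"
      using cont_sobolev_eq_ser[OF V s'] by blast
    then have aeS: "AE z in cylM T. \<forall>j. V (fst z) (snd z) $ emb j = ?S j (fst z) (snd z)"
      by (simp add: AE_all_countable)
    have ae: "AE z in cylM T. (\<Sum>j\<in>UNIV. ?S j (fst z) (snd z) * D j (fst z) (snd z) $ emb i) =
        (-1) * Vt (fst z) (snd z) $ emb i + (\<nu> * (\<Sum>j\<in>UNIV. D2 j (fst z) (snd z) $ i) + (- (1 / \<epsilon>)) * G (fst z) (snd z) $ i)"
      using eq[unfolded ae_torus_cyl] aeS
    proof eventually_elim
      case (elim z)
      from arg_cong[OF elim(1), of "\<lambda>X. X $ emb i"]
      have "Vt (fst z) (snd z) $ emb i + (\<Sum>j\<in>UNIV. V (fst z) (snd z) $ emb j * D j (fst z) (snd z) $ emb i)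
         - \<nu> * (\<Sum>j\<in>UNIV. D2 j (fst z) (snd z) $ i) = - (1 / \<epsilon>) * G (fst z) (snd z) $ i"
        by (simp add: with_fourth_emb Ai vel_emb sum_component)
      then show ?case using elim(2) by simp
    qed
    have "(\<Sum>j\<in>UNIV. ?M (\<lambda>t x. ?S j t x * D j t x $ emb i)) = ?M (\<lambda>t x. \<Sum>j\<in>UNIV. ?S j t x * D j t x $ emb i)"
      by (rule MI_sum[OF thc finite iS, symmetric])
    also have "\<dots> = ?M (\<lambda>t x. (-1) * Vt t x $ emb i + (\<nu> * (\<Sum>j\<in>UNIV. D2 j t x $ i) + (- (1 / \<epsilon>)) * G t x $ i))"
      by (rule MI_cong_AE[OF ae thc])
        (intro Bochner_Integration.integrable_sum Bochner_Integration.integrable_add integrable_mult_right iS iVt iD2 iG)+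
    also have "\<dots> = ?M (\<lambda>t x. (-1) * Vt t x $ emb i) + (?M (\<lambda>t x. \<nu> * (\<Sum>j\<in>UNIV. D2 j t x $ i)) + ?M (\<lambda>t x. (- (1 / \<epsilon>)) * G t x $ i))"
      by (subst MI_add[OF thc], (intro Bochner_Integration.integrable_sum Bochner_Integration.integrable_add integrable_mult_right iVt iD2 iG)+,
          subst MI_add[OF thc], (intro Bochner_Integration.integrable_sum Bochner_Integration.integrable_add integrable_mult_right iVt iD2 iG)+) simp
    also have "\<dots> = - ?M (\<lambda>t x. Vt t x $ emb i) + (of_real \<nu> * (\<Sum>j\<in>UNIV. ?M (\<lambda>t x. D2 j t x $ i)) - of_real (1 / \<epsilon>) * ?M (\<lambda>t x. G t x $ i))"
      unfolding MI_cmult MI_sum[OF thc finite iD2] by simp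
    also have "?M (\<lambda>t x. Vt t x $ emb i) = - MI T (\<lambda>t. of_real (deriv \<theta> t)) n (\<lambda>t x. V t x $ emb i)"
      using weak_dt_MI[OF wVt th] by simp
    also have "(\<Sum>j\<in>UNIV. ?M (\<lambda>t x. D2 j t x $ i)) = - of_real ((norm (freq a n))\<^sup>2) * ?M (\<lambda>t x. V t x $ emb i)"
    proof -
      have "?M (\<lambda>t x. D2 j t x $ i) = - of_real ((freq a n $ j)\<^sup>2) * ?M (\<lambda>t x. V t x $ emb i)" for j
        unfolding weak_dx_MI[OF wD2 th] weak_dx_MI[OF wD th] i_mult_twice by (simp add: power2_eq_square)
      then have "(\<Sum>j\<in>UNIV. ?M (\<lambda>t x. D2 j t x $ i)) = - of_real (\<Sum>j\<in>UNIV. (freq a n $ j)\<^sup>2) * ?M (\<lambda>t x. V t x $ emb i)"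
        by (simp add: sum_distrib_right sum_negf)
      then show ?thesis by (simp add: norm_vec_square_sum)
    qed
    also have "?M (\<lambda>t x. G t x $ i) = \<i> * of_real (freq a n $ i) * ?M \<Phi>" by (rule weak_dx_MI[OF \<Phi> th])
    finally show ?thesis by (simp add: algebra_simps)
  qed
  let ?W = "\<lambda>t. hermitian (?V t n) (e0 a n)"
  have "(\<Sum>i\<in>UNIV. of_real (perp n i) * (\<Sum>j\<in>UNIV. ?M (\<lambda>t x. ?S j t x * D j t x $ emb i))) =
     (\<Sum>i\<in>UNIV. of_real (perp n i) * (MI T (\<lambda>t. of_real (deriv \<theta> t)) n (\<lambda>t x. V t x $ emb i)
       - of_real (\<nu> * (norm (freq a n))\<^sup>2) * ?M (\<lambda>t x. V t x $ emb i)
       - \<i> * of_real (freq a n $ i) * (of_real (1 / \<epsilon>) * ?M \<Phi>)))"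
  proof (rule sum.cong[OF refl], goal_cases)
    case (1 i)
    show ?case
    proof (cases "i = 3")
      case True then show ?thesis by (simp only: perp_simps(3) of_real_0 mult_zero_left)
    next
      case False from component[OF this] show ?thesis by (rule arg_cong)
    qed
  qed
  also have "\<dots> = (\<Sum>i\<in>UNIV. of_real (perp n i) * MI T (\<lambda>t. of_real (deriv \<theta> t)) n (\<lambda>t x. V t x $ emb i))
     - of_real (\<nu> * (norm (freq a n))\<^sup>2) * (\<Sum>i\<in>UNIV. of_real (perp n i) * ?M (\<lambda>t x. V t x $ emb i))
     - \<i> * of_real (\<Sum>i\<in>UNIV. perp n i * freq a n $ i) * (of_real (1 / \<epsilon>) * ?M \<Phi>)"
    by (simp add: sum_3 algebra_simps)
  also have "\<dots> = of_real vol * ((\<integral>t. of_real (deriv \<theta> t) * ?W t \<partial>timeM T)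
        - of_real (\<nu> * (norm (freq a n))\<^sup>2) * (\<integral>t. of_real (\<theta> t) * ?W t \<partial>timeM T))"
  proof -
    have e: "(\<Sum>i\<in>UNIV. of_real (perp n i) * MI T h n (\<lambda>t x. V t x $ emb i)) = of_real vol * (\<integral>t. h t * ?W t \<partial>timeM T)"
      if h: "continuous_on {0..T} h" for h
    proof -
      have "(\<Sum>i\<in>UNIV. of_real (perp n i) * MI T h n (\<lambda>t x. V t x $ emb i)) =
          of_real vol * (\<Sum>i\<in>UNIV. \<integral>t. of_real (perp n i) * (h t * ?V t n $ emb i) \<partial>timeM T)"
        unfolding integral_mult_right_zero by (simp add: MI_fourier[OF h iV] sum_distrib_left mult_ac)
      also have "(\<Sum>i\<in>UNIV. \<integral>t. of_real (perp n i) * (h t * ?V t n $ emb i) \<partial>timeM T) =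
          (\<integral>t. (\<Sum>i\<in>UNIV. of_real (perp n i) * (h t * ?V t n $ emb i)) \<partial>timeM T)"
        by (rule Bochner_Integration.integral_sum[symmetric]) (intro continuous_integrable_timeM continuous_intros h cV)
      also have "\<dots> = (\<integral>t. h t * ?W t \<partial>timeM T)"
        by (simp add: hermitian_e0 sum_distrib_left ac_simps)
      finally show ?thesis .
    qed
    show ?thesis unfolding e[OF thc] e[OF thc'] perp_orth by (simp add: algebra_simps)
  qed
  finally have tot: "(\<Sum>i\<in>UNIV. of_real (perp n i) * (\<Sum>j\<in>UNIV. ?M (\<lambda>t x. ?S j t x * D j t x $ emb i))) =
     of_real vol * ((\<integral>t. of_real (deriv \<theta> t) * ?W t \<partial>timeM T)
        - of_real (\<nu> * (norm (freq a n))\<^sup>2) * (\<integral>t. of_real (\<theta> t) * ?W t \<partial>timeM T))" .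
  let ?I = "\<lambda>i j k. \<integral>t. ?V t k $ emb j * of_real (\<theta> t) * ?V t (n - k) $ emb i \<partial>timeM T"
  let ?lhs = "\<lambda>N. \<Sum>i\<in>UNIV. of_real (perp n i) * (\<Sum>j\<in>UNIV. \<Sum>k\<in>ball_modes N. \<i> * of_real (freq a (n - k) $ j) * (of_real vol * ?I i j k))"
  have "?lhs \<longlonglongrightarrow> (\<Sum>i\<in>UNIV. of_real (perp n i) * (\<Sum>j\<in>UNIV. ?M (\<lambda>t x. ?S j t x * D j t x $ emb i)))"
  proof (intro tendsto_sum tendsto_mult_left)
    show "(\<lambda>N. \<Sum>k\<in>ball_modes N. \<i> * of_real (freq a (n - k) $ j) * (of_real vol * ?I i j k)) \<longlonglongrightarrow> ?M (\<lambda>t x. ?S j t x * D j t x $ emb i)" for i j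
      unfolding fourier_nth by (rule conv(2)[unfolded fourier_nth]) auto
  qed
  moreover have "?lhs N = of_real vol * (\<Sum>k\<in>ball_modes N. \<integral>t. \<i> * of_real (\<theta> t) * kdot (n - k) (?V t k) * hermitian (?V t (n - k)) (e0 a n) \<partial>timeM T)" for N
  proof -
    have inner: "(\<Sum>i\<in>UNIV. \<Sum>j\<in>UNIV. \<i> * of_real (perp n i) * of_real (freq a (n - k) $ j) * ?I i j k) =
       (\<integral>t. \<i> * of_real (\<theta> t) * kdot (n - k) (?V t k) * hermitian (?V t (n - k)) (e0 a n) \<partial>timeM T)" for k
    proof -
      have "(\<Sum>i\<in>UNIV. \<Sum>j\<in>UNIV. \<i> * of_real (perp n i) * of_real (freq a (n - k) $ j) * ?I i j k) =
         (\<integral>t. (\<Sum>i\<in>UNIV. \<Sum>j\<in>UNIV. \<i> * of_real (perp n i) * of_real (freq a (n - k) $ j) *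
            (?V t k $ emb j * of_real (\<theta> t) * ?V t (n - k) $ emb i)) \<partial>timeM T)"
        unfolding integral_mult_right_zero[symmetric]
        by (subst Bochner_Integration.integral_sum, intro continuous_integrable_timeM continuous_intros thc cV,
            subst Bochner_Integration.integral_sum, intro continuous_integrable_timeM continuous_intros thc cV) simp
      also have "\<dots> = (\<integral>t. \<i> * of_real (\<theta> t) * kdot (n - k) (?V t k) * hermitian (?V t (n - k)) (e0 a n) \<partial>timeM T)"
        by (simp add: hermitian_e0 kdot_def sum_3 algebra_simps)
      finally show ?thesis .
    qed
    have "?lhs N = of_real vol * (\<Sum>k\<in>ball_modes N. \<Sum>i\<in>UNIV. \<Sum>j\<in>UNIV. \<i> * of_real (perp n i) * of_real (freq a (n - k) $ j) * ?I i j k)"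
      by (simp add: sum_distrib_left sum.swap[of _ "ball_modes N"] ac_simps)
    then show ?thesis by (simp only: inner)
  qed
  ultimately have "(\<lambda>N. of_real vol * (\<Sum>k\<in>ball_modes N. \<integral>t. \<i> * of_real (\<theta> t) * kdot (n - k) (?V t k) * hermitian (?V t (n - k)) (e0 a n) \<partial>timeM T))
     \<longlonglongrightarrow> of_real vol * ((\<integral>t. of_real (deriv \<theta> t) * ?W t \<partial>timeM T)
        - of_real (\<nu> * (norm (freq a n))\<^sup>2) * (\<integral>t. of_real (\<theta> t) * ?W t \<partial>timeM T))"
    unfolding tot by simp
  then show ?thesis using vol_pos by (subst (asm) tendsto_mult_left_iff) auto
qed

end

section \<open>The propagator on Fourier modes\<close>

text \<open>The propagator is only ever observed through left eigenvectors of its generator, on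
  which the exponential series is scalar.\<close>

lemma exp_series_eigenfunctional:
  fixes B :: "'b::euclidean_space \<Rightarrow> 'b" and f :: "'b \<Rightarrow> complex"
  assumes B: "\<And>X. norm (B X) \<le> M * norm X" and M: "0 \<le> M" and f: "bounded_linear f" and eig: "\<And>X. f (B X) = \<mu> * f X"
  shows "summable (\<lambda>k. ((- \<tau>)^k / fact k) *\<^sub>R (B ^^ k) X)"
    and "f (\<Sum>k. ((- \<tau>)^k / fact k) *\<^sub>R (B ^^ k) X) = exp (- of_real \<tau> * \<mu>) * f X"
    and "norm (\<Sum>k. ((- \<tau>)^k / fact k) *\<^sub>R (B ^^ k) X) \<le> exp (M * \<bar>\<tau>\<bar>) * norm X"
proof -
  interpret f: bounded_linear f by (rule f)
  have Bk: "norm ((B ^^ k) X) \<le> M ^ k * norm X" for k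
  proof (induction k)
    case (Suc k)
    have "norm ((B ^^ Suc k) X) \<le> M * norm ((B ^^ k) X)" using B by simp
    also have "\<dots> \<le> M * (M ^ k * norm X)" using Suc M by (rule mult_left_mono)
    finally show ?case by (simp add: mult.assoc)
  qed simp
  have bd: "norm (((- \<tau>)^k / fact k) *\<^sub>R (B ^^ k) X) \<le> ((M * \<bar>\<tau>\<bar>)^k /\<^sub>R fact k) * norm X" for k
  proof -
    have "norm (((- \<tau>)^k / fact k) *\<^sub>R (B ^^ k) X) = (\<bar>\<tau>\<bar>^k / fact k) * norm ((B ^^ k) X)"
      by (simp add: power_abs)
    also have "\<dots> \<le> (\<bar>\<tau>\<bar>^k / fact k) * (M ^ k * norm X)" by (intro mult_left_mono Bk) auto
    finally show ?thesis by (simp add: power_mult_distrib divide_inverse ac_simps)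
  qed
  have es: "(\<lambda>k. ((M * \<bar>\<tau>\<bar>)^k /\<^sub>R fact k) * norm X) sums (exp (M * \<bar>\<tau>\<bar>) * norm X)"
    by (intro sums_mult2 exp_converges)
  then have ss: "summable (\<lambda>k. ((M * \<bar>\<tau>\<bar>)^k /\<^sub>R fact k) * norm X)" by (rule sums_summable)
  have ns: "summable (\<lambda>k. norm (((- \<tau>)^k / fact k) *\<^sub>R (B ^^ k) X))"
    by (rule summable_comparison_test'[OF ss]) (use bd in simp)
  then show s: "summable (\<lambda>k. ((- \<tau>)^k / fact k) *\<^sub>R (B ^^ k) X)" by (rule summable_norm_cancel)
  show "norm (\<Sum>k. ((- \<tau>)^k / fact k) *\<^sub>R (B ^^ k) X) \<le> exp (M * \<bar>\<tau>\<bar>) * norm X"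
    using summable_norm[OF ns] suminf_le[OF bd ns ss] sums_unique[OF es] by simp
  have fk: "f ((B ^^ k) X) = \<mu> ^ k * f X" for k by (induction k) (simp_all add: eig mult.assoc)
  have "f (\<Sum>k. ((- \<tau>)^k / fact k) *\<^sub>R (B ^^ k) X) = (\<Sum>k. f (((- \<tau>)^k / fact k) *\<^sub>R (B ^^ k) X))"
    by (rule f.suminf[OF s])
  also have "\<dots> = (\<Sum>k. ((- of_real \<tau> * \<mu>) ^ k /\<^sub>R fact k) * f X)"
  proof (rule arg_cong[where f=suminf], rule ext)
    fix k
    have "(- of_real \<tau> * \<mu>) ^ k = of_real ((- \<tau>) ^ k) * \<mu> ^ k"
      by (simp add: power_mult_distrib flip: of_real_minus)
    then show "f (((- \<tau>)^k / fact k) *\<^sub>R (B ^^ k) X) = ((- of_real \<tau> * \<mu>) ^ k /\<^sub>R fact k) * f X"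
      by (simp add: f.scaleR fk scaleR_conv_of_real divide_inverse ac_simps)
  qed
  also have "\<dots> = exp (- of_real \<tau> * \<mu>) * f X"
    by (rule sums_unique[symmetric]) (intro sums_mult2 exp_converges)
  finally show "f (\<Sum>k. ((- \<tau>)^k / fact k) *\<^sub>R (B ^^ k) X) = exp (- of_real \<tau> * \<mu>) * f X" .
qed

lemma norm_vec_le_sum: "norm X \<le> (\<Sum>i\<in>UNIV. norm (X $ i))" for X :: "'b::real_normed_vector^'k"
  unfolding norm_vec_def by (rule L2_set_le_sum) simp

context torus begin

abbreviation gen :: "int^3 \<Rightarrow> complex^4 \<Rightarrow> complex^4" where "gen n X \<equiv> leray a n (A_op X)"

abbreviation quot :: "int^3 \<Rightarrow> complex^4 \<Rightarrow> complex" where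
  "quot n X \<equiv> of_real (freq a n $ 3) * X $ 4 / of_real ((norm (freq a n))\<^sup>2)"

lemma gen_nth: "gen n X $ 1 = - quot n X * of_real (freq a n $ 1)" "gen n X $ 2 = - quot n X * of_real (freq a n $ 2)"
  "gen n X $ 3 = X $ 4 - quot n X * of_real (freq a n $ 3)" "gen n X $ 4 = - X $ 3"
  by (simp_all add: leray_def Let_def vector_4 A_op_hor)

lemma gen_bound: "norm (gen n X) \<le> 8 * norm X"
proof -
  let ?k = "freq a n"
  have q: "norm (quot n X * of_real (?k $ i)) \<le> norm X" for i
  proof (cases "?k = 0")
    case False
    have "\<bar>?k $ 3\<bar> * \<bar>?k $ i\<bar> \<le> norm ?k * norm ?k" by (intro mult_mono component_le_norm_cart) auto
    then have "(\<bar>?k $ 3\<bar> * \<bar>?k $ i\<bar>) / (norm ?k)\<^sup>2 \<le> 1" using False by (simp add: power2_eq_square)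
    moreover have "norm (quot n X * of_real (?k $ i)) = (\<bar>?k $ 3\<bar> * \<bar>?k $ i\<bar>) / (norm ?k)\<^sup>2 * norm (X $ 4)"
      by (simp add: norm_mult norm_divide ac_simps norm_power)
    ultimately have "norm (quot n X * of_real (?k $ i)) \<le> 1 * norm (X $ 4)"
      by (simp only:) (intro mult_right_mono; simp)
    also have "\<dots> \<le> norm X" by (simp add: Finite_Cartesian_Product.norm_nth_le)
    finally show ?thesis .
  qed simp
  have n: "norm (X $ i) \<le> norm X" for i by (rule Finite_Cartesian_Product.norm_nth_le)
  have "norm (gen n X) \<le> norm (gen n X $ 1) + norm (gen n X $ 2) + norm (gen n X $ 3) + norm (gen n X $ 4)"
    using norm_vec_le_sum[of "gen n X"] by (simp add: sum_4')
  also have "norm (gen n X $ 1) \<le> norm X" using q[of 1] by (simp add: gen_nth)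
  also have "norm (gen n X $ 2) \<le> norm X" using q[of 2] by (simp add: gen_nth)
  also have "norm (gen n X $ 3) \<le> norm X + norm X"
    unfolding gen_nth by (rule order_trans[OF norm_triangle_ineq4 add_mono[OF n q]])
  also have "norm (gen n X $ 4) \<le> norm X" using n[of 3] by (simp add: gen_nth)
  finally show ?thesis using norm_ge_zero[of X] by linarith
qed

lemma propagator_symbol_eigen:
  fixes f :: "complex^4 \<Rightarrow> complex"
  assumes "bounded_linear f" "\<And>X. f (gen n X) = \<mu> * f X"
  shows "f (propagator_symbol a \<tau> n X) = exp (- of_real \<tau> * \<mu>) * f X"
  unfolding propagator_symbol_def
  by (rule exp_series_eigenfunctional(2)[where M=8]) (use assms gen_bound in auto)

text \<open>A crude bound, enough for the filtered field to be as regular as the solution at each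
  fixed time and parameter.\<close>

lemma propagator_symbol_bound: "norm (propagator_symbol a \<tau> n X) \<le> exp (8 * \<bar>\<tau>\<bar>) * norm X"
  unfolding propagator_symbol_def
  by (rule exp_series_eigenfunctional(3)[where f="\<lambda>_. 0" and \<mu>=0]) (use gen_bound in auto)

lemma propagator_symbol_0: "propagator_symbol a 0 n X = X"
proof -
  have "(\<lambda>k. ((- 0::real)^k / fact k) *\<^sub>R (gen n ^^ k) X) = (\<lambda>k. if k = 0 then X else 0)"
    by (auto simp: fun_eq_iff)
  then show ?thesis
    unfolding propagator_symbol_def using sums_unique[OF sums_single[of 0 "\<lambda>_. X"]] by simp
qed

lemma propagator_symbol_cnj:
  assumes "\<And>i. Y $ i = cnj (X $ i)"
  shows "propagator_symbol a \<tau> (- n) Y $ i = cnj (propagator_symbol a \<tau> n X $ i)"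
proof -
  have g: "gen (- n) Y $ i = cnj (gen n X $ i)" if "\<And>i. Y $ i = cnj (X $ i)" for X Y i
    using exhaust_4[of i] that by (auto simp: gen_nth freq_minus)
  have gk: "(gen (- n) ^^ k) Y $ i = cnj ((gen n ^^ k) X $ i)" for k i
  proof (induction k arbitrary: i)
    case 0 then show ?case using assms by simp
  next
    case (Suc k) then show ?case using g[of "(gen (- n) ^^ k) Y" "(gen n ^^ k) X"] by simp
  qed
  have s: "summable (\<lambda>k. ((- \<tau>)^k / fact k) *\<^sub>R (gen m ^^ k) Z)" for m Z
    by (rule exp_series_eigenfunctional(1)[where f="\<lambda>_. 0" and \<mu>=0 and M=8]) (use gen_bound in auto)
  have "propagator_symbol a \<tau> (- n) Y $ i = (\<Sum>k. (((- \<tau>)^k / fact k) *\<^sub>R (gen (- n) ^^ k) Y) $ i)"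
    unfolding propagator_symbol_def by (rule bounded_linear.suminf[OF bounded_linear_vec_nth s])
  also have "\<dots> = (\<Sum>k. cnj ((((- \<tau>)^k / fact k) *\<^sub>R (gen n ^^ k) X) $ i))"
    by (simp add: gk)
  also have "\<dots> = cnj (\<Sum>k. (((- \<tau>)^k / fact k) *\<^sub>R (gen n ^^ k) X) $ i)"
    by (rule bounded_linear.suminf[OF bounded_linear_cnj, symmetric])
      (rule bounded_linear.summable[OF bounded_linear_vec_nth s])
  also have "(\<Sum>k. (((- \<tau>)^k / fact k) *\<^sub>R (gen n ^^ k) X) $ i) = propagator_symbol a \<tau> n X $ i"
    unfolding propagator_symbol_def by (rule bounded_linear.suminf[OF bounded_linear_vec_nth s, symmetric])
  finally show ?thesis .
qed

lemma fourier_propagator: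
  assumes f: "f \<in> sobolev a s" and s: "3/2 < s"
  shows "propagator a \<tau> f \<in> sobolev a s"
    and "fourier a (propagator a \<tau> f) n = propagator_symbol a \<tau> n (fourier a f n)"
proof -
  let ?c = "\<lambda>n. propagator_symbol a \<tau> n (fourier a f n)"
  have w: "weighted s (fourier a f)" using f by (simp add: sobolev_iff)
  have "wt n powr s * (norm (?c n))\<^sup>2 \<le> (exp (8 * \<bar>\<tau>\<bar>))\<^sup>2 * (wt n powr s * (norm (fourier a f n))\<^sup>2)" for n
  proof -
    have "(norm (?c n))\<^sup>2 \<le> (exp (8 * \<bar>\<tau>\<bar>) * norm (fourier a f n))\<^sup>2"
      by (intro power_mono propagator_symbol_bound) simp
    then show ?thesis by (simp add: power_mult_distrib mult.left_commute mult_left_mono)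
  qed
  from weighted_mono(1)[OF w this] have wc: "weighted s ?c" .
  have l: "l1 (\<lambda>n. ?c n $ i)" for i by (rule l1_weighted(1)[OF s weighted_nth(1)[OF wc]])
  have sym: "?c (- n) $ i = cnj (?c n $ i)" for n i
    by (rule propagator_symbol_cnj) (rule fourier_minus_index)
  show "propagator a \<tau> f \<in> sobolev a s" unfolding propagator_def by (rule synth_sobolev[OF l sym wc])
  show "fourier a (propagator a \<tau> f) n = ?c n" unfolding propagator_def by (rule fourier_synth[OF l sym])
qed

subsection \<open>Kernel and oscillating parts\<close>

text \<open>\<open>omega n\<close> is the frequency of the internal waves with wave vector \<open>n\<close>; on horizontal averages
  it vanishes.  The waves themselves have amplitude \<open>wave n\<close> (in the velocity) and are
  detected by the functionals \<open>zeta\<close>, left eigenvectors of the generator.\<close>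

definition omega :: "int^3 \<Rightarrow> real" where "omega n = rad n / norm (freq a n)"

definition zeta :: "int^3 \<Rightarrow> int \<Rightarrow> complex^4 \<Rightarrow> complex" where
  "zeta n p X = X $ 3 + \<i> * of_int p * of_real (omega n) * X $ 4"

definition wave :: "int^3 \<Rightarrow> 3 \<Rightarrow> real" where
  "wave n i = (if i = 3 then 1 else - freq a n $ 3 * freq a n $ i / (rad n)\<^sup>2)"

text \<open>The slow velocity (\<open>p = 0\<close>) and the velocities of the two waves (\<open>p = 1, -1\<close>).\<close>

definition part :: "int^3 \<Rightarrow> int \<Rightarrow> complex^4 \<Rightarrow> 3 \<Rightarrow> complex" where
  "part n p X i =
    (if p = 0 then (if horizontal n then hermitian X (e0 a n) * of_real (perp n i)
                    else if i = 3 then 0 else X $ emb i)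
     else if horizontal n then zeta n p X / 2 * of_real (wave n i) else 0)"

lemma rad_square: "(rad n)\<^sup>2 = (freq a n $ 1)\<^sup>2 + (freq a n $ 2)\<^sup>2"
  by (simp add: rad_def)

lemma norm_freq_square: "(norm (freq a n))\<^sup>2 = (rad n)\<^sup>2 + (freq a n $ 3)\<^sup>2"
  unfolding norm_vec_square_sum sum_3 rad_square by simp

lemma horizontal_freq_nz: "horizontal n \<Longrightarrow> norm (freq a n) \<noteq> 0"
  using rad_pos[of n] norm_freq_square[of n] by (auto simp: power2_eq_square add_nonneg_eq_0_iff)

lemma omega_pos: "horizontal n \<Longrightarrow> 0 < omega n"
  using rad_pos[of n] horizontal_freq_nz[of n] by (simp add: omega_def)

lemma zeta_gen:
  assumes n: "horizontal n" and p: "p = 1 \<or> p = -1"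
  shows "zeta n p (gen n X) = (- \<i> * of_int p * of_real (omega n)) * zeta n p X"
proof -
  let ?w = "complex_of_real (omega n)"
  have nz: "(norm (freq a n))\<^sup>2 \<noteq> 0" using horizontal_freq_nz[OF n] by simp
  have "1 - (freq a n $ 3)\<^sup>2 / (norm (freq a n))\<^sup>2 = (omega n)\<^sup>2"
  proof -
    have "1 - (freq a n $ 3)\<^sup>2 / (norm (freq a n))\<^sup>2 = ((norm (freq a n))\<^sup>2 - (freq a n $ 3)\<^sup>2) / (norm (freq a n))\<^sup>2"
      using nz by (simp add: field_simps)
    then show ?thesis by (simp add: norm_freq_square[of n] omega_def power_divide)
  qed
  then have w: "?w * ?w = 1 - of_real (freq a n $ 3) * of_real (freq a n $ 3) / of_real ((norm (freq a n))\<^sup>2)"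
    unfolding of_real_mult[symmetric] of_real_divide[symmetric] of_real_1[where 'a=complex, symmetric]
      of_real_diff[symmetric] by (simp add: power2_eq_square)
  have 3: "gen n X $ 3 = ?w * ?w * X $ 4" unfolding w gen_nth by (simp add: algebra_simps)
  have pp: "(of_int p :: complex) * of_int p = 1" using p by auto
  let ?r = "of_int p * ?w"
  have rr: "?r * ?r = ?w * ?w"
  proof -
    have "?r * ?r = (of_int p * of_int p) * (?w * ?w)" by (simp only: mult_ac)
    then show ?thesis by (simp add: pp)
  qed
  have "(- \<i> * of_int p * ?w) * zeta n p X = - (\<i> * ?r * X $ 3) - \<i> * ?r * (\<i> * ?r * X $ 4)"
    unfolding zeta_def by (simp add: algebra_simps)
  also have "\<dots> = - (\<i> * ?r * X $ 3) + ?w * ?w * X $ 4" unfolding i_mult_twice rr by simp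
  also have "\<dots> = zeta n p (gen n X)" unfolding zeta_def 3 by (simp add: gen_nth mult.assoc)
  finally show ?thesis ..
qed

lemma bounded_linear_complex4:
  fixes f :: "complex^4 \<Rightarrow> complex"
  assumes "f = (\<lambda>X. a1 * X $ 1 + a2 * X $ 2 + a3 * X $ 3 + a4 * X $ 4)" shows "bounded_linear f"
  unfolding assms
  by (intro bounded_linear_add bounded_linear_compose[OF bounded_linear_mult_right bounded_linear_vec_nth])

lemma zeta_propagator:
  assumes n: "horizontal n" and p: "p = 1 \<or> p = -1"
  shows "zeta n p (propagator_symbol a \<tau> n X) = exp (\<i> * of_real (of_int p * omega n * \<tau>)) * zeta n p X"
proof -
  have "bounded_linear (zeta n p)"
    by (rule bounded_linear_complex4[of _ 0 0 1 "\<i> * of_int p * of_real (omega n)"]) (simp add: zeta_def fun_eq_iff)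
  from propagator_symbol_eigen[OF this zeta_gen[OF n p], of \<tau> X]
  show ?thesis by (simp add: ac_simps)
qed

lemma e0_propagator:
  assumes n: "horizontal n"
  shows "hermitian (propagator_symbol a \<tau> n X) (e0 a n) = hermitian X (e0 a n)"
proof -
  have "bounded_linear (\<lambda>X. hermitian X (e0 a n))"
    by (rule bounded_linear_complex4[of _ "of_real (perp n 1)" "of_real (perp n 2)" 0 0])
      (simp add: hermitian_e0 sum_3 perp_simps fun_eq_iff)
  moreover have "hermitian (gen n X) (e0 a n) = 0 * hermitian X (e0 a n)" for X
    by (simp add: hermitian_e0 sum_3 perp_simps gen_nth)
  ultimately show ?thesis using propagator_symbol_eigen[of "\<lambda>X. hermitian X (e0 a n)" n 0 \<tau> X] by simp
qed

text \<open>For wave vectors without horizontal part the projection only affects the vertical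
  component.\<close>

lemma average_propagator:
  assumes n: "\<not> horizontal n" and i: "i = 1 \<or> i = 2"
  shows "propagator_symbol a \<tau> n X $ i = X $ i"
proof -
  have "gen n X $ i = 0 * X $ i" for X using n i by (auto simp: horizontal_def gen_nth freq_nth)
  then show ?thesis using propagator_symbol_eigen[OF bounded_linear_vec_nth[of i], of n 0 \<tau> X] by simp
qed

lemma kernel_part_propagator: "part n 0 (propagator_symbol a \<tau> n X) i = part n 0 X i"
proof (cases "horizontal n")
  case True then show ?thesis by (simp add: part_def e0_propagator)
next
  case False
  then show ?thesis using exhaust_3[of i] by (auto simp: part_def average_propagator)
qed

text \<open>Without a horizontal wave vector, vanishing divergence or vanishing mean leaves only
  horizontal velocity.  Otherwise divergence-free velocities are spanned by \<open>e0\<close> and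
  \<open>wave n\<close>, and each of the three parts is an eigenvector.\<close>

lemma mode_decomposition:
  assumes div: "kdot n X = 0" and mean: "n = 0 \<Longrightarrow> X = 0"
  shows "X $ emb i = (\<Sum>p\<in>{-1,0,1}. exp (\<i> * of_real (of_int p * omega n * \<tau>)) * part n p (propagator_symbol a (- \<tau>) n X) i)"
proof (cases "horizontal n")
  case True
  let ?k = "\<lambda>i. complex_of_real (freq a n $ i)" and ?r = "complex_of_real (rad n)"
  have r: "?r \<noteq> 0" using rad_pos[OF True] by simp
  have r2: "?r * ?r = ?k 1 * ?k 1 + ?k 2 * ?k 2"
    using arg_cong[OF rad_square[of n], of complex_of_real] by (simp add: power2_eq_square)
  have z: "exp (\<i> * of_real (of_int p * omega n * \<tau>)) * zeta n p (propagator_symbol a (- \<tau>) n X) = zeta n p X"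
    if p: "p = 1 \<or> p = -1" for p
    unfolding zeta_propagator[OF True p] by (simp add: mult.assoc[symmetric] exp_add[symmetric])
  have "(\<Sum>p\<in>{-1,0,1}. exp (\<i> * of_real (of_int p * omega n * \<tau>)) * part n p (propagator_symbol a (- \<tau>) n X) i)
      = hermitian X (e0 a n) * of_real (perp n i) + (zeta n (-1) X + zeta n 1 X) / 2 * of_real (wave n i)"
    using z[of 1, symmetric] z[of "-1", symmetric] True by (simp add: part_def e0_propagator algebra_simps add_divide_distrib)
  also have "\<dots> = hermitian X (e0 a n) * of_real (perp n i) + X $ 3 * of_real (wave n i)"
    by (simp add: zeta_def)
  also have "\<dots> = X $ emb i"
  proof -
    have d: "?k 3 * X $ 3 = - (?k 1 * X $ 1 + ?k 2 * X $ 2)"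
      using div by (simp add: kdot_def sum_3 add_eq_0_iff2 add.commute)
    have X1: "(- ?k 2 * X $ 1 + ?k 1 * X $ 2) * - ?k 2 - ?k 3 * ?k 1 * X $ 3 = ?r * ?r * X $ 1"
    proof -
      have e: "?k 3 * ?k 1 * X $ 3 = ?k 1 * - (?k 1 * X $ 1 + ?k 2 * X $ 2)"
        unfolding d[symmetric] by (simp only: mult_ac)
      show ?thesis unfolding r2 e by (simp add: algebra_simps)
    qed
    have X2: "(- ?k 2 * X $ 1 + ?k 1 * X $ 2) * ?k 1 - ?k 3 * ?k 2 * X $ 3 = ?r * ?r * X $ 2"
    proof -
      have e: "?k 3 * ?k 2 * X $ 3 = ?k 2 * - (?k 1 * X $ 1 + ?k 2 * X $ 2)"
        unfolding d[symmetric] by (simp only: mult_ac)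
      show ?thesis unfolding r2 e by (simp add: algebra_simps)
    qed
    consider "i = 1" | "i = 2" | "i = 3" using exhaust_3[of i] by blast
    then show ?thesis
    proof cases
      case 1
      have "hermitian X (e0 a n) * of_real (perp n 1) + X $ 3 * of_real (wave n 1)
          = ((- ?k 2 * X $ 1 + ?k 1 * X $ 2) * - ?k 2 - ?k 3 * ?k 1 * X $ 3) / (?r * ?r)"
        using r by (simp add: hermitian_e0 sum_3 perp_simps wave_def power2_eq_square field_simps)
      also have "\<dots> = X $ 1" unfolding X1 using r by simp
      finally show ?thesis using 1 by simp
    next
      case 2
      have "hermitian X (e0 a n) * of_real (perp n 2) + X $ 3 * of_real (wave n 2)
          = ((- ?k 2 * X $ 1 + ?k 1 * X $ 2) * ?k 1 - ?k 3 * ?k 2 * X $ 3) / (?r * ?r)"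
        using r by (simp add: hermitian_e0 sum_3 perp_simps wave_def power2_eq_square field_simps)
      also have "\<dots> = X $ 2" unfolding X2 using r by simp
      finally show ?thesis using 2 by simp
    next
      case 3 then show ?thesis by (simp add: perp_simps wave_def)
    qed
  qed
  finally show ?thesis ..
next
  case False
  have "X $ 3 = 0"
  proof (cases "n = 0")
    case True then show ?thesis using mean by simp
  next
    case nz: False
    then have "n $ 3 \<noteq> 0" using False by (auto simp: horizontal_def vec_eq_iff forall_3)
    then show ?thesis using div False by (simp add: kdot_def sum_3 horizontal_def freq_nth)
  qed
  then show ?thesis using False exhaust_3[of i] by (auto simp: part_def average_propagator)
qed

end

section \<open>Oscillating integrals and resonances\<close>

lemma infsum_remainder_le:
  fixes f :: "'x \<Rightarrow> complex"
  assumes fh: "\<And>k. norm (f k) \<le> h k" and h: "h summable_on UNIV" and F: "finite F"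
  shows "f summable_on UNIV" and "norm (infsum f UNIV - sum f F) \<le> infsum h UNIV - sum h F"
proof -
  have h0: "0 \<le> h k" for k using order_trans[OF norm_ge_zero fh] .
  have n: "(\<lambda>k. norm (f k)) summable_on UNIV"
    by (rule summable_on_comparison_test[OF h]) (use fh in auto)
  then show f: "f summable_on UNIV" by (rule abs_summable_summable)
  have 1: "(f has_sum infsum f UNIV - sum f F) (UNIV - F)"
    using F f by (intro has_sum_Diff has_sum_infsum has_sum_finite) auto
  have 2: "(h has_sum infsum h UNIV - sum h F) (UNIV - F)"
    using F h by (intro has_sum_Diff has_sum_infsum has_sum_finite) auto
  have n': "(\<lambda>k. norm (f k)) summable_on (UNIV - F)"
    using n by (rule summable_on_subset) simp
  have "norm (infsum f UNIV - sum f F) \<le> infsum (\<lambda>k. norm (f k)) (UNIV - F)"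
    by (rule norm_has_sum_bound[OF has_sum_infsum[OF n'] 1])
  also have "\<dots> \<le> infsum h UNIV - sum h F"
    by (rule has_sum_mono[OF has_sum_infsum[OF n'] 2 fh])
  finally show "norm (infsum f UNIV - sum f F) \<le> infsum h UNIV - sum h F" .
qed

lemma infsum_dominated_convergence:
  fixes f :: "nat \<Rightarrow> 'x \<Rightarrow> complex"
  assumes lim: "\<And>k. (\<lambda>j. f j k) \<longlonglongrightarrow> g k" and fh: "\<And>j k. norm (f j k) \<le> h k" and h: "h summable_on UNIV"
  shows "(\<lambda>j. infsum (f j) UNIV) \<longlonglongrightarrow> infsum g UNIV" and "\<And>k. norm (g k) \<le> h k"
proof -
  show gh: "norm (g k) \<le> h k" for k
    by (rule LIMSEQ_le_const2[OF tendsto_norm[OF lim]]) (use fh in auto)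
  show "(\<lambda>j. infsum (f j) UNIV) \<longlonglongrightarrow> infsum g UNIV"
  proof (rule tendstoI)
    fix e :: real assume e: "0 < e"
    have "(sum h \<longlongrightarrow> infsum h UNIV) (finite_subsets_at_top UNIV)"
      using has_sum_infsum[OF h] by (simp add: has_sum_def)
    from order_tendstoD(1)[OF this, of "infsum h UNIV - e / 3"] e
    have "\<forall>\<^sub>F F in finite_subsets_at_top UNIV. infsum h UNIV - e / 3 < sum h F" by simp
    then obtain F where F: "finite F" "infsum h UNIV - sum h F < e / 3"
      unfolding eventually_finite_subsets_at_top by (metis add.commute diff_less_eq order_refl subset_UNIV)
    have "(\<lambda>j. sum (f j) F) \<longlonglongrightarrow> sum g F" by (intro tendsto_sum lim)
    from tendstoD[OF this, of "e / 3"] e have "\<forall>\<^sub>F j in sequentially. dist (sum (f j) F) (sum g F) < e / 3" by simp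
    then show "\<forall>\<^sub>F j in sequentially. dist (infsum (f j) UNIV) (infsum g UNIV) < e"
    proof eventually_elim
      case (elim j)
      have 1: "norm (infsum (f j) UNIV - sum (f j) F) < e / 3"
        using infsum_remainder_le(2)[of "f j", OF fh h F(1)] F(2) by linarith
      have 2: "norm (infsum g UNIV - sum g F) < e / 3"
        using infsum_remainder_le(2)[of g, OF gh h F(1)] F(2) by linarith
      have "infsum (f j) UNIV - infsum g UNIV =
          (infsum (f j) UNIV - sum (f j) F) + (sum (f j) F - sum g F) - (infsum g UNIV - sum g F)" by simp
      also have "norm \<dots> \<le> norm ((infsum (f j) UNIV - sum (f j) F) + (sum (f j) F - sum g F)) + norm (infsum g UNIV - sum g F)"
        by (rule norm_triangle_ineq4)
      also have "\<dots> \<le> norm (infsum (f j) UNIV - sum (f j) F) + norm (sum (f j) F - sum g F) + norm (infsum g UNIV - sum g F)"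
        by (intro add_right_mono norm_triangle_ineq)
      also have "\<dots> < e" using 1 2 elim by (simp add: dist_norm)
      finally show ?case by (simp add: dist_norm)
    qed
  qed
qed

context torus begin

lemma timeM_integral: "integral\<^sup>L (timeM T) f = integral\<^sup>L lborel (\<lambda>t. indicator {0..T} t *\<^sub>R f t)"
  for f :: "real \<Rightarrow> 'b::{banach, second_countable_topology}"
  by (simp add: timeM_def integral_restrict_space)

lemma norm_timeM_integral_le:
  fixes g :: "real \<Rightarrow> complex"
  assumes g: "continuous_on {0..T} g" and b: "\<And>t. t \<in> {0..T} \<Longrightarrow> norm (g t) \<le> d" and d: "0 \<le> d"
  shows "norm (integral\<^sup>L (timeM T) g) \<le> d * (1 + \<bar>T\<bar>)"
proof -
  have "norm (integral\<^sup>L (timeM T) g) \<le> (\<integral>t. norm (g t) \<partial>timeM T)" by (rule integral_norm_bound)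
  also have "\<dots> \<le> (\<integral>t. d \<partial>timeM T)"
    using continuous_integrable_timeM[OF g] b by (intro integral_mono) auto
  also have "\<dots> = measure (timeM T) {0..T} * d" by simp
  also have "measure (timeM T) {0..T} = measure lborel {0..T}" by (simp add: timeM_def measure_restrict_space)
  also have "measure lborel {0..T} * d \<le> (1 + \<bar>T\<bar>) * d" using d by (intro mult_right_mono) (auto simp: measure_def emeasure_lborel_Icc_eq)
  finally show ?thesis by (simp add: mult.commute)
qed

lemma integral_null_uniform:
  fixes g :: "nat \<Rightarrow> real \<Rightarrow> complex"
  assumes c: "\<And>j. continuous_on {0..T} (g j)"
    and u: "\<And>d. 0 < d \<Longrightarrow> \<forall>\<^sub>F j in sequentially. \<forall>t\<in>{0..T}. norm (g j t) \<le> d"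
  shows "(\<lambda>j. integral\<^sup>L (timeM T) (g j)) \<longlonglongrightarrow> 0"
proof (rule tendstoI)
  fix e :: real assume e: "0 < e"
  define d where "d = e / (2 * (1 + \<bar>T\<bar>))"
  have d: "0 < d" using e by (simp add: d_def)
  have de: "d * (1 + \<bar>T\<bar>) < e" using e by (simp add: d_def field_simps add_pos_nonneg)
  from u[OF d] show "\<forall>\<^sub>F j in sequentially. dist (integral\<^sup>L (timeM T) (g j)) 0 < e"
  proof eventually_elim
    case (elim j)
    then have "norm (integral\<^sup>L (timeM T) (g j)) \<le> d * (1 + \<bar>T\<bar>)"
      using d by (intro norm_timeM_integral_le c) auto
    then show ?case using de by simp
  qed
qed

text \<open>Integration by parts.\<close>

lemma oscillating_polynomial_bound:
  assumes p: "real_polynomial_function p"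
  shows "\<exists>K. \<forall>\<mu>. \<mu> \<noteq> 0 \<longrightarrow> norm (\<integral>t. exp (\<i> * of_real (\<mu> * t)) * of_real (p t) \<partial>timeM T) \<le> K / \<bar>\<mu>\<bar>"
proof (cases "0 \<le> T")
  case False
  then have "integral\<^sup>L (timeM T) f = 0" for f :: "real \<Rightarrow> complex" by (simp add: timeM_integral)
  then show ?thesis by (intro exI[of _ 0]) simp
next
  case True
  obtain q where q: "real_polynomial_function q" "\<And>t. (p has_real_derivative q t) (at t)"
    using has_real_derivative_polynomial_function[OF p] by blast
  have pc: "continuous_on S p" and qc: "continuous_on S q" for S
    using p q(1) by (simp_all add: continuous_on_polymonial_function real_polynomial_function_eq)
  obtain B where B: "0 \<le> B" "\<And>t. t \<in> {0..T} \<Longrightarrow> norm (complex_of_real (q t)) \<le> B"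
    using continuous_bounded[of T "\<lambda>t. complex_of_real (q t)"] qc by (metis continuous_on_of_real)
  show ?thesis
  proof (intro exI allI impI)
    fix \<mu> :: real assume mu: "\<mu> \<noteq> 0"
    let ?e = "\<lambda>t. exp (\<i> * of_real (\<mu> * t))"
    let ?G = "\<lambda>t. ?e t * of_real (p t) / (\<i> * of_real \<mu>)"
    have ne: "norm (?e t) = 1" for t by (simp add: norm_exp_eq_Re)
    have ec: "continuous_on S ?e" for S by (intro continuous_intros)
    have de: "(?e has_vector_derivative \<i> * of_real \<mu> * ?e t) (at t within S)" for t S
    proof -
      have e: "exp (\<i> * of_real (\<mu> * t)) = cis (\<mu> * t)" for t by (simp add: cis_conv_exp)
      show ?thesis
        unfolding has_vector_derivative_def e
        by (auto intro!: derivative_eq_intros simp: scaleR_conv_of_real algebra_simps)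
    qed
    have dp: "((\<lambda>t. complex_of_real (p t)) has_vector_derivative of_real (q t)) (at t within S)" for t S
      using q(2)[of t] has_vector_derivative_of_real by (metis has_field_derivative_at_within has_real_derivative_iff_has_vector_derivative)
    have dG: "(?G has_vector_derivative ?e t * of_real (p t) + ?e t * of_real (q t) / (\<i> * of_real \<mu>)) (at t within S)" for t S
    proof -
      have "((\<lambda>t. ?e t * of_real (p t)) has_vector_derivative ?e t * of_real (q t) + \<i> * of_real \<mu> * ?e t * of_real (p t)) (at t within S)"
        by (rule has_vector_derivative_mult[OF de dp])
      then have "(?G has_vector_derivative (?e t * of_real (q t) + \<i> * of_real \<mu> * ?e t * of_real (p t)) / (\<i> * of_real \<mu>)) (at t within S)"
        by (rule has_vector_derivative_divide)
      moreover have "(?e t * of_real (q t) + \<i> * of_real \<mu> * ?e t * of_real (p t)) / (\<i> * of_real \<mu>) =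
          ?e t * of_real (p t) + ?e t * of_real (q t) / (\<i> * of_real \<mu>)"
        using mu by (simp add: add_divide_distrib)
      ultimately show ?thesis by simp
    qed
    have c1: "continuous_on {0..T} (\<lambda>t. ?e t * of_real (p t))" by (intro continuous_intros ec pc)
    have c2: "continuous_on {0..T} (\<lambda>t. ?e t * of_real (q t) / (\<i> * of_real \<mu>))" using mu by (intro continuous_intros ec qc) auto
    have "(\<integral>t. ?e t * of_real (p t) + ?e t * of_real (q t) / (\<i> * of_real \<mu>) \<partial>timeM T) = ?G T - ?G 0"
      unfolding timeM_integral by (rule integral_FTC_atLeastAtMost[OF True dG]) (intro continuous_on_add c1 c2)
    then have "(\<integral>t. ?e t * of_real (p t) \<partial>timeM T) = ?G T - ?G 0 - (\<integral>t. ?e t * of_real (q t) / (\<i> * of_real \<mu>) \<partial>timeM T)"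
      using continuous_integrable_timeM[OF c1] continuous_integrable_timeM[OF c2] by (simp add: algebra_simps)
    also have "norm \<dots> \<le> norm (?G T) + norm (?G 0) + norm (\<integral>t. ?e t * of_real (q t) / (\<i> * of_real \<mu>) \<partial>timeM T)"
      by (intro order_trans[OF norm_triangle_ineq4] add_mono norm_triangle_ineq4 order_refl)
    also have "norm (\<integral>t. ?e t * of_real (q t) / (\<i> * of_real \<mu>) \<partial>timeM T) \<le> (B / \<bar>\<mu>\<bar>) * (1 + \<bar>T\<bar>)"
    proof (rule norm_timeM_integral_le[OF c2])
      show "norm (?e t * of_real (q t) / (\<i> * of_real \<mu>)) \<le> B / \<bar>\<mu>\<bar>" if "t \<in> {0..T}" for t
        using B(2)[OF that] by (simp add: norm_mult norm_divide ne divide_right_mono)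
    qed (use B in simp)
    also have "norm (?G T) = \<bar>p T\<bar> / \<bar>\<mu>\<bar>" by (simp add: norm_mult norm_divide ne)
    also have "norm (?G 0) = \<bar>p 0\<bar> / \<bar>\<mu>\<bar>" by (simp add: norm_mult norm_divide)
    finally show "norm (\<integral>t. ?e t * of_real (p t) \<partial>timeM T) \<le> (\<bar>p T\<bar> + \<bar>p 0\<bar> + B * (1 + \<bar>T\<bar>)) / \<bar>\<mu>\<bar>"
      by (simp add: add_divide_distrib)
  qed
qed

text \<open>For polynomial amplitudes integration by parts gains a factor \<open>e j\<close>; the
  Weierstrass theorem reduces the continuous case to this one.\<close>

lemma riemann_lebesgue:
  fixes g :: "real \<Rightarrow> complex"
  assumes g: "continuous_on {0..T} g" and l: "l \<noteq> 0" and e: "\<And>j::nat. 0 < e j" "e \<longlonglongrightarrow> 0"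
  shows "(\<lambda>j. \<integral>t. exp (\<i> * of_real (l * (t / e j))) * g t \<partial>timeM T) \<longlonglongrightarrow> 0"
proof -
  let ?x = "\<lambda>j t. exp (\<i> * of_real (l * (t / e j)))"
  have xc: "continuous_on S (?x j)" for S j using e(1)[of j] by (intro continuous_intros) auto
  have nx: "norm (?x j t) = 1" for j t by (simp add: norm_exp_eq_Re)
  have real: "(\<lambda>j. \<integral>t. ?x j t * of_real (h t) \<partial>timeM T) \<longlonglongrightarrow> 0" if h: "continuous_on {0..T} h" for h :: "real \<Rightarrow> real"
  proof (rule tendstoI)
    fix r :: real assume r: "0 < r"
    define d where "d = r / (4 * (1 + \<bar>T\<bar>))"
    have d: "0 < d" using r by (simp add: d_def)
    have dr: "d * (1 + \<bar>T\<bar>) < r / 2" using r by (simp add: d_def field_simps add_pos_nonneg)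
    obtain p where p: "real_polynomial_function p" "\<And>t. t \<in> {0..T} \<Longrightarrow> \<bar>h t - p t\<bar> < d"
      using Stone_Weierstrass_real_polynomial_function[OF compact_Icc h d] by metis
    have pc: "continuous_on S p" for S
      using p by (simp_all add: continuous_on_polymonial_function real_polynomial_function_eq)
    obtain K where K: "\<And>\<mu>. \<mu> \<noteq> 0 \<Longrightarrow> norm (\<integral>t. exp (\<i> * of_real (\<mu> * t)) * of_real (p t) \<partial>timeM T) \<le> K / \<bar>\<mu>\<bar>"
      using oscillating_polynomial_bound[OF p(1), of T] by blast
    have "(\<lambda>j. K / \<bar>l\<bar> * e j) \<longlonglongrightarrow> K / \<bar>l\<bar> * 0" by (intro tendsto_intros e)
    then have "\<forall>\<^sub>F j in sequentially. K / \<bar>l\<bar> * e j < r / 2" by (rule order_tendstoD) (use r in simp)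
    then show "\<forall>\<^sub>F j in sequentially. dist (\<integral>t. ?x j t * of_real (h t) \<partial>timeM T) 0 < r"
    proof eventually_elim
      case (elim j)
      have c1: "continuous_on {0..T} (\<lambda>t. ?x j t * of_real (h t - p t))" by (intro continuous_intros xc h pc)
      have c2: "continuous_on {0..T} (\<lambda>t. ?x j t * of_real (p t))" by (intro continuous_intros xc pc)
      have "(\<integral>t. ?x j t * of_real (h t) \<partial>timeM T) = (\<integral>t. ?x j t * of_real (h t - p t) + ?x j t * of_real (p t) \<partial>timeM T)"
        by (simp add: algebra_simps)
      also have "\<dots> = (\<integral>t. ?x j t * of_real (h t - p t) \<partial>timeM T) + (\<integral>t. ?x j t * of_real (p t) \<partial>timeM T)"
        by (rule Bochner_Integration.integral_add[OF continuous_integrable_timeM[OF c1] continuous_integrable_timeM[OF c2]])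
      finally have 0: "norm (\<integral>t. ?x j t * of_real (h t) \<partial>timeM T) \<le> norm (\<integral>t. ?x j t * of_real (h t - p t) \<partial>timeM T) + norm (\<integral>t. ?x j t * of_real (p t) \<partial>timeM T)"
        by (simp only: norm_triangle_ineq)
      have 1: "norm (\<integral>t. ?x j t * of_real (h t - p t) \<partial>timeM T) \<le> d * (1 + \<bar>T\<bar>)"
      proof (rule norm_timeM_integral_le[OF c1])
        show "norm (?x j t * of_real (h t - p t)) \<le> d" if "t \<in> {0..T}" for t
          using p(2)[OF that] unfolding norm_mult nx norm_of_real by simp
      qed (use d in simp)
      have 2: "norm (\<integral>t. ?x j t * of_real (p t) \<partial>timeM T) \<le> K / \<bar>l\<bar> * e j"
      proof -
        have "norm (\<integral>t. exp (\<i> * of_real ((l / e j) * t)) * of_real (p t) \<partial>timeM T) \<le> K / \<bar>l / e j\<bar>"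
          using l e(1)[of j] by (intro K) auto
        then show ?thesis using e(1)[of j] by (simp add: abs_mult)
      qed
      have "norm (\<integral>t. ?x j t * of_real (h t) \<partial>timeM T) < r" using 0 1 2 dr elim by linarith
      then show ?case by (simp only: dist_norm diff_zero)
    qed
  qed
  have c: "continuous_on {0..T} (\<lambda>t. Re (g t))" "continuous_on {0..T} (\<lambda>t. Im (g t))" by (intro continuous_intros g)+
  have i: "integrable (timeM T) (\<lambda>t. ?x j t * of_real (Re (g t)))" "integrable (timeM T) (\<lambda>t. ?x j t * of_real (Im (g t)))" for j
    by (intro continuous_integrable_timeM continuous_intros xc c)+
  have "(\<integral>t. ?x j t * g t \<partial>timeM T) = (\<integral>t. ?x j t * of_real (Re (g t)) \<partial>timeM T) + \<i> * (\<integral>t. ?x j t * of_real (Im (g t)) \<partial>timeM T)" for j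
  proof -
    have "(\<integral>t. ?x j t * g t \<partial>timeM T) = (\<integral>t. ?x j t * of_real (Re (g t)) + \<i> * (?x j t * of_real (Im (g t))) \<partial>timeM T)"
    proof (rule Bochner_Integration.integral_cong[OF refl])
      fix t
      have "?x j t * g t = ?x j t * (of_real (Re (g t)) + \<i> * of_real (Im (g t)))" by (subst complex_eq[symmetric]) simp
      then show "?x j t * g t = ?x j t * of_real (Re (g t)) + \<i> * (?x j t * of_real (Im (g t)))" by (simp add: algebra_simps)
    qed
    then show ?thesis using i[of j] by simp
  qed
  moreover have "(\<lambda>j. (\<integral>t. ?x j t * of_real (Re (g t)) \<partial>timeM T) + \<i> * (\<integral>t. ?x j t * of_real (Im (g t)) \<partial>timeM T)) \<longlonglongrightarrow> 0 + \<i> * 0"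
    by (intro tendsto_add tendsto_mult_left real c)
  ultimately show ?thesis by simp
qed

text \<open>The contribution to the \<open>e0\<close>-component at \<open>n = k + m\<close> of the
  mode \<open>m\<close> with velocity \<open>y\<close>, advected by the mode \<open>k\<close> with
  velocity \<open>x\<close>.  As \<open>x\<close> is orthogonal to the wave vector of
  \<open>k\<close>, the derivative may be taken with \<open>n\<close> instead of \<open>m\<close>.
  Resonant contributions only cancel after symmetrisation.\<close>

definition inter :: "int^3 \<Rightarrow> (3 \<Rightarrow> complex) \<Rightarrow> (3 \<Rightarrow> complex) \<Rightarrow> complex" where
  "inter n x y = (\<Sum>j\<in>UNIV. of_real (freq a n $ j) * x j) * (\<Sum>i\<in>UNIV. of_real (perp n i) * y i)"

definition sym_inter :: "int^3 \<Rightarrow> (3 \<Rightarrow> complex) \<Rightarrow> (3 \<Rightarrow> complex) \<Rightarrow> complex" where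
  "sym_inter n x y = inter n x y + inter n y x"

lemma sym_inter_scale: "sym_inter n (\<lambda>i. c * x i) (\<lambda>i. d * y i) = c * d * sym_inter n x y"
  by (simp add: sym_inter_def inter_def sum_3 algebra_simps)

lemma sym_inter_sum:
  fixes x y :: "int \<Rightarrow> 3 \<Rightarrow> complex"
  shows "sym_inter n (\<lambda>i. \<Sum>p\<in>P. x p i) (\<lambda>i. \<Sum>q\<in>Q. y q i) = (\<Sum>p\<in>P. \<Sum>q\<in>Q. sym_inter n (x p) (y q))"
proof -
  have 1: "inter n (\<lambda>i. \<Sum>p\<in>P. x p i) (\<lambda>i. \<Sum>q\<in>Q. y q i) = (\<Sum>p\<in>P. \<Sum>q\<in>Q. inter n (x p) (y q))" for P Q and x y :: "int \<Rightarrow> 3 \<Rightarrow> complex"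
    unfolding inter_def sum_product[symmetric] by (simp add: sum_3 sum_distrib_left sum.distrib)
  show ?thesis
    unfolding sym_inter_def 1 by (simp add: sum.distrib sum.swap[of _ Q P])
qed

text \<open>Two waves interact with amplitude proportional to \<open>k$3\<^sup>2 / rad k\<^sup>2 - m$3\<^sup>2 / rad m\<^sup>2\<close>, which
  vanishes exactly when their frequencies agree.\<close>

lemma wave_interaction:
  assumes k: "horizontal k" and m: "horizontal m" and n: "n = k + m" and w: "omega k = omega m"
  shows "sym_inter n (\<lambda>i. of_real (wave k i)) (\<lambda>i. of_real (wave m i)) = 0"
proof -
  let ?k = "\<lambda>i. freq a k $ i" and ?m = "\<lambda>i. freq a m $ i" and ?n = "\<lambda>i. freq a n $ i"
  define A where "A = (rad k)\<^sup>2"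
  define B where "B = (rad m)\<^sup>2"
  have A0: "0 < A" using rad_pos[OF k] by (simp add: A_def)
  have A1: "A = ?k 1 * ?k 1 + ?k 2 * ?k 2" using rad_square[of k] by (simp add: A_def power2_eq_square)
  note A = A0 A1
  have B0: "0 < B" using rad_pos[OF m] by (simp add: B_def)
  have B1: "B = ?m 1 * ?m 1 + ?m 2 * ?m 2" using rad_square[of m] by (simp add: B_def power2_eq_square)
  note B = B0 B1
  have "A / (A + (?k 3)\<^sup>2) = B / (B + (?m 3)\<^sup>2)"
    using arg_cong[OF w, of power2] by (simp add: omega_def power_divide norm_freq_square A_def B_def)
  then have "A * (B + (?m 3)\<^sup>2) = B * (A + (?k 3)\<^sup>2)"
    using A(1) B(1) by (simp add: frac_eq_eq add_pos_nonneg less_imp_neq[symmetric] mult.commute)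
  then have res: "(?k 3)\<^sup>2 / A = (?m 3)\<^sup>2 / B"
    using A(1) B(1) by (simp add: field_simps)
  define c where "c = ?k 1 * ?m 2 - ?k 2 * ?m 1"
  define d where "d = ?k 1 * ?m 1 + ?k 2 * ?m 2"
  have nn: "?n i = ?k i + ?m i" for i by (simp add: n freq_add)
  have 1: "(\<Sum>j\<in>UNIV. ?n j * wave k j) = ?m 3 - (?k 3 / A) * d"
  proof -
    have "(\<Sum>j\<in>UNIV. ?n j * wave k j) = ?k 3 + ?m 3 - (?k 3 / A) * ((?k 1 * ?k 1 + ?k 2 * ?k 2) + d)"
      by (simp add: sum_3 wave_def nn A_def[symmetric] d_def algebra_simps add_divide_distrib)
    then show ?thesis unfolding A(2)[symmetric] using A(1) by (simp add: distrib_left)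
  qed
  have 2: "(\<Sum>j\<in>UNIV. ?n j * wave m j) = ?k 3 - (?m 3 / B) * d"
  proof -
    have "(\<Sum>j\<in>UNIV. ?n j * wave m j) = ?k 3 + ?m 3 - (?m 3 / B) * ((?m 1 * ?m 1 + ?m 2 * ?m 2) + d)"
      by (simp add: sum_3 wave_def nn B_def[symmetric] d_def algebra_simps add_divide_distrib)
    then show ?thesis unfolding B(2)[symmetric] using B(1) by (simp add: distrib_left)
  qed
  have 3: "(\<Sum>i\<in>UNIV. perp n i * wave m i) = - (?m 3 / B) * c / rad n"
    by (simp add: sum_3 perp_simps wave_def B_def[symmetric] c_def nn algebra_simps add_divide_distrib diff_divide_distrib)
  have 4: "(\<Sum>i\<in>UNIV. perp n i * wave k i) = (?k 3 / A) * c / rad n"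
    by (simp add: sum_3 perp_simps wave_def A_def[symmetric] c_def nn algebra_simps add_divide_distrib diff_divide_distrib)
  have "sym_inter n (\<lambda>i. of_real (wave k i)) (\<lambda>i. of_real (wave m i)) =
     of_real ((\<Sum>j\<in>UNIV. ?n j * wave k j) * (\<Sum>i\<in>UNIV. perp n i * wave m i)
       + (\<Sum>j\<in>UNIV. ?n j * wave m j) * (\<Sum>i\<in>UNIV. perp n i * wave k i))"
    by (simp add: sym_inter_def inter_def)
  also have "(\<Sum>j\<in>UNIV. ?n j * wave k j) * (\<Sum>i\<in>UNIV. perp n i * wave m i)
       + (\<Sum>j\<in>UNIV. ?n j * wave m j) * (\<Sum>i\<in>UNIV. perp n i * wave k i) = ((?k 3)\<^sup>2 / A - (?m 3)\<^sup>2 / B) * c / rad n"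
    unfolding 1 2 3 4 by (simp add: algebra_simps power2_eq_square diff_divide_distrib)
  finally show ?thesis using res by simp
qed

text \<open>Wave frequencies are positive, so a slow part is never in resonance with a wave, and
  two waves only if their frequencies agree and their phases are opposite.\<close>

lemma resonance:
  assumes p: "p \<in> {-1, 0, 1}" and q: "q \<in> {-1, 0, 1}" and pq: "\<not> (p = 0 \<and> q = 0)"
    and res: "of_int p * omega k + of_int q * omega m = 0" and n: "n = k + m"
  shows "sym_inter n (part k p X) (part m q Y) = 0"
proof -
  have z: "sym_inter n x (\<lambda>i. 0) = 0" "sym_inter n (\<lambda>i. 0) x = 0" for x
    by (simp_all add: sym_inter_def inter_def)
  consider "p \<noteq> 0" "\<not> horizontal k" | "q \<noteq> 0" "\<not> horizontal m" | "p = 0" "q \<noteq> 0" "horizontal m" | "q = 0" "p \<noteq> 0" "horizontal k"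
    | "p \<noteq> 0" "q \<noteq> 0" "horizontal k" "horizontal m" using pq by blast
  then show ?thesis
  proof cases
    case 1 then have "part k p X = (\<lambda>i. 0)" by (simp add: part_def fun_eq_iff)
    then show ?thesis by (simp add: z)
  next
    case 2 then have "part m q Y = (\<lambda>i. 0)" by (simp add: part_def fun_eq_iff)
    then show ?thesis by (simp add: z)
  next
    case 3 then show ?thesis using res omega_pos[of m] by simp
  next
    case 4 then show ?thesis using res omega_pos[of k] by simp
  next
    case 5
    have "omega k = omega m"
      using 5 res p q omega_pos[of k] omega_pos[of m] by auto
    from wave_interaction[OF 5(3,4) n this] 5
      sym_inter_scale[of n "zeta k p X / 2" "\<lambda>i. of_real (wave k i)" "zeta m q Y / 2" "\<lambda>i. of_real (wave m i)"]
    show ?thesis by (simp add: part_def[abs_def])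
  qed
qed

lemma bounded_linear_part: "bounded_linear (\<lambda>X. part n p X i)"
proof -
  consider "p = 0" "horizontal n" | "p = 0" "\<not> horizontal n" | "p \<noteq> 0" "horizontal n" | "p \<noteq> 0" "\<not> horizontal n" by blast
  then show ?thesis
  proof cases
    case 1 then show ?thesis
      by (intro bounded_linear_complex4[of _ "of_real (perp n 1) * of_real (perp n i)" "of_real (perp n 2) * of_real (perp n i)" 0 0])
        (simp add: part_def hermitian_e0 sum_3 perp_simps fun_eq_iff algebra_simps)
  next
    case 2 then show ?thesis by (cases "i = 3") (simp_all add: part_def bounded_linear_vec_nth bounded_linear_zero)
  next
    case 3 then show ?thesis
      by (intro bounded_linear_complex4[of _ 0 0 "of_real (wave n i) / 2" "\<i> * of_int p * of_real (omega n) / 2 * of_real (wave n i)"])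
        (simp add: part_def zeta_def fun_eq_iff algebra_simps add_divide_distrib)
  next
    case 4 then show ?thesis by (simp add: part_def bounded_linear_zero)
  qed
qed

lemma perp_le_1: "\<bar>perp n i\<bar> \<le> 1"
proof -
  have "\<bar>freq a n $ 1\<bar> \<le> rad n" "\<bar>freq a n $ 2\<bar> \<le> rad n" "0 \<le> rad n"
    unfolding rad_def by (simp_all add: real_le_rsqrt real_sqrt_ge_0_iff)
  then show ?thesis by (auto simp: perp_def divide_le_eq)
qed

lemma norm_hermitian_e0: "norm (hermitian X (e0 a n)) \<le> 2 * norm X"
proof -
  have "norm (of_real (perp n i) * X $ emb i) \<le> norm X" for i
    using mult_mono[OF perp_le_1[of n i] Finite_Cartesian_Product.norm_nth_le[of X "emb i"]] by (simp add: norm_mult)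
  from this[of 1] this[of 2]
  have "norm (of_real (perp n 1) * X $ 1 + of_real (perp n 2) * X $ 2) \<le> norm X + norm X"
    by (intro order_trans[OF norm_triangle_ineq add_mono]) simp_all
  then show ?thesis by (simp add: hermitian_e0 sum_3 perp_simps(3))
qed

lemma norm_kernel_part: "norm (part n 0 X i) \<le> 2 * norm X"
proof (cases "horizontal n")
  case True
  have "norm (hermitian X (e0 a n)) * \<bar>perp n i\<bar> \<le> (2 * norm X) * 1"
    by (intro mult_mono norm_hermitian_e0 perp_le_1) auto
  then show ?thesis using True by (simp add: part_def norm_mult)
next
  case False
  then show ?thesis
    using order_trans[OF Finite_Cartesian_Product.norm_nth_le[of X "emb i"], of "2 * norm X"] by (simp add: part_def)
qed

end

section \<open>The limit of the filtered solutions\<close>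

lemma norm_product_diff:
  fixes x y z w :: "'b::real_normed_algebra"
  shows "norm (x * y - z * w) \<le> norm (x - z) * norm y + norm z * norm (y - w)"
proof -
  have "x * y - z * w = (x - z) * y + z * (y - w)" by (simp add: algebra_simps)
  then show ?thesis
    using norm_triangle_ineq[of "(x - z) * y" "z * (y - w)"] norm_mult_ineq[of "x - z" y] norm_mult_ineq[of z "y - w"]
    by simp
qed

locale filtered_limit = torus a for a :: "real^3" +
  fixes \<nu> s T C \<sigma> :: real and V0 :: "real^3 \<Rightarrow> real^4"
    and V :: "real \<Rightarrow> real \<Rightarrow> real^3 \<Rightarrow> real^4" and U :: "real \<Rightarrow> real^3 \<Rightarrow> real^4" and e :: "nat \<Rightarrow> real"
  assumes s: "5/2 < s" and \<sigma>: "s - 2 < \<sigma>" "\<sigma> < s"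
    and sol: "\<And>\<epsilon>. 0 < \<epsilon> \<Longrightarrow> pbs_solution a \<nu> \<epsilon> s T V0 (V \<epsilon>)"
    and bound: "\<And>\<epsilon> t. 0 < \<epsilon> \<Longrightarrow> t \<in> {0..T} \<Longrightarrow> sobolev_norm a s (V \<epsilon> t) \<le> C"
    and U: "U \<in> cont_sobolev a T \<sigma>"
    and e: "\<And>k. 0 < e k" "e \<longlonglongrightarrow> 0"
    and conv: "\<And>\<delta>. 0 < \<delta> \<Longrightarrow> \<forall>\<^sub>F k in sequentially. \<forall>t\<in>{0..T}.
        sobolev_norm a \<sigma> (\<lambda>x. filtered a V (e k) t x - U t x) < \<delta>"
begin

lemma s': "3/2 < s" and \<sigma>0: "0 \<le> \<sigma>" using s \<sigma> by auto

text \<open>Fourier coefficients along the sequence \<open>e\<close>: of the solutions, of the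
  filtered solutions and of the limit, and the slow velocity of the limit.\<close>

definition Vh :: "nat \<Rightarrow> real \<Rightarrow> int^3 \<Rightarrow> complex^4" where "Vh j t k = fourier a (V (e j) t) k"
definition Wh :: "nat \<Rightarrow> real \<Rightarrow> int^3 \<Rightarrow> complex^4" where "Wh j t k = propagator_symbol a (- (t / e j)) k (Vh j t k)"
definition Uh :: "real \<Rightarrow> int^3 \<Rightarrow> complex^4" where "Uh t k = fourier a (U t) k"
definition Z :: "real \<Rightarrow> int^3 \<Rightarrow> 3 \<Rightarrow> complex" where "Z t k i = part k 0 (Uh t k) i"

lemma V_cont: "V (e j) \<in> cont_sobolev a T s"
  using sol[OF e(1)] by (simp add: pbs_solution_def)

lemma V_sobolev: "t \<in> {0..T} \<Longrightarrow> V (e j) t \<in> sobolev a s"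
  using V_cont by (auto simp: cont_sobolev_def)

lemma U_sobolev: "t \<in> {0..T} \<Longrightarrow> U t \<in> sobolev a \<sigma>"
  using U by (auto simp: cont_sobolev_def)

lemma W_fourier:
  assumes t: "t \<in> {0..T}"
  shows "filtered a V (e j) t \<in> sobolev a s" "fourier a (filtered a V (e j) t) k = Wh j t k"
  using fourier_propagator[OF V_sobolev[OF t] s', where \<tau>="- t / e j"] by (simp_all add: filtered_def Wh_def Vh_def)

lemma sobolev_mono: "f \<in> sobolev a s \<Longrightarrow> f \<in> sobolev a \<rho>" if "\<rho> \<le> s" for f :: "real^3 \<Rightarrow> real^4"
proof -
  assume f: "f \<in> sobolev a s"
  then have w: "weighted s (fourier a f)" by (simp add: sobolev_iff)
  have "wt n powr \<rho> * (norm (fourier a f n))\<^sup>2 \<le> 1 * (wt n powr s * (norm (fourier a f n))\<^sup>2)" for n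
    using wt_ge_1[of n] that by (auto intro!: mult_right_mono powr_mono)
  from weighted_mono(1)[OF w this] f show ?thesis by (simp add: sobolev_iff)
qed

lemma W_conv:
  assumes "0 < \<delta>"
  shows "\<forall>\<^sub>F j in sequentially. \<forall>t\<in>{0..T}. norm (Wh j t k - Uh t k) < \<delta>"
  using conv[OF assms]
proof eventually_elim
  case (elim j)
  show ?case
  proof
    fix t assume t: "t \<in> {0..T}"
    have Ws: "filtered a V (e j) t \<in> sobolev a \<sigma>" by (rule sobolev_mono[OF less_imp_le[OF \<sigma>(2)] W_fourier(1)[OF t]])
    have "norm (Wh j t k - Uh t k) \<le> sobolev_norm a \<sigma> (\<lambda>x. filtered a V (e j) t x - U t x)"
      using fourier_diff_le[OF Ws U_sobolev[OF t] \<sigma>0, of k] unfolding W_fourier(2)[OF t] Uh_def .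
    also have "\<dots> < \<delta>" using elim t by blast
    finally show "norm (Wh j t k - Uh t k) < \<delta>" .
  qed
qed

lemma W_lim: "t \<in> {0..T} \<Longrightarrow> (\<lambda>j. Wh j t k) \<longlonglongrightarrow> Uh t k"
proof (rule tendstoI)
  fix d :: real assume t: "t \<in> {0..T}" and "0 < d"
  from W_conv[OF \<open>0 < d\<close>, of k] show "\<forall>\<^sub>F j in sequentially. dist (Wh j t k) (Uh t k) < d"
    by eventually_elim (use t in \<open>simp add: dist_norm\<close>)
qed

lemma U_continuous: "continuous_on {0..T} (\<lambda>t. Uh t k)"
  unfolding Uh_def by (rule cont_sobolev_fourier[OF U \<sigma>0])

lemma V_continuous: "continuous_on {0..T} (\<lambda>t. Vh j t k)"
  unfolding Vh_def using s by (intro cont_sobolev_fourier[OF V_cont]) simp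

lemma Z_continuous: "continuous_on {0..T} (\<lambda>t. Z t k i)"
  unfolding Z_def by (rule bounded_linear.continuous_on[OF bounded_linear_part U_continuous])

lemma Z_lim: "t \<in> {0..T} \<Longrightarrow> (\<lambda>j. part k 0 (Vh j t k) i) \<longlonglongrightarrow> Z t k i"
  using bounded_linear.tendsto[OF bounded_linear_part[of k 0 i] W_lim[of t k]]
  by (simp add: Z_def Wh_def kernel_part_propagator)

lemma V_weighted: "t \<in> {0..T} \<Longrightarrow> weighted s (Vh j t)" "t \<in> {0..T} \<Longrightarrow> wnorm s (Vh j t) \<le> C\<^sup>2"
  using solution_bound(3,4)[OF V_cont s' bound[OF e(1)]] unfolding Vh_def[abs_def] by auto

text \<open>The propagator does not move the kernel part, so the uniform bound on the solutions passes to its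
  limit by finite sums.\<close>

lemma Z_weighted:
  assumes t: "t \<in> {0..T}"
  shows "weighted s (\<lambda>k. Z t k i)" and "wnorm s (\<lambda>k. Z t k i) \<le> 4 * C\<^sup>2"
proof -
  have fin: "(\<Sum>k\<in>F. wt k powr s * (norm (Z t k i))\<^sup>2) \<le> 4 * C\<^sup>2" if F: "finite F" for F
  proof (rule LIMSEQ_le_const2)
    show "(\<lambda>j. \<Sum>k\<in>F. wt k powr s * (norm (part k 0 (Vh j t k) i))\<^sup>2) \<longlonglongrightarrow> (\<Sum>k\<in>F. wt k powr s * (norm (Z t k i))\<^sup>2)"
      by (intro tendsto_sum tendsto_intros Z_lim t)
    have "(\<Sum>k\<in>F. wt k powr s * (norm (part k 0 (Vh j t k) i))\<^sup>2) \<le> 4 * C\<^sup>2" for j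
    proof -
      have le: "wt k powr s * (norm (part k 0 (Vh j t k) i))\<^sup>2 \<le> 4 * (wt k powr s * (norm (Vh j t k))\<^sup>2)" for k
      proof -
        have "(norm (part k 0 (Vh j t k) i))\<^sup>2 \<le> (2 * norm (Vh j t k))\<^sup>2" by (intro power_mono norm_kernel_part) simp
        from mult_left_mono[OF this, of "wt k powr s"] show ?thesis by (simp add: power_mult_distrib mult.left_commute)
      qed
      note w = weighted_mono[OF V_weighted(1)[OF t] le]
      have "(\<Sum>k\<in>F. wt k powr s * (norm (part k 0 (Vh j t k) i))\<^sup>2) \<le> wnorm s (\<lambda>k. part k 0 (Vh j t k) i)"
        unfolding wnorm_def using w(1) F unfolding weighted_def by (intro finite_sum_le_infsum) auto
      also have "\<dots> \<le> 4 * wnorm s (Vh j t)" by (rule w(2))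
      also have "\<dots> \<le> 4 * C\<^sup>2" using V_weighted(2)[OF t, of j] by simp
      finally show ?thesis .
    qed
    then show "\<exists>N. \<forall>j\<ge>N. (\<Sum>k\<in>F. wt k powr s * (norm (part k 0 (Vh j t k) i))\<^sup>2) \<le> 4 * C\<^sup>2" by blast
  qed
  show 1: "weighted s (\<lambda>k. Z t k i)"
    unfolding weighted_def
    by (rule nonneg_bdd_above_summable_on) (use fin in \<open>auto intro!: bdd_aboveI2[where M="4 * C\<^sup>2"]\<close>)
  show "wnorm s (\<lambda>k. Z t k i) \<le> 4 * C\<^sup>2"
    unfolding wnorm_def using 1 fin unfolding weighted_def by (intro infsum_le_finite_sums) auto
qed

lemma mode_decay:
  assumes w: "weighted s c" "wnorm s c \<le> B\<^sup>2" and B: "0 \<le> B"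
  shows "norm (c k) \<le> B * wt k powr (- s / 2)"
proof -
  have p: "wt k powr s = (wt k powr (s / 2))\<^sup>2" using wt_pos[of k] by (simp add: power2_eq_square powr_add[symmetric])
  have "(wt k powr (s / 2) * norm (c k))\<^sup>2 \<le> B\<^sup>2"
    using weighted_term_le[OF w(1), of k] w(2) by (simp add: power_mult_distrib p)
  then have "wt k powr (s / 2) * norm (c k) \<le> B" using B by (rule power2_le_imp_le)
  then have "wt k powr (- s / 2) * (wt k powr (s / 2) * norm (c k)) \<le> wt k powr (- s / 2) * B"
    by (rule mult_left_mono) simp
  moreover have "wt k powr (- s / 2) * (wt k powr (s / 2) * norm (c k)) = norm (c k)"
    using wt_pos[of k] by (simp add: mult.assoc[symmetric] powr_add[symmetric])
  ultimately show ?thesis by (simp only: mult.commute)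
qed

lemma V_decay: "t \<in> {0..T} \<Longrightarrow> norm (Vh j t k $ i) \<le> \<bar>C\<bar> * wt k powr (- s / 2)"
  using mode_decay[OF V_weighted(1), of t j "\<bar>C\<bar>" k] V_weighted(2)[of t j]
    Finite_Cartesian_Product.norm_nth_le[of "Vh j t k" i] by (auto intro: order_trans)

lemma Z_decay: "t \<in> {0..T} \<Longrightarrow> norm (Z t k i) \<le> 2 * \<bar>C\<bar> * wt k powr (- s / 2)"
  using mode_decay[OF Z_weighted(1), of t i "2 * \<bar>C\<bar>" k] Z_weighted(2)[of t i] by (simp add: power_mult_distrib)

lemma decay_product:
  assumes "norm x \<le> A * wt k powr (- s / 2)" "norm y \<le> A * wt m powr (- s / 2)" and A: "0 \<le> A"
  shows "norm x * norm y \<le> A\<^sup>2 * (wt k powr - s + wt m powr - s)"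
proof -
  let ?u = "wt k powr (- s / 2)" and ?v = "wt m powr (- s / 2)"
  have sq: "?u\<^sup>2 = wt k powr - s" "?v\<^sup>2 = wt m powr - s" by (simp_all add: power2_eq_square powr_add[symmetric])
  have "norm x * norm y \<le> (A * ?u) * (A * ?v)" using assms by (intro mult_mono) auto
  also have "\<dots> = A\<^sup>2 * (?u * ?v)" by (simp add: power2_eq_square)
  also have "\<dots> \<le> A\<^sup>2 * (?u\<^sup>2 + ?v\<^sup>2)"
  proof (rule mult_left_mono)
    show "?u * ?v \<le> ?u\<^sup>2 + ?v\<^sup>2"
      using sum_squares_bound[of ?u ?v] zero_le_power2[of ?u] zero_le_power2[of ?v] by linarith
  qed simp
  finally show ?thesis unfolding sq .
qed

text \<open>A summable bound for the interactions of \<open>k\<close> with \<open>n - k\<close>.\<close>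

definition dom :: "int^3 \<Rightarrow> int^3 \<Rightarrow> real" where "dom n k = wt k powr - s + wt (n - k) powr - s"

lemma reflect_bij: "bij (\<lambda>k. n - k :: int^3)"
  by (rule bijI') (auto intro: exI[of _ "n - _"])

lemma dom_summable: "dom n summable_on UNIV"
proof -
  have w: "(\<lambda>k. wt k powr - s) summable_on UNIV" by (rule summable_wt[OF s'])
  have "(\<lambda>k. wt (n - k) powr - s) summable_on UNIV"
    using summable_on_reindex_bij_betw[OF reflect_bij[of n], of "\<lambda>k. wt k powr - s"] w by simp
  with w show ?thesis unfolding dom_def by (rule summable_on_add)
qed

lemma norm_inter_le:
  assumes x: "\<And>i. norm (x i) \<le> A * wt k powr (- s / 2)" and y: "\<And>i. norm (y i) \<le> A * wt (n - k) powr (- s / 2)" and A: "0 \<le> A"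
  shows "norm (inter n x y) \<le> 9 * norm (freq a n) * A\<^sup>2 * dom n k"
proof -
  let ?u = "A * wt k powr (- s / 2)" and ?v = "A * wt (n - k) powr (- s / 2)"
  have u: "0 \<le> ?u" "0 \<le> ?v" using A by auto
  have "norm (of_real (freq a n $ j) * x j) \<le> norm (freq a n) * ?u" for j
    unfolding norm_mult norm_of_real by (intro mult_mono x component_le_norm_cart) auto
  then have "norm (\<Sum>j\<in>UNIV. of_real (freq a n $ j) * x j) \<le> (\<Sum>j\<in>(UNIV::3 set). norm (freq a n) * ?u)"
    by (intro order_trans[OF norm_sum sum_mono])
  then have 1: "norm (\<Sum>j\<in>UNIV. of_real (freq a n $ j) * x j) \<le> 3 * norm (freq a n) * ?u" by simp
  have "norm (of_real (perp n i) * y i) \<le> 1 * ?v" for i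
    unfolding norm_mult norm_of_real by (intro mult_mono y perp_le_1) auto
  then have "norm (\<Sum>i\<in>UNIV. of_real (perp n i) * y i) \<le> (\<Sum>i\<in>(UNIV::3 set). 1 * ?v)"
    by (intro order_trans[OF norm_sum sum_mono])
  then have 2: "norm (\<Sum>i\<in>UNIV. of_real (perp n i) * y i) \<le> 3 * ?v" by simp
  have "norm (inter n x y) \<le> (3 * norm (freq a n) * ?u) * (3 * ?v)"
    unfolding inter_def norm_mult using u by (intro mult_mono 1 2) auto
  also have "\<dots> = 9 * norm (freq a n) * (norm (complex_of_real ?u) * norm (complex_of_real ?v))"
    using u by (simp only: norm_of_real abs_of_nonneg mult_ac)
  also have "\<dots> \<le> 9 * norm (freq a n) * (A\<^sup>2 * (wt k powr - s + wt (n - k) powr - s))"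
  proof (rule mult_left_mono)
    show "norm (complex_of_real ?u) * norm (complex_of_real ?v) \<le> A\<^sup>2 * (wt k powr - s + wt (n - k) powr - s)"
      by (rule decay_product) (use u A in \<open>auto simp: norm_mult\<close>)
  qed simp
  finally show ?thesis by (simp add: dom_def mult.assoc)
qed

definition Vc :: "nat \<Rightarrow> real \<Rightarrow> int^3 \<Rightarrow> 3 \<Rightarrow> complex" where "Vc j t k i = Vh j t k $ emb i"

text \<open>The limit profile, carried back by the propagator.\<close>

definition Rc :: "nat \<Rightarrow> real \<Rightarrow> int^3 \<Rightarrow> 3 \<Rightarrow> complex" where
  "Rc j t k i = (\<Sum>p\<in>{-1,0,1}. exp (\<i> * of_real (of_int p * omega k * (t / e j))) * part k p (Uh t k) i)"

lemma Vc_continuous: "continuous_on {0..T} (\<lambda>t. Vc j t k i)"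
  unfolding Vc_def by (intro continuous_intros V_continuous)

lemma part_continuous: "continuous_on {0..T} (\<lambda>t. part k p (Uh t k) i)"
  by (rule bounded_linear.continuous_on[OF bounded_linear_part U_continuous])

lemma phase_continuous: "continuous_on S (\<lambda>t. exp (\<i> * of_real (l * (t / e j))))"
  using e(1)[of j] by (intro continuous_intros) auto

lemma Rc_continuous: "continuous_on {0..T} (\<lambda>t. Rc j t k i)"
  unfolding Rc_def by (intro continuous_intros phase_continuous part_continuous)

lemma norm_phase: "norm (exp (\<i> * of_real x)) = 1" by (simp add: norm_exp_eq_Re)

lemma Rc_bounded: "\<exists>B. \<forall>j. \<forall>t\<in>{0..T}. \<forall>i. norm (Rc j t k i) \<le> B"
proof -
  have "\<forall>p i. \<exists>B. \<forall>t\<in>{0..T}. norm (part k p (Uh t k) i) \<le> B"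
    using continuous_bounded[OF part_continuous] by metis
  then obtain B where B: "\<And>p i t. t \<in> {0..T} \<Longrightarrow> norm (part k p (Uh t k) i) \<le> B p i" by metis
  have "norm (Rc j t k i) \<le> (\<Sum>i\<in>UNIV. \<Sum>p\<in>{-1,0,1}. \<bar>B p i\<bar>)" if t: "t \<in> {0..T}" for j t i
  proof -
    have "norm (Rc j t k i) \<le> (\<Sum>p\<in>{-1,0,1}. \<bar>B p i\<bar>)"
      unfolding Rc_def
    proof (rule order_trans[OF norm_sum sum_mono])
      fix p show "norm (exp (\<i> * of_real (of_int p * omega k * (t / e j))) * part k p (Uh t k) i) \<le> \<bar>B p i\<bar>"
        using B[OF t, of p i] unfolding norm_mult norm_phase by linarith
    qed
    also have "\<dots> \<le> (\<Sum>i\<in>UNIV. \<Sum>p\<in>{-1,0,1}. \<bar>B p i\<bar>)"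
      by (rule member_le_sum) (auto intro: sum_nonneg)
    finally show ?thesis .
  qed
  then show ?thesis by blast
qed

lemma V_mean: assumes t: "t \<in> {0..T}" shows "Vh j t 0 = 0"
proof -
  have i: "integrable cellM (\<lambda>x. V (e j) t x $ i)" for i by (rule sobolev_nth_integrable[OF V_sobolev[OF t]])
  have "(LINT x:cell a|lborel. V (e j) t x) = 0" using sol[OF e(1)[of j]] t by (auto simp: pbs_solution_def)
  then have z: "integral\<^sup>L cellM (V (e j) t) = 0" by (simp add: integral_cell)
  have iv: "integrable cellM (V (e j) t)" by (rule integrable_vector[OF i])
  have "integral\<^sup>L cellM (\<lambda>x. V (e j) t x $ i) = 0" for i
    using integral_bounded_linear[OF bounded_linear_vec_nth iv, of i] z by simp
  then show ?thesis by (simp add: Vh_def vec_eq_iff fourier_nth fc_cellM)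
qed

lemma divergence: "time_test T \<theta> \<Longrightarrow> t \<in> {0..T} \<Longrightarrow> \<theta> t \<noteq> 0 \<Longrightarrow> kdot k (Vh j t k) = 0"
  using divergence_modes[OF sol[OF e(1)[of j]] s, of \<theta> t k] by (simp add: Vh_def)

text \<open>Where \<open>\<theta>\<close> does not vanish the mode is divergence-free and equals
  the sum of its parts, with phases of modulus one; the parts converge uniformly in time with the
  filtered solutions.\<close>

lemma V_close:
  assumes th: "time_test T \<theta>" and d: "0 < d"
  shows "\<forall>\<^sub>F j in sequentially. \<forall>t\<in>{0..T}. \<forall>i. \<theta> t \<noteq> 0 \<longrightarrow> norm (Vc j t k i - Rc j t k i) \<le> d"
proof -
  have "\<forall>p i. \<exists>K. \<forall>X. norm (part k p X i) \<le> norm X * K"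
    using bounded_linear.bounded[OF bounded_linear_part] by blast
  then obtain K where K: "\<And>p i X. norm (part k p X i) \<le> norm X * K p i" by metis
  define L where "L = 1 + (\<Sum>i\<in>UNIV. \<Sum>p\<in>{-1,0,1}. \<bar>K p i\<bar>)"
  have L: "0 < L" unfolding L_def by (intro add_pos_nonneg sum_nonneg) auto
  have "\<forall>\<^sub>F j in sequentially. \<forall>t\<in>{0..T}. norm (Wh j t k - Uh t k) < d / L"
    using d L by (intro W_conv) simp
  then show ?thesis
  proof eventually_elim
    case (elim j)
    show ?case
    proof (intro ballI allI impI)
      fix t i assume t: "t \<in> {0..T}" and "\<theta> t \<noteq> 0"
      have "Vc j t k i = (\<Sum>p\<in>{-1,0,1}. exp (\<i> * of_real (of_int p * omega k * (t / e j))) * part k p (Wh j t k) i)"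
        unfolding Vc_def Wh_def
        by (rule mode_decomposition[OF divergence[OF th t \<open>\<theta> t \<noteq> 0\<close>]]) (use V_mean[OF t] in auto)
      then have "Vc j t k i - Rc j t k i = (\<Sum>p\<in>{-1,0,1}. exp (\<i> * of_real (of_int p * omega k * (t / e j))) * part k p (Wh j t k - Uh t k) i)"
        by (simp add: Rc_def linear_diff[OF bounded_linear.linear[OF bounded_linear_part]] right_diff_distrib)
      also have "norm \<dots> \<le> (\<Sum>p\<in>{-1,0,1}. norm (Wh j t k - Uh t k) * \<bar>K p i\<bar>)"
      proof (rule order_trans[OF norm_sum sum_mono])
        fix p
        have "norm (part k p (Wh j t k - Uh t k) i) \<le> norm (Wh j t k - Uh t k) * \<bar>K p i\<bar>"
          by (rule order_trans[OF K]) (simp add: mult_left_mono)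
        then show "norm (exp (\<i> * of_real (of_int p * omega k * (t / e j))) * part k p (Wh j t k - Uh t k) i)
            \<le> norm (Wh j t k - Uh t k) * \<bar>K p i\<bar>"
          unfolding norm_mult norm_phase by simp
      qed
      also have "\<dots> = norm (Wh j t k - Uh t k) * (\<Sum>p\<in>{-1,0,1}. \<bar>K p i\<bar>)" by (simp only: sum_distrib_left)
      also have "\<dots> \<le> (d / L) * L"
      proof (rule mult_mono)
        have "(\<Sum>p\<in>{-1,0,1}. \<bar>K p i\<bar>) \<le> (\<Sum>i\<in>UNIV. \<Sum>p\<in>{-1,0,1}. \<bar>K p i\<bar>)"
          by (rule member_le_sum) (auto intro: sum_nonneg)
        then show "(\<Sum>p\<in>{-1,0,1}. \<bar>K p i\<bar>) \<le> L" by (simp add: L_def)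
        show "norm (Wh j t k - Uh t k) \<le> d / L" using elim t by (auto intro: less_imp_le)
        show "0 \<le> d / L" using d L by simp
        show "0 \<le> (\<Sum>p\<in>{-1,0,1}. \<bar>K p i\<bar>)" by (intro sum_nonneg) simp
      qed
      finally show "norm (Vc j t k i - Rc j t k i) \<le> d" using L by simp
    qed
  qed
qed

lemma sym_inter_expand:
  "sym_inter n x y = (\<Sum>j\<in>UNIV. \<Sum>i\<in>UNIV. of_real (freq a n $ j * perp n i + perp n j * freq a n $ i) * (x j * y i))"
  by (simp add: sym_inter_def inter_def sum_3 algebra_simps)

lemma sym_inter_continuous:
  assumes "\<And>i. continuous_on S (\<lambda>t. x t i)" "\<And>i. continuous_on S (\<lambda>t. y t i)"
  shows "continuous_on S (\<lambda>t. sym_inter n (x t) (y t))"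
  unfolding sym_inter_expand by (intro continuous_intros assms)

lemma time_test_continuous: "time_test T \<theta> \<Longrightarrow> continuous_on {0..T} (\<lambda>t. complex_of_real (\<theta> t))"
  using time_test_derivative(4) continuous_on_subset by (blast intro: continuous_intros)

text \<open>Expansion into parts yields the phases \<open>p * omega k + q * omega m\<close>.
  Non-zero ones average out, and for zero ones the amplitude vanishes unless both parts are slow.\<close>

lemma interaction_limit:
  assumes th: "time_test T \<theta>" and n: "n = k + m"
  shows "(\<lambda>j. \<integral>t. of_real (\<theta> t) * sym_inter n (Vc j t k) (Vc j t m) \<partial>timeM T)
    \<longlonglongrightarrow> (\<integral>t. of_real (\<theta> t) * sym_inter n (Z t k) (Z t m) \<partial>timeM T)"
proof -
  note thc = time_test_continuous[OF th]
  obtain A where A: "0 \<le> A" "\<And>t. t \<in> {0..T} \<Longrightarrow> norm (complex_of_real (\<theta> t)) \<le> A"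
    using continuous_bounded[OF thc] by metis
  obtain B1 where B1: "\<And>j t i. t \<in> {0..T} \<Longrightarrow> norm (Rc j t k i) \<le> B1" using Rc_bounded by metis
  define B where "B = \<bar>B1\<bar> + \<bar>C\<bar> * wt m powr (- s / 2) + 1"
  have B: "0 < B" unfolding B_def by (intro add_nonneg_pos) auto
  have BR: "norm (Rc j t k i) \<le> B" if "t \<in> {0..T}" for j t i
  proof -
    have "0 \<le> \<bar>C\<bar> * wt m powr (- s / 2)" by simp
    then show ?thesis using B1[OF that, of j i] unfolding B_def by linarith
  qed
  have BV: "norm (Vc j t m i) \<le> B" if "t \<in> {0..T}" for j t i
    using V_decay[OF that, of j m "emb i"] unfolding Vc_def B_def by linarith
  let ?M = "\<lambda>j i. freq a n $ j * perp n i + perp n j * freq a n $ i"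
  define S where "S = 1 + (\<Sum>j\<in>UNIV. \<Sum>i\<in>UNIV. \<bar>?M j i\<bar>)"
  have S: "0 < S" unfolding S_def by (intro add_pos_nonneg sum_nonneg) auto
  let ?g = "\<lambda>j t. of_real (\<theta> t) * (sym_inter n (Vc j t k) (Vc j t m) - sym_inter n (Rc j t k) (Rc j t m))"
  have c1: "continuous_on {0..T} (\<lambda>t. of_real (\<theta> t) * sym_inter n (Vc j t k) (Vc j t m))" for j
    by (intro continuous_intros thc sym_inter_continuous Vc_continuous)
  have c2: "continuous_on {0..T} (\<lambda>t. of_real (\<theta> t) * sym_inter n (Rc j t k) (Rc j t m))" for j
    by (intro continuous_intros thc sym_inter_continuous Rc_continuous)
  have "(\<lambda>j. integral\<^sup>L (timeM T) (?g j)) \<longlonglongrightarrow> 0"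
  proof (rule integral_null_uniform)
    show "continuous_on {0..T} (?g j)" for j
      by (intro continuous_intros thc sym_inter_continuous Vc_continuous Rc_continuous)
    fix d :: real assume d: "0 < d"
    define \<delta> where "\<delta> = d / ((1 + A) * S * (2 * B))"
    have \<delta>: "0 < \<delta>" unfolding \<delta>_def using d A(1) S B by (intro divide_pos_pos mult_pos_pos) auto
    have de: "(1 + A) * (S * (2 * B * \<delta>)) = d"
      using A(1) S B by (simp add: \<delta>_def)
    from V_close[OF th \<delta>, of k] V_close[OF th \<delta>, of m]
    show "\<forall>\<^sub>F j in sequentially. \<forall>t\<in>{0..T}. norm (?g j t) \<le> d"
    proof eventually_elim
      case (elim j)
      show ?case
      proof
        fix t assume t: "t \<in> {0..T}"
        show "norm (?g j t) \<le> d"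
        proof (cases "\<theta> t = 0")
          case True then show ?thesis using d by simp
        next
          case False
          have pr: "norm (Vc j t k q * Vc j t m i - Rc j t k q * Rc j t m i) \<le> 2 * B * \<delta>" for q i
          proof -
            have "norm (Vc j t k q - Rc j t k q) * norm (Vc j t m i) + norm (Rc j t k q) * norm (Vc j t m i - Rc j t m i)
                \<le> \<delta> * B + B * \<delta>"
              using elim t False \<delta> B BV[OF t] BR[OF t] by (intro add_mono mult_mono) auto
            with norm_product_diff[of "Vc j t k q" "Vc j t m i" "Rc j t k q" "Rc j t m i"]
            show ?thesis by simp
          qed
          have eq: "sym_inter n (Vc j t k) (Vc j t m) - sym_inter n (Rc j t k) (Rc j t m) =
             (\<Sum>q\<in>UNIV. \<Sum>i\<in>UNIV. of_real (?M q i) * (Vc j t k q * Vc j t m i - Rc j t k q * Rc j t m i))"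
            unfolding sym_inter_expand by (simp add: sum_subtractf right_diff_distrib)
          have "norm (sym_inter n (Vc j t k) (Vc j t m) - sym_inter n (Rc j t k) (Rc j t m))
              \<le> (\<Sum>q\<in>UNIV. \<Sum>i\<in>UNIV. \<bar>?M q i\<bar> * (2 * B * \<delta>))"
            unfolding eq
          proof (rule order_trans[OF norm_sum sum_mono], rule order_trans[OF norm_sum sum_mono])
            fix q i
            show "norm (of_real (?M q i) * (Vc j t k q * Vc j t m i - Rc j t k q * Rc j t m i)) \<le> \<bar>?M q i\<bar> * (2 * B * \<delta>)"
              unfolding norm_mult norm_of_real by (rule mult_left_mono[OF pr]) simp
          qed
          moreover have "(\<Sum>q\<in>UNIV. \<Sum>i\<in>UNIV. \<bar>?M q i\<bar> * (2 * B * \<delta>)) = (S - 1) * (2 * B * \<delta>)"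
            by (simp add: S_def sum_distrib_right)
          moreover have "(S - 1) * (2 * B * \<delta>) \<le> S * (2 * B * \<delta>)" using B \<delta> by (intro mult_right_mono) auto
          ultimately have sl: "norm (sym_inter n (Vc j t k) (Vc j t m) - sym_inter n (Rc j t k) (Rc j t m)) \<le> S * (2 * B * \<delta>)"
            by linarith
          have "norm (?g j t) \<le> (1 + A) * (S * (2 * B * \<delta>))"
            unfolding norm_mult using A(2)[OF t] S B \<delta> A(1) by (intro mult_mono sl) auto
          then show ?thesis using de by simp
        qed
      qed
    qed
  qed
  moreover have "(\<lambda>j. \<integral>t. of_real (\<theta> t) * sym_inter n (Rc j t k) (Rc j t m) \<partial>timeM T)
    \<longlonglongrightarrow> (\<integral>t. of_real (\<theta> t) * sym_inter n (Z t k) (Z t m) \<partial>timeM T)"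
  proof -
    let ?P = "{-1,0,1} :: int set"
    let ?h = "\<lambda>p q t. of_real (\<theta> t) * sym_inter n (part k p (Uh t k)) (part m q (Uh t m))"
    let ?l = "\<lambda>p q. of_int p * omega k + of_int q * omega m"
    have hc: "continuous_on {0..T} (?h p q)" for p q
      by (intro continuous_intros thc sym_inter_continuous part_continuous)
    have "of_real (\<theta> t) * sym_inter n (Rc j t k) (Rc j t m) =
        (\<Sum>p\<in>?P. \<Sum>q\<in>?P. exp (\<i> * of_real (?l p q * (t / e j))) * ?h p q t)" for j t
    proof -
      have "sym_inter n (Rc j t k) (Rc j t m) = (\<Sum>p\<in>?P. \<Sum>q\<in>?P.
          exp (\<i> * of_real (of_int p * omega k * (t / e j))) * exp (\<i> * of_real (of_int q * omega m * (t / e j))) *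
          sym_inter n (part k p (Uh t k)) (part m q (Uh t m)))"
        unfolding Rc_def[abs_def] sym_inter_sum sym_inter_scale ..
      moreover have "exp (\<i> * of_real (of_int p * omega k * (t / e j))) * exp (\<i> * of_real (of_int q * omega m * (t / e j))) =
          exp (\<i> * of_real (?l p q * (t / e j)))" for p q
      proof -
        have "of_int p * omega k * (t / e j) + of_int q * omega m * (t / e j) = ?l p q * (t / e j)"
          by (simp only: distrib_right)
        then show ?thesis unfolding exp_add[symmetric] by (metis distrib_left of_real_add)
      qed
      ultimately show ?thesis by (simp only: sum_distrib_left) (simp only: mult_ac)
    qed
    then have "(\<integral>t. of_real (\<theta> t) * sym_inter n (Rc j t k) (Rc j t m) \<partial>timeM T) =
        (\<Sum>p\<in>?P. \<Sum>q\<in>?P. \<integral>t. exp (\<i> * of_real (?l p q * (t / e j))) * ?h p q t \<partial>timeM T)" for j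
      by (simp only:)
        (subst Bochner_Integration.integral_sum, intro continuous_integrable_timeM continuous_intros phase_continuous hc,
         intro sum.cong refl Bochner_Integration.integral_sum continuous_integrable_timeM continuous_intros phase_continuous hc)
    moreover have "(\<lambda>j. \<Sum>p\<in>?P. \<Sum>q\<in>?P. \<integral>t. exp (\<i> * of_real (?l p q * (t / e j))) * ?h p q t \<partial>timeM T)
       \<longlonglongrightarrow> (\<Sum>p\<in>?P. \<Sum>q\<in>?P. if p = 0 \<and> q = 0 then integral\<^sup>L (timeM T) (?h 0 0) else 0)"
    proof (intro tendsto_sum)
      fix p q assume p: "p \<in> ?P" and q: "q \<in> ?P"
      show "(\<lambda>j. \<integral>t. exp (\<i> * of_real (?l p q * (t / e j))) * ?h p q t \<partial>timeM T) \<longlonglongrightarrow>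
          (if p = 0 \<and> q = 0 then integral\<^sup>L (timeM T) (?h 0 0) else 0)"
      proof (cases "?l p q = 0")
        case True
        show ?thesis
        proof (cases "p = 0 \<and> q = 0")
          case True then show ?thesis by simp
        next
          case False
          have "?h p q t = 0" for t using resonance[OF p q False True n] by simp
          then show ?thesis using False by (simp only: mult_zero_right) auto
        qed
      next
        case False
        then have "\<not> (p = 0 \<and> q = 0)" by auto
        then show ?thesis using riemann_lebesgue[OF hc False e] by simp
      qed
    qed
    moreover have "(\<Sum>p\<in>?P. \<Sum>q\<in>?P. if p = 0 \<and> q = 0 then integral\<^sup>L (timeM T) (?h 0 0) else 0) = integral\<^sup>L (timeM T) (?h 0 0)"
      by simp
    ultimately show ?thesis by (simp add: Z_def[abs_def])
  qed
  ultimately have "(\<lambda>j. integral\<^sup>L (timeM T) (?g j) + (\<integral>t. of_real (\<theta> t) * sym_inter n (Rc j t k) (Rc j t m) \<partial>timeM T))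
    \<longlonglongrightarrow> 0 + (\<integral>t. of_real (\<theta> t) * sym_inter n (Z t k) (Z t m) \<partial>timeM T)" by (rule tendsto_add)
  moreover have "integral\<^sup>L (timeM T) (?g j) + (\<integral>t. of_real (\<theta> t) * sym_inter n (Rc j t k) (Rc j t m) \<partial>timeM T)
      = (\<integral>t. of_real (\<theta> t) * sym_inter n (Vc j t k) (Vc j t m) \<partial>timeM T)" for j
    using continuous_integrable_timeM[OF c1, of j] continuous_integrable_timeM[OF c2, of j]
    by (simp add: right_diff_distrib)
  ultimately show ?thesis by simp
qed

end

context filtered_limit begin

definition wl :: "real \<Rightarrow> int^3 \<Rightarrow> complex" where "wl t n = hermitian (Uh t n) (e0 a n)"

text \<open>The \<open>e0\<close>-component of the convection of the slow velocity by itself.\<close>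

definition Nl :: "real \<Rightarrow> int^3 \<Rightarrow> complex" where
  "Nl t n = (\<Sum>\<^sub>\<infinity>k. \<i> * inter n (Z t k) (Z t (n - k)))"

lemma inter_continuous:
  assumes "\<And>i. continuous_on S (\<lambda>t. x t i)" "\<And>i. continuous_on S (\<lambda>t. y t i)"
  shows "continuous_on S (\<lambda>t. inter n (x t) (y t))"
  unfolding inter_def by (intro continuous_intros assms)

text \<open>The reflection that exchanges \<open>k\<close> and \<open>n - k\<close> shows that the
  sum over all pairs only sees the symmetrised interaction.\<close>

lemma interaction_sum:
  fixes X :: "real \<Rightarrow> int^3 \<Rightarrow> 3 \<Rightarrow> complex" and n :: "int^3"
  assumes th: "time_test T \<theta>" and X: "\<And>k i. continuous_on {0..T} (\<lambda>t. X t k i)"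
    and D: "\<And>t k i. t \<in> {0..T} \<Longrightarrow> norm (X t k i) \<le> D * wt k powr (- s / 2)" "0 \<le> D"
    and A: "\<And>t. t \<in> {0..T} \<Longrightarrow> \<bar>\<theta> t\<bar> \<le> A" "0 \<le> A"
  defines "H \<equiv> A * (9 * norm (freq a n) * D\<^sup>2) * (1 + \<bar>T\<bar>)"
  shows "norm (\<integral>t. \<i> * of_real (\<theta> t) * inter n (X t k) (X t (n - k)) \<partial>timeM T) \<le> H * dom n k"
    and "norm (\<integral>t. of_real (\<theta> t) * sym_inter n (X t k) (X t (n - k)) \<partial>timeM T) \<le> 2 * H * dom n k"
    and "(\<lambda>k. \<integral>t. \<i> * of_real (\<theta> t) * inter n (X t k) (X t (n - k)) \<partial>timeM T) summable_on UNIV"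
    and "2 * (\<Sum>\<^sub>\<infinity>k. \<integral>t. \<i> * of_real (\<theta> t) * inter n (X t k) (X t (n - k)) \<partial>timeM T)
      = \<i> * (\<Sum>\<^sub>\<infinity>k. \<integral>t. of_real (\<theta> t) * sym_inter n (X t k) (X t (n - k)) \<partial>timeM T)"
proof -
  let ?A = "\<lambda>k. \<integral>t. \<i> * of_real (\<theta> t) * inter n (X t k) (X t (n - k)) \<partial>timeM T"
  let ?B = "\<lambda>k. \<integral>t. of_real (\<theta> t) * sym_inter n (X t k) (X t (n - k)) \<partial>timeM T"
  note thc = time_test_continuous[OF th]
  have H: "0 \<le> H" unfolding H_def using A D by (intro mult_nonneg_nonneg) auto
  have ic: "continuous_on {0..T} (\<lambda>t. \<i> * of_real (\<theta> t) * inter n (X t k) (X t m))" for k m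
    by (intro continuous_intros thc inter_continuous X)
  have d0: "0 \<le> dom n k" for k by (simp add: dom_def)
  have 1: "norm (?A k) \<le> H * dom n k" for k
  proof -
    have "norm (?A k) \<le> (A * (9 * norm (freq a n) * D\<^sup>2 * dom n k)) * (1 + \<bar>T\<bar>)"
    proof (rule norm_timeM_integral_le[OF ic])
      fix t assume t: "t \<in> {0..T}"
      have "norm (complex_of_real (\<theta> t)) * norm (inter n (X t k) (X t (n - k))) \<le> A * (9 * norm (freq a n) * D\<^sup>2 * dom n k)"
        using A(1)[OF t] A(2) d0 D(2) by (intro mult_mono norm_inter_le D(1)[OF t]) auto
      then show "norm (\<i> * of_real (\<theta> t) * inter n (X t k) (X t (n - k))) \<le> A * (9 * norm (freq a n) * D\<^sup>2 * dom n k)"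
        by (simp add: norm_mult)
    qed (use A D d0 in \<open>intro mult_nonneg_nonneg; simp\<close>)
    then show ?thesis by (simp add: H_def ac_simps)
  qed
  then show "norm (?A k) \<le> H * dom n k" .
  have dh: "(\<lambda>k. H * dom n k) summable_on UNIV" by (intro summable_on_cmult_right dom_summable)
  show sA: "?A summable_on UNIV" by (rule infsum_remainder_le(1)[OF 1 dh finite.emptyI])
  have AB: "?A k + ?A (n - k) = \<i> * ?B k" for k
  proof -
    have "?A k + ?A (n - k) = (\<integral>t. \<i> * of_real (\<theta> t) * inter n (X t k) (X t (n - k)) + \<i> * of_real (\<theta> t) * inter n (X t (n - k)) (X t k) \<partial>timeM T)"
      using continuous_integrable_timeM[OF ic] by simp
    also have "\<dots> = (\<integral>t. \<i> * (of_real (\<theta> t) * sym_inter n (X t k) (X t (n - k))) \<partial>timeM T)"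
      by (simp add: sym_inter_def algebra_simps)
    finally show ?thesis by simp
  qed
  have ds: "dom n (n - k) = dom n k" for k by (simp add: dom_def)
  show "norm (?B k) \<le> 2 * H * dom n k"
  proof -
    have "norm (?B k) = norm (?A k + ?A (n - k))" unfolding AB by (simp add: norm_mult)
    also have "\<dots> \<le> H * dom n k + H * dom n (n - k)" by (intro order_trans[OF norm_triangle_ineq add_mono] 1)
    finally show ?thesis by (simp add: ds)
  qed
  have r: "(\<lambda>k. ?A (n - k)) summable_on UNIV" "(\<Sum>\<^sub>\<infinity>k. ?A (n - k)) = infsum ?A UNIV"
    using summable_on_reindex_bij_betw[OF reflect_bij[of n], of ?A] sA infsum_reindex_bij_betw[OF reflect_bij[of n], of ?A] by simp_all
  have "2 * infsum ?A UNIV = (\<Sum>\<^sub>\<infinity>k. ?A k + ?A (n - k))"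
    using infsum_add[OF sA r(1)] r(2) by simp
  also have "\<dots> = \<i> * infsum ?B UNIV" unfolding AB by (rule infsum_cmult_right')
  finally show "2 * infsum ?A UNIV = \<i> * infsum ?B UNIV" .
qed

lemma kdot_inter: "inter n (\<lambda>i. X $ emb i) (\<lambda>i. Y $ emb i) = kdot n X * hermitian Y (e0 a n)"
  by (simp add: inter_def kdot_def hermitian_e0)

lemma kdot_diff: "kdot (n - k) X = kdot n X - kdot k X"
  by (simp add: kdot_def freq_diff left_diff_distrib sum_subtractf)

text \<open>The propagator does not move the \<open>e0\<close>-component, so it converges without
  filtering.\<close>

lemma w_lim:
  assumes n: "horizontal n" and h: "continuous_on {0..T} h"
  shows "(\<lambda>j. \<integral>t. h t * hermitian (Vh j t n) (e0 a n) \<partial>timeM T) \<longlonglongrightarrow> (\<integral>t. h t * wl t n \<partial>timeM T)"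
proof -
  obtain A where A: "0 \<le> A" "\<And>t. t \<in> {0..T} \<Longrightarrow> norm (h t) \<le> A" using continuous_bounded[OF h] by metis
  have hc: "continuous_on {0..T} (\<lambda>t. hermitian (f t) (e0 a n))" if "continuous_on {0..T} f" for f
    unfolding hermitian_e0 by (intro continuous_intros that)
  have c1: "continuous_on {0..T} (\<lambda>t. h t * hermitian (Vh j t n) (e0 a n))" for j
    by (intro continuous_intros h hc V_continuous)
  have c2: "continuous_on {0..T} (\<lambda>t. h t * wl t n)"
    unfolding wl_def by (intro continuous_intros h hc U_continuous)
  have "(\<lambda>j. \<integral>t. h t * hermitian (Vh j t n) (e0 a n) - h t * wl t n \<partial>timeM T) \<longlonglongrightarrow> 0"
  proof (rule integral_null_uniform)
    show "continuous_on {0..T} (\<lambda>t. h t * hermitian (Vh j t n) (e0 a n) - h t * wl t n)" for j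
      by (intro continuous_on_diff c1 c2)
    fix d :: real assume d: "0 < d"
    have "0 < d / ((1 + A) * 2)" using d A by simp
    from W_conv[OF this, of n]
    show "\<forall>\<^sub>F j in sequentially. \<forall>t\<in>{0..T}. norm (h t * hermitian (Vh j t n) (e0 a n) - h t * wl t n) \<le> d"
    proof eventually_elim
      case (elim j)
      show ?case
      proof
        fix t assume t: "t \<in> {0..T}"
        have "hermitian (Vh j t n) (e0 a n) - wl t n = hermitian (Wh j t n - Uh t n) (e0 a n)"
          unfolding Wh_def wl_def e0_propagator[OF n, symmetric, of "Vh j t n" "- (t / e j)"]
          by (simp add: hermitian_def sum_subtractf left_diff_distrib)
        then have "norm (h t * hermitian (Vh j t n) (e0 a n) - h t * wl t n) = norm (h t) * norm (hermitian (Wh j t n - Uh t n) (e0 a n))"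
          by (simp add: right_diff_distrib[symmetric] norm_mult)
        also have "\<dots> \<le> (1 + A) * (2 * norm (Wh j t n - Uh t n))"
          using A(2)[OF t] A(1) by (intro mult_mono norm_hermitian_e0) auto
        also have "\<dots> \<le> (1 + A) * (2 * (d / ((1 + A) * 2)))"
          using elim t A(1) by (intro mult_left_mono) (auto intro: less_imp_le)
        also have "\<dots> = d"
        proof -
          have "1 + A \<noteq> 0" using A(1) by simp
          then show ?thesis by (simp add: field_simps)
        qed
        finally show "norm (h t * hermitian (Vh j t n) (e0 a n) - h t * wl t n) \<le> d" .
      qed
    qed
  qed
  moreover have "(\<integral>t. h t * hermitian (Vh j t n) (e0 a n) - h t * wl t n \<partial>timeM T) =
     (\<integral>t. h t * hermitian (Vh j t n) (e0 a n) \<partial>timeM T) - (\<integral>t. h t * wl t n \<partial>timeM T)" for j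
    using continuous_integrable_timeM[OF c1] continuous_integrable_timeM[OF c2] by (rule Bochner_Integration.integral_diff)
  ultimately show ?thesis by (simp add: LIM_zero_iff)
qed

text \<open>Where \<open>\<theta>\<close> does not vanish the advecting mode is divergence-free,
  which brings the interaction into the form of \<open>inter\<close>.\<close>

lemma mode_sum:
  assumes th: "time_test T \<theta>"
  shows "(\<Sum>\<^sub>\<infinity>k. \<integral>t. \<i> * of_real (\<theta> t) * inter n (Vc j t k) (Vc j t (n - k)) \<partial>timeM T) =
     (\<integral>t. of_real (deriv \<theta> t) * hermitian (Vh j t n) (e0 a n) \<partial>timeM T)
        - of_real (\<nu> * (norm (freq a n))\<^sup>2) * (\<integral>t. of_real (\<theta> t) * hermitian (Vh j t n) (e0 a n) \<partial>timeM T)"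
proof -
  obtain A where A: "0 \<le> A" "\<And>t. t \<in> {0..T} \<Longrightarrow> \<bar>\<theta> t\<bar> \<le> A"
    using continuous_bounded[OF time_test_continuous[OF th]] by (metis norm_of_real)
  let ?A = "\<lambda>k. \<integral>t. \<i> * of_real (\<theta> t) * inter n (Vc j t k) (Vc j t (n - k)) \<partial>timeM T"
  have dec: "norm (Vc j t k i) \<le> \<bar>C\<bar> * wt k powr (- s / 2)" if "t \<in> {0..T}" for t k i
    unfolding Vc_def by (rule V_decay[OF that])
  have "?A summable_on UNIV"
    by (rule interaction_sum(3)[OF th Vc_continuous dec _ A(2,1)]) auto
  then have "(\<lambda>N. sum ?A (ball_modes N)) \<longlonglongrightarrow> infsum ?A UNIV" by (intro has_sum_ball_modes has_sum_infsum)
  moreover have "?A k = (\<integral>t. \<i> * of_real (\<theta> t) * kdot (n - k) (fourier a (V (e j) t) k) *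
            hermitian (fourier a (V (e j) t) (n - k)) (e0 a n) \<partial>timeM T)" for k
  proof (rule Bochner_Integration.integral_cong[OF refl])
    fix t assume "t \<in> space (timeM T)"
    then have t: "t \<in> {0..T}" by simp
    show "\<i> * of_real (\<theta> t) * inter n (Vc j t k) (Vc j t (n - k)) = \<i> * of_real (\<theta> t) * kdot (n - k) (fourier a (V (e j) t) k) *
            hermitian (fourier a (V (e j) t) (n - k)) (e0 a n)"
    proof (cases "\<theta> t = 0")
      case False
      have "inter n (Vc j t k) (Vc j t (n - k)) = kdot n (Vh j t k) * hermitian (Vh j t (n - k)) (e0 a n)"
        unfolding Vc_def[abs_def] by (rule kdot_inter)
      moreover have "kdot (n - k) (Vh j t k) = kdot n (Vh j t k)"
        using divergence[OF th t False, of k j] by (simp add: kdot_diff)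
      ultimately show ?thesis by (simp add: Vh_def)
    qed simp
  qed
  moreover have "(\<lambda>N. \<Sum>k\<in>ball_modes N. \<integral>t. \<i> * of_real (\<theta> t) * kdot (n - k) (fourier a (V (e j) t) k) *
            hermitian (fourier a (V (e j) t) (n - k)) (e0 a n) \<partial>timeM T)
      \<longlonglongrightarrow> (\<integral>t. of_real (deriv \<theta> t) * hermitian (fourier a (V (e j) t) n) (e0 a n) \<partial>timeM T)
        - of_real (\<nu> * (norm (freq a n))\<^sup>2) * (\<integral>t. of_real (\<theta> t) * hermitian (fourier a (V (e j) t) n) (e0 a n) \<partial>timeM T)"
    by (rule mode_equation[OF sol[OF e(1)] s bound[OF e(1)] th])
  ultimately show ?thesis
    by (simp only: Vh_def) (rule LIMSEQ_unique)
qed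

text \<open>Each pair of modes has a limit, and the decay of the coefficients, uniform in the
  parameter, dominates the sum over the pairs.\<close>

theorem limit_mode_equation:
  assumes th: "time_test T \<theta>" and n: "horizontal n"
  shows "(\<integral>t. of_real (deriv \<theta> t) * wl t n \<partial>timeM T) =
    of_real (\<nu> * (norm (freq a n))\<^sup>2) * (\<integral>t. of_real (\<theta> t) * wl t n \<partial>timeM T) + (\<integral>t. of_real (\<theta> t) * Nl t n \<partial>timeM T)"
proof -
  note thc = time_test_continuous[OF th]
  have thc': "continuous_on {0..T} (\<lambda>t. complex_of_real (deriv \<theta> t))"
    using time_test_derivative(3)[OF th] continuous_on_subset by (blast intro: continuous_intros)
  obtain A where A: "0 \<le> A" "\<And>t. t \<in> {0..T} \<Longrightarrow> \<bar>\<theta> t\<bar> \<le> A"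
    using continuous_bounded[OF thc] by (metis norm_of_real)
  have dV: "norm (Vc j t k i) \<le> \<bar>C\<bar> * wt k powr (- s / 2)" if "t \<in> {0..T}" for j t k i
    unfolding Vc_def by (rule V_decay[OF that])
  have c2: "0 \<le> 2 * \<bar>C\<bar>" by simp
  let ?BV = "\<lambda>j k. \<integral>t. of_real (\<theta> t) * sym_inter n (Vc j t k) (Vc j t (n - k)) \<partial>timeM T"
  let ?BZ = "\<lambda>k. \<integral>t. of_real (\<theta> t) * sym_inter n (Z t k) (Z t (n - k)) \<partial>timeM T"
  let ?AZ = "\<lambda>k. \<integral>t. \<i> * of_real (\<theta> t) * inter n (Z t k) (Z t (n - k)) \<partial>timeM T"
  let ?R = "\<lambda>f. (\<integral>t. of_real (deriv \<theta> t) * f t \<partial>timeM T) - of_real (\<nu> * (norm (freq a n))\<^sup>2) * (\<integral>t. of_real (\<theta> t) * f t \<partial>timeM T)"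
  let ?H = "2 * (A * (9 * norm (freq a n) * \<bar>C\<bar>\<^sup>2) * (1 + \<bar>T\<bar>))"
  have V2: "norm (?BV j k) \<le> ?H * dom n k" for j k
    by (rule interaction_sum(2)[OF th Vc_continuous dV abs_ge_zero A(2,1)])
  have V4: "2 * (\<Sum>\<^sub>\<infinity>k. \<integral>t. \<i> * of_real (\<theta> t) * inter n (Vc j t k) (Vc j t (n - k)) \<partial>timeM T) = \<i> * infsum (?BV j) UNIV" for j
    by (rule interaction_sum(4)[OF th Vc_continuous dV abs_ge_zero A(2,1)])
  have Z3: "?AZ summable_on UNIV" by (rule interaction_sum(3)[OF th Z_continuous Z_decay c2 A(2,1)])
  have Z4: "2 * infsum ?AZ UNIV = \<i> * infsum ?BZ UNIV" by (rule interaction_sum(4)[OF th Z_continuous Z_decay c2 A(2,1)])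
  have "(\<lambda>j. infsum (?BV j) UNIV) \<longlonglongrightarrow> infsum ?BZ UNIV"
  proof (rule infsum_dominated_convergence(1))
    show "(\<lambda>j. ?BV j k) \<longlonglongrightarrow> ?BZ k" for k by (rule interaction_limit[OF th]) simp
    show "norm (?BV j k) \<le> ?H * dom n k" for j k by (rule V2)
    show "(\<lambda>k. ?H * dom n k) summable_on UNIV" by (intro summable_on_cmult_right dom_summable)
  qed
  then have "(\<lambda>j. \<i> * infsum (?BV j) UNIV / 2) \<longlonglongrightarrow> \<i> * infsum ?BZ UNIV / 2" by (intro tendsto_intros) auto
  moreover have "\<i> * infsum (?BV j) UNIV / 2 = ?R (\<lambda>t. hermitian (Vh j t n) (e0 a n))" for j
    unfolding V4[symmetric] mode_sum[OF th] by simp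
  moreover have "\<i> * infsum ?BZ UNIV / 2 = infsum ?AZ UNIV" unfolding Z4[symmetric] by simp
  ultimately have 1: "(\<lambda>j. ?R (\<lambda>t. hermitian (Vh j t n) (e0 a n))) \<longlonglongrightarrow> infsum ?AZ UNIV" by simp
  have 2: "(\<lambda>j. ?R (\<lambda>t. hermitian (Vh j t n) (e0 a n))) \<longlonglongrightarrow> ?R (\<lambda>t. wl t n)"
    by (intro tendsto_diff tendsto_mult_left w_lim n thc thc')
  have 3: "?R (\<lambda>t. wl t n) = infsum ?AZ UNIV" by (rule LIMSEQ_unique[OF 2 1])
  have "infsum ?AZ UNIV = (\<integral>t. of_real (\<theta> t) * Nl t n \<partial>timeM T)"
  proof -
    let ?K = "9 * norm (freq a n) * (2 * \<bar>C\<bar>)\<^sup>2"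
    have ni: "norm (\<i> * inter n (Z t k) (Z t (n - k))) \<le> ?K * dom n k" if "t \<in> {0..T}" for t k
      using norm_inter_le[OF Z_decay[OF that] Z_decay[OF that] c2, of n k] by (simp add: norm_mult)
    have dK: "(\<lambda>k. ?K * dom n k) summable_on UNIV" by (intro summable_on_cmult_right dom_summable)
    have zc: "continuous_on {0..T} (\<lambda>t. \<i> * inter n (Z t k) (Z t (n - k)))" for k
      by (intro continuous_intros inter_continuous Z_continuous)
    have lim: "(\<lambda>N. \<Sum>k\<in>ball_modes N. \<i> * inter n (Z t k) (Z t (n - k))) \<longlonglongrightarrow> Nl t n" if t: "t \<in> {0..T}" for t
      unfolding Nl_def
      by (intro has_sum_ball_modes has_sum_infsum infsum_remainder_le(1)[OF ni[OF t] dK finite.emptyI])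
    have "(\<lambda>N. \<integral>t. of_real (\<theta> t) * (\<Sum>k\<in>ball_modes N. \<i> * inter n (Z t k) (Z t (n - k))) \<partial>timeM T)
        \<longlonglongrightarrow> (\<integral>t. of_real (\<theta> t) * Nl t n \<partial>timeM T)"
    proof (rule integral_dominated_convergence[where w="\<lambda>_. A * (?K * infsum (dom n) UNIV)"])
      have m: "(\<lambda>t. of_real (\<theta> t) * (\<Sum>k\<in>ball_modes N. \<i> * inter n (Z t k) (Z t (n - k)))) \<in> borel_measurable (timeM T)" for N
        by (intro continuous_timeM continuous_intros thc zc inter_continuous Z_continuous)
      then show "(\<lambda>t. of_real (\<theta> t) * (\<Sum>k\<in>ball_modes N. \<i> * inter n (Z t k) (Z t (n - k)))) \<in> borel_measurable (timeM T)" for N .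
      show "(\<lambda>t. of_real (\<theta> t) * Nl t n) \<in> borel_measurable (timeM T)"
      proof (rule borel_measurable_LIMSEQ_metric)
        show "(\<lambda>N. of_real (\<theta> t) * (\<Sum>k\<in>ball_modes N. \<i> * inter n (Z t k) (Z t (n - k)))) \<longlonglongrightarrow> of_real (\<theta> t) * Nl t n"
          if "t \<in> space (timeM T)" for t
          using that by (intro tendsto_mult_left lim) simp
      qed (rule m)
      show "AE t in timeM T. (\<lambda>N. of_real (\<theta> t) * (\<Sum>k\<in>ball_modes N. \<i> * inter n (Z t k) (Z t (n - k)))) \<longlonglongrightarrow> of_real (\<theta> t) * Nl t n"
        by (intro AE_I2 tendsto_mult_left lim) simp
      show "AE t in timeM T. norm (of_real (\<theta> t) * (\<Sum>k\<in>ball_modes N. \<i> * inter n (Z t k) (Z t (n - k)))) \<le> A * (?K * infsum (dom n) UNIV)" for N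
      proof (rule AE_I2)
        fix t assume "t \<in> space (timeM T)"
        then have t: "t \<in> {0..T}" by simp
        have "norm (\<Sum>k\<in>ball_modes N. \<i> * inter n (Z t k) (Z t (n - k))) \<le> (\<Sum>k\<in>ball_modes N. ?K * dom n k)"
          by (intro order_trans[OF norm_sum sum_mono] ni t)
        also have "\<dots> \<le> (\<Sum>\<^sub>\<infinity>k. ?K * dom n k)"
          by (intro finite_sum_le_infsum dK) (auto simp: dom_def)
        also have "\<dots> = ?K * infsum (dom n) UNIV" by (rule infsum_cmult_right')
        finally show "norm (of_real (\<theta> t) * (\<Sum>k\<in>ball_modes N. \<i> * inter n (Z t k) (Z t (n - k)))) \<le> A * (?K * infsum (dom n) UNIV)"
          unfolding norm_mult norm_of_real using A(2)[OF t] A(1) by (intro mult_mono) auto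
      qed
    qed simp
    moreover have "(\<integral>t. of_real (\<theta> t) * (\<Sum>k\<in>ball_modes N. \<i> * inter n (Z t k) (Z t (n - k))) \<partial>timeM T) = sum ?AZ (ball_modes N)" for N
    proof -
      have "(\<integral>t. of_real (\<theta> t) * (\<Sum>k\<in>ball_modes N. \<i> * inter n (Z t k) (Z t (n - k))) \<partial>timeM T)
          = (\<integral>t. (\<Sum>k\<in>ball_modes N. \<i> * of_real (\<theta> t) * inter n (Z t k) (Z t (n - k))) \<partial>timeM T)"
        by (simp add: sum_distrib_left ac_simps)
      also have "\<dots> = sum ?AZ (ball_modes N)"
        by (rule Bochner_Integration.integral_sum)
          (intro continuous_integrable_timeM continuous_intros thc inter_continuous Z_continuous)
      finally show ?thesis .
    qed
    moreover have "(\<lambda>N. sum ?AZ (ball_modes N)) \<longlonglongrightarrow> infsum ?AZ UNIV"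
      by (intro has_sum_ball_modes has_sum_infsum Z3)
    ultimately show ?thesis using LIMSEQ_unique by simp
  qed
  then show ?thesis using 3 by (simp add: algebra_simps)
qed

end

section \<open>Products of Fourier series\<close>

context torus begin

definition convol :: "(int^3 \<Rightarrow> complex) \<Rightarrow> (int^3 \<Rightarrow> complex) \<Rightarrow> int^3 \<Rightarrow> complex" where
  "convol f g n = (\<Sum>\<^sub>\<infinity>k. f k * g (n - k))"

lemma bij_shear: "bij (\<lambda>(n::int^3, k). (k, n - k))"
proof (rule bijI')
  show "\<exists>p. q = (case p of (n, k) \<Rightarrow> (k, n - k))" for q :: "(int^3) \<times> (int^3)"
    by (rule exI[of _ "(fst q + snd q, fst q)"]) simp
qed auto

text \<open>The absolutely convergent double series of the product, summed along the diagonals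
  \<open>k + m = n\<close>.\<close>

lemma convol_facts:
  assumes f: "l1 f" and g: "l1 g"
  shows "l1 (convol f g)" "l1norm (convol f g) \<le> l1norm f * l1norm g"
    "ser (convol f g) x = ser f x * ser g x" "(\<lambda>k. f k * g (n - k)) summable_on UNIV"
proof -
  have nf: "((\<lambda>k. norm (f k)) has_sum l1norm f) UNIV" and ng: "((\<lambda>k. norm (g k)) has_sum l1norm g) UNIV"
    using f g unfolding l1_def l1norm_def by (simp_all add: has_sum_infsum)
  have pos: "((\<lambda>(k, m). norm (f k) * norm (g m)) has_sum l1norm f * l1norm g) (UNIV \<times> UNIV)"
  proof (rule has_sum_SigmaI)
    show "((\<lambda>m. case (k, m) of (k, m) \<Rightarrow> norm (f k) * norm (g m)) has_sum norm (f k) * l1norm g) UNIV" for k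
      using has_sum_cmult_right[OF ng] by simp
    show "((\<lambda>k. norm (f k) * l1norm g) has_sum l1norm f * l1norm g) UNIV" by (rule has_sum_cmult_left[OF nf])
    show "(\<lambda>(k, m). norm (f k) * norm (g m)) summable_on UNIV \<times> UNIV"
      using summable_on_product[OF has_sum_imp_summable[OF nf] has_sum_imp_summable[OF ng]] by simp
  qed
  have sheared: "((\<lambda>(n, k). norm (f k) * norm (g (n - k))) has_sum l1norm f * l1norm g) (UNIV \<times> UNIV)"
    using has_sum_reindex_bij_betw[OF bij_shear, of "\<lambda>(k, m). norm (f k) * norm (g m)" "l1norm f * l1norm g"] pos
    by (simp add: case_prod_unfold)
  have abs: "(\<lambda>p. norm (case p of (n, k) \<Rightarrow> f k * g (n - k))) summable_on (UNIV \<times> UNIV)"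
    using has_sum_imp_summable[OF sheared] by (simp add: case_prod_unfold norm_mult)
  have absn: "(\<lambda>k. norm (f k * g (n - k))) summable_on UNIV" for n
    using summable_on_SigmaD1[OF has_sum_imp_summable[OF sheared], of n] by (simp add: norm_mult)
  then show "(\<lambda>k. f k * g (n - k)) summable_on UNIV" by (rule abs_summable_summable)
  have fib: "(\<lambda>n. \<Sum>\<^sub>\<infinity>k. norm (f k) * norm (g (n - k))) summable_on UNIV"
    using summable_on_Sigma_banach[of "\<lambda>n k. norm (f k) * norm (g (n - k))" UNIV "\<lambda>_. UNIV"] has_sum_imp_summable[OF sheared] by simp
  have tot: "(\<Sum>\<^sub>\<infinity>n. \<Sum>\<^sub>\<infinity>k. norm (f k) * norm (g (n - k))) = l1norm f * l1norm g"
    using infsum_Sigma'_banach[of "\<lambda>n k. norm (f k) * norm (g (n - k))" UNIV "\<lambda>_. UNIV"] has_sum_imp_summable[OF sheared] infsumI[OF sheared]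
    by simp
  have le: "norm (convol f g n) \<le> (\<Sum>\<^sub>\<infinity>k. norm (f k) * norm (g (n - k)))" for n
    using norm_infsum_bound[OF absn[of n]] by (simp add: convol_def norm_mult)
  show l: "l1 (convol f g)"
    unfolding l1_def by (rule summable_on_comparison_test[OF fib]) (use le in auto)
  show "l1norm (convol f g) \<le> l1norm f * l1norm g"
    unfolding l1norm_def tot[unfolded l1norm_def, symmetric] using l le fib unfolding l1_def by (intro infsum_mono) auto
  have p: "(\<lambda>(k, m). (f k * E k x) * (g m * E m x)) summable_on UNIV \<times> UNIV"
  proof (rule abs_summable_summable)
    show "(\<lambda>p. norm (case p of (k, m) \<Rightarrow> (f k * E k x) * (g m * E m x))) summable_on UNIV \<times> UNIV"
      using has_sum_imp_summable[OF pos] by (simp add: case_prod_unfold norm_mult)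
  qed
  have "ser f x * ser g x = (\<Sum>\<^sub>\<infinity>k. \<Sum>\<^sub>\<infinity>m. (f k * E k x) * (g m * E m x))"
    unfolding ser_def by (simp add: infsum_cmult_right' infsum_cmult_left')
  also have "\<dots> = (\<Sum>\<^sub>\<infinity>(k, m)\<in>UNIV \<times> UNIV. (f k * E k x) * (g m * E m x))"
    using infsum_Sigma'_banach[of "\<lambda>k m. (f k * E k x) * (g m * E m x)" UNIV "\<lambda>_. UNIV"] p by simp
  also have "\<dots> = (\<Sum>\<^sub>\<infinity>(n, k)\<in>UNIV \<times> UNIV. (f k * E k x) * (g (n - k) * E (n - k) x))"
    using infsum_reindex_bij_betw[OF bij_shear, of "\<lambda>(k, m). (f k * E k x) * (g m * E m x)"] by (simp add: case_prod_unfold)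
  also have "\<dots> = (\<Sum>\<^sub>\<infinity>(n, k)\<in>UNIV \<times> UNIV. f k * g (n - k) * E n x)"
  proof -
    have "E k x * E (n - k) x = E n x" for n k using E_add[of k "n - k" x] by simp
    then have "(f k * E k x) * (g (n - k) * E (n - k) x) = f k * g (n - k) * E n x" for n k
      by (metis (no_types, lifting) mult.assoc mult.commute)
    then show ?thesis by (simp only:)
  qed
  also have "\<dots> = (\<Sum>\<^sub>\<infinity>n. \<Sum>\<^sub>\<infinity>k. f k * g (n - k) * E n x)"
  proof -
    have "(\<lambda>(n, k). f k * g (n - k) * E n x) summable_on UNIV \<times> UNIV"
      by (rule abs_summable_summable) (use abs in \<open>simp add: case_prod_unfold norm_mult\<close>)
    then show ?thesis
      using infsum_Sigma'_banach[of "\<lambda>n k. f k * g (n - k) * E n x" UNIV "\<lambda>_. UNIV"] by simp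
  qed
  also have "\<dots> = ser (convol f g) x"
    by (simp add: ser_def convol_def infsum_cmult_left')
  finally show "ser (convol f g) x = ser f x * ser g x" ..
qed

lemma ser_add: "l1 f \<Longrightarrow> l1 g \<Longrightarrow> ser (\<lambda>n. f n + g n) x = ser f x + ser g x"
  using has_sum_add[OF ser_has_sum ser_has_sum, of f g x] by (simp add: ser_def distrib_right infsumI)

lemma l1_add: "l1 f \<Longrightarrow> l1 g \<Longrightarrow> l1 (\<lambda>n. f n + g n)" "l1 f \<Longrightarrow> l1 g \<Longrightarrow> l1norm (\<lambda>n. f n + g n) \<le> l1norm f + l1norm g"
proof -
  assume f: "l1 f" and g: "l1 g"
  have s: "(\<lambda>n. norm (f n) + norm (g n)) summable_on UNIV" using f g unfolding l1_def by (rule summable_on_add)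
  show 1: "l1 (\<lambda>n. f n + g n)" unfolding l1_def
    by (rule summable_on_comparison_test[OF s]) (auto intro: norm_triangle_ineq)
  have "l1norm (\<lambda>n. f n + g n) \<le> (\<Sum>\<^sub>\<infinity>n. norm (f n) + norm (g n))"
    unfolding l1norm_def using 1 s unfolding l1_def by (intro infsum_mono norm_triangle_ineq)
  also have "\<dots> = l1norm f + l1norm g" unfolding l1norm_def using f g unfolding l1_def by (rule infsum_add)
  finally show "l1norm (\<lambda>n. f n + g n) \<le> l1norm f + l1norm g" .
qed

lemma l1_mono:
  assumes f: "l1 f" and le: "\<And>n. norm (g n) \<le> K * norm (f n)"
  shows "l1 g" "l1norm g \<le> K * l1norm f"
proof -
  have s: "(\<lambda>n. K * norm (f n)) summable_on UNIV" using f unfolding l1_def by (rule summable_on_cmult_right)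
  show 1: "l1 g" unfolding l1_def by (rule summable_on_comparison_test[OF s]) (use le in auto)
  show "l1norm g \<le> K * l1norm f"
    unfolding l1norm_def infsum_cmult_right'[symmetric] using 1 s le unfolding l1_def by (intro infsum_mono)
qed

section \<open>Space-time fields with given modes\<close>

text \<open>For truncations it suffices that each mode is bounded and measurable in time; the uniform bound
  on the sum over the modes makes the series itself a bounded measurable function of space-time.\<close>

definition mode_family :: "real \<Rightarrow> (real \<Rightarrow> int^3 \<Rightarrow> complex) \<Rightarrow> bool" where
  "mode_family T c \<longleftrightarrow> (\<forall>n. (\<lambda>t. c t n) \<in> borel_measurable (timeM T) \<and> (\<exists>B. \<forall>t\<in>{0..T}. norm (c t n) \<le> B))"

definition l1_family :: "real \<Rightarrow> (real \<Rightarrow> int^3 \<Rightarrow> complex) \<Rightarrow> bool" where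
  "l1_family T c \<longleftrightarrow> (\<forall>n. (\<lambda>t. c t n) \<in> borel_measurable (timeM T)) \<and> (\<exists>B. \<forall>t\<in>{0..T}. l1 (c t) \<and> l1norm (c t) \<le> B)"

lemma l1_mode_le: "l1 c \<Longrightarrow> norm (c n) \<le> l1norm c"
  unfolding l1_def l1norm_def using finite_sum_le_infsum[of "\<lambda>n. norm (c n)" UNIV "{n}"] by simp

lemma l1_family_mode_family: "l1_family T c \<Longrightarrow> mode_family T c"
  unfolding mode_family_def
proof (intro allI conjI)
  fix n assume c: "l1_family T c"
  then show "(\<lambda>t. c t n) \<in> borel_measurable (timeM T)" by (simp add: l1_family_def)
  from c obtain B where B: "\<And>t. t \<in> {0..T} \<Longrightarrow> l1 (c t)" "\<And>t. t \<in> {0..T} \<Longrightarrow> l1norm (c t) \<le> B"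
    unfolding l1_family_def by blast
  have "norm (c t n) \<le> B" if t: "t \<in> {0..T}" for t
    using l1_mode_le[OF B(1)[OF t], of n] B(2)[OF t] by linarith
  then show "\<exists>B. \<forall>t\<in>{0..T}. norm (c t n) \<le> B" by blast
qed

definition trunc :: "(real \<Rightarrow> int^3 \<Rightarrow> complex) \<Rightarrow> nat \<Rightarrow> real \<Rightarrow> real^3 \<Rightarrow> real" where
  "trunc c N t x = Re (\<Sum>n\<in>ball_modes N. c t n * E n x)"

lemma mode_family_integrable:
  assumes c: "mode_family T c" shows "integrable (timeM T) (\<lambda>t. c t n)"
proof -
  obtain B where "\<And>t. t \<in> {0..T} \<Longrightarrow> norm (c t n) \<le> B" using c unfolding mode_family_def by blast
  then show ?thesis
    using c by (intro timeM.integrable_const_bound[where B=B] AE_I2) (auto simp: mode_family_def)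
qed

lemma mode_integrable:
  assumes c: "mode_family T c" shows "integrable (cylM T) (\<lambda>z. c (fst z) n * E n (snd z))"
proof -
  obtain B where B: "\<And>t. t \<in> {0..T} \<Longrightarrow> norm (c t n) \<le> B" using c unfolding mode_family_def by blast
  have [measurable]: "(\<lambda>z. c (fst z) n) \<in> borel_measurable (cylM T)"
    using c by (intro measurable_compose[OF fst_measurable_cyl]) (simp add: mode_family_def)
  show ?thesis
    by (rule cylM.integrable_const_bound[where B=B]) (use B in \<open>auto intro!: AE_I2 simp: norm_mult\<close>)
qed

lemma trunc_integrable:
  assumes c: "mode_family T c" shows "cyl_integrable T (trunc c N)"
  unfolding trunc_def by (intro integrable_Re Bochner_Integration.integrable_sum mode_integrable c)

lemma trunc_derivative:
  "((\<lambda>h. trunc c N t (x + h *\<^sub>R axis j 1)) has_vector_derivative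
     trunc (\<lambda>t n. \<i> * of_real (freq a n $ j) * c t n) N t (x + h *\<^sub>R axis j 1)) (at h)"
proof -
  have "((\<lambda>h. \<Sum>n\<in>ball_modes N. c t n * E n (x + h *\<^sub>R axis j 1)) has_vector_derivative
      (\<Sum>n\<in>ball_modes N. c t n * (\<i> * of_real (freq a n $ j) * E n (x + h *\<^sub>R axis j 1)))) (at h)"
    by (intro has_vector_derivative_sum has_vector_derivative_mult_right E_derivative)
  then have "((\<lambda>h. Re (\<Sum>n\<in>ball_modes N. c t n * E n (x + h *\<^sub>R axis j 1))) has_vector_derivative
      Re (\<Sum>n\<in>ball_modes N. c t n * (\<i> * of_real (freq a n $ j) * E n (x + h *\<^sub>R axis j 1)))) (at h)"
    by (rule bounded_linear.has_vector_derivative[OF bounded_linear_Re])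
  then show ?thesis by (simp add: trunc_def ac_simps)
qed

lemma continuous_trunc: "continuous_on S (trunc c N t)"
  unfolding trunc_def by (intro continuous_intros)

lemma periodic_trunc: "periodic a (trunc c N t)"
  using periodic_E by (simp add: periodic_def trunc_def)

lemma weak_dx_trunc:
  assumes c: "mode_family T c"
  shows "weak_dx a T j (trunc c N) (trunc (\<lambda>t n. \<i> * of_real (freq a n $ j) * c t n) N)"
proof -
  let ?d = "\<lambda>t n. \<i> * of_real (freq a n $ j) * c t n"
  have d: "mode_family T ?d"
    unfolding mode_family_def
  proof (intro allI conjI)
    fix n
    show "(\<lambda>t. ?d t n) \<in> borel_measurable (timeM T)"
      using c unfolding mode_family_def by (intro borel_measurable_times) auto
    obtain B where "\<And>t. t \<in> {0..T} \<Longrightarrow> norm (c t n) \<le> B" using c unfolding mode_family_def by blast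
    then show "\<exists>B. \<forall>t\<in>{0..T}. norm (?d t n) \<le> B"
      by (intro exI[of _ "\<bar>freq a n $ j\<bar> * B"]) (auto simp: norm_mult intro: mult_left_mono)
  qed
  show ?thesis
    unfolding weak_deriv_cyl
  proof (intro conjI allI impI trunc_integrable c d)
    fix \<phi> assume \<phi>: "test_function a T \<phi>"
    have sm: "smooth \<phi>" and per: "periodic a (\<lambda>x. \<phi> (t, x))" for t using \<phi> by (simp_all add: test_function_def)
    let ?\<phi>' = "\<lambda>z. frechet_derivative \<phi> (at z) (0, axis j 1)"
    note pc = smooth_continuous[OF sm] and pc' = smooth_continuous[OF smooth_partial[OF sm space_in_Basis[of j]]]
    have slice: "continuous_on UNIV (\<lambda>x. f (t, x))" if "continuous_on UNIV f" for f :: "real \<times> (real^3) \<Rightarrow> real" and t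
      by (rule continuous_on_compose2[OF that]) (auto intro!: continuous_intros)
    have i1: "integrable (cylM T) (\<lambda>z. ?\<phi>' z * trunc c N (fst z) (snd z))"
      by (rule test_mult_integrable[OF pc' trunc_integrable[OF c]])
    have i2: "integrable (cylM T) (\<lambda>z. \<phi> z * trunc ?d N (fst z) (snd z))"
      by (rule test_mult_integrable[OF pc trunc_integrable[OF d]])
    have "(\<integral>x. ?\<phi>' (t, x) * trunc c N t x \<partial>cellM) = - (\<integral>x. \<phi> (t, x) * trunc ?d N t x \<partial>cellM)" for t
    proof -
      have c1: "continuous_on UNIV (\<lambda>x. ?\<phi>' (t, x) * trunc c N t x)" and c2: "continuous_on UNIV (\<lambda>x. \<phi> (t, x) * trunc ?d N t x)"
        by (intro continuous_intros slice pc pc' continuous_trunc)+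
      have "(\<integral>x. ?\<phi>' (t, x) * trunc c N t x + \<phi> (t, x) * trunc ?d N t x \<partial>cellM) = 0"
      proof (rule integral_cell_partial[where g="\<lambda>x. \<phi> (t, x) * trunc c N t x" and j=j])
        show "periodic a (\<lambda>x. \<phi> (t, x) * trunc c N t x)"
          using per[of t] periodic_trunc[of c N t] by (simp add: periodic_def)
        show "continuous_on UNIV (\<lambda>x. \<phi> (t, x) * trunc c N t x)" by (intro continuous_intros slice pc continuous_trunc)
        show "continuous_on UNIV (\<lambda>x. ?\<phi>' (t, x) * trunc c N t x + \<phi> (t, x) * trunc ?d N t x)"
          by (intro continuous_on_add c1 c2)
        fix x h
        have "((\<phi> \<circ> (\<lambda>h. (t, x + h *\<^sub>R axis j 1))) has_derivative
            (frechet_derivative \<phi> (at (t, x + h *\<^sub>R axis j 1)) \<circ> (\<lambda>u. (0, u *\<^sub>R axis j 1)))) (at h)"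
          by (intro diff_chain_at smooth_has_derivative[OF sm]) (auto intro!: derivative_eq_intros)
        moreover have "frechet_derivative \<phi> (at z) (0, u *\<^sub>R axis j 1) = u * ?\<phi>' z" for z u
        proof -
          have "linear (frechet_derivative \<phi> (at z))" using smooth_has_derivative[OF sm] by (rule has_derivative_linear)
          from linear_scale[OF this, of u "(0, axis j 1)"] show ?thesis by simp
        qed
        ultimately have "((\<lambda>h. \<phi> (t, x + h *\<^sub>R axis j 1)) has_vector_derivative ?\<phi>' (t, x + h *\<^sub>R axis j 1)) (at h)"
          by (simp add: o_def has_vector_derivative_def)
        from has_vector_derivative_mult[OF this trunc_derivative]
        show "((\<lambda>h. \<phi> (t, x + h *\<^sub>R axis j 1) * trunc c N t (x + h *\<^sub>R axis j 1)) has_vector_derivative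
            ?\<phi>' (t, x + h *\<^sub>R axis j 1) * trunc c N t (x + h *\<^sub>R axis j 1) + \<phi> (t, x + h *\<^sub>R axis j 1) * trunc ?d N t (x + h *\<^sub>R axis j 1)) (at h)"
          by (simp add: add.commute)
      qed
      then show ?thesis
        using integrable_cell_continuous[OF c1] integrable_cell_continuous[OF c2] by simp
    qed
    then show "(\<integral>z. ?\<phi>' z *\<^sub>R trunc c N (fst z) (snd z) \<partial>cylM T) = - (\<integral>z. \<phi> z *\<^sub>R trunc ?d N (fst z) (snd z) \<partial>cylM T)"
      using fubini_cyl(1)[OF i1] fubini_cyl(1)[OF i2] by simp
  qed
qed

lemma integral_test_mode:
  assumes c: "mode_family T c" and f: "continuous_on UNIV (f :: real \<times> (real^3) \<Rightarrow> real)"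
  shows "(\<integral>z. of_real (f z) * (c (fst z) n * E n (snd z)) \<partial>cylM T) =
    (\<integral>t. of_real (\<integral>x. f (t, x) * cos (freq a n \<bullet> x) \<partial>cellM) * c t n \<partial>timeM T)
    + \<i> * (\<integral>t. of_real (\<integral>x. f (t, x) * sin (freq a n \<bullet> x) \<partial>cellM) * c t n \<partial>timeM T)"
    and "integrable (cylM T) (\<lambda>z. of_real (f z) * (c (fst z) n * E n (snd z)))"
proof -
  obtain B where B: "\<And>z. z \<in> space (cylM T) \<Longrightarrow> norm (f z) \<le> B" "0 \<le> B" "f \<in> borel_measurable (cylM T)"
    using test_bounded[OF f, where T=T] by metis
  have fm: "(\<lambda>z. complex_of_real (f z)) \<in> borel_measurable (cylM T)" using B(3) by measurable
  show i: "integrable (cylM T) (\<lambda>z. of_real (f z) * (c (fst z) n * E n (snd z)))"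
    by (rule integrable_bounded_mult[OF mode_integrable[OF c] fm, of B]) (use B(1) in simp)
  have slice: "continuous_on UNIV (\<lambda>x. f (t, x))" for t
    by (rule continuous_on_compose2[OF f]) (auto intro!: continuous_intros)
  have av: "continuous_on UNIV (\<lambda>t. \<integral>x. f (t, x) * q x \<partial>cellM)" if q: "continuous_on UNIV q" for q :: "real^3 \<Rightarrow> real"
  proof -
    have "continuous_on (UNIV \<times> cbox 0 ((2 * pi) *\<^sub>R a)) (\<lambda>z. f z * q (snd z))"
      by (intro continuous_intros continuous_on_subset[OF f] continuous_on_compose2[OF q]) auto
    then have "continuous_on UNIV (\<lambda>t. integral (cbox 0 ((2 * pi) *\<^sub>R a)) (\<lambda>x. f (t, x) * q x))"
      by (intro integral_continuous_on_param) (simp add: case_prod_unfold)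
    moreover have "(\<integral>x. f (t, x) * q x \<partial>cellM) = integral (cell a) (\<lambda>x. f (t, x) * q x)" for t
      by (intro integral_cell_HK continuous_intros slice q)
    ultimately show ?thesis by (simp add: cell_def)
  qed
  have icn: "integrable (timeM T) (\<lambda>t. of_real (\<integral>x. f (t, x) * q x \<partial>cellM) * c t n)" if q: "continuous_on UNIV q" for q :: "real^3 \<Rightarrow> real"
  proof -
    have qc: "continuous_on {0..T} (\<lambda>t. complex_of_real (\<integral>x. f (t, x) * q x \<partial>cellM))"
      by (intro continuous_on_of_real continuous_on_subset[OF av[OF q]] subset_UNIV)
    obtain D where "0 \<le> D" "\<And>t. t \<in> {0..T} \<Longrightarrow> norm (complex_of_real (\<integral>x. f (t, x) * q x \<partial>cellM)) \<le> D"
      using continuous_bounded[OF qc] by metis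
    then show ?thesis
      by (intro integrable_bounded_mult[OF mode_family_integrable[OF c] continuous_timeM[OF qc], of D]) auto
  qed
  have cc: "continuous_on UNIV (\<lambda>x. cos (freq a n \<bullet> x))" "continuous_on UNIV (\<lambda>x. sin (freq a n \<bullet> x))"
    by (intro continuous_intros)+
  have "(\<integral>x. of_real (f (t, x)) * (c t n * E n x) \<partial>cellM) =
      of_real (\<integral>x. f (t, x) * cos (freq a n \<bullet> x) \<partial>cellM) * c t n + \<i> * (of_real (\<integral>x. f (t, x) * sin (freq a n \<bullet> x) \<partial>cellM) * c t n)" for t
  proof -
    have k: "integrable cellM (\<lambda>x. complex_of_real (f (t, x) * cos (freq a n \<bullet> x)))" "integrable cellM (\<lambda>x. complex_of_real (f (t, x) * sin (freq a n \<bullet> x)))"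
      by (intro integrable_cell_continuous continuous_intros slice)+
    have "(\<integral>x. of_real (f (t, x)) * (c t n * E n x) \<partial>cellM) =
       (\<integral>x. c t n * of_real (f (t, x) * cos (freq a n \<bullet> x)) + (\<i> * c t n) * of_real (f (t, x) * sin (freq a n \<bullet> x)) \<partial>cellM)"
    proof (rule Bochner_Integration.integral_cong[OF refl])
      fix x
      have "E n x = of_real (cos (freq a n \<bullet> x)) + \<i> * of_real (sin (freq a n \<bullet> x))" by (simp add: complex_eq_iff)
      then show "of_real (f (t, x)) * (c t n * E n x) = c t n * of_real (f (t, x) * cos (freq a n \<bullet> x)) + (\<i> * c t n) * of_real (f (t, x) * sin (freq a n \<bullet> x))"
        by (simp add: algebra_simps)
    qed
    also have "\<dots> = c t n * (\<integral>x. complex_of_real (f (t, x) * cos (freq a n \<bullet> x)) \<partial>cellM) + (\<i> * c t n) * (\<integral>x. complex_of_real (f (t, x) * sin (freq a n \<bullet> x)) \<partial>cellM)"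
      using k by (subst Bochner_Integration.integral_add) (simp_all only: integrable_mult_right integral_mult_right_zero)
    finally show ?thesis by (simp only: integral_complex_of_real mult_ac)
  qed
  then have "(\<integral>z. of_real (f z) * (c (fst z) n * E n (snd z)) \<partial>cylM T) =
    (\<integral>t. of_real (\<integral>x. f (t, x) * cos (freq a n \<bullet> x) \<partial>cellM) * c t n + \<i> * (of_real (\<integral>x. f (t, x) * sin (freq a n \<bullet> x) \<partial>cellM) * c t n) \<partial>timeM T)"
    unfolding fubini_cyl(1)[OF i] by (simp only: fst_conv snd_conv)
  also have "\<dots> = (\<integral>t. of_real (\<integral>x. f (t, x) * cos (freq a n \<bullet> x) \<partial>cellM) * c t n \<partial>timeM T)
    + \<i> * (\<integral>t. of_real (\<integral>x. f (t, x) * sin (freq a n \<bullet> x) \<partial>cellM) * c t n \<partial>timeM T)"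
    using icn[OF cc(1)] icn[OF cc(2)] by (subst Bochner_Integration.integral_add) (simp_all only: integrable_mult_right integral_mult_right_zero)
  finally show "(\<integral>z. of_real (f z) * (c (fst z) n * E n (snd z)) \<partial>cylM T) =
    (\<integral>t. of_real (\<integral>x. f (t, x) * cos (freq a n \<bullet> x) \<partial>cellM) * c t n \<partial>timeM T)
    + \<i> * (\<integral>t. of_real (\<integral>x. f (t, x) * sin (freq a n \<bullet> x) \<partial>cellM) * c t n \<partial>timeM T)" .
qed

lemma integral_test_trunc:
  assumes c: "mode_family T c" and f: "continuous_on UNIV (f :: real \<times> (real^3) \<Rightarrow> real)"
  shows "(\<integral>z. f z * trunc c N (fst z) (snd z) \<partial>cylM T) =
     Re (\<Sum>n\<in>ball_modes N. \<integral>z. of_real (f z) * (c (fst z) n * E n (snd z)) \<partial>cylM T)"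
proof -
  note i = integral_test_mode(2)[OF c f]
  have "(\<integral>z. f z * trunc c N (fst z) (snd z) \<partial>cylM T) = (\<integral>z. Re (\<Sum>n\<in>ball_modes N. of_real (f z) * (c (fst z) n * E n (snd z))) \<partial>cylM T)"
    unfolding trunc_def by (rule Bochner_Integration.integral_cong[OF refl]) (simp add: sum_distrib_left[symmetric])
  also have "\<dots> = Re (\<integral>z. (\<Sum>n\<in>ball_modes N. of_real (f z) * (c (fst z) n * E n (snd z))) \<partial>cylM T)"
    by (rule integral_Re) (intro Bochner_Integration.integrable_sum i)
  also have "(\<integral>z. (\<Sum>n\<in>ball_modes N. of_real (f z) * (c (fst z) n * E n (snd z))) \<partial>cylM T) =
      (\<Sum>n\<in>ball_modes N. \<integral>z. of_real (f z) * (c (fst z) n * E n (snd z)) \<partial>cylM T)"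
    by (rule Bochner_Integration.integral_sum) (rule i)
  finally show ?thesis .
qed

text \<open>The average over the cell of a test function against a cosine or sine is a time test
  function, so the derivative in time may be taken mode by mode.\<close>

lemma weak_dt_trunc:
  assumes c: "mode_family T c" and d: "mode_family T d"
    and cd: "\<And>n \<theta>. time_test T \<theta> \<Longrightarrow> (\<integral>t. of_real (deriv \<theta> t) * c t n \<partial>timeM T) = - (\<integral>t. of_real (\<theta> t) * d t n \<partial>timeM T)"
  shows "weak_dt a T (trunc c N) (trunc d N)"
  unfolding weak_deriv_cyl
proof (intro conjI allI impI trunc_integrable c d)
  fix \<phi> assume \<phi>: "test_function a T \<phi>"
  have sm: "smooth \<phi>" using \<phi> by (simp add: test_function_def)
  note pc = smooth_continuous[OF sm] and pc' = smooth_continuous[OF smooth_partial[OF sm time_in_Basis]]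
  have cc: "continuous_on UNIV (\<lambda>x. cos (freq a n \<bullet> x))" "continuous_on UNIV (\<lambda>x. sin (freq a n \<bullet> x))" for n
    by (intro continuous_intros)+
  have "(\<integral>z. of_real (frechet_derivative \<phi> (at z) (1, 0)) * (c (fst z) n * E n (snd z)) \<partial>cylM T)
      = - (\<integral>z. of_real (\<phi> z) * (d (fst z) n * E n (snd z)) \<partial>cylM T)" for n
    unfolding integral_test_mode(1)[OF c pc'] integral_test_mode(1)[OF d pc]
    unfolding time_test_average(2)[OF \<phi> cc(1), symmetric] time_test_average(2)[OF \<phi> cc(2), symmetric]
      cd[OF time_test_average(1)[OF \<phi> cc(1)]] cd[OF time_test_average(1)[OF \<phi> cc(2)]] by simp
  then show "(\<integral>z. frechet_derivative \<phi> (at z) (1, 0) *\<^sub>R trunc c N (fst z) (snd z) \<partial>cylM T) = - (\<integral>z. \<phi> z *\<^sub>R trunc d N (fst z) (snd z) \<partial>cylM T)"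
    unfolding real_scaleR_def integral_test_trunc[OF c pc'] integral_test_trunc[OF d pc] by (simp add: sum_negf)
qed

subsection \<open>Limits in the mean\<close>

text \<open>Convergence in \<open>L\<^sup>1\<close> of space-time, under which weak derivatives
  are closed.\<close>

definition mean_limit :: "real \<Rightarrow> (nat \<Rightarrow> real \<Rightarrow> real^3 \<Rightarrow> real) \<Rightarrow> (real \<Rightarrow> real^3 \<Rightarrow> real) \<Rightarrow> bool" where
  "mean_limit T f g \<longleftrightarrow> (\<forall>N. cyl_integrable T (f N)) \<and> cyl_integrable T g \<and>
     (\<lambda>N. \<integral>z. \<bar>f N (fst z) (snd z) - g (fst z) (snd z)\<bar> \<partial>cylM T) \<longlonglongrightarrow> 0"

lemma mean_limit_integral:
  assumes m: "mean_limit T f g" and \<phi>: "continuous_on UNIV \<phi>"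
  shows "(\<lambda>N. \<integral>z. \<phi> z * f N (fst z) (snd z) \<partial>cylM T) \<longlonglongrightarrow> (\<integral>z. \<phi> z * g (fst z) (snd z) \<partial>cylM T)"
proof -
  obtain B where B: "\<And>z. z \<in> space (cylM T) \<Longrightarrow> norm (\<phi> z) \<le> B" "0 \<le> B" "\<phi> \<in> borel_measurable (cylM T)"
    using test_bounded[OF \<phi>, where T=T] by metis
  have f: "cyl_integrable T (f N)" and g: "cyl_integrable T g" for N using m by (simp_all add: mean_limit_def)
  have i: "integrable (cylM T) (\<lambda>z. \<phi> z * q z)" if "integrable (cylM T) q" for q
    by (rule test_mult_integrable[OF \<phi> that])
  have "(\<lambda>N. (\<integral>z. \<phi> z * f N (fst z) (snd z) \<partial>cylM T) - (\<integral>z. \<phi> z * g (fst z) (snd z) \<partial>cylM T)) \<longlonglongrightarrow> 0"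
  proof (rule Lim_null_comparison)
    show "(\<lambda>N. B * (\<integral>z. \<bar>f N (fst z) (snd z) - g (fst z) (snd z)\<bar> \<partial>cylM T)) \<longlonglongrightarrow> 0"
      using m tendsto_mult_right_zero by (auto simp: mean_limit_def)
    show "\<forall>\<^sub>F N in sequentially. norm ((\<integral>z. \<phi> z * f N (fst z) (snd z) \<partial>cylM T) - (\<integral>z. \<phi> z * g (fst z) (snd z) \<partial>cylM T))
        \<le> B * (\<integral>z. \<bar>f N (fst z) (snd z) - g (fst z) (snd z)\<bar> \<partial>cylM T)"
    proof (rule always_eventually, rule allI)
      fix N
      have fg: "integrable (cylM T) (\<lambda>z. f N (fst z) (snd z) - g (fst z) (snd z))" using f g by simp
      have "(\<integral>z. \<phi> z * f N (fst z) (snd z) \<partial>cylM T) - (\<integral>z. \<phi> z * g (fst z) (snd z) \<partial>cylM T)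
          = (\<integral>z. \<phi> z * (f N (fst z) (snd z) - g (fst z) (snd z)) \<partial>cylM T)"
        using i[OF f[of N]] i[OF g] by (simp add: right_diff_distrib)
      then have "norm ((\<integral>z. \<phi> z * f N (fst z) (snd z) \<partial>cylM T) - (\<integral>z. \<phi> z * g (fst z) (snd z) \<partial>cylM T))
          \<le> (\<integral>z. norm (\<phi> z * (f N (fst z) (snd z) - g (fst z) (snd z))) \<partial>cylM T)"
        by (simp only: integral_norm_bound)
      also have "\<dots> \<le> (\<integral>z. B * \<bar>f N (fst z) (snd z) - g (fst z) (snd z)\<bar> \<partial>cylM T)"
      proof (rule integral_mono)
        show "integrable (cylM T) (\<lambda>z. norm (\<phi> z * (f N (fst z) (snd z) - g (fst z) (snd z))))"
          by (rule integrable_norm[OF i[OF fg]])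
        show "integrable (cylM T) (\<lambda>z. B * \<bar>f N (fst z) (snd z) - g (fst z) (snd z)\<bar>)"
          by (intro integrable_mult_right integrable_abs fg)
        show "norm (\<phi> z * (f N (fst z) (snd z) - g (fst z) (snd z))) \<le> B * \<bar>f N (fst z) (snd z) - g (fst z) (snd z)\<bar>"
          if "z \<in> space (cylM T)" for z
          using mult_right_mono[OF B(1)[OF that] abs_ge_zero] by (simp add: abs_mult)
      qed
      finally show "norm ((\<integral>z. \<phi> z * f N (fst z) (snd z) \<partial>cylM T) - (\<integral>z. \<phi> z * g (fst z) (snd z) \<partial>cylM T))
        \<le> B * (\<integral>z. \<bar>f N (fst z) (snd z) - g (fst z) (snd z)\<bar> \<partial>cylM T)" by simp
    qed
  qed
  then show ?thesis by (simp add: LIM_zero_iff)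
qed

lemma weak_deriv_mean_limit:
  assumes f: "mean_limit T fN f" and g: "mean_limit T gN g" and w: "\<And>N. weak_deriv a T b (fN N) (gN N)" and b: "b \<in> Basis"
  shows "weak_deriv a T b f g"
  unfolding weak_deriv_cyl
proof (intro conjI allI impI)
  show "cyl_integrable T f" "cyl_integrable T g" using f g by (simp_all add: mean_limit_def)
  fix \<phi> assume \<phi>: "test_function a T \<phi>"
  have sm: "smooth \<phi>" using \<phi> by (simp add: test_function_def)
  have 1: "(\<lambda>N. \<integral>z. frechet_derivative \<phi> (at z) b * fN N (fst z) (snd z) \<partial>cylM T) \<longlonglongrightarrow> (\<integral>z. frechet_derivative \<phi> (at z) b * f (fst z) (snd z) \<partial>cylM T)"
    by (rule mean_limit_integral[OF f smooth_continuous[OF smooth_partial[OF sm b]]])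
  have 2: "(\<lambda>N. - (\<integral>z. \<phi> z * gN N (fst z) (snd z) \<partial>cylM T)) \<longlonglongrightarrow> - (\<integral>z. \<phi> z * g (fst z) (snd z) \<partial>cylM T)"
    by (intro tendsto_minus mean_limit_integral[OF g smooth_continuous[OF sm]])
  have "(\<integral>z. frechet_derivative \<phi> (at z) b * fN N (fst z) (snd z) \<partial>cylM T) = - (\<integral>z. \<phi> z * gN N (fst z) (snd z) \<partial>cylM T)" for N
    using weak_deriv_test[OF w[of N] \<phi>] by simp
  with 1 2 show "(\<integral>z. frechet_derivative \<phi> (at z) b *\<^sub>R f (fst z) (snd z) \<partial>cylM T) = - (\<integral>z. \<phi> z *\<^sub>R g (fst z) (snd z) \<partial>cylM T)"
    by (simp add: LIMSEQ_unique)
qed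

lemma mean_limit_add:
  assumes f: "mean_limit T fN f" and g: "mean_limit T gN g"
  shows "mean_limit T (\<lambda>N t x. r * fN N t x + q * gN N t x) (\<lambda>t x. r * f t x + q * g t x)"
proof -
  have iN: "cyl_integrable T (fN N)" "cyl_integrable T (gN N)" for N
    using f g by (simp_all add: mean_limit_def)
  have i: "cyl_integrable T f" "cyl_integrable T g"
    using f g by (simp_all add: mean_limit_def)
  have i': "integrable (cylM T) (\<lambda>z. \<bar>fN N (fst z) (snd z) - f (fst z) (snd z)\<bar>)" "integrable (cylM T) (\<lambda>z. \<bar>gN N (fst z) (snd z) - g (fst z) (snd z)\<bar>)" for N
    by (intro integrable_abs Bochner_Integration.integrable_diff iN i)+
  have "(\<lambda>N. \<integral>z. \<bar>(r * fN N (fst z) (snd z) + q * gN N (fst z) (snd z)) - (r * f (fst z) (snd z) + q * g (fst z) (snd z))\<bar> \<partial>cylM T) \<longlonglongrightarrow> 0"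
  proof (rule Lim_null_comparison)
    have "(\<lambda>N. \<bar>r\<bar> * (\<integral>z. \<bar>fN N (fst z) (snd z) - f (fst z) (snd z)\<bar> \<partial>cylM T) + \<bar>q\<bar> * (\<integral>z. \<bar>gN N (fst z) (snd z) - g (fst z) (snd z)\<bar> \<partial>cylM T))
        \<longlonglongrightarrow> \<bar>r\<bar> * 0 + \<bar>q\<bar> * 0"
      using f g unfolding mean_limit_def by (intro tendsto_add tendsto_mult_left) auto
    then show "(\<lambda>N. \<bar>r\<bar> * (\<integral>z. \<bar>fN N (fst z) (snd z) - f (fst z) (snd z)\<bar> \<partial>cylM T) + \<bar>q\<bar> * (\<integral>z. \<bar>gN N (fst z) (snd z) - g (fst z) (snd z)\<bar> \<partial>cylM T)) \<longlonglongrightarrow> 0" by simp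
    show "\<forall>\<^sub>F N in sequentially. norm (\<integral>z. \<bar>(r * fN N (fst z) (snd z) + q * gN N (fst z) (snd z)) - (r * f (fst z) (snd z) + q * g (fst z) (snd z))\<bar> \<partial>cylM T)
       \<le> \<bar>r\<bar> * (\<integral>z. \<bar>fN N (fst z) (snd z) - f (fst z) (snd z)\<bar> \<partial>cylM T) + \<bar>q\<bar> * (\<integral>z. \<bar>gN N (fst z) (snd z) - g (fst z) (snd z)\<bar> \<partial>cylM T)"
    proof (rule always_eventually, rule allI)
      fix N
      have "norm (\<integral>z. \<bar>(r * fN N (fst z) (snd z) + q * gN N (fst z) (snd z)) - (r * f (fst z) (snd z) + q * g (fst z) (snd z))\<bar> \<partial>cylM T)
          \<le> (\<integral>z. \<bar>r\<bar> * \<bar>fN N (fst z) (snd z) - f (fst z) (snd z)\<bar> + \<bar>q\<bar> * \<bar>gN N (fst z) (snd z) - g (fst z) (snd z)\<bar> \<partial>cylM T)"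
      proof (rule order_trans[OF integral_norm_bound integral_mono])
        show "integrable (cylM T) (\<lambda>z. norm \<bar>(r * fN N (fst z) (snd z) + q * gN N (fst z) (snd z)) - (r * f (fst z) (snd z) + q * g (fst z) (snd z))\<bar>)"
          using iN[of N] i by (intro integrable_norm integrable_abs) auto
        show "integrable (cylM T) (\<lambda>z. \<bar>r\<bar> * \<bar>fN N (fst z) (snd z) - f (fst z) (snd z)\<bar> + \<bar>q\<bar> * \<bar>gN N (fst z) (snd z) - g (fst z) (snd z)\<bar>)"
          using i'(1)[of N] i'(2)[of N] by auto
        fix z
        have "(r * fN N (fst z) (snd z) + q * gN N (fst z) (snd z)) - (r * f (fst z) (snd z) + q * g (fst z) (snd z)) =
           r * (fN N (fst z) (snd z) - f (fst z) (snd z)) + q * (gN N (fst z) (snd z) - g (fst z) (snd z))" by (simp add: algebra_simps)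
        then show "norm \<bar>(r * fN N (fst z) (snd z) + q * gN N (fst z) (snd z)) - (r * f (fst z) (snd z) + q * g (fst z) (snd z))\<bar>
           \<le> \<bar>r\<bar> * \<bar>fN N (fst z) (snd z) - f (fst z) (snd z)\<bar> + \<bar>q\<bar> * \<bar>gN N (fst z) (snd z) - g (fst z) (snd z)\<bar>"
          by (simp add: abs_mult[symmetric] abs_triangle_ineq)
      qed
      also have "\<dots> = \<bar>r\<bar> * (\<integral>z. \<bar>fN N (fst z) (snd z) - f (fst z) (snd z)\<bar> \<partial>cylM T) + \<bar>q\<bar> * (\<integral>z. \<bar>gN N (fst z) (snd z) - g (fst z) (snd z)\<bar> \<partial>cylM T)"
        using i'(1)[of N] i'(2)[of N] by simp
      finally show "norm (\<integral>z. \<bar>(r * fN N (fst z) (snd z) + q * gN N (fst z) (snd z)) - (r * f (fst z) (snd z) + q * g (fst z) (snd z))\<bar> \<partial>cylM T)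
       \<le> \<bar>r\<bar> * (\<integral>z. \<bar>fN N (fst z) (snd z) - f (fst z) (snd z)\<bar> \<partial>cylM T) + \<bar>q\<bar> * (\<integral>z. \<bar>gN N (fst z) (snd z) - g (fst z) (snd z)\<bar> \<partial>cylM T)" .
    qed
  qed
  then show ?thesis unfolding mean_limit_def using i iN by auto
qed

lemma mean_limit_l1_family:
  assumes c: "l1_family T c" shows "mean_limit T (trunc c) (\<lambda>t x. Re (ser (c t) x))"
proof -
  obtain B where B: "\<And>t. t \<in> {0..T} \<Longrightarrow> l1 (c t)" "\<And>t. t \<in> {0..T} \<Longrightarrow> l1norm (c t) \<le> B"
    using c unfolding l1_family_def by blast
  have m: "(\<lambda>z. ser (c (fst z)) (snd z)) \<in> borel_measurable (cylM T)"
    using c by (intro ser_cyl_measurable B(1)) (auto simp: l1_family_def)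
  have sb: "\<bar>Re (ser (c t) x)\<bar> \<le> B" if t: "t \<in> {0..T}" for t x
    using norm_ser[OF B(1)[OF t], of x] B(2)[OF t] abs_Re_le_cmod[of "ser (c t) x"] by linarith
  have tb: "\<bar>trunc c N t x\<bar> \<le> B" if t: "t \<in> {0..T}" for N t x
    unfolding trunc_def
    using norm_partial_ser[OF B(1)[OF t] finite_ball_modes[of N], of x] B(2)[OF t]
      abs_Re_le_cmod[of "\<Sum>n\<in>ball_modes N. c t n * E n x"] by linarith
  have i: "cyl_integrable T (trunc c N)" for N by (rule trunc_integrable[OF l1_family_mode_family[OF c]])
  have g: "cyl_integrable T (\<lambda>t x. Re (ser (c t) x))"
  proof (rule cylM.integrable_const_bound[where B=B])
    show "(\<lambda>z. Re (ser (c (fst z)) (snd z))) \<in> borel_measurable (cylM T)" using m by measurable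
    show "AE z in cylM T. norm (Re (ser (c (fst z)) (snd z))) \<le> B"
      using sb by (intro AE_I2) auto
  qed
  have "(\<lambda>N. \<integral>z. \<bar>trunc c N (fst z) (snd z) - Re (ser (c (fst z)) (snd z))\<bar> \<partial>cylM T) \<longlonglongrightarrow> (\<integral>z. 0 \<partial>cylM T)"
  proof (rule integral_dominated_convergence[where w="\<lambda>_. 2 * B"])
    show "(\<lambda>z. \<bar>trunc c N (fst z) (snd z) - Re (ser (c (fst z)) (snd z))\<bar>) \<in> borel_measurable (cylM T)" for N
      using i[of N] g by auto
    show "AE z in cylM T. (\<lambda>N. \<bar>trunc c N (fst z) (snd z) - Re (ser (c (fst z)) (snd z))\<bar>) \<longlonglongrightarrow> 0"
    proof (rule AE_I2)
      fix z assume "z \<in> space (cylM T)"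
      then have "(\<lambda>N. trunc c N (fst z) (snd z)) \<longlonglongrightarrow> Re (ser (c (fst z)) (snd z))"
        unfolding trunc_def by (intro tendsto_Re ser_tendsto B(1)) auto
      then show "(\<lambda>N. \<bar>trunc c N (fst z) (snd z) - Re (ser (c (fst z)) (snd z))\<bar>) \<longlonglongrightarrow> 0"
        by (intro tendsto_rabs_zero LIM_zero)
    qed
    show "AE z in cylM T. norm \<bar>trunc c N (fst z) (snd z) - Re (ser (c (fst z)) (snd z))\<bar> \<le> 2 * B" for N
    proof (rule AE_I2)
      fix z assume "z \<in> space (cylM T)"
      then have t: "fst z \<in> {0..T}" by auto
      show "norm \<bar>trunc c N (fst z) (snd z) - Re (ser (c (fst z)) (snd z))\<bar> \<le> 2 * B"
        using sb[OF t, of "snd z"] tb[OF t, of N "snd z"] by simp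
    qed
  qed auto
  then show ?thesis unfolding mean_limit_def using i g by simp
qed

end

section \<open>Horizontal averages\<close>

definition join3 :: "(real^2) \<times> real \<Rightarrow> real^3" where "join3 p = vector [fst p $ 1, fst p $ 2, snd p]"

lemma join3_nth: "join3 p $ 1 = fst p $ 1" "join3 p $ 2 = fst p $ 2" "join3 p $ 3 = snd p"
  by (simp_all add: join3_def)

lemma continuous_join3: "continuous_on S join3"
proof -
  have eq: "join3 = (\<lambda>p. \<chi> i. if i = 1 then fst p $ 1 else if i = 2 then fst p $ 2 else snd p)"
    by (simp add: fun_eq_iff vec_eq_iff forall_3 join3_nth)
  have "continuous_on S (\<lambda>p::(real^2) \<times> real. if i = 1 then fst p $ 1 else if i = 2 then fst p $ 2 else snd p)" for i :: 3
    using exhaust_3[of i] by (auto intro!: continuous_intros)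
  then have "continuous_on S (\<lambda>p::(real^2) \<times> real. \<chi> i::3. if i = 1 then fst p $ 1 else if i = 2 then fst p $ 2 else snd p)"
    by (intro continuous_on_vec_lambda)
  then show ?thesis by (rule back_subst[where P="continuous_on S", OF _ eq[symmetric]])
qed

lemma join3_measurable [measurable]: "join3 \<in> borel_measurable borel"
  by (rule borel_measurable_continuous_onI[OF continuous_join3])

lemma prod_Basis_cart: "(\<Prod>b\<in>(Basis :: (real^'n) set). f b) = (\<Prod>i\<in>UNIV. f (axis i 1))"
proof -
  have "(Basis :: (real^'n) set) = range (\<lambda>i. axis i 1)" by (auto simp: Basis_vec_def)
  moreover have "inj (\<lambda>i. axis i (1::real) :: real^'n)" by (simp add: inj_on_def axis_eq_axis)
  ultimately show ?thesis by (metis (no_types, lifting) prod.reindex_cong)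
qed

lemma prod_2: "prod f (UNIV :: 2 set) = f 1 * f 2" for f :: "2 \<Rightarrow> 'b::comm_monoid_mult"
  unfolding UNIV_2 by simp

lemma distr_join3: "distr lborel borel join3 = lborel"
proof (rule lborel_eqI[symmetric])
  show "sets (distr lborel borel join3) = sets borel" by simp
  fix l u :: "real^3" assume le: "\<And>b. b \<in> Basis \<Longrightarrow> l \<bullet> b \<le> u \<bullet> b"
  have lu: "l $ i \<le> u $ i" for i using le[of "axis i 1"] by (simp add: inner_axis axis_in_Basis_iff)
  let ?l = "vector [l$1, l$2] :: real^2" and ?u = "vector [u$1, u$2] :: real^2"
  have pre: "join3 -` box l u = box ?l ?u \<times> box (l$3) (u$3)"
    by (auto simp: mem_box_cart forall_3 forall_2 join3_nth)
  have "emeasure (distr lborel borel join3) (box l u) = emeasure lborel (box ?l ?u \<times> box (l$3) (u$3))"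
    using pre by (subst emeasure_distr) auto
  also have "\<dots> = emeasure (lborel \<Otimes>\<^sub>M lborel) (box ?l ?u \<times> box (l$3) (u$3))" by (simp add: lborel_prod)
  also have "\<dots> = emeasure lborel (box ?l ?u) * emeasure lborel (box (l$3) (u$3))"
    by (intro lborel.emeasure_pair_measure_Times) auto
  also have "emeasure lborel (box ?l ?u) = ennreal (\<Prod>b\<in>Basis. (?u - ?l) \<bullet> b)"
  proof (rule emeasure_lborel_box)
    fix b :: "real^2" assume "b \<in> Basis"
    then obtain i where "b = axis i 1" by (auto simp: Basis_vec_def)
    then show "?l \<bullet> b \<le> ?u \<bullet> b" using lu exhaust_2[of i] by (auto simp: inner_axis)
  qed
  also have "(\<Prod>b\<in>Basis. (?u - ?l) \<bullet> b) = (u$1 - l$1) * (u$2 - l$2)"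
    unfolding prod_Basis_cart prod_2 by (simp add: inner_axis)
  also have "emeasure lborel (box (l$3) (u$3)) = ennreal (u$3 - l$3)"
    using lu[of 3] by (simp add: box_real)
  also have "ennreal ((u$1 - l$1) * (u$2 - l$2)) * ennreal (u$3 - l$3) = ennreal ((u$1 - l$1) * (u$2 - l$2) * (u$3 - l$3))"
    using lu by (intro ennreal_mult[symmetric]) auto
  also have "(u$1 - l$1) * (u$2 - l$2) * (u$3 - l$3) = (\<Prod>b\<in>Basis. (u - l) \<bullet> b)"
    unfolding prod_Basis_cart prod_3 by (simp add: inner_axis)
  finally show "emeasure (distr lborel borel join3) (box l u) = (\<Prod>b\<in>Basis. (u - l) \<bullet> b)" .
qed

context torus begin

definition sect :: "(real^2) set" where "sect = cbox 0 (vector [2 * pi * a$1, 2 * pi * a$2])"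
definition sectM :: "(real^2) measure" where "sectM = restrict_space lborel sect"

abbreviation height :: real where "height \<equiv> 2 * pi * a$3"

lemma sect_sets [measurable]: "sect \<in> sets borel" by (simp add: sect_def)

lemma space_sectM [simp]: "space sectM = sect" by (simp add: sectM_def space_restrict_space)

lemma cell_join3: "join3 p \<in> cell a \<longleftrightarrow> p \<in> sect \<times> {0..height}"
  by (cases p) (auto simp: mem_cell sect_def mem_box_cart forall_3 forall_2 join3_nth)

lemma sect_measure: "emeasure lborel sect = ennreal (4 * pi\<^sup>2 * a$1 * a$2)"
proof -
  have ne: "cbox 0 (vector [2 * pi * a$1, 2 * pi * a$2] :: real^2) \<noteq> {}"
    using side_pos by (auto simp: interval_ne_empty_cart forall_2 less_imp_le)
  have "measure lborel sect = (\<Prod>i\<in>UNIV. vector [2 * pi * a$1, 2 * pi * a$2] $ (i::2))"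
    unfolding sect_def using content_cbox_cart[OF ne] by simp
  also have "\<dots> = 4 * pi\<^sup>2 * a$1 * a$2" unfolding prod_2 by (simp add: power2_eq_square)
  finally show ?thesis
    by (metis sect_def emeasure_eq_ennreal_measure emeasure_lborel_cbox_finite infinity_ennreal_def less_irrefl)
qed

sublocale sectM: finite_measure sectM
  by standard (simp add: sectM_def emeasure_restrict_space sect_measure space_restrict_space)

lemma measure_sectM [simp]: "measure sectM sect = 4 * pi\<^sup>2 * a$1 * a$2"
  using side_pos[of 1] side_pos[of 2] by (simp add: sectM_def measure_def emeasure_restrict_space sect_measure)

sublocale sz: pair_sigma_finite sectM "timeM height" by unfold_locales

lemma pair_restrict: "sectM \<Otimes>\<^sub>M timeM height = restrict_space lborel (sect \<times> {0..height})"
  unfolding sectM_def timeM_def by (rule restrict_pair) auto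

lemma join3_cell_measurable: "join3 \<in> sectM \<Otimes>\<^sub>M timeM height \<rightarrow>\<^sub>M cellM"
  unfolding pair_restrict cellM_def
  by (intro measurable_restrict_space3) (auto simp: cell_join3)

lemma cellM_distr: "cellM = distr (sectM \<Otimes>\<^sub>M timeM height) cellM join3"
proof (rule measure_eqI)
  fix A assume A: "A \<in> sets cellM"
  then have A': "A \<in> sets borel" "A \<subseteq> cell a" by (auto simp: cellM_def sets_restrict_space)
  have St: "sect \<times> {0..height} \<in> sets borel"
    by (intro borel_closed closed_Times closed_atLeastAtMost) (simp add: sect_def closed_cbox)
  have sub: "join3 -` A \<subseteq> sect \<times> {0..height}" using A'(2) cell_join3 by blast
  have "emeasure (distr (sectM \<Otimes>\<^sub>M timeM height) cellM join3) A = emeasure (sectM \<Otimes>\<^sub>M timeM height) (join3 -` A \<inter> space (sectM \<Otimes>\<^sub>M timeM height))"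
    by (rule emeasure_distr[OF join3_cell_measurable A])
  also have "join3 -` A \<inter> space (sectM \<Otimes>\<^sub>M timeM height) = join3 -` A" using sub by (auto simp: space_pair_measure)
  also have "emeasure (sectM \<Otimes>\<^sub>M timeM height) (join3 -` A) = emeasure lborel (join3 -` A)"
    unfolding pair_restrict by (rule emeasure_restrict_space) (use sub St in auto)
  also have "\<dots> = emeasure (distr lborel borel join3) A" using A'(1) by (subst emeasure_distr) auto
  also have "\<dots> = emeasure lborel A" by (simp add: distr_join3)
  also have "\<dots> = emeasure cellM A" using A' unfolding cellM_def by (subst emeasure_restrict_space) auto
  finally show "emeasure cellM A = emeasure (distr (sectM \<Otimes>\<^sub>M timeM height) cellM join3) A" ..
qed simp

lemma integrable_join3:
  fixes f :: "real^3 \<Rightarrow> 'b::{banach, second_countable_topology}"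
  assumes "integrable cellM f"
  shows "integrable (sectM \<Otimes>\<^sub>M timeM height) (\<lambda>p. f (join3 p))"
    and "integral\<^sup>L cellM f = (\<integral>z. (\<integral>y. f (join3 (y, z)) \<partial>sectM) \<partial>timeM height)"
    and "integrable (timeM height) (\<lambda>z. \<integral>y. f (join3 (y, z)) \<partial>sectM)"
    and "AE z in timeM height. integrable sectM (\<lambda>y. f (join3 (y, z)))"
proof -
  have f: "f \<in> borel_measurable cellM" using assms by simp
  show i: "integrable (sectM \<Otimes>\<^sub>M timeM height) (\<lambda>p. f (join3 p))"
    using assms integrable_distr_eq[OF join3_cell_measurable f] cellM_distr by metis
  then have i': "integrable (sectM \<Otimes>\<^sub>M timeM height) (\<lambda>(y, z). f (join3 (y, z)))" by (simp add: case_prod_unfold)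
  have "integral\<^sup>L cellM f = (\<integral>p. f (join3 p) \<partial>(sectM \<Otimes>\<^sub>M timeM height))"
    using integral_distr[OF join3_cell_measurable f] cellM_distr by metis
  then show "integral\<^sup>L cellM f = (\<integral>z. (\<integral>y. f (join3 (y, z)) \<partial>sectM) \<partial>timeM height)"
    using sz.integral_snd[OF i'] by (simp add: case_prod_unfold)
  show "integrable (timeM height) (\<lambda>z. \<integral>y. f (join3 (y, z)) \<partial>sectM)" by (rule sz.integrable_snd[OF i'])
  show "AE z in timeM height. integrable sectM (\<lambda>y. f (join3 (y, z)))" using sz.AE_integrable_snd[OF i'] by simp
qed

lemma integral_join3:
  fixes f :: "real^3 \<Rightarrow> 'b::{banach, second_countable_topology}"
  assumes f: "f \<in> borel_measurable cellM" and i: "integrable (sectM \<Otimes>\<^sub>M timeM height) (\<lambda>p. f (join3 p))"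
  shows "integrable cellM f"
  using i integrable_distr_eq[OF join3_cell_measurable f] cellM_distr by metis

lemma hor_average_sectM:
  "hor_average a g z = (1 / (4 * pi\<^sup>2 * a$1 * a$2)) *\<^sub>R (\<integral>y. g (join3 (y, z)) \<partial>sectM)"
  by (simp add: hor_average_def sect_def[symmetric] join3_def sectM_def integral_restrict_space set_lebesgue_integral_def)

lemma E_join3: "E n (join3 (y, z)) = cis (freq a n $ 1 * y $ 1 + freq a n $ 2 * y $ 2) * cis (freq a n $ 3 * z)"
  by (simp add: inner_vec_def sum_3 join3_nth cis_mult)

lemma horizontal_integral:
  "(\<integral>y. cis (freq a n $ 1 * y $ 1 + freq a n $ 2 * y $ 2) \<partial>sectM) = (if horizontal n then 0 else of_real (4 * pi\<^sup>2 * a$1 * a$2))"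
proof (cases "horizontal n")
  case False
  then show ?thesis by (simp add: horizontal_def freq_nth scaleR_conv_of_real)
next
  case True
  define m :: "int^3" where "m = vector [n$1, n$2, 0]"
  have m0: "m \<noteq> 0" using True by (auto simp: m_def horizontal_def vec_eq_iff forall_3)
  have fm: "freq a m $ 1 = freq a n $ 1" "freq a m $ 2 = freq a n $ 2" "freq a m $ 3 = 0"
    by (simp_all add: m_def freq_nth)
  have "0 = integral\<^sup>L cellM (E m)" using m0 by (simp add: integral_E)
  also have "\<dots> = (\<integral>z. (\<integral>y. cis (freq a n $ 1 * y $ 1 + freq a n $ 2 * y $ 2) \<partial>sectM) \<partial>timeM height)"
    using integrable_join3(2)[OF integrable_cell_continuous[OF continuous_E[of UNIV m]]] by (simp add: E_join3 fm)
  also have "\<dots> = of_real height * (\<integral>y. cis (freq a n $ 1 * y $ 1 + freq a n $ 2 * y $ 2) \<partial>sectM)"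
    using side_pos[of 3] by (simp add: timeM_def measure_restrict_space scaleR_conv_of_real)
  finally show ?thesis using True side_pos[of 3] by simp
qed

text \<open>By Fubini, averaging over the horizontal cell annihilates every character with
  horizontal wave vector and fixes the others; completeness then identifies the average with its
  series.\<close>

lemma hor_average_modes:
  assumes g: "g \<in> sobolev a \<sigma>" and l: "l1 (\<lambda>n. if horizontal n then 0 else fourier a g n $ i)"
  shows "AE x in cellM. hor_average a g (x $ 3) $ i = Re (ser (\<lambda>n. if horizontal n then 0 else fourier a g n $ i) x)"
proof -
  let ?c = "1 / (4 * pi\<^sup>2 * a$1 * a$2)" and ?u = "\<lambda>n. if horizontal n then 0 else fourier a g n $ i"
  have c: "(4 * pi\<^sup>2 * a$1 * a$2) \<noteq> 0" by simp
  have gi: "integrable cellM g" by (rule integrable_vector[OF sobolev_nth_integrable[OF g]])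
  define q where "q z = (\<integral>y. g (join3 (y, z)) \<partial>sectM)" for z
  have qi: "integrable (timeM height) q" unfolding q_def by (rule integrable_join3(3)[OF gi])
  have qi': "integrable (timeM height) (\<lambda>z. q z $ i)" by (rule integrable_bounded_linear[OF bounded_linear_vec_nth qi])
  have qe: "AE z in timeM height. q z $ i = (\<integral>y. g (join3 (y, z)) $ i \<partial>sectM)"
    using integrable_join3(4)[OF gi] unfolding q_def
    by eventually_elim (rule integral_bounded_linear[OF bounded_linear_vec_nth, symmetric])
  let ?f = "\<lambda>x. hor_average a g (x $ 3) $ i"
  have fq: "?f (join3 (y, z)) = ?c * q z $ i" for y z by (simp add: hor_average_sectM q_def join3_nth)
  have sn: "(\<lambda>x. x $ 3) \<in> cellM \<rightarrow>\<^sub>M timeM height"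
    unfolding cellM_def timeM_def by (intro measurable_restrict_space3) (auto simp: mem_cell)
  have fm: "?f \<in> borel_measurable cellM"
  proof -
    have "(\<lambda>x. ?c * q (x $ 3) $ i) \<in> borel_measurable cellM"
      using measurable_compose[OF sn borel_measurable_integrable[OF qi']] by measurable
    then show ?thesis by (simp add: hor_average_sectM q_def)
  qed
  have prod_int: "integrable (sectM \<Otimes>\<^sub>M timeM height) (\<lambda>(y, z). u y * v z)"
    if u: "integrable sectM u" and v: "integrable (timeM height) v" for u :: "real^2 \<Rightarrow> complex" and v :: "real \<Rightarrow> complex"
  proof (rule sz.Fubini_integrable)
    have um: "u \<in> borel_measurable sectM" and vm: "v \<in> borel_measurable (timeM height)" using u v by simp_all
    show "(\<lambda>(y, z). u y * v z) \<in> borel_measurable (sectM \<Otimes>\<^sub>M timeM height)"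
      unfolding case_prod_unfold
      by (rule borel_measurable_times[OF measurable_compose[OF measurable_fst um] measurable_compose[OF measurable_snd vm]])
    show "integrable sectM (\<lambda>y. \<integral>z. norm (case (y, z) of (y, z) \<Rightarrow> u y * v z) \<partial>timeM height)"
      using u by (simp add: norm_mult)
    show "AE y in sectM. integrable (timeM height) (\<lambda>z. case (y, z) of (y, z) \<Rightarrow> u y * v z)" using v by simp
  qed
  have fi: "integrable cellM ?f"
  proof (rule integral_join3[OF fm])
    have "integrable (sectM \<Otimes>\<^sub>M timeM height) (\<lambda>(y, z). 1 * complex_of_real (?c * q z $ i))"
      using qi' by (intro prod_int) auto
    then have "integrable (sectM \<Otimes>\<^sub>M timeM height) (\<lambda>p. Re (case p of (y, z) \<Rightarrow> 1 * complex_of_real (?c * q z $ i)))"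
      by (rule integrable_Re)
    moreover have "(\<lambda>p. Re (case p of (y, z) \<Rightarrow> 1 * complex_of_real (?c * q z $ i))) = (\<lambda>p. ?f (join3 p))"
      by (auto simp: fq fun_eq_iff simp del: hor_average_def)
    ultimately show "integrable (sectM \<Otimes>\<^sub>M timeM height) (\<lambda>p. ?f (join3 p))" by simp
  qed
  have fc: "fc ?f n = ?u n" for n
  proof -
    let ?z = "\<lambda>z. cis (freq a (- n) $ 3 * z)" and ?y = "\<lambda>y. cis (freq a (- n) $ 1 * y $ 1 + freq a (- n) $ 2 * y $ 2)"
    have hm: "horizontal (- n) = horizontal n" by (simp add: horizontal_def)
    have "(\<integral>x. E (- n) x * of_real (?f x) \<partial>cellM) = (\<integral>z. (\<integral>y. ?y y * (?z z * of_real (?c * q z $ i)) \<partial>sectM) \<partial>timeM height)"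
      unfolding integrable_join3(2)[OF integrable_E_mult[OF fi]] E_join3 fq by (simp only: mult.assoc)
    also have "\<dots> = (if horizontal n then 0 else of_real (4 * pi\<^sup>2 * a$1 * a$2)) * (\<integral>z. ?z z * of_real (?c * q z $ i) \<partial>timeM height)"
      unfolding integral_mult_left_zero horizontal_integral hm integral_mult_right_zero ..
    also have "\<dots> = of_real vol * ?u n"
    proof (cases "horizontal n")
      case False
      have cancel: "complex_of_real K * (w * of_real (1 / K * x)) = w * of_real x" if "K \<noteq> 0" for K x w
        using that by simp
      have y1: "?y y = 1" for y using False by (simp add: horizontal_def freq_nth freq_minus)
      have "of_real (4 * pi\<^sup>2 * a$1 * a$2) * (\<integral>z. ?z z * of_real (?c * q z $ i) \<partial>timeM height) = (\<integral>z. ?z z * of_real (q z $ i) \<partial>timeM height)"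
        unfolding integral_mult_right_zero[symmetric]
        by (rule Bochner_Integration.integral_cong[OF refl]) (rule cancel[OF c])
      also have "\<dots> = (\<integral>z. (\<integral>y. E (- n) (join3 (y, z)) * of_real (g (join3 (y, z)) $ i) \<partial>sectM) \<partial>timeM height)"
      proof (rule integral_cong_AE)
        have zm: "?z \<in> borel_measurable (timeM height)" by (intro continuous_timeM continuous_intros)
        show "(\<lambda>z. ?z z * of_real (q z $ i)) \<in> borel_measurable (timeM height)"
          using zm borel_measurable_integrable[OF qi'] by measurable
        show "(\<lambda>z. \<integral>y. E (- n) (join3 (y, z)) * of_real (g (join3 (y, z)) $ i) \<partial>sectM) \<in> borel_measurable (timeM height)"
          by (intro borel_measurable_integrable integrable_join3(3)[of "\<lambda>x. E (- n) x * of_real (g x $ i)"] integrable_E_mult sobolev_nth_integrable[OF g])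
        show "AE z in timeM height. ?z z * of_real (q z $ i) = (\<integral>y. E (- n) (join3 (y, z)) * of_real (g (join3 (y, z)) $ i) \<partial>sectM)"
          using qe
        proof eventually_elim
          case (elim z)
          show ?case unfolding E_join3 y1 elim by simp
        qed
      qed
      also have "\<dots> = (\<integral>x. E (- n) x * of_real (g x $ i) \<partial>cellM)"
        by (rule integrable_join3(2)[symmetric, OF integrable_E_mult[OF sobolev_nth_integrable[OF g]]])
      also have "\<dots> = of_real vol * fourier a g n $ i" using vol_pos by (simp add: fourier_nth fc_cellM)
      finally show ?thesis using False by simp
    qed simp
    finally show ?thesis using vol_pos by (simp add: fc_cellM)
  qed
  have sym: "?u (- n) = cnj (?u n)" for n by (simp add: horizontal_def fourier_minus_index)
  show ?thesis
  proof (rule fourier_unique[OF fi])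
    show "integrable cellM (\<lambda>x. Re (ser ?u x))" by (intro integrable_cell_continuous continuous_intros continuous_ser l)
    show "fc ?f n = fc (\<lambda>x. Re (ser ?u x)) n" for n unfolding fc fc_ser[of ?u, OF l sym] ..
  qed
qed

lemma hor_average_measurable:
  assumes u: "u \<in> cont_sobolev a T \<sigma>"
  shows "(\<lambda>z. hor_average a (u (fst z)) (snd z $ 3) $ i) \<in> borel_measurable (cylM T)"
proof -
  have um: "(\<lambda>z. indicator ({0..T} \<times> UNIV) z *\<^sub>R u (fst z) (snd z)) \<in> borel_measurable borel"
    using u by (simp add: cont_sobolev_def set_borel_measurable_def case_prod_unfold)
  let ?P = "cylM T \<Otimes>\<^sub>M sectM"
  have f1: "(\<lambda>p. fst (fst p)) \<in> borel_measurable ?P"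
    by (rule measurable_compose[OF measurable_fst fst_borel_cyl])
  have f2: "(\<lambda>p. snd (fst p) $ 3) \<in> borel_measurable ?P"
    by (rule measurable_compose[OF measurable_compose[OF measurable_fst snd_borel_cyl] measurable_vec_nth])
  have f3: "snd \<in> borel_measurable ?P"
    by (rule measurable_compose[OF measurable_snd]) (simp add: sectM_def measurable_restrict_space1)
  have "(\<lambda>p. (fst (fst p), join3 (snd p, snd (fst p) $ 3))) \<in> borel_measurable ?P"
    by (intro borel_measurable_Pair f1 measurable_compose[OF borel_measurable_Pair[OF f3 f2] join3_measurable])
  from measurable_compose[OF this um]
  have "(\<lambda>p. indicator ({0..T} \<times> UNIV) (fst (fst p), join3 (snd p, snd (fst p) $ 3)) *\<^sub>R u (fst (fst p)) (join3 (snd p, snd (fst p) $ 3))) \<in> borel_measurable ?P"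
    by simp
  then have "(\<lambda>(z, y). indicator ({0..T} \<times> UNIV) (fst z, join3 (y, snd z $ 3)) *\<^sub>R u (fst z) (join3 (y, snd z $ 3))) \<in> borel_measurable ?P"
    by (simp add: case_prod_unfold)
  then have "(\<lambda>z. \<integral>y. indicator ({0..T} \<times> UNIV) (fst z, join3 (y, snd z $ 3)) *\<^sub>R u (fst z) (join3 (y, snd z $ 3)) \<partial>sectM) \<in> borel_measurable (cylM T)"
    by (rule sectM.borel_measurable_lebesgue_integral)
  then have "(\<lambda>z. \<integral>y. u (fst z) (join3 (y, snd z $ 3)) \<partial>sectM) \<in> borel_measurable (cylM T)"
    by (rule measurable_cong[THEN iffD1, rotated]) auto
  then have "(\<lambda>z. hor_average a (u (fst z)) (snd z $ 3)) \<in> borel_measurable (cylM T)"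
    unfolding hor_average_sectM by measurable
  then show ?thesis by (rule measurable_compose[OF _ measurable_vec_nth])
qed

end

section \<open>Truncations that converge in the mean\<close>

text \<open>The integrals of the increments are summable, so the increments are absolutely
  summable almost everywhere.\<close>

lemma L1_limit:
  fixes g :: "nat \<Rightarrow> 'x \<Rightarrow> real"
  assumes g: "\<And>i. integrable M (g i)" and s: "summable (\<lambda>i. \<integral>x. \<bar>g i x\<bar> \<partial>M)"
  obtains f where "integrable M f" "(\<lambda>N. \<integral>x. \<bar>(\<Sum>i<N. g i x) - f x\<bar> \<partial>M) \<longlonglongrightarrow> 0"
proof -
  have gm [measurable]: "g i \<in> borel_measurable M" for i using g by (rule borel_measurable_integrable)
  have p: "0 \<le> (\<integral>x. \<bar>g i x\<bar> \<partial>M)" for i by (rule Bochner_Integration.integral_nonneg) simp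
  have "(\<integral>\<^sup>+x. (\<Sum>i. ennreal \<bar>g i x\<bar>) \<partial>M) = (\<Sum>i. \<integral>\<^sup>+x. ennreal \<bar>g i x\<bar> \<partial>M)"
    by (rule nn_integral_suminf) simp
  also have "\<dots> = (\<Sum>i. ennreal (\<integral>x. \<bar>g i x\<bar> \<partial>M))"
    by (intro suminf_cong nn_integral_eq_integral) (auto intro: g)
  also have "\<dots> \<noteq> \<infinity>" using ennreal_suminf_neq_top[OF s p] by simp
  finally have "AE x in M. (\<Sum>i. ennreal \<bar>g i x\<bar>) \<noteq> \<infinity>"
    by (intro nn_integral_PInf_AE) simp_all
  then have ae: "AE x in M. summable (\<lambda>i. norm (g i x))"
    by eventually_elim (auto intro: summable_suminf_not_top)
  have f: "integrable M (\<lambda>x. \<Sum>i. g i x)" by (rule integrable_suminf[OF g ae]) (use s in simp)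
  have bound: "(\<integral>x. \<bar>(\<Sum>i<N. g i x) - (\<Sum>i. g i x)\<bar> \<partial>M) \<le> (\<Sum>i. \<integral>x. \<bar>g (i + N) x\<bar> \<partial>M)" for N
  proof -
    have aeN: "AE x in M. summable (\<lambda>i. norm \<bar>g (i + N) x\<bar>)"
      using ae by eventually_elim (simp add: summable_iff_shift[where f="\<lambda>i. \<bar>g i _\<bar>"])
    have sN: "summable (\<lambda>i. \<integral>x. norm \<bar>g (i + N) x\<bar> \<partial>M)"
      using s summable_iff_shift[of "\<lambda>i. \<integral>x. \<bar>g i x\<bar> \<partial>M" N] by simp
    have gN: "integrable M (\<lambda>x. \<bar>g (i + N) x\<bar>)" for i by (intro integrable_abs g)
    have "(\<integral>x. \<bar>(\<Sum>i<N. g i x) - (\<Sum>i. g i x)\<bar> \<partial>M) \<le> (\<integral>x. (\<Sum>i. \<bar>g (i + N) x\<bar>) \<partial>M)"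
    proof (rule integral_mono_AE)
      show "integrable M (\<lambda>x. \<bar>(\<Sum>i<N. g i x) - (\<Sum>i. g i x)\<bar>)" using f g by auto
      show "integrable M (\<lambda>x. \<Sum>i. \<bar>g (i + N) x\<bar>)" by (rule integrable_suminf[OF gN aeN sN])
      show "AE x in M. \<bar>(\<Sum>i<N. g i x) - (\<Sum>i. g i x)\<bar> \<le> (\<Sum>i. \<bar>g (i + N) x\<bar>)"
        using ae
      proof eventually_elim
        case (elim x)
        then have sg: "summable (\<lambda>i. g i x)" by (rule summable_norm_cancel)
        have sh: "summable (\<lambda>i. \<bar>g (i + N) x\<bar>)" using elim summable_iff_shift[of "\<lambda>i. \<bar>g i x\<bar>" N] by simp
        have "\<bar>(\<Sum>i<N. g i x) - (\<Sum>i. g i x)\<bar> = \<bar>\<Sum>i. g (i + N) x\<bar>"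
          using suminf_minus_initial_segment[OF sg, of N] by simp
        also have "\<dots> \<le> (\<Sum>i. \<bar>g (i + N) x\<bar>)" by (rule summable_rabs[OF sh])
        finally show ?case .
      qed
    qed
    also have "\<dots> = (\<Sum>i. \<integral>x. \<bar>g (i + N) x\<bar> \<partial>M)" by (rule integral_suminf[OF gN aeN sN])
    finally show ?thesis .
  qed
  show thesis
  proof (rule that[OF f])
    show "(\<lambda>N. \<integral>x. \<bar>(\<Sum>i<N. g i x) - (\<Sum>i. g i x)\<bar> \<partial>M) \<longlonglongrightarrow> 0"
    proof (rule Lim_null_comparison[OF _ suminf_exist_split2[OF s]])
      show "\<forall>\<^sub>F N in sequentially. norm (\<integral>x. \<bar>(\<Sum>i<N. g i x) - (\<Sum>i. g i x)\<bar> \<partial>M) \<le> (\<Sum>i. \<integral>x. \<bar>g (i + N) x\<bar> \<partial>M)"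
        using bound by (intro always_eventually allI) simp
    qed
  qed
qed

context torus begin

lemma parseval_finite:
  assumes F: "finite F"
  shows "(\<integral>x. (norm (\<Sum>n\<in>F. c n * E n x))\<^sup>2 \<partial>cellM) = vol * (\<Sum>n\<in>F. (norm (c n))\<^sup>2)"
proof -
  have ii: "integrable cellM (\<lambda>x. z * E n x)" for z :: complex and n
    by (intro integrable_cell_continuous continuous_intros)
  have eq: "of_real ((norm (\<Sum>n\<in>F. c n * E n x))\<^sup>2) = (\<Sum>n\<in>F. \<Sum>m\<in>F. (c n * cnj (c m)) * E (n - m) x)" for x
  proof -
    have "of_real ((norm (\<Sum>n\<in>F. c n * E n x))\<^sup>2) = (\<Sum>n\<in>F. c n * E n x) * cnj (\<Sum>n\<in>F. c n * E n x)"
      by (simp add: complex_norm_square del: of_real_power)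
    also have "\<dots> = (\<Sum>n\<in>F. \<Sum>m\<in>F. (c n * E n x) * (cnj (c m) * cnj (E m x)))"
      by (simp add: sum_product del: cis_cnj)
    also have "\<dots> = (\<Sum>n\<in>F. \<Sum>m\<in>F. (c n * cnj (c m)) * E (n - m) x)"
    proof (intro sum.cong refl)
      fix n m
      have "E (n - m) x = E n x * cnj (E m x)" using E_add[of n "- m" x] cnj_E[of m x] by simp
      then show "(c n * E n x) * (cnj (c m) * cnj (E m x)) = (c n * cnj (c m)) * E (n - m) x" by (simp only: mult_ac)
    qed
    finally show ?thesis .
  qed
  have "complex_of_real (\<integral>x. (norm (\<Sum>n\<in>F. c n * E n x))\<^sup>2 \<partial>cellM) = (\<integral>x. (\<Sum>n\<in>F. \<Sum>m\<in>F. (c n * cnj (c m)) * E (n - m) x) \<partial>cellM)"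
    unfolding integral_complex_of_real[symmetric] eq ..
  also have "\<dots> = (\<Sum>n\<in>F. \<Sum>m\<in>F. (\<integral>x. (c n * cnj (c m)) * E (n - m) x \<partial>cellM))"
    by (subst Bochner_Integration.integral_sum, intro Bochner_Integration.integrable_sum ii,
        subst Bochner_Integration.integral_sum, rule ii, rule refl)
  also have "\<dots> = (\<Sum>n\<in>F. \<Sum>m\<in>F. if m = n then of_real vol * (c n * cnj (c n)) else 0)"
    unfolding integral_mult_right_zero integral_E by (intro sum.cong refl) auto
  also have "\<dots> = of_real (vol * (\<Sum>n\<in>F. (norm (c n))\<^sup>2))"
    using F by (simp add: sum_distrib_left flip: complex_norm_square)
  finally show ?thesis by (simp only: of_real_eq_iff)
qed

text \<open>By Parseval, the shell between two consecutive truncations is small in mean square, geometrically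
  in the index; square means dominate means.\<close>

lemma trunc_shell:
  assumes c: "mode_family T c" and w: "\<And>t. t \<in> {0..T} \<Longrightarrow> weighted r (c t)" "\<And>t. t \<in> {0..T} \<Longrightarrow> wnorm r (c t) \<le> K"
    and r: "0 < r"
  defines "q \<equiv> 2 powr (- r / 2)"
  shows "(\<integral>z. \<bar>trunc c (Suc N) (fst z) (snd z) - trunc c N (fst z) (snd z)\<bar> \<partial>cylM T)
     \<le> (vol * \<bar>K\<bar> * measure (timeM T) (space (timeM T)) + measure (cylM T) (space (cylM T))) * q ^ N"
proof -
  let ?S = "ball_modes (Suc N) - ball_modes N"
  let ?w = "\<lambda>z. \<Sum>n\<in>?S. c (fst z) n * E n (snd z)"
  let ?g = "\<lambda>z. trunc c (Suc N) (fst z) (snd z) - trunc c N (fst z) (snd z)"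
  have q: "0 < q" by (simp add: q_def)
  have sub: "ball_modes N \<subseteq> ball_modes (Suc N)" by (auto simp: ball_modes_def intro: less_le_trans)
  have gw: "?g z = Re (?w z)" for z
    using sum_diff[OF finite_ball_modes sub, of "\<lambda>n. c (fst z) n * E n (snd z)"] by (simp add: trunc_def)
  have iw: "integrable (cylM T) ?w" by (intro Bochner_Integration.integrable_sum mode_integrable c)
  have ig: "cyl_integrable T (trunc c M)" for M by (rule trunc_integrable[OF c])
  have tail: "(\<Sum>n\<in>?S. (norm (c t n))\<^sup>2) \<le> q ^ N * q ^ N * \<bar>K\<bar>" if t: "t \<in> {0..T}" for t
  proof -
    have "(\<Sum>n\<in>?S. (norm (c t n))\<^sup>2) \<le> (\<Sum>n\<in>?S. q ^ N * q ^ N * (wt n powr r * (norm (c t n))\<^sup>2))"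
    proof (rule sum_mono)
      fix n assume "n \<in> ?S"
      then have "2 ^ N \<le> wt n" by (simp add: ball_modes_def not_less)
      then have "(2 ^ N) powr r \<le> wt n powr r" using r by (intro powr_mono2) auto
      moreover have "q ^ N * q ^ N * (2 ^ N) powr r = 1"
      proof -
        have "q ^ N = 2 powr (- r / 2 * real N)" unfolding q_def by (simp add: powr_powr flip: powr_realpow)
        moreover have "(2 ^ N :: real) powr r = 2 powr (real N * r)" by (simp add: powr_powr flip: powr_realpow)
        ultimately show ?thesis by (simp add: powr_add[symmetric] algebra_simps)
      qed
      ultimately have "1 \<le> q ^ N * q ^ N * wt n powr r"
        using mult_left_mono[of "(2 ^ N) powr r" "wt n powr r" "q ^ N * q ^ N"] q by simp
      from mult_right_mono[OF this, of "(norm (c t n))\<^sup>2"]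
      show "(norm (c t n))\<^sup>2 \<le> q ^ N * q ^ N * (wt n powr r * (norm (c t n))\<^sup>2)" by (simp add: mult.assoc)
    qed
    also have "\<dots> = q ^ N * q ^ N * (\<Sum>n\<in>?S. wt n powr r * (norm (c t n))\<^sup>2)" by (simp add: sum_distrib_left)
    also have "\<dots> \<le> q ^ N * q ^ N * \<bar>K\<bar>"
    proof (rule mult_left_mono)
      have "(\<Sum>n\<in>?S. wt n powr r * (norm (c t n))\<^sup>2) \<le> wnorm r (c t)"
        unfolding wnorm_def using w(1)[OF t] unfolding weighted_def by (intro finite_sum_le_infsum) auto
      then show "(\<Sum>n\<in>?S. wt n powr r * (norm (c t n))\<^sup>2) \<le> \<bar>K\<bar>" using w(2)[OF t] by linarith
    qed (use q in simp)
    finally show ?thesis .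
  qed
  have iw2: "integrable (cylM T) (\<lambda>z. (norm (?w z))\<^sup>2)"
  proof -
    obtain B where B: "\<And>n t. n \<in> ?S \<Longrightarrow> t \<in> {0..T} \<Longrightarrow> norm (c t n) \<le> B n"
      using c unfolding mode_family_def by metis
    have wm: "(\<lambda>z. (norm (?w z))\<^sup>2) \<in> borel_measurable (cylM T)" using borel_measurable_integrable[OF iw] by measurable
    show ?thesis
    proof (rule cylM.integrable_const_bound[where B="(\<Sum>n\<in>?S. B n)\<^sup>2"])
      show "AE z in cylM T. norm ((norm (?w z))\<^sup>2) \<le> (\<Sum>n\<in>?S. B n)\<^sup>2"
      proof (rule AE_I2)
        fix z assume z: "z \<in> space (cylM T)"
        have "norm (?w z) \<le> (\<Sum>n\<in>?S. B n)"
          using z by (intro sum_norm_le) (auto simp: norm_mult intro!: B)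
        then show "norm ((norm (?w z))\<^sup>2) \<le> (\<Sum>n\<in>?S. B n)\<^sup>2" by (simp add: power_mono)
      qed
    qed (rule wm)
  qed
  let ?P = "measure (timeM T) (space (timeM T))"
  have sq: "(\<integral>z. (norm (?w z))\<^sup>2 \<partial>cylM T) \<le> vol * \<bar>K\<bar> * ?P * (q ^ N * q ^ N)"
  proof -
    have "(\<integral>z. (norm (?w z))\<^sup>2 \<partial>cylM T) = (\<integral>t. vol * (\<Sum>n\<in>?S. (norm (c t n))\<^sup>2) \<partial>timeM T)"
      unfolding fubini_cyl(1)[OF iw2] using parseval_finite[of ?S] by simp
    also have "\<dots> \<le> (\<integral>t. vol * (q ^ N * q ^ N * \<bar>K\<bar>) \<partial>timeM T)"
    proof (rule integral_mono)
      show "integrable (timeM T) (\<lambda>t. vol * (\<Sum>n\<in>?S. (norm (c t n))\<^sup>2))"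
        using fubini_cyl(2)[OF iw2] parseval_finite[of ?S] by simp
      show "vol * (\<Sum>n\<in>?S. (norm (c t n))\<^sup>2) \<le> vol * (q ^ N * q ^ N * \<bar>K\<bar>)" if "t \<in> space (timeM T)" for t
        using tail[of t] that vol_pos by (intro mult_left_mono) auto
    qed simp
    also have "\<dots> = vol * \<bar>K\<bar> * ?P * (q ^ N * q ^ N)" by simp
    finally show ?thesis .
  qed
  \<comment> \<open>The weight \<open>1 / q ^ N\<close> balances the square, of size \<open>q ^ (2 * N)\<close>, against the constant.\<close>
  have "(\<integral>z. \<bar>?g z\<bar> \<partial>cylM T) \<le> (\<integral>z. (1 / q ^ N) * (norm (?w z))\<^sup>2 + q ^ N \<partial>cylM T)"
  proof (rule integral_mono)
    show "integrable (cylM T) (\<lambda>z. \<bar>?g z\<bar>)" by (intro integrable_abs Bochner_Integration.integrable_diff ig)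
    show "integrable (cylM T) (\<lambda>z. (1 / q ^ N) * (norm (?w z))\<^sup>2 + q ^ N)" using iw2 by simp
    fix z
    have "\<bar>?g z\<bar> \<le> norm (?w z)" unfolding gw by (rule abs_Re_le_cmod)
    also have "\<dots> \<le> (1 / q ^ N) * (norm (?w z))\<^sup>2 + q ^ N"
    proof -
      have "x * y \<le> x\<^sup>2 + y * y" if "0 \<le> x" "0 \<le> y" for x y :: real
        using sum_squares_bound[of x y] mult_nonneg_nonneg[OF that] by (simp add: power2_eq_square)
      from this[of "norm (?w z)" "q ^ N"]
      have "norm (?w z) * q ^ N \<le> (norm (?w z))\<^sup>2 + q ^ N * q ^ N" using q by simp
      then show ?thesis using q by (simp add: field_simps)
    qed
    finally show "\<bar>?g z\<bar> \<le> (1 / q ^ N) * (norm (?w z))\<^sup>2 + q ^ N" .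
  qed
  also have "\<dots> = (1 / q ^ N) * (\<integral>z. (norm (?w z))\<^sup>2 \<partial>cylM T) + measure (cylM T) (space (cylM T)) * q ^ N"
    using iw2 by simp
  also have "\<dots> \<le> (1 / q ^ N) * (vol * \<bar>K\<bar> * ?P * (q ^ N * q ^ N)) + measure (cylM T) (space (cylM T)) * q ^ N"
    by (intro add_right_mono mult_left_mono sq) (use q in simp)
  also have "\<dots> = (vol * \<bar>K\<bar> * ?P + measure (cylM T) (space (cylM T))) * q ^ N"
    using q by (simp add: field_simps)
  finally show ?thesis .
qed

text \<open>This applies to second derivatives, whose coefficients need not be absolutely
  summable.\<close>

lemma mean_limit_weighted:
  assumes c: "mode_family T c" and w: "\<And>t. t \<in> {0..T} \<Longrightarrow> weighted r (c t)" "\<And>t. t \<in> {0..T} \<Longrightarrow> wnorm r (c t) \<le> K"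
    and r: "0 < r"
  obtains f where "mean_limit T (trunc c) f"
proof -
  let ?g = "\<lambda>i z. trunc c (Suc i) (fst z) (snd z) - trunc c i (fst z) (snd z)"
  let ?q = "2 powr (- r / 2)" and ?A = "vol * \<bar>K\<bar> * measure (timeM T) (space (timeM T)) + measure (cylM T) (space (cylM T))"
  have ig: "cyl_integrable T (trunc c M)" for M by (rule trunc_integrable[OF c])
  then have g: "integrable (cylM T) (?g i)" for i by simp
  have q: "\<bar>?q\<bar> < 1" using r powr_less_mono[of "- r / 2" 0 2] by simp
  have "summable (\<lambda>N. ?A * ?q ^ N)" using q by (intro summable_mult summable_geometric) simp
  then have "summable (\<lambda>i. \<integral>z. \<bar>?g i z\<bar> \<partial>cylM T)"
  proof (rule summable_comparison_test[rotated], intro exI[of _ 0] allI impI)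
    fix N
    have "0 \<le> (\<integral>z. \<bar>?g N z\<bar> \<partial>cylM T)" by (rule Bochner_Integration.integral_nonneg) simp
    moreover have "(\<integral>z. \<bar>?g N z\<bar> \<partial>cylM T) \<le> ?A * ?q ^ N" by (rule trunc_shell[OF c w r])
    ultimately show "norm (\<integral>z. \<bar>?g N z\<bar> \<partial>cylM T) \<le> ?A * ?q ^ N" by simp
  qed
  then obtain h where h: "integrable (cylM T) h" "(\<lambda>N. \<integral>z. \<bar>(\<Sum>i<N. ?g i z) - h z\<bar> \<partial>cylM T) \<longlonglongrightarrow> 0"
    by (rule L1_limit[where g="?g", OF g]) (rule that)
  have tel: "(\<Sum>i<N. ?g i z) = trunc c N (fst z) (snd z) - trunc c 0 (fst z) (snd z)" for N z
    by (rule sum_lessThan_telescope)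
  have "(\<integral>z. \<bar>(\<Sum>i<N. ?g i z) - h z\<bar> \<partial>cylM T) = (\<integral>z. \<bar>trunc c N (fst z) (snd z) - (trunc c 0 (fst z) (snd z) + h (fst z, snd z))\<bar> \<partial>cylM T)" for N
    unfolding tel by (simp add: diff_diff_eq)
  then have "mean_limit T (trunc c) (\<lambda>t x. trunc c 0 t x + h (t, x))"
    unfolding mean_limit_def using h ig by simp
  then show thesis by (rule that)
qed

section \<open>Families of coefficients\<close>

lemma l1_family_measurable: "l1_family T c \<Longrightarrow> (\<lambda>t. c t n) \<in> borel_measurable (timeM T)"
  by (simp add: l1_family_def)

lemma l1_familyI:
  assumes "\<And>n. (\<lambda>t. c t n) \<in> borel_measurable (timeM T)" "\<And>t. t \<in> {0..T} \<Longrightarrow> l1 (c t)" "\<And>t. t \<in> {0..T} \<Longrightarrow> l1norm (c t) \<le> B"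
  shows "l1_family T c"
  unfolding l1_family_def using assms by blast

lemma l1_familyE:
  assumes "l1_family T c"
  obtains B where "\<And>t. t \<in> {0..T} \<Longrightarrow> l1 (c t)" "\<And>t. t \<in> {0..T} \<Longrightarrow> l1norm (c t) \<le> B"
  using assms unfolding l1_family_def by blast

lemma l1_family_multiplier:
  assumes c: "l1_family T c" and m: "\<And>n. norm (m n) \<le> K"
  shows "l1_family T (\<lambda>t n. m n * c t n)"
proof -
  obtain B where B: "\<And>t. t \<in> {0..T} \<Longrightarrow> l1 (c t)" "\<And>t. t \<in> {0..T} \<Longrightarrow> l1norm (c t) \<le> B"
    using l1_familyE[OF c] by metis
  have K: "0 \<le> K" using m[of 0] norm_ge_zero order_trans by blast
  have le: "norm (m n * c t n) \<le> K * norm (c t n)" for t n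
    unfolding norm_mult by (intro mult_right_mono m) simp
  show ?thesis
  proof (rule l1_familyI)
    show "(\<lambda>t. m n * c t n) \<in> borel_measurable (timeM T)" for n
      using l1_family_measurable[OF c] by (intro borel_measurable_times) auto
    fix t assume t: "t \<in> {0..T}"
    show "l1 (\<lambda>n. m n * c t n)" by (rule l1_mono(1)[OF B(1)[OF t] le])
    have "l1norm (\<lambda>n. m n * c t n) \<le> K * l1norm (c t)" by (rule l1_mono(2)[OF B(1)[OF t] le])
    also have "\<dots> \<le> K * B" using B(2)[OF t] K by (rule mult_left_mono)
    finally show "l1norm (\<lambda>n. m n * c t n) \<le> K * B" .
  qed
qed

lemma l1_family_add:
  assumes c: "l1_family T c" and d: "l1_family T d" shows "l1_family T (\<lambda>t n. c t n + d t n)"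
proof -
  obtain B where B: "\<And>t. t \<in> {0..T} \<Longrightarrow> l1 (c t)" "\<And>t. t \<in> {0..T} \<Longrightarrow> l1norm (c t) \<le> B"
    using l1_familyE[OF c] by metis
  obtain B' where B': "\<And>t. t \<in> {0..T} \<Longrightarrow> l1 (d t)" "\<And>t. t \<in> {0..T} \<Longrightarrow> l1norm (d t) \<le> B'"
    using l1_familyE[OF d] by metis
  show ?thesis
  proof (rule l1_familyI)
    show "(\<lambda>t. c t n + d t n) \<in> borel_measurable (timeM T)" for n
      by (intro borel_measurable_add l1_family_measurable c d)
    fix t assume t: "t \<in> {0..T}"
    show "l1 (\<lambda>n. c t n + d t n)" by (rule l1_add(1)[OF B(1)[OF t] B'(1)[OF t]])
    show "l1norm (\<lambda>n. c t n + d t n) \<le> B + B'"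
      using l1_add(2)[OF B(1)[OF t] B'(1)[OF t]] B(2)[OF t] B'(2)[OF t] by linarith
  qed
qed

lemma l1_family_convol:
  assumes c: "l1_family T c" and d: "l1_family T d" shows "l1_family T (\<lambda>t. convol (c t) (d t))"
proof -
  obtain B where B: "\<And>t. t \<in> {0..T} \<Longrightarrow> l1 (c t)" "\<And>t. t \<in> {0..T} \<Longrightarrow> l1norm (c t) \<le> B"
    using l1_familyE[OF c] by metis
  obtain B' where B': "\<And>t. t \<in> {0..T} \<Longrightarrow> l1 (d t)" "\<And>t. t \<in> {0..T} \<Longrightarrow> l1norm (d t) \<le> B'"
    using l1_familyE[OF d] by metis
  show ?thesis
  proof (rule l1_familyI)
    show "(\<lambda>t. convol (c t) (d t) n) \<in> borel_measurable (timeM T)" for n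
    proof (rule borel_measurable_LIMSEQ_metric)
      show "(\<lambda>t. \<Sum>k\<in>ball_modes N. c t k * d t (n - k)) \<in> borel_measurable (timeM T)" for N
        by (intro borel_measurable_sum borel_measurable_times l1_family_measurable c d)
      fix t assume "t \<in> space (timeM T)"
      then have t: "t \<in> {0..T}" by simp
      show "(\<lambda>N. \<Sum>k\<in>ball_modes N. c t k * d t (n - k)) \<longlonglongrightarrow> convol (c t) (d t) n"
        unfolding convol_def by (rule has_sum_ball_modes[OF has_sum_infsum[OF convol_facts(4)[OF B(1)[OF t] B'(1)[OF t]]]])
    qed
    fix t assume t: "t \<in> {0..T}"
    show "l1 (convol (c t) (d t))" by (rule convol_facts(1)[OF B(1)[OF t] B'(1)[OF t]])
    have "l1norm (convol (c t) (d t)) \<le> l1norm (c t) * l1norm (d t)" by (rule convol_facts(2)[OF B(1)[OF t] B'(1)[OF t]])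
    also have "\<dots> \<le> B * B'"
      using B(2)[OF t] B'(2)[OF t] l1norm_nonneg[of "c t"] l1norm_nonneg[of "d t"] by (intro mult_mono) auto
    finally show "l1norm (convol (c t) (d t)) \<le> B * B'" .
  qed
qed

section \<open>Continuous curves in Sobolev spaces\<close>

lemma has_sum_finite_sum:
  fixes f :: "'i \<Rightarrow> 'x \<Rightarrow> real"
  assumes "finite I" "\<And>i. i \<in> I \<Longrightarrow> (f i has_sum S i) A"
  shows "((\<lambda>x. \<Sum>i\<in>I. f i x) has_sum (\<Sum>i\<in>I. S i)) A"
  using assms by (induction I) (auto intro!: has_sum_add)

lemma weighted_vector:
  fixes c :: "int^3 \<Rightarrow> complex^'k"
  assumes "\<And>i. weighted \<sigma> (\<lambda>n. c n $ i)"
  shows "weighted \<sigma> c" "wnorm \<sigma> c = (\<Sum>i\<in>UNIV. wnorm \<sigma> (\<lambda>n. c n $ i))"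
proof -
  have "((\<lambda>n. \<Sum>i\<in>UNIV. wt n powr \<sigma> * (norm (c n $ i))\<^sup>2) has_sum (\<Sum>i\<in>UNIV. wnorm \<sigma> (\<lambda>n. c n $ i))) UNIV"
    unfolding wnorm_def using assms unfolding weighted_def by (intro has_sum_finite_sum has_sum_infsum) auto
  then have "((\<lambda>n. wt n powr \<sigma> * (norm (c n))\<^sup>2) has_sum (\<Sum>i\<in>UNIV. wnorm \<sigma> (\<lambda>n. c n $ i))) UNIV"
    by (simp add: norm_vec_square_sum[of "c _"] sum_distrib_left)
  then show "weighted \<sigma> c" "wnorm \<sigma> c = (\<Sum>i\<in>UNIV. wnorm \<sigma> (\<lambda>n. c n $ i))"
    unfolding weighted_def wnorm_def by (auto simp: summable_on_def intro: infsumI)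
qed

text \<open>Interpolation between frequencies: below a cut-off finitely many continuous modes matter, beyond it
  the stronger norm is uniformly bounded.\<close>

lemma wnorm_cutoff:
  fixes c d :: "int^3 \<Rightarrow> complex^'k"
  assumes c: "weighted s c" and d: "weighted s d" and \<rho>: "\<rho> \<le> s"
  shows "wnorm \<rho> (\<lambda>n. c n - d n) \<le> (\<Sum>n\<in>ball_modes N. wt n powr \<rho> * (norm (c n - d n))\<^sup>2)
     + (2 ^ N) powr (\<rho> - s) * (2 * wnorm s c + 2 * wnorm s d)"
proof -
  let ?b = "\<lambda>n. wt n powr \<rho> * (norm (c n - d n))\<^sup>2" and ?K = "(2 ^ N :: real) powr (\<rho> - s)"
  let ?t = "\<lambda>n. ?K * (2 * (wt n powr s * (norm (c n))\<^sup>2) + 2 * (wt n powr s * (norm (d n))\<^sup>2))"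
  have hs: "((\<lambda>n. wt n powr s * (norm (c n))\<^sup>2) has_sum wnorm s c) UNIV" "((\<lambda>n. wt n powr s * (norm (d n))\<^sup>2) has_sum wnorm s d) UNIV"
    unfolding wnorm_def using c d unfolding weighted_def by (auto intro: has_sum_infsum)
  have 1: "(?t has_sum ?K * (2 * wnorm s c + 2 * wnorm s d)) UNIV"
    by (intro has_sum_cmult_right has_sum_add hs)
  have 2: "((\<lambda>n. if n \<in> ball_modes N then ?b n else 0) has_sum (\<Sum>n\<in>ball_modes N. ?b n)) UNIV"
    by (rule has_sum_finite_neutralI[of "ball_modes N"]) auto
  note 3 = has_sum_add[OF 2 1]
  have le: "?b n \<le> (if n \<in> ball_modes N then ?b n else 0) + ?t n" for n
  proof (cases "n \<in> ball_modes N")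
    case True then show ?thesis by simp
  next
    case False
    then have "2 ^ N \<le> wt n" by (simp add: ball_modes_def)
    then have "wt n powr (\<rho> - s) \<le> ?K" using \<rho> by (intro powr_mono2') auto
    then have "wt n powr (\<rho> - s) * wt n powr s \<le> ?K * wt n powr s" by (rule mult_right_mono) simp
    then have "wt n powr \<rho> \<le> ?K * wt n powr s" by (simp add: powr_add[symmetric])
    then have "?b n \<le> (?K * wt n powr s) * (2 * (norm (c n))\<^sup>2 + 2 * (norm (d n))\<^sup>2)"
      by (intro mult_mono norm_diff_square_le) auto
    also have "\<dots> = ?t n" by (simp add: algebra_simps)
    finally show ?thesis using False by simp
  qed
  have sb: "?b summable_on UNIV"
    by (rule summable_on_comparison_test[OF has_sum_imp_summable[OF 3]]) (use le in auto)
  show ?thesis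
    unfolding wnorm_def[of \<rho>] by (rule has_sum_mono[OF has_sum_infsum[OF sb] 3 le])
qed

text \<open>Finitely many modes are continuous in time, and the bound in the stronger space
  controls the rest.  The field is jointly measurable as a pointwise limit of truncations, which
  are continuous on the closed cylinder.\<close>

lemma cont_sobolev_synth:
  fixes c :: "real \<Rightarrow> int^3 \<Rightarrow> complex^'k"
  assumes cont: "\<And>n i. continuous_on {0..T} (\<lambda>t. c t n $ i)"
    and w: "\<And>t. t \<in> {0..T} \<Longrightarrow> weighted s (c t)" and K: "\<And>t. t \<in> {0..T} \<Longrightarrow> wnorm s (c t) \<le> K"
    and sym: "\<And>t n i. t \<in> {0..T} \<Longrightarrow> c t (- n) $ i = cnj (c t n $ i)" and s: "3/2 < s" and \<rho>: "\<rho> < s"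
  shows "(\<lambda>t. synth a (c t)) \<in> cont_sobolev a T \<rho>"
  unfolding cont_sobolev_def mem_Collect_eq
proof (intro conjI ballI)
  have l: "l1 (\<lambda>n. c t n $ i)" if t: "t \<in> {0..T}" for t i by (rule l1_weighted(1)[OF s weighted_nth(1)[OF w[OF t]]])
  have w\<rho>: "weighted \<rho> (c t)" if t: "t \<in> {0..T}" for t
  proof -
    have "wt n powr \<rho> * (norm (c t n))\<^sup>2 \<le> 1 * (wt n powr s * (norm (c t n))\<^sup>2)" for n
      using wt_ge_1[of n] \<rho> by (auto intro!: mult_right_mono powr_mono)
    from weighted_mono(1)[OF w[OF t] this] show ?thesis .
  qed
  have mem: "synth a (c t) \<in> sobolev a \<rho>" if t: "t \<in> {0..T}" for t by (rule synth_sobolev[OF l[OF t] sym[OF t] w\<rho>[OF t]])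
  then show "synth a (c t) \<in> sobolev a \<rho>" if "t \<in> {0..T}" for t using that by blast
  let ?A = "{0..T} \<times> (UNIV :: (real^3) set)"
  show "set_borel_measurable borel ({0..T} \<times> UNIV) (\<lambda>(t, x). synth a (c t) x)"
    unfolding set_borel_measurable_def
  proof (rule borel_measurable_LIMSEQ_metric)
    fix N
    have cl: "?A \<in> sets borel" by (intro borel_closed closed_Times) auto
    have "continuous_on ?A (\<lambda>z. \<chi> i. Re (\<Sum>n\<in>ball_modes N. c (fst z) n $ i * E n (snd z)))"
      by (intro continuous_intros continuous_on_vec_lambda continuous_on_compose2[OF cont continuous_on_fst[OF continuous_on_id]]) auto
    then show "(\<lambda>z. indicator ?A z *\<^sub>R (\<chi> i. Re (\<Sum>n\<in>ball_modes N. c (fst z) n $ i * E n (snd z)))) \<in> borel_measurable borel"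
      by (rule borel_measurable_continuous_on_indicator[OF cl])
  next
    fix z :: "real \<times> (real^3)"
    show "(\<lambda>N. indicator ?A z *\<^sub>R (\<chi> i. Re (\<Sum>n\<in>ball_modes N. c (fst z) n $ i * E n (snd z)))) \<longlonglongrightarrow> indicator ?A z *\<^sub>R (case z of (t, x) \<Rightarrow> synth a (c t) x)"
    proof (cases "z \<in> ?A")
      case True
      have "(\<lambda>N. \<chi> i. Re (\<Sum>n\<in>ball_modes N. c (fst z) n $ i * E n (snd z))) \<longlonglongrightarrow> synth a (c (fst z)) (snd z)"
      proof (intro vec_tendstoI)
        fix i
        show "(\<lambda>N. (\<chi> i. Re (\<Sum>n\<in>ball_modes N. c (fst z) n $ i * E n (snd z))) $ i) \<longlonglongrightarrow> synth a (c (fst z)) (snd z) $ i"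
          unfolding vec_lambda_beta synth_nth by (intro tendsto_Re ser_tendsto l) (use True in auto)
      qed
      then show ?thesis using True by (simp add: case_prod_unfold)
    qed simp
  qed
  fix t assume t: "t \<in> {0..T}"
  have fd: "sobolev_norm a \<rho> (\<lambda>x. synth a (c \<tau>) x - synth a (c t) x) = sqrt (wnorm \<rho> (\<lambda>n. c \<tau> n - c t n))" if \<tau>: "\<tau> \<in> {0..T}" for \<tau>
  proof -
    have "fourier a (\<lambda>x. synth a (c \<tau>) x - synth a (c t) x) = (\<lambda>n. c \<tau> n - c t n)"
      unfolding fun_eq_iff fourier_diff[OF mem[OF \<tau>] mem[OF t]]
      using fourier_synth[of "c \<tau>", OF l[OF \<tau>] sym[OF \<tau>]] fourier_synth[of "c t", OF l[OF t] sym[OF t]] by simp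
    then show ?thesis by (simp add: sobolev_norm_wnorm)
  qed
  have "((\<lambda>\<tau>. wnorm \<rho> (\<lambda>n. c \<tau> n - c t n)) \<longlongrightarrow> 0) (at t within {0..T})"
  proof (rule tendstoI)
    fix \<epsilon> :: real assume \<epsilon>: "0 < \<epsilon>"
    have "(\<lambda>N. ((2 powr (\<rho> - s)) ^ N) * (4 * K)) \<longlonglongrightarrow> 0 * (4 * K)"
      using \<rho> powr_less_mono[of "\<rho> - s" 0 2] by (intro tendsto_mult_right LIMSEQ_power_zero) simp
    then have "\<forall>\<^sub>F N in sequentially. ((2 powr (\<rho> - s)) ^ N) * (4 * K) < \<epsilon> / 2"
      using \<epsilon> by (intro order_tendstoD(2)) auto
    then obtain N where "((2 powr (\<rho> - s)) ^ N) * (4 * K) < \<epsilon> / 2" by (auto simp: eventually_sequentially)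
    moreover have "(2 powr (\<rho> - s)) ^ N = (2 ^ N) powr (\<rho> - s)" by (simp add: powr_powr mult.commute flip: powr_realpow)
    ultimately have N: "(2 ^ N) powr (\<rho> - s) * (4 * K) < \<epsilon> / 2" by simp
    have "((\<lambda>\<tau>. c \<tau> n) \<longlongrightarrow> c t n) (at t within {0..T})" for n
      using cont t by (intro vec_tendstoI) (auto simp: continuous_on_def)
    then have "((\<lambda>\<tau>. \<Sum>n\<in>ball_modes N. wt n powr \<rho> * (norm (c \<tau> n - c t n))\<^sup>2) \<longlongrightarrow> (\<Sum>n\<in>ball_modes N. wt n powr \<rho> * (norm (c t n - c t n))\<^sup>2)) (at t within {0..T})"
      by (intro tendsto_intros)
    then have "\<forall>\<^sub>F \<tau> in at t within {0..T}. (\<Sum>n\<in>ball_modes N. wt n powr \<rho> * (norm (c \<tau> n - c t n))\<^sup>2) < \<epsilon> / 2"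
      using \<epsilon> by (intro order_tendstoD(2)) auto
    moreover have "\<forall>\<^sub>F \<tau> in at t within {0..T}. \<tau> \<in> {0..T}" by (simp add: eventually_at_filter)
    ultimately show "\<forall>\<^sub>F \<tau> in at t within {0..T}. dist (wnorm \<rho> (\<lambda>n. c \<tau> n - c t n)) 0 < \<epsilon>"
    proof eventually_elim
      case (elim \<tau>)
      have "wnorm \<rho> (\<lambda>n. c \<tau> n - c t n) \<le> (\<Sum>n\<in>ball_modes N. wt n powr \<rho> * (norm (c \<tau> n - c t n))\<^sup>2)
         + (2 ^ N) powr (\<rho> - s) * (2 * wnorm s (c \<tau>) + 2 * wnorm s (c t))"
        by (rule wnorm_cutoff[OF w[OF elim(2)] w[OF t] less_imp_le[OF \<rho>]])
      also have "(2 ^ N) powr (\<rho> - s) * (2 * wnorm s (c \<tau>) + 2 * wnorm s (c t)) \<le> (2 ^ N) powr (\<rho> - s) * (4 * K)"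
        using K[OF elim(2)] K[OF t] by (intro mult_left_mono) auto
      finally show ?case using elim(1) N wnorm_nonneg[of \<rho> "\<lambda>n. c \<tau> n - c t n"] by simp
    qed
  qed
  then have "((\<lambda>\<tau>. sqrt (wnorm \<rho> (\<lambda>n. c \<tau> n - c t n))) \<longlongrightarrow> sqrt 0) (at t within {0..T})" by (rule tendsto_real_sqrt)
  then have "((\<lambda>\<tau>. sqrt (wnorm \<rho> (\<lambda>n. c \<tau> n - c t n))) \<longlongrightarrow> 0) (at t within {0..T})" by simp
  moreover have "\<forall>\<^sub>F \<tau> in at t within {0..T}. sqrt (wnorm \<rho> (\<lambda>n. c \<tau> n - c t n)) = sobolev_norm a \<rho> (\<lambda>x. synth a (c \<tau>) x - synth a (c t) x)"
    unfolding eventually_at_filter by (intro always_eventually allI impI) (simp add: fd)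
  ultimately show "((\<lambda>\<tau>. sobolev_norm a \<rho> (\<lambda>x. synth a (c \<tau>) x - synth a (c t) x)) \<longlongrightarrow> 0) (at t within {0..T})"
    by (rule Lim_transform_eventually)
qed

end

section \<open>The limit equations\<close>

definition hemb :: "2 \<Rightarrow> 3" where "hemb i = (if i = 1 then 1 else 2)"

lemma hemb_simps [simp]: "hemb 1 = 1" "hemb 2 = 2" by (simp_all add: hemb_def)

lemma hor_nth: "hor X $ i = X $ emb (hemb i)"
  using exhaust_2[of i] by (auto simp: hor_def)

lemma exhaust_emb: obtains i where "j = emb i" | "j = (4::4)"
  using exhaust_4[of j] emb_simps by metis

context torus begin

lemma horizontal_minus [simp]: "horizontal (- n) = horizontal n"
  by (simp add: horizontal_def)

lemma perp_minus: "perp (- n) i = - perp n i"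
  by (simp add: perp_def rad_def freq_minus)

lemma kernel_part_cnj:
  assumes "\<And>i. Y $ i = cnj (X $ i)" shows "part (- n) 0 Y i = cnj (part n 0 X i)"
  using assms by (simp add: part_def hermitian_e0 perp_minus sum_negf)

definition proj_coeff :: "(real^3 \<Rightarrow> real^4) \<Rightarrow> int^3 \<Rightarrow> complex^4" where
  "proj_coeff f n = (if n$1 \<noteq> 0 \<or> n$2 \<noteq> 0 then hermitian (fourier a f n) (e0 a n) *s e0 a n else 0)"

lemma proj0_synth: "proj0 a f = synth a (proj_coeff f)"
  by (simp add: proj0_def proj_coeff_def[abs_def])

lemma proj_coeff_nth:
  "proj_coeff f n $ emb i = (if horizontal n then part n 0 (fourier a f n) i else 0)" "proj_coeff f n $ 4 = 0"
  by (auto simp: proj_coeff_def horizontal_def part_def e0_nth)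

lemma proj_coeff_cnj: "proj_coeff f (- n) $ i = cnj (proj_coeff f n $ i)"
  by (cases i rule: exhaust_emb) (auto simp: proj_coeff_nth intro!: kernel_part_cnj fourier_minus_index)

lemma proj0_sobolev:
  assumes f: "f \<in> sobolev a r" and r: "3/2 < r" shows "proj0 a f \<in> sobolev a r"
proof -
  have w: "weighted r (fourier a f)" using f by (simp add: sobolev_iff)
  have "norm (proj_coeff f n $ i) \<le> 2 * norm (fourier a f n)" for n i
    by (cases i rule: exhaust_emb) (auto simp: proj_coeff_nth intro!: norm_kernel_part)
  then have "wt n powr r * (norm (proj_coeff f n $ i))\<^sup>2 \<le> wt n powr r * (2 * norm (fourier a f n))\<^sup>2" for n i
    by (intro mult_left_mono power_mono) auto
  then have "wt n powr r * (norm (proj_coeff f n $ i))\<^sup>2 \<le> 4 * (wt n powr r * (norm (fourier a f n))\<^sup>2)" for n i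
    by (simp add: power_mult_distrib mult.left_commute)
  from weighted_mono(1)[OF w this] have wi: "weighted r (\<lambda>n. proj_coeff f n $ i)" for i .
  show ?thesis
    unfolding proj0_synth
    by (rule synth_sobolev[OF l1_weighted(1)[OF r wi] proj_coeff_cnj weighted_vector(1)[OF wi]])
qed

lemma weighted_derivative:
  fixes c :: "int^3 \<Rightarrow> complex"
  assumes c: "weighted r c"
  shows "weighted (r - 1) (\<lambda>n. \<i> * of_real (freq a n $ j) * c n)"
    and "wnorm (r - 1) (\<lambda>n. \<i> * of_real (freq a n $ j) * c n) \<le> wnorm r c"
proof -
  have "wt n powr (r - 1) * (norm (\<i> * of_real (freq a n $ j) * c n))\<^sup>2 \<le> 1 * (wt n powr r * (norm (c n))\<^sup>2)" for n
  proof -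
    have "\<bar>freq a n $ j\<bar>\<^sup>2 \<le> (sqrt (wt n))\<^sup>2" by (rule power_mono[OF norm_freq_nth_le]) simp
    then have "(freq a n $ j)\<^sup>2 \<le> wt n" using wt_pos[of n] by simp
    then have "wt n powr (r - 1) * ((freq a n $ j)\<^sup>2 * (norm (c n))\<^sup>2) \<le> wt n powr (r - 1) * (wt n * (norm (c n))\<^sup>2)"
      by (intro mult_left_mono mult_right_mono) auto
    moreover have "wt n powr (r - 1) * wt n = wt n powr r"
      using wt_pos[of n] powr_add[of "wt n" "r - 1" 1] by simp
    ultimately show ?thesis by (simp add: norm_mult power_mult_distrib mult.assoc[symmetric])
  qed
  from weighted_mono[OF c this] show "weighted (r - 1) (\<lambda>n. \<i> * of_real (freq a n $ j) * c n)"
    "wnorm (r - 1) (\<lambda>n. \<i> * of_real (freq a n $ j) * c n) \<le> wnorm r c" by simp_all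
qed

lemma l1_family_weighted:
  assumes m: "\<And>n. (\<lambda>t. c t n) \<in> borel_measurable (timeM T)" and r: "3/2 < r"
    and w: "\<And>t. t \<in> {0..T} \<Longrightarrow> weighted r (c t)" "\<And>t. t \<in> {0..T} \<Longrightarrow> wnorm r (c t) \<le> K"
  shows "l1_family T c"
proof (rule l1_familyI[OF m])
  fix t assume t: "t \<in> {0..T}"
  show "l1 (c t)" by (rule l1_weighted(1)[OF r w(1)[OF t]])
  show "l1norm (c t) \<le> (\<Sum>\<^sub>\<infinity>n. wt n powr - r) + K"
    using l1_weighted(2)[OF r w(1)[OF t]] w(2)[OF t] by linarith
qed

lemma mode_family_lincomb:
  assumes c: "mode_family T c" and d: "mode_family T d"
  shows "mode_family T (\<lambda>t n. x n * c t n + y n * d t n)"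
  unfolding mode_family_def
proof (intro allI conjI)
  fix n
  obtain B where Bc: "\<And>t. t \<in> {0..T} \<Longrightarrow> norm (c t n) \<le> B" using c unfolding mode_family_def by blast
  obtain B' where Bd: "\<And>t. t \<in> {0..T} \<Longrightarrow> norm (d t n) \<le> B'" using d unfolding mode_family_def by blast
  show "(\<lambda>t. x n * c t n + y n * d t n) \<in> borel_measurable (timeM T)"
    using c d unfolding mode_family_def by (intro borel_measurable_add borel_measurable_times) auto
  have "norm (x n * c t n + y n * d t n) \<le> norm (x n) * B + norm (y n) * B'" if "t \<in> {0..T}" for t
    by (rule order_trans[OF norm_triangle_ineq]) (auto simp: norm_mult intro!: add_mono mult_left_mono Bc Bd that)
  then show "\<exists>B. \<forall>t\<in>{0..T}. norm (x n * c t n + y n * d t n) \<le> B" by blast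
qed

lemma mode_family_test_integrable:
  assumes c: "mode_family T c" and h: "continuous_on {0..T} h"
  shows "integrable (timeM T) (\<lambda>t. h t * c t n)"
proof -
  obtain B where B: "0 \<le> B" "\<And>t. t \<in> {0..T} \<Longrightarrow> norm (h t) \<le> B" using continuous_bounded[OF h] by metis
  show ?thesis
    by (rule integrable_bounded_mult[OF mode_family_integrable[OF c] continuous_timeM[OF h], where B=B]) (use B(2) in simp)
qed

lemma mean_limit_trunc_lincomb:
  assumes "mean_limit T (trunc c) f" "mean_limit T (trunc d) g"
  shows "mean_limit T (trunc (\<lambda>t n. of_real r * c t n + of_real q * d t n)) (\<lambda>t x. r * f t x + q * g t x)"
proof -
  have "trunc (\<lambda>t n. of_real r * c t n + of_real q * d t n) = (\<lambda>N t x. r * trunc c N t x + q * trunc d N t x)"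
    by (simp add: fun_eq_iff trunc_def distrib_right sum.distrib mult.assoc sum_distrib_left[symmetric])
  then show ?thesis using mean_limit_add[OF assms] by simp
qed

text \<open>The pressure multiplier; it is bounded because horizontal wave vectors stay away from zero.\<close>

definition press :: "3 \<Rightarrow> int^3 \<Rightarrow> complex" where
  "press j n = (if horizontal n then \<i> * of_real (freq a n $ j / (rad n)\<^sup>2) else 0)"

lemma freq_le_rad: "i \<noteq> 3 \<Longrightarrow> \<bar>freq a n $ i\<bar> \<le> rad n"
  using exhaust_3[of i] unfolding rad_def by (auto simp: real_le_rsqrt)

lemma norm_press:
  assumes j: "j \<noteq> 3" shows "norm (press j n) \<le> a$1 + a$2"
proof (cases "horizontal n")
  case True
  note r = rad_pos[OF True]
  have "(1::3) \<noteq> 3" "(2::3) \<noteq> 3" by simp_all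
  with True obtain i :: 3 where i: "i \<noteq> 3" "n $ i \<noteq> 0" unfolding horizontal_def by blast
  have "1 \<le> \<bar>of_int (n $ i) :: real\<bar>" using i(2) by linarith
  then have "1 \<le> a $ i * \<bar>freq a n $ i\<bar>" using side_pos[of i] by (simp add: freq_nth)
  also have "\<dots> \<le> a $ i * rad n" using freq_le_rad[OF i(1)] side_pos[of i] by (intro mult_left_mono) auto
  also have "\<dots> \<le> (a$1 + a$2) * rad n"
    using exhaust_3[of i] i(1) side_pos[of 1] side_pos[of 2] r by (intro mult_right_mono) auto
  finally have 1: "1 \<le> (a$1 + a$2) * rad n" .
  have "norm (press j n) = \<bar>freq a n $ j\<bar> / (rad n)\<^sup>2" using True by (simp add: press_def norm_mult norm_divide norm_power)
  also have "\<dots> \<le> rad n / (rad n)\<^sup>2" using freq_le_rad[OF j] by (intro divide_right_mono) auto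
  also have "\<dots> = 1 / rad n" using r by (simp add: power2_eq_square)
  also have "\<dots> \<le> a$1 + a$2" using 1 r by (simp add: divide_le_eq)
  finally show ?thesis .
qed (use side_pos[of 1] side_pos[of 2] in \<open>simp add: press_def\<close>)

lemma norm_freq_press:
  assumes "i \<noteq> 3" "j \<noteq> 3" shows "norm (\<i> * of_real (freq a n $ i) * press j n) \<le> 1"
proof (cases "horizontal n")
  case True
  note r = rad_pos[OF True]
  have "\<bar>freq a n $ i\<bar> * \<bar>freq a n $ j\<bar> \<le> rad n * rad n" using assms r by (intro mult_mono freq_le_rad) auto
  then show ?thesis using True r by (simp add: press_def norm_mult norm_divide norm_power divide_le_eq power2_eq_square abs_mult)
qed (simp add: press_def)

end

context filtered_limit begin

text \<open>Coefficients of the projection (\<open>uc\<close>) and of the averaged velocity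
  (\<open>uav\<close>), of the first and second derivatives of the projection, of the slow
  velocity as a family (\<open>Zc\<close>), of the convection term (\<open>Fh\<close>), of the
  pressure (\<open>ph\<close>) and its gradient (\<open>Gh\<close>), and of the derivative in time
  that these prescribe (\<open>dc\<close>).\<close>

definition uc :: "3 \<Rightarrow> real \<Rightarrow> int^3 \<Rightarrow> complex" where "uc i t n = (if horizontal n then Z t n i else 0)"
definition uav :: "3 \<Rightarrow> real \<Rightarrow> int^3 \<Rightarrow> complex" where "uav i t n = (if horizontal n then 0 else Z t n i)"
definition Du :: "3 \<Rightarrow> 3 \<Rightarrow> real \<Rightarrow> int^3 \<Rightarrow> complex" where "Du j i t n = \<i> * of_real (freq a n $ j) * uc i t n"
definition DDu :: "3 \<Rightarrow> 3 \<Rightarrow> real \<Rightarrow> int^3 \<Rightarrow> complex" where "DDu j i t n = \<i> * of_real (freq a n $ j) * Du j i t n"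
definition Zc :: "3 \<Rightarrow> real \<Rightarrow> int^3 \<Rightarrow> complex" where "Zc j t n = Z t n j"
definition Fh :: "3 \<Rightarrow> real \<Rightarrow> int^3 \<Rightarrow> complex" where
  "Fh i t n = convol (Zc 1 t) (Du 1 i t) n + convol (Zc 2 t) (Du 2 i t) n"
definition ph :: "real \<Rightarrow> int^3 \<Rightarrow> complex" where "ph t n = press 1 n * Fh 1 t n + press 2 n * Fh 2 t n"
definition Gh :: "3 \<Rightarrow> real \<Rightarrow> int^3 \<Rightarrow> complex" where "Gh i t n = \<i> * of_real (freq a n $ i) * ph t n"
definition dc :: "3 \<Rightarrow> real \<Rightarrow> int^3 \<Rightarrow> complex" where
  "dc i t n = - Fh i t n - Gh i t n + of_real \<nu> * (DDu 1 i t n + DDu 2 i t n + DDu 3 i t n)"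

lemma proj_coeff_uc: "proj_coeff (U t) n $ emb i = uc i t n"
  by (simp add: proj_coeff_nth uc_def Z_def Uh_def)

lemma Z_split: "Zc j t n = uc j t n + uav j t n"
  by (simp add: Zc_def uc_def uav_def)

lemma Z_cnj: "Zc j t (- n) = cnj (Zc j t n)"
  unfolding Zc_def Z_def Uh_def by (intro kernel_part_cnj fourier_minus_index)

lemma uc_weighted:
  assumes t: "t \<in> {0..T}"
  shows "weighted s (uc i t)" "wnorm s (uc i t) \<le> 4 * C\<^sup>2" "weighted s (uav i t)" "wnorm s (uav i t) \<le> 4 * C\<^sup>2"
proof -
  have 1: "wt n powr s * (norm (uc i t n))\<^sup>2 \<le> 1 * (wt n powr s * (norm (Z t n i))\<^sup>2)"
    and 2: "wt n powr s * (norm (uav i t n))\<^sup>2 \<le> 1 * (wt n powr s * (norm (Z t n i))\<^sup>2)" for n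
    by (simp_all add: uc_def uav_def)
  show "weighted s (uc i t)" "wnorm s (uc i t) \<le> 4 * C\<^sup>2"
    using weighted_mono[OF Z_weighted(1)[OF t] 1] Z_weighted(2)[OF t, of i] by auto
  show "weighted s (uav i t)" "wnorm s (uav i t) \<le> 4 * C\<^sup>2"
    using weighted_mono[OF Z_weighted(1)[OF t] 2] Z_weighted(2)[OF t, of i] by auto
qed

lemma uc_continuous: "continuous_on {0..T} (\<lambda>t. uc i t n)"
  by (cases "horizontal n") (simp_all add: uc_def Z_continuous)

theorem projection_continuous:
  assumes \<rho>: "\<rho> < s" shows "(\<lambda>t. proj0 a (U t)) \<in> cont_sobolev a T \<rho>"
  unfolding proj0_synth
proof (rule cont_sobolev_synth[OF _ _ _ _ s' \<rho>])
  have w: "weighted s (\<lambda>n. proj_coeff (U t) n $ i)" "wnorm s (\<lambda>n. proj_coeff (U t) n $ i) \<le> 4 * C\<^sup>2" if t: "t \<in> {0..T}" for t i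
    using uc_weighted(1,2)[OF t]
    by (cases i rule: exhaust_emb; auto simp: proj_coeff_uc[abs_def] proj_coeff_nth(2) weighted_def wnorm_def uc_def[abs_def])+
  show "continuous_on {0..T} (\<lambda>t. proj_coeff (U t) n $ i)" for n i
    by (cases i rule: exhaust_emb) (simp_all add: proj_coeff_uc proj_coeff_nth(2) uc_continuous)
  show "weighted s (proj_coeff (U t))" if t: "t \<in> {0..T}" for t by (rule weighted_vector(1)[OF w(1)[OF t]])
  show "wnorm s (proj_coeff (U t)) \<le> 16 * C\<^sup>2" if t: "t \<in> {0..T}" for t
  proof -
    have "(\<Sum>i\<in>UNIV. wnorm s (\<lambda>n. proj_coeff (U t) n $ i)) \<le> of_nat (card (UNIV :: 4 set)) * (4 * C\<^sup>2)"
      by (rule sum_bounded_above) (rule w(2)[OF t])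
    then show ?thesis unfolding weighted_vector(2)[OF w(1)[OF t]] by simp
  qed
qed (rule proj_coeff_cnj)

text \<open>At time zero the propagator is the identity, so every filtered solution starts from
  \<open>V0\<close>.\<close>

lemma projection_initial:
  assumes T: "0 \<le> T" and V0: "V0 \<in> sobolev a s" shows "proj0 a (U 0) = proj0 a V0"
proof -
  have 0: "0 \<in> {0..T}" using T by simp
  have "Vh j 0 n $ i = fourier a V0 n $ i" for j n i
  proof -
    have "AE x in lborel. V (e j) 0 x = V0 x" using sol[OF e(1)] by (simp add: pbs_solution_def)
    then have ae: "AE x in cellM. V (e j) 0 x $ i = V0 x $ i" unfolding AE_cell by eventually_elim simp
    show ?thesis unfolding Vh_def fourier_nth
      by (rule fc_cong_AE[OF ae]) (use sobolev_nth_integrable[OF V_sobolev[OF 0]] sobolev_nth_integrable[OF V0] in auto)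
  qed
  then have "Wh j 0 n = fourier a V0 n" for j n by (simp add: Wh_def propagator_symbol_0 vec_eq_iff)
  with W_lim[OF 0] have "(\<lambda>j::nat. fourier a V0 n) \<longlonglongrightarrow> Uh 0 n" for n by simp
  then have "fourier a (U 0) n = fourier a V0 n" for n using LIMSEQ_unique tendsto_const unfolding Uh_def by blast
  then have eq: "fourier a (U 0) = fourier a V0" by (rule ext)
  show ?thesis unfolding proj0_def eq ..
qed

lemma families:
  shows "l1_family T (uc i)" "l1_family T (uav i)" "l1_family T (Zc i)" "l1_family T (Du j i)"
    and "mode_family T (DDu j i)"
proof -
  have Zm: "(\<lambda>t. Z t n i) \<in> borel_measurable (timeM T)" for n i by (rule continuous_timeM[OF Z_continuous])
  show u: "l1_family T (uc i)" for i
    by (rule l1_family_weighted[OF continuous_timeM[OF uc_continuous] s' uc_weighted(1,2)])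
  have "(\<lambda>t. uav i t n) \<in> borel_measurable (timeM T)" for n
    by (cases "horizontal n") (simp_all add: uav_def Zm)
  then show v: "l1_family T (uav i)"
    by (rule l1_family_weighted[OF _ s' uc_weighted(3,4)])
  show "l1_family T (Zc i)" using l1_family_add[OF u[of i] v] by (simp add: Z_split[abs_def])
  have m: "(\<lambda>t. \<i> * of_real (freq a n $ j) * uc i t n) \<in> borel_measurable (timeM T)" for n i
    by (intro continuous_timeM continuous_intros uc_continuous)
  show D: "l1_family T (Du j i)" unfolding Du_def[abs_def]
  proof (rule l1_family_weighted[OF m, where r="s - 1" and K="4 * C\<^sup>2"])
    show "3/2 < s - 1" using s by simp
    fix t assume t: "t \<in> {0..T}"
    show "weighted (s - 1) (\<lambda>n. \<i> * of_real (freq a n $ j) * uc i t n)" by (rule weighted_derivative(1)[OF uc_weighted(1)[OF t]])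
    show "wnorm (s - 1) (\<lambda>n. \<i> * of_real (freq a n $ j) * uc i t n) \<le> 4 * C\<^sup>2"
      by (rule order_trans[OF weighted_derivative(2)[OF uc_weighted(1)[OF t]] uc_weighted(2)[OF t]])
  qed
  show "mode_family T (DDu j i)"
    using mode_family_lincomb[OF l1_family_mode_family[OF D] l1_family_mode_family[OF D], of "\<lambda>n. \<i> * of_real (freq a n $ j)" "\<lambda>n. 0"]
    by (simp add: DDu_def[abs_def])
qed

lemma DDu_mean_limit: obtains f where "mean_limit T (trunc (DDu j i)) f"
proof (rule mean_limit_weighted[OF families(5), where r="s - 1 - 1" and K="4 * C\<^sup>2"])
  show "0 < s - 1 - 1" using s by simp
  fix t assume t: "t \<in> {0..T}"
  have w: "weighted (s - 1) (Du j i t)" "wnorm (s - 1) (Du j i t) \<le> 4 * C\<^sup>2"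
    unfolding Du_def[abs_def]
    by (rule weighted_derivative(1)[OF uc_weighted(1)[OF t]], rule order_trans[OF weighted_derivative(2)[OF uc_weighted(1)[OF t]] uc_weighted(2)[OF t]])
  show "weighted (s - 1 - 1) (DDu j i t)" unfolding DDu_def[abs_def] by (rule weighted_derivative(1)[OF w(1)])
  show "wnorm (s - 1 - 1) (DDu j i t) \<le> 4 * C\<^sup>2" unfolding DDu_def[abs_def]
    by (rule order_trans[OF weighted_derivative(2)[OF w(1)] w(2)])
qed (rule that)

lemma Fh_family: "l1_family T (Fh i)"
  unfolding Fh_def[abs_def] by (intro l1_family_add l1_family_convol families)

lemma ph_family: "l1_family T ph"
  unfolding ph_def[abs_def]
  by (intro l1_family_add l1_family_multiplier[OF Fh_family norm_press]) simp_all

lemma Gh_family: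
  assumes i: "i \<noteq> 3" shows "l1_family T (Gh i)"
proof -
  have "Gh i = (\<lambda>t n. (\<i> * of_real (freq a n $ i) * press 1 n) * Fh 1 t n + (\<i> * of_real (freq a n $ i) * press 2 n) * Fh 2 t n)"
    by (simp add: fun_eq_iff Gh_def ph_def algebra_simps)
  then show ?thesis
    by (simp only:) (intro l1_family_add l1_family_multiplier[OF Fh_family norm_freq_press] i; simp)
qed

lemma Z_orth: "of_real (freq a k $ 1) * Z t k 1 + of_real (freq a k $ 2) * Z t k 2 = 0"
proof (cases "horizontal k")
  case True then show ?thesis by (simp add: Z_def part_def perp_simps algebra_simps)
next
  case False then show ?thesis by (simp add: horizontal_def freq_nth)
qed

text \<open>Because the advecting modes are orthogonal to their own wave vectors, the derivative may be moved
  outside the interaction.\<close>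

lemma Fh_interaction:
  assumes t: "t \<in> {0..T}"
  defines "q \<equiv> \<lambda>n k. of_real (freq a n $ 1) * Z t k 1 + of_real (freq a n $ 2) * Z t k 2"
  shows "((\<lambda>k. \<i> * q n k * uc i t (n - k)) has_sum Fh i t n) UNIV"
proof -
  have l: "l1 (Zc j t)" "l1 (Du j i t)" for j i
    using families(3)[of j] families(4)[of j i] t by (auto simp: l1_family_def)
  have h: "((\<lambda>k. Zc j t k * Du j i t (n - k)) has_sum convol (Zc j t) (Du j i t) n) UNIV" for j
    unfolding convol_def by (rule has_sum_infsum[OF convol_facts(4)[OF l]])
  have "Zc 1 t k * Du 1 i t (n - k) + Zc 2 t k * Du 2 i t (n - k) = \<i> * q n k * uc i t (n - k)" for k
  proof -
    have "Zc 1 t k * Du 1 i t (n - k) + Zc 2 t k * Du 2 i t (n - k) = \<i> * q (n - k) k * uc i t (n - k)"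
      by (simp add: Zc_def Du_def q_def algebra_simps)
    also have "q (n - k) k = q n k" using Z_orth[of k t] by (simp add: q_def freq_diff algebra_simps)
    finally show ?thesis .
  qed
  with has_sum_add[OF h[of 1] h[of 2]] show ?thesis by (simp add: Fh_def)
qed

text \<open>As the slow velocity is horizontal, the convection term is the divergence of a
  horizontal flux, and such a divergence has no modes without horizontal wave vector.\<close>

lemma Fh_average:
  assumes t: "t \<in> {0..T}" and n: "\<not> horizontal n" shows "Fh i t n = 0"
  using has_sum_unique[OF Fh_interaction[OF t, of n i]] n by (simp add: horizontal_def freq_nth has_sum_0)

text \<open>If the advected mode belongs to the average, the advecting one has the horizontal wave
  vector of \<open>n\<close> and is orthogonal to it; so it does not matter that \<open>Fh\<close>
  omits such modes.\<close>

lemma Fh_perp: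
  assumes t: "t \<in> {0..T}" shows "of_real (perp n 1) * Fh 1 t n + of_real (perp n 2) * Fh 2 t n = Nl t n"
proof -
  let ?q = "\<lambda>k. of_real (freq a n $ 1) * Z t k 1 + of_real (freq a n $ 2) * Z t k 2"
  have Z3: "Z t k 3 = 0" for k by (simp add: Z_def part_def perp_simps)
  have "of_real (perp n 1) * (\<i> * ?q k * uc 1 t (n - k)) + of_real (perp n 2) * (\<i> * ?q k * uc 2 t (n - k)) = \<i> * inter n (Z t k) (Z t (n - k))" for k
  proof (cases "horizontal (n - k)")
    case True then show ?thesis by (simp add: inter_def sum_3 Z3 uc_def algebra_simps)
  next
    case False
    then have "freq a n $ 1 = freq a k $ 1" "freq a n $ 2 = freq a k $ 2" by (auto simp: horizontal_def freq_nth)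
    then have "?q k = 0" using Z_orth[of k t] by simp
    then show ?thesis by (simp add: inter_def sum_3 Z3)
  qed
  with has_sum_add[OF has_sum_cmult_right[OF Fh_interaction[OF t, of n 1], of "of_real (perp n 1)"] has_sum_cmult_right[OF Fh_interaction[OF t, of n 2], of "of_real (perp n 2)"]]
  show ?thesis unfolding Nl_def by (simp add: infsumI)
qed

lemma uc_wl: "horizontal n \<Longrightarrow> uc i t n = wl t n * of_real (perp n i)"
  by (simp add: uc_def Z_def part_def wl_def)

lemma DDu_sum: "DDu 1 i t n + DDu 2 i t n + DDu 3 i t n = - of_real ((norm (freq a n))\<^sup>2) * uc i t n"
  unfolding DDu_def Du_def i_mult_twice norm_vec_square_sum sum_3 by (simp add: algebra_simps power2_eq_square)

text \<open>The horizontal part of \<open>e0 n\<close> and the normalised horizontal wave vector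
  form an orthonormal basis of the plane.  The pressure gradient removes the component of the
  convection term along the latter, and \<open>Nl\<close> is the component along the former.\<close>

lemma dc_mode:
  assumes t: "t \<in> {0..T}" and n: "horizontal n" and i: "i \<noteq> 3"
  shows "dc i t n = - (of_real (perp n i) * Nl t n + of_real (\<nu> * (norm (freq a n))\<^sup>2) * uc i t n)"
proof -
  let ?r = "complex_of_real (rad n)" and ?k = "\<lambda>i. complex_of_real (freq a n $ i)"
  have r: "?r \<noteq> 0" using rad_pos[OF n] by simp
  have r2: "?r * ?r = ?k 1 * ?k 1 + ?k 2 * ?k 2"
    using arg_cong[OF rad_square[of n], of complex_of_real] by (simp add: power2_eq_square)
  have p: "press j n = \<i> * (?k j / (?r * ?r))" for j using n by (simp add: press_def power2_eq_square)
  have P: "ph t n = \<i> * ((?k 1 * Fh 1 t n + ?k 2 * Fh 2 t n) / (?r * ?r))"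
    unfolding ph_def p using r by (simp add: field_simps)
  have G: "?r * ?r * Gh i t n = - (?k i * (?k 1 * Fh 1 t n + ?k 2 * Fh 2 t n))"
  proof -
    have "?r * ?r * Gh i t n = (\<i> * \<i>) * (?k i * (?r * ?r * ((?k 1 * Fh 1 t n + ?k 2 * Fh 2 t n) / (?r * ?r))))"
      unfolding Gh_def P by (simp only: mult_ac)
    then show ?thesis using r by simp
  qed
  have "?r * ?r * (of_real (perp n i) * Nl t n) = (?r * of_real (perp n i)) * (?r * of_real (perp n 1) * Fh 1 t n + ?r * of_real (perp n 2) * Fh 2 t n)"
    unfolding Fh_perp[OF t, symmetric] by (simp add: algebra_simps)
  also have "?r * of_real (perp n 1) = - ?k 2" using r by (simp add: perp_simps)
  also have "?r * of_real (perp n 2) = ?k 1" using r by (simp add: perp_simps)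
  also have "(?r * of_real (perp n i)) * (- ?k 2 * Fh 1 t n + ?k 1 * Fh 2 t n) = ?r * ?r * Fh i t n + ?r * ?r * Gh i t n"
  proof -
    consider "i = 1" | "i = 2" using exhaust_3[of i] i by auto
    then show ?thesis unfolding G unfolding r2
      by cases (use r in \<open>simp_all add: perp_simps algebra_simps\<close>)
  qed
  finally have "?r * ?r * (of_real (perp n i) * Nl t n) = ?r * ?r * (Fh i t n + Gh i t n)" by (simp only: distrib_left)
  then have "of_real (perp n i) * Nl t n = Fh i t n + Gh i t n" using r by simp
  then show ?thesis unfolding dc_def DDu_sum by (simp add: algebra_simps)
qed

lemma dc_average:
  assumes t: "t \<in> {0..T}" and n: "\<not> horizontal n" shows "dc i t n = 0"
  using n Fh_average[OF assms] by (simp add: dc_def Gh_def ph_def DDu_def Du_def uc_def)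

lemma dc_family:
  assumes i: "i \<noteq> 3" shows "mode_family T (dc i)"
proof -
  note FG = mode_family_lincomb[OF l1_family_mode_family[OF Fh_family] l1_family_mode_family[OF Gh_family[OF i]], of "\<lambda>_. -1" i "\<lambda>_. -1"]
  note D = mode_family_lincomb[OF mode_family_lincomb[OF families(5) families(5), of "\<lambda>_. 1" 1 i "\<lambda>_. 1" 2 i] families(5), of "\<lambda>_. 1" "\<lambda>_. 1" 3 i]
  show ?thesis using mode_family_lincomb[OF FG D, of "\<lambda>_. 1" "\<lambda>_. of_real \<nu>"] by (simp add: dc_def[abs_def])
qed

lemma mode_evolution:
  assumes th: "time_test T \<theta>" and i: "i \<noteq> 3"
  shows "(\<integral>t. of_real (deriv \<theta> t) * uc i t n \<partial>timeM T) = - (\<integral>t. of_real (\<theta> t) * dc i t n \<partial>timeM T)"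
proof (cases "horizontal n")
  case False
  have "(\<integral>t. of_real (\<theta> t) * dc i t n \<partial>timeM T) = (\<integral>t. 0 \<partial>timeM T)"
    by (rule Bochner_Integration.integral_cong[OF refl]) (simp add: dc_average False)
  then show ?thesis using False by (simp add: uc_def)
next
  case True
  note thc = time_test_continuous[OF th]
  let ?p = "complex_of_real (perp n i)" and ?k = "complex_of_real (\<nu> * (norm (freq a n))\<^sup>2)"
  let ?N = "\<lambda>t. of_real (perp n 1) * Fh 1 t n + of_real (perp n 2) * Fh 2 t n"
  have Nf: "mode_family T (\<lambda>t n. of_real (perp n 1) * Fh 1 t n + of_real (perp n 2) * Fh 2 t n)"
    by (intro mode_family_lincomb l1_family_mode_family Fh_family)
  have iN: "integrable (timeM T) (\<lambda>t. of_real (\<theta> t) * ?N t)"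
    by (rule mode_family_test_integrable[OF Nf thc, of n])
  have iu: "integrable (timeM T) (\<lambda>t. of_real (\<theta> t) * uc i t n)"
    by (rule mode_family_test_integrable[OF l1_family_mode_family[OF families(1)] thc])
  have "(\<integral>t. of_real (\<theta> t) * dc i t n \<partial>timeM T) = (\<integral>t. - (?p * (of_real (\<theta> t) * ?N t) + ?k * (of_real (\<theta> t) * uc i t n)) \<partial>timeM T)"
  proof (rule Bochner_Integration.integral_cong[OF refl])
    fix t assume "t \<in> space (timeM T)"
    then have t: "t \<in> {0..T}" by simp
    show "of_real (\<theta> t) * dc i t n = - (?p * (of_real (\<theta> t) * ?N t) + ?k * (of_real (\<theta> t) * uc i t n))"
      unfolding dc_mode[OF t True i] Fh_perp[OF t] by (simp add: algebra_simps)
  qed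
  also have "\<dots> = - (?p * (\<integral>t. of_real (\<theta> t) * ?N t \<partial>timeM T) + ?k * (\<integral>t. of_real (\<theta> t) * uc i t n \<partial>timeM T))"
    using iN iu by simp
  also have "(\<integral>t. of_real (\<theta> t) * ?N t \<partial>timeM T) = (\<integral>t. of_real (\<theta> t) * Nl t n \<partial>timeM T)"
    by (rule Bochner_Integration.integral_cong[OF refl]) (simp add: Fh_perp)
  also have "(\<integral>t. of_real (\<theta> t) * uc i t n \<partial>timeM T) = ?p * (\<integral>t. of_real (\<theta> t) * wl t n \<partial>timeM T)"
    unfolding integral_mult_right_zero[symmetric] uc_wl[OF True] by (simp only: mult_ac)
  finally have dq: "(\<integral>t. of_real (\<theta> t) * dc i t n \<partial>timeM T) =
      - (?p * (\<integral>t. of_real (\<theta> t) * Nl t n \<partial>timeM T) + ?k * (?p * (\<integral>t. of_real (\<theta> t) * wl t n \<partial>timeM T)))" .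
  have "- (\<integral>t. of_real (\<theta> t) * dc i t n \<partial>timeM T) = ?p * (?k * (\<integral>t. of_real (\<theta> t) * wl t n \<partial>timeM T) + (\<integral>t. of_real (\<theta> t) * Nl t n \<partial>timeM T))"
    unfolding dq by (simp add: algebra_simps)
  also have "\<dots> = ?p * (\<integral>t. of_real (deriv \<theta> t) * wl t n \<partial>timeM T)"
    unfolding limit_mode_equation[OF th True] ..
  also have "\<dots> = (\<integral>t. of_real (deriv \<theta> t) * uc i t n \<partial>timeM T)"
    unfolding integral_mult_right_zero[symmetric] uc_wl[OF True] by (simp only: mult_ac)
  finally show ?thesis by simp
qed

text \<open>Coefficients of a product are convolutions, and the slow velocity is the projection
  plus the average.\<close>

lemma advection_product:
  assumes t: "t \<in> {0..T}"
  shows "Re (ser (Fh i t) x) = (Re (ser (uc 1 t) x) + Re (ser (uav 1 t) x)) * Re (ser (Du 1 i t) x)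
     + (Re (ser (uc 2 t) x) + Re (ser (uav 2 t) x)) * Re (ser (Du 2 i t) x)"
proof -
  have l: "l1 (uc j t)" "l1 (uav j t)" "l1 (Zc j t)" "l1 (Du j i t)" for j
    using families(1-3)[of j] families(4)[of j i] t by (auto simp: l1_family_def)
  have "ser (Fh i t) x = ser (Zc 1 t) x * ser (Du 1 i t) x + ser (Zc 2 t) x * ser (Du 2 i t) x"
    unfolding Fh_def[abs_def] by (simp add: ser_add convol_facts(1,3) l)
  moreover have "Im (ser (Zc j t) x) = 0" for j by (rule ser_real[of "Zc j t", OF Z_cnj])
  moreover have "ser (Zc j t) x = ser (uc j t) x + ser (uav j t) x" for j
    using ser_add[OF l(1)[of j] l(2)[of j], of x] by (simp add: Z_split[symmetric])
  then have "Re (ser (Zc j t) x) = Re (ser (uc j t) x) + Re (ser (uav j t) x)" for j by simp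
  ultimately show ?thesis by simp
qed

lemma average_ae:
  assumes i: "i \<noteq> 3"
  shows "AE z in cylM T. hor_average a (U (fst z)) (snd z $ 3) $ emb i = Re (ser (uav i (fst z)) (snd z))"
proof (rule AE_cyl_combine[where P="\<lambda>z. hor_average a (U (fst z)) (snd z $ 3) $ emb i = Re (ser (uav i (fst z)) (snd z))"])
  have l: "l1 (uav i t)" if "t \<in> {0..T}" for t using families(2)[of i] that by (auto simp: l1_family_def)
  have 1: "(\<lambda>z. hor_average a (U (fst z)) (snd z $ 3) $ emb i) \<in> borel_measurable (cylM T)"
    by (rule hor_average_measurable[OF U])
  have 2: "(\<lambda>z. Re (ser (uav i (fst z)) (snd z))) \<in> borel_measurable (cylM T)"
  proof -
    have "(\<lambda>z. ser (uav i (fst z)) (snd z)) \<in> borel_measurable (cylM T)"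
      by (rule ser_cyl_measurable[OF l1_family_measurable[OF families(2)] l])
    then show ?thesis by measurable
  qed
  show "{z \<in> space (cylM T). hor_average a (U (fst z)) (snd z $ 3) $ emb i = Re (ser (uav i (fst z)) (snd z))} \<in> sets (cylM T)"
    by (rule borel_measurable_eq[OF 1 2])
  fix t assume t: "t \<in> {0..T}"
  have "(\<lambda>n. if horizontal n then 0 else fourier a (U t) n $ emb i) = uav i t"
    using i by (simp add: fun_eq_iff uav_def Z_def part_def Uh_def)
  with hor_average_modes[OF U_sobolev[OF t], of "emb i"] l[OF t]
  show "AE x in cellM. hor_average a (U (fst (t, x))) (snd (t, x) $ 3) $ emb i = Re (ser (uav i (fst (t, x))) (snd (t, x)))"
    by simp
qed

theorem limit_equations:
  "limit_solution a \<nu> T (\<lambda>t x3. hor (hor_average a (U t) x3)) (\<lambda>t x. hor (proj0 a (U t) x))"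
proof -
  define DD where "DD j i = (SOME f. mean_limit T (trunc (DDu j i)) f)" for j i
  have DD: "mean_limit T (trunc (DDu j i)) (DD j i)" for j i
  proof -
    have "\<exists>f. mean_limit T (trunc (DDu j i)) f" by (rule DDu_mean_limit[where j=j and i=i]) blast
    then show ?thesis unfolding DD_def by (rule someI_ex)
  qed
  have h3: "hemb i \<noteq> 3" for i by (simp add: hemb_def)
  let ?R = "\<lambda>c t x. Re (ser (c t) x)"
  define ut where "ut i = (\<lambda>t x. 1 * (- 1 * ?R (Fh i) t x + - 1 * ?R (Gh i) t x) + \<nu> * (1 * (1 * DD 1 i t x + 1 * DD 2 i t x) + 1 * DD 3 i t x))" for i
  have lim: "l1_family T c \<Longrightarrow> mean_limit T (trunc c) (?R c)" for c by (rule mean_limit_l1_family)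
  have wt: "weak_dt a T (?R (uc i)) (ut i)" if i: "i \<noteq> 3" for i
  proof (rule weak_deriv_mean_limit[OF lim[OF families(1)] _ _ time_in_Basis])
    show "weak_dt a T (trunc (uc i) N) (trunc (dc i) N)" for N
      by (rule weak_dt_trunc[OF l1_family_mode_family[OF families(1)] dc_family[OF i] mode_evolution[OF _ i]])
    have eq: "(\<lambda>t n. of_real 1 * (of_real (- 1) * Fh i t n + of_real (- 1) * Gh i t n) + of_real \<nu> * (of_real 1 * (of_real 1 * DDu 1 i t n + of_real 1 * DDu 2 i t n) + of_real 1 * DDu 3 i t n)) = dc i"
      by (simp add: fun_eq_iff dc_def)
    show "mean_limit T (trunc (dc i)) (ut i)"
      unfolding ut_def eq[symmetric]
      by (intro mean_limit_trunc_lincomb lim Fh_family Gh_family i DD)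
  qed
  have wx: "weak_dx a T j (?R (uc i)) (?R (Du j i))" for i j
    using weak_dx_trunc[OF l1_family_mode_family[OF families(1)], of j i]
    by (intro weak_deriv_mean_limit[OF lim[OF families(1)] lim[OF families(4)] _ space_in_Basis]) (simp add: Du_def[abs_def])
  have wxx: "weak_dx a T j (?R (Du j i)) (DD j i)" for i j
    using weak_dx_trunc[OF l1_family_mode_family[OF families(4)], of j j i]
    by (intro weak_deriv_mean_limit[OF lim[OF families(4)] DD _ space_in_Basis]) (simp add: DDu_def[abs_def])
  have wp: "weak_dx a T i (?R ph) (?R (Gh i))" if i: "i \<noteq> 3" for i
    using weak_dx_trunc[OF l1_family_mode_family[OF ph_family], of i]
    by (intro weak_deriv_mean_limit[OF lim[OF ph_family] lim[OF Gh_family[OF i]] _ space_in_Basis]) (simp add: Gh_def[abs_def])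
  have u: "(\<lambda>t x. hor (proj0 a (U t) x)) = (\<lambda>t x. \<chi> i. ?R (uc (hemb i)) t x)"
    by (simp add: fun_eq_iff vec_eq_iff hor_nth proj0_synth synth_nth proj_coeff_uc[abs_def] cong: if_cong)
  have pde: "AE z in cylM T. \<forall>i. ut (hemb i) (fst z) (snd z)
      + (?R (uc 1) (fst z) (snd z) * ?R (Du 1 (hemb i)) (fst z) (snd z) + ?R (uc 2) (fst z) (snd z) * ?R (Du 2 (hemb i)) (fst z) (snd z))
      + (hor_average a (U (fst z)) (snd z $ 3) $ 1 * ?R (Du 1 (hemb i)) (fst z) (snd z) + hor_average a (U (fst z)) (snd z $ 3) $ 2 * ?R (Du 2 (hemb i)) (fst z) (snd z))
      - \<nu> * (DD 1 (hemb i) (fst z) (snd z) + DD 2 (hemb i) (fst z) (snd z) + DD 3 (hemb i) (fst z) (snd z))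
      = - ?R (Gh (hemb i)) (fst z) (snd z)"
  proof -
    have "AE z in cylM T. hor_average a (U (fst z)) (snd z $ 3) $ emb 1 = ?R (uav 1) (fst z) (snd z)"
      "AE z in cylM T. hor_average a (U (fst z)) (snd z $ 3) $ emb 2 = ?R (uav 2) (fst z) (snd z)"
      by (intro average_ae; simp)+
    moreover have "AE z in cylM T. fst z \<in> {0..T}" by (rule AE_I2) auto
    ultimately show ?thesis
    proof eventually_elim
      case (elim z)
      have 1: "hor_average a (U (fst z)) (snd z $ 3) $ 1 = ?R (uav 1) (fst z) (snd z)"
        and 2: "hor_average a (U (fst z)) (snd z $ 3) $ 2 = ?R (uav 2) (fst z) (snd z)" using elim by simp_all
      show ?case unfolding 1 2 ut_def advection_product[OF elim(3)] by (simp add: algebra_simps)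
    qed
  qed
  have div: "?R (Du 1 1) t x + ?R (Du 2 2) t x = 0" if t: "t \<in> {0..T}" for t x
  proof -
    have l: "l1 (Du j i t)" for j i using families(4)[of j i] t by (auto simp: l1_family_def)
    have "Du 1 1 t n + Du 2 2 t n = 0" for n
    proof -
      have "Du 1 1 t n + Du 2 2 t n = \<i> * (of_real (freq a n $ 1) * uc 1 t n + of_real (freq a n $ 2) * uc 2 t n)"
        by (simp add: Du_def algebra_simps)
      also have "of_real (freq a n $ 1) * uc 1 t n + of_real (freq a n $ 2) * uc 2 t n = 0"
        using Z_orth[of n t] by (simp add: uc_def)
      finally show ?thesis by simp
    qed
    then have "ser (Du 1 1 t) x + ser (Du 2 2 t) x = 0" using ser_add[OF l[of 1 1] l[of 2 2], of x] by (simp add: ser_def)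
    then show ?thesis by (metis plus_complex.sel(1) zero_complex.sel(1))
  qed
  show ?thesis
    unfolding limit_solution_def u
  proof (intro exI conjI allI)
    show "weak_dt a T (\<lambda>t x. \<chi> i. ?R (uc (hemb i)) t x) (\<lambda>t x. \<chi> i. ut (hemb i) t x)"
      by (simp add: weak_deriv_components[OF time_in_Basis] wt[OF h3])
    show "weak_dx a T j (\<lambda>t x. \<chi> i. ?R (uc (hemb i)) t x) (\<lambda>t x. \<chi> i. ?R (Du j (hemb i)) t x)" for j
      by (simp add: weak_deriv_components[OF space_in_Basis] wx)
    show "weak_dx a T j (\<lambda>t x. \<chi> i. ?R (Du j (hemb i)) t x) (\<lambda>t x. \<chi> i. DD j (hemb i) t x)" for j
      by (simp add: weak_deriv_components[OF space_in_Basis] wxx)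
    show "periodic a (?R ph t)" for t using periodic_ser[of "ph t"] by (simp add: periodic_def)
    show "weak_dx a T 1 (?R ph) (\<lambda>t x. (\<chi> i. ?R (Gh (hemb i)) t x) $ 1)" using wp[of 1] by simp
    show "weak_dx a T 2 (?R ph) (\<lambda>t x. (\<chi> i. ?R (Gh (hemb i)) t x) $ 2)" using wp[of 2] by simp
    show "ae_torus a T (\<lambda>t x. (\<chi> i. ut (hemb i) t x)
        + ((\<chi> i. ?R (uc (hemb i)) t x) $ 1 *\<^sub>R (\<chi> i. ?R (Du 1 (hemb i)) t x) + (\<chi> i. ?R (uc (hemb i)) t x) $ 2 *\<^sub>R (\<chi> i. ?R (Du 2 (hemb i)) t x))
        + (hor (hor_average a (U t) (x$3)) $ 1 *\<^sub>R (\<chi> i. ?R (Du 1 (hemb i)) t x) + hor (hor_average a (U t) (x$3)) $ 2 *\<^sub>R (\<chi> i. ?R (Du 2 (hemb i)) t x))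
        - \<nu> *\<^sub>R (\<Sum>j\<in>UNIV. \<chi> i. DD j (hemb i) t x) = - (\<chi> i. ?R (Gh (hemb i)) t x))"
      unfolding ae_torus_cyl using pde
    proof eventually_elim
      case (elim z)
      show ?case unfolding vec_eq_iff
      proof
        fix i
        show "((\<chi> i. ut (hemb i) (fst z) (snd z))
        + ((\<chi> i. ?R (uc (hemb i)) (fst z) (snd z)) $ 1 *\<^sub>R (\<chi> i. ?R (Du 1 (hemb i)) (fst z) (snd z)) + (\<chi> i. ?R (uc (hemb i)) (fst z) (snd z)) $ 2 *\<^sub>R (\<chi> i. ?R (Du 2 (hemb i)) (fst z) (snd z)))
        + (hor (hor_average a (U (fst z)) (snd z$3)) $ 1 *\<^sub>R (\<chi> i. ?R (Du 1 (hemb i)) (fst z) (snd z)) + hor (hor_average a (U (fst z)) (snd z$3)) $ 2 *\<^sub>R (\<chi> i. ?R (Du 2 (hemb i)) (fst z) (snd z)))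
        - \<nu> *\<^sub>R (\<Sum>j\<in>UNIV. \<chi> i. DD j (hemb i) (fst z) (snd z))) $ i = (- (\<chi> i. ?R (Gh (hemb i)) (fst z) (snd z))) $ i"
          using elim[rule_format, of i] by (simp add: hor_nth sum_3)
      qed
    qed
    show "ae_torus a T (\<lambda>t x. (\<chi> i. ?R (Du 1 (hemb i)) t x) $ 1 + (\<chi> i. ?R (Du 2 (hemb i)) t x) $ 2 = 0)"
      unfolding ae_torus_cyl by (rule AE_I2) (auto simp: div)
  qed
qed

end

theorem proposition5p8:
  fixes a :: "real^3" and \<nu> s Tstar :: real
    and V0 :: "real^3 \<Rightarrow> real^4"
    and V :: "real \<Rightarrow> real \<Rightarrow> real^3 \<Rightarrow> real^4"
    and U :: "real \<Rightarrow> real^3 \<Rightarrow> real^4"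
  assumes "\<forall>i. 0 < a $ i" and "0 < \<nu>" and "5 / 2 < s"
    and "V0 \<in> data_space a s"
    and "0 < Tstar"
    and "\<forall>T\<in>{0..<Tstar}. \<forall>\<epsilon>>0. pbs_solution a \<nu> \<epsilon> s T V0 (V \<epsilon>)"
    and "\<forall>T\<in>{0..<Tstar}. \<exists>C. \<forall>\<epsilon>>0. \<forall>t\<in>{0..T}. sobolev_norm a s (V \<epsilon> t) \<le> C"
    and "\<forall>T\<in>{0..<Tstar}. \<exists>\<sigma>\<in>{s - 2<..<s}. limit_point a T \<sigma> (filtered a V) U"
  shows "proj0 a V0 \<in> sobolev a s \<and>
    (\<forall>T\<in>{0..<Tstar}.
      (\<forall>\<sigma>\<in>{s - 2<..<s}. (\<lambda>t. proj0 a (U t)) \<in> cont_sobolev a T \<sigma>) \<and>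
      (\<forall>t\<in>{0..T}. \<forall>x. proj0 a (U t) x $ 3 = 0 \<and> proj0 a (U t) x $ 4 = 0) \<and>
      limit_solution a \<nu> T (\<lambda>t x3. hor (hor_average a (U t) x3)) (\<lambda>t x. hor (proj0 a (U t) x)) \<and>
      proj0 a (U 0) = proj0 a V0)"
proof -
  interpret torus a by standard (use assms(1) in simp)
  have V0: "V0 \<in> sobolev a s" using assms(4) by (simp add: data_space_def)
  have main: "(\<forall>\<sigma>\<in>{s - 2<..<s}. (\<lambda>t. proj0 a (U t)) \<in> cont_sobolev a T \<sigma>) \<and>
      limit_solution a \<nu> T (\<lambda>t x3. hor (hor_average a (U t) x3)) (\<lambda>t x. hor (proj0 a (U t) x)) \<and>
      proj0 a (U 0) = proj0 a V0" if T: "T \<in> {0..<Tstar}" for T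
  proof -
    obtain C where C: "\<And>\<epsilon> t. 0 < \<epsilon> \<Longrightarrow> t \<in> {0..T} \<Longrightarrow> sobolev_norm a s (V \<epsilon> t) \<le> C" using assms(7) T by blast
    obtain \<sigma> where \<sigma>s: "\<sigma> \<in> {s - 2<..<s}" and lp: "limit_point a T \<sigma> (filtered a V) U" using assms(8) T by blast
    have \<sigma>: "s - 2 < \<sigma>" "\<sigma> < s" using \<sigma>s by simp_all
    obtain e where e: "\<And>k. 0 < e k" "e \<longlonglongrightarrow> (0::real)" and
      conv: "\<And>\<delta>. 0 < \<delta> \<Longrightarrow> \<forall>\<^sub>F k in sequentially. \<forall>t\<in>{0..T}. sobolev_norm a \<sigma> (\<lambda>x. filtered a V (e k) t x - U t x) < \<delta>"
      using lp unfolding limit_point_def by blast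
    have sol: "pbs_solution a \<nu> \<epsilon> s T V0 (V \<epsilon>)" if "0 < \<epsilon>" for \<epsilon> using assms(6) T that by blast
    have U: "U \<in> cont_sobolev a T \<sigma>" using lp by (simp add: limit_point_def)
    interpret filtered_limit a \<nu> s T C \<sigma> V0 V U e
      by unfold_locales (fact assms(3) \<sigma> sol C U e conv)+
    show ?thesis using projection_continuous limit_equations projection_initial[OF _ V0] T by auto
  qed
  have "proj0 a (U t) x $ 3 = 0 \<and> proj0 a (U t) x $ 4 = 0" for t x
  proof -
    have "proj_coeff (U t) n $ 3 = 0" for n using proj_coeff_nth(1)[of "U t" n 3] by (simp add: part_def perp_simps)
    then show ?thesis by (simp add: proj0_synth synth_nth ser_def proj_coeff_nth(2))
  qed
  with main proj0_sobolev[OF V0] assms(3) show ?thesis by simp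
qed

end
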